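(* Let $\mathbb{A}$ be a connected graph of groups whose vertex groups and edge groups are all virtually $\mathbb{Z}$, and let $G$ be its fundamental group. Then $G$ has the f.g.i.p. if and only if one of the following holds: (i) $G$ is virtually $\mathbb{Z}$; (ii) $G$ is an amalgamated product $A*_C B$ of two virtually $\mathbb{Z}$ groups $A,B$ such that $C$ has index $2$ in both $A$ and $B$; (iii) $G$ is an HNN extension $A*_{\varphi}$, where $A$ is virtually $\mathbb{Z}$ and $\varphi$ identifies $A$ with a subgroup of itself.
   Context: A group has the f.g.i.p. (finitely generated intersection property) if the intersection of any two of its finitely generated subgroups is finitely generated. A group is virtually $\mathbb{Z}$ if it has an infinite cyclic subgroup of finite index. A graph of groups consists of an underlying graph, a group for each vertex and each edge, and injective homomorphisms from each edge group into the vertex groups at the two ends of the edge; it is connected if its underlying graph is connected. In (iii), $\varphi\colon A\to\varphi(A)\leqslant A$ is an isomorphism onto a subgroup of $A$ and $A*_\varphi=\langle A,t\mid t^{-1}at=\varphi(a),\ a\in A\rangle$.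
   Formalization: The underlying graph is assumed finite; for infinite graphs the claim fails: an infinite ray of copies of Z with edge inclusions given by multiplication by n+1 has G = Q, which has the f.g.i.p. but satisfies none of (i)–(iii). *)

theory Defs
  imports
    "HOL-Algebra.Elementary_Groups"
    "HOL-Algebra.Generated_Groups"
    "Graph_Theory.Digraph_Component"
begin

section \<open>Virtually cyclic groups and the finitely generated intersection property\<close>

definition finite_index :: "'a set \<Rightarrow> ('a, 'm) monoid_scheme \<Rightarrow> bool" where
  "finite_index H G \<longleftrightarrow> subgroup H G \<and> finite (rcosets\<^bsub>G\<^esub> H)"

definition virtually_Z :: "('a, 'm) monoid_scheme \<Rightarrow> bool" where
  "virtually_Z G \<longleftrightarrow> group G \<and>
     (\<exists>H. finite_index H G \<and> cyclic_group (G\<lparr>carrier := H\<rparr>) \<and> infinite H)"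

definition fin_gen_subgroup :: "'a set \<Rightarrow> ('a, 'm) monoid_scheme \<Rightarrow> bool" where
  "fin_gen_subgroup H G \<longleftrightarrow> (\<exists>S. finite S \<and> S \<subseteq> carrier G \<and> H = generate G S)"

definition fgip :: "('a, 'm) monoid_scheme \<Rightarrow> bool" where
  "fgip G \<longleftrightarrow> (\<forall>H K. subgroup H G \<and> fin_gen_subgroup H G \<and> subgroup K G \<and> fin_gen_subgroup K G
      \<longrightarrow> fin_gen_subgroup (H \<inter> K) G)"


section \<open>Groups given by generators and relations\<close>

text \<open>
  The letter \<open>(x, True)\<close> stands for the generator \<open>x\<close>, and \<open>(x, False)\<close> for its inverse.
  A relation is a pair \<open>(l, r)\<close> of words, to be read as \<open>l = r\<close>.
\<close>

type_synonym 'x word = "('x \<times> bool) list"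

abbreviation words :: "'x set \<Rightarrow> 'x word set" where
  "words X \<equiv> lists (X \<times> UNIV)"

inductive_set word_eq :: "'x set \<Rightarrow> ('x word \<times> 'x word) set \<Rightarrow> ('x word \<times> 'x word) set"
  for X R where
  refl: "w \<in> words X \<Longrightarrow> (w, w) \<in> word_eq X R"
| sym: "(v, w) \<in> word_eq X R \<Longrightarrow> (w, v) \<in> word_eq X R"
| trans: "(u, v) \<in> word_eq X R \<Longrightarrow> (v, w) \<in> word_eq X R \<Longrightarrow> (u, w) \<in> word_eq X R"
| cancel: "u \<in> words X \<Longrightarrow> v \<in> words X \<Longrightarrow> x \<in> X
    \<Longrightarrow> (u @ [(x, b), (x, \<not> b)] @ v, u @ v) \<in> word_eq X R"
| rel: "u \<in> words X \<Longrightarrow> v \<in> words X \<Longrightarrow> (l, r) \<in> R \<Longrightarrow> l \<in> words X \<Longrightarrow> r \<in> words X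
    \<Longrightarrow> (u @ l @ v, u @ r @ v) \<in> word_eq X R"

definition presented_group ::
  "'x set \<Rightarrow> ('x word \<times> 'x word) set \<Rightarrow> 'x word set monoid" where
  "presented_group X R =
    \<lparr>carrier = words X // word_eq X R,
     monoid.mult = (\<lambda>p q. \<Union>u\<in>p. \<Union>v\<in>q. word_eq X R `` {u @ v}),
     one = word_eq X R `` {[]}\<rparr>"

lemma word_eq_words: "(v, w) \<in> word_eq X R \<Longrightarrow> v \<in> words X \<and> w \<in> words X"
  by (induction rule: word_eq.induct) auto

lemma equiv_word_eq: "equiv (words X) (word_eq X R)"
proof (rule equivI)
  show "word_eq X R \<subseteq> words X \<times> words X" by (auto dest!: word_eq_words)
  show "refl_on (words X) (word_eq X R)"
    by (auto simp: refl_on_def intro: word_eq.refl)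
  show "sym (word_eq X R)" by (meson symI word_eq.sym)
  show "trans (word_eq X R)" by (meson transI word_eq.trans)
qed

lemma word_eq_append_left:
  "(v, w) \<in> word_eq X R \<Longrightarrow> u \<in> words X \<Longrightarrow> (u @ v, u @ w) \<in> word_eq X R"
proof (induction rule: word_eq.induct)
  case (refl w) then show ?case by (intro word_eq.refl) auto
next
  case (sym v w) then show ?case by (blast intro: word_eq.sym)
next
  case (trans a b c) then show ?case by (blast intro: word_eq.trans)
next
  case (cancel a b x c)
  then show ?case using word_eq.cancel[of "u @ a" X b x c R] by auto
next
  case (rel a b l r)
  then show ?case using word_eq.rel[of "u @ a" X b l r R] by auto
qed

lemma word_eq_append_right:
  "(v, w) \<in> word_eq X R \<Longrightarrow> u \<in> words X \<Longrightarrow> (v @ u, w @ u) \<in> word_eq X R"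
proof (induction rule: word_eq.induct)
  case (refl w) then show ?case by (intro word_eq.refl) auto
next
  case (sym v w) then show ?case by (blast intro: word_eq.sym)
next
  case (trans a b c) then show ?case by (blast intro: word_eq.trans)
next
  case (cancel a b x c)
  then show ?case using word_eq.cancel[of a X "b @ u" x c R] by auto
next
  case (rel a b l r)
  then show ?case using word_eq.rel[of a X "b @ u" l r R] by auto
qed

lemma word_eq_append:
  assumes "(u, u') \<in> word_eq X R" "(v, v') \<in> word_eq X R"
  shows "(u @ v, u' @ v') \<in> word_eq X R"
proof (rule word_eq.trans)
  show "(u @ v, u @ v') \<in> word_eq X R"
    using word_eq_append_left[OF assms(2)] word_eq_words[OF assms(1)] by blast
  show "(u @ v', u' @ v') \<in> word_eq X R"
    using word_eq_append_right[OF assms(1)] word_eq_words[OF assms(2)] by blast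
qed

lemma presented_group_mult:
  assumes "u \<in> words X" "v \<in> words X"
  shows "(word_eq X R `` {u}) \<otimes>\<^bsub>presented_group X R\<^esub> (word_eq X R `` {v}) = word_eq X R `` {u @ v}"
proof -
  let ?P = "word_eq X R `` {u}" and ?Q = "word_eq X R `` {v}"
  have eq: "word_eq X R `` {u' @ v'} = word_eq X R `` {u @ v}" if "u' \<in> ?P" "v' \<in> ?Q" for u' v'
  proof -
    have "(u, u') \<in> word_eq X R" "(v, v') \<in> word_eq X R" using that by simp_all
    then show ?thesis
      by (intro equiv_class_eq[OF equiv_word_eq word_eq.sym] word_eq_append)
  qed
  have "u \<in> ?P" "v \<in> ?Q" using assms by (simp_all only: Image_singleton_iff word_eq.refl)
  then have "(\<Union>u'\<in>?P. \<Union>v'\<in>?Q. word_eq X R `` {u' @ v'}) = word_eq X R `` {u @ v}"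
    using eq by (metis (no_types, lifting) SUP_eq_const empty_iff)
  then show ?thesis by (simp add: presented_group_def)
qed

lemma word_inverse:
  assumes "w \<in> words X"
  shows "(rev (map (\<lambda>(x, b). (x, \<not> b)) w) @ w, []) \<in> word_eq X R"
  using assms
proof (induction w rule: list.induct)
  case Nil then show ?case by (simp add: word_eq.refl)
next
  case (Cons p w)
  obtain x b where p: "p = (x, b)" by force
  let ?i = "rev (map (\<lambda>(x, b). (x, \<not> b)) w)"
  have "w \<in> words X" "x \<in> X" using Cons.prems p by simp_all
  moreover from this have "?i \<in> words X" by (auto simp: in_lists_conv_set)
  ultimately have "(?i @ [(x, \<not> b), (x, \<not> \<not> b)] @ w, ?i @ w) \<in> word_eq X R"
    by (intro word_eq.cancel)
  then show ?case using Cons p by (auto intro: word_eq.trans)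
qed

lemma group_presented_group: "group (presented_group X R)"
proof (rule groupI)
  let ?G = "presented_group X R"
  have one: "\<one>\<^bsub>?G\<^esub> = word_eq X R `` {[]}" by (simp add: presented_group_def)
  have class_in: "word_eq X R `` {w} \<in> carrier ?G" if "w \<in> words X" for w
    using that by (simp add: presented_group_def quotientI)
  have class_of: "\<exists>w\<in>words X. x = word_eq X R `` {w}" if "x \<in> carrier ?G" for x
    using that unfolding presented_group_def by (auto elim!: quotientE)
  show "\<one>\<^bsub>?G\<^esub> \<in> carrier ?G" unfolding one by (rule class_in) simp
  show "x \<otimes>\<^bsub>?G\<^esub> y \<in> carrier ?G" if x: "x \<in> carrier ?G" and y: "y \<in> carrier ?G" for x y
  proof -
    from class_of[OF x] obtain u where u: "u \<in> words X" "x = word_eq X R `` {u}" ..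
    from class_of[OF y] obtain v where v: "v \<in> words X" "y = word_eq X R `` {v}" ..
    have "u @ v \<in> words X" using u(1) v(1) by simp
    then show ?thesis unfolding u(2) v(2) presented_group_mult[OF u(1) v(1)] by (rule class_in)
  qed
  show "x \<otimes>\<^bsub>?G\<^esub> y \<otimes>\<^bsub>?G\<^esub> z = x \<otimes>\<^bsub>?G\<^esub> (y \<otimes>\<^bsub>?G\<^esub> z)"
    if x: "x \<in> carrier ?G" and y: "y \<in> carrier ?G" and z: "z \<in> carrier ?G" for x y z
  proof -
    from class_of[OF x] obtain u where u: "u \<in> words X" "x = word_eq X R `` {u}" ..
    from class_of[OF y] obtain v where v: "v \<in> words X" "y = word_eq X R `` {v}" ..
    from class_of[OF z] obtain w where w: "w \<in> words X" "z = word_eq X R `` {w}" ..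
    have uv: "u @ v \<in> words X" and vw: "v @ w \<in> words X" using u(1) v(1) w(1) by simp_all
    show ?thesis
      unfolding u(2) v(2) w(2) presented_group_mult[OF u(1) v(1)] presented_group_mult[OF v(1) w(1)]
        presented_group_mult[OF uv w(1)] presented_group_mult[OF u(1) vw] append_assoc ..
  qed
  show "\<one>\<^bsub>?G\<^esub> \<otimes>\<^bsub>?G\<^esub> x = x" if x: "x \<in> carrier ?G" for x
  proof -
    from class_of[OF x] obtain w where w: "w \<in> words X" "x = word_eq X R `` {w}" ..
    show ?thesis unfolding w(2) one presented_group_mult[OF lists.Nil w(1)] by simp
  qed
  show "\<exists>y\<in>carrier ?G. y \<otimes>\<^bsub>?G\<^esub> x = \<one>\<^bsub>?G\<^esub>" if x: "x \<in> carrier ?G" for x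
  proof -
    from class_of[OF x] obtain w where w: "w \<in> words X" "x = word_eq X R `` {w}" ..
    let ?i = "rev (map (\<lambda>(x, b). (x, \<not> b)) w)"
    have i: "?i \<in> words X" using w(1) by (auto simp: in_lists_conv_set)
    have "word_eq X R `` {?i} \<otimes>\<^bsub>?G\<^esub> x = \<one>\<^bsub>?G\<^esub>"
      unfolding w(2) one presented_group_mult[OF i w(1)]
      by (rule equiv_class_eq[OF equiv_word_eq word_inverse[OF w(1)]])
    then show ?thesis using class_in[OF i] by (rule bexI)
  qed
qed

text \<open>The multiplication table of \<open>A\<close>, with the element \<open>a\<close> of \<open>A\<close> named by the generator \<open>f a\<close>.\<close>

definition table :: "('a \<Rightarrow> 'x) \<Rightarrow> ('a, 'm) monoid_scheme \<Rightarrow> ('x word \<times> 'x word) set" where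
  "table f A = {([(f a, True), (f b, True)], [(f (a \<otimes>\<^bsub>A\<^esub> b), True)]) | a b.
      a \<in> carrier A \<and> b \<in> carrier A}"


section \<open>Amalgamated products and ascending HNN extensions\<close>

text \<open>\<open>A *\<^sub>C B\<close>, where \<open>C\<close> is embedded in \<open>A\<close> by \<open>i\<close> and in \<open>B\<close> by \<open>j\<close>.\<close>

definition amalgam ::
  "'a monoid \<Rightarrow> 'b monoid \<Rightarrow> 'c monoid \<Rightarrow> ('c \<Rightarrow> 'a) \<Rightarrow> ('c \<Rightarrow> 'b) \<Rightarrow> ('a + 'b) word set monoid"
where
  "amalgam A B C i j =
    presented_group (carrier A <+> carrier B)
      (table Inl A \<union> table Inr B \<union>
       {([(Inl (i c), True)], [(Inr (j c), True)]) | c. c \<in> carrier C})"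

text \<open>\<open>\<langle>A, t | t\<inverse> a t = \<phi> a, a \<in> A\<rangle>\<close>; the stable letter \<open>t\<close> is \<open>None\<close>.\<close>

definition ascending_hnn :: "'a monoid \<Rightarrow> ('a \<Rightarrow> 'a) \<Rightarrow> 'a option word set monoid" where
  "ascending_hnn A \<phi> =
    presented_group (insert None (Some ` carrier A))
      (table Some A \<union>
       {([(None, False), (Some a, True), (None, True)], [(Some (\<phi> a), True)]) | a. a \<in> carrier A})"


section \<open>Graphs of groups\<close>

text \<open>
  The edges of the underlying undirected graph are given once each, with an arbitrarily chosen
  orientation. Loops and parallel edges are allowed, and \<^const>\<open>connected\<close> disregards orientation.
\<close>

record ('v, 'e, 'a, 'c) graph_of_groups_data =
  base :: "('v, 'e) pre_digraph"
  vgroup :: "'v \<Rightarrow> 'a monoid"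
  egroup :: "'e \<Rightarrow> 'c monoid"
  tail_map :: "'e \<Rightarrow> 'c \<Rightarrow> 'a"
  head_map :: "'e \<Rightarrow> 'c \<Rightarrow> 'a"

locale graph_of_groups =
  fixes \<A> :: "('v, 'e, 'a, 'c) graph_of_groups_data"
  assumes wf_base: "wf_digraph (base \<A>)"
    and group_vgroup: "v \<in> verts (base \<A>) \<Longrightarrow> group (vgroup \<A> v)"
    and group_egroup: "e \<in> arcs (base \<A>) \<Longrightarrow> group (egroup \<A> e)"
    and tail_map: "e \<in> arcs (base \<A>) \<Longrightarrow>
      tail_map \<A> e \<in> mon (egroup \<A> e) (vgroup \<A> (tail (base \<A>) e))"
    and head_map: "e \<in> arcs (base \<A>) \<Longrightarrow>
      head_map \<A> e \<in> mon (egroup \<A> e) (vgroup \<A> (head (base \<A>) e))"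

text \<open>
  A set of edges forms a spanning tree if it connects all the vertices and none of its edges can be
  dropped. The constant \<^const>\<open>spanning_tree\<close> would be wrong here: it only excludes directed cycles,
  and hence depends on the orientation.
\<close>

definition spanning_tree_arcs :: "'e set \<Rightarrow> ('v, 'e) pre_digraph \<Rightarrow> bool" where
  "spanning_tree_arcs T D \<longleftrightarrow> T \<subseteq> arcs D \<and> connected (D\<lparr>arcs := T\<rparr>) \<and>
     (\<forall>e\<in>T. \<not> connected (D\<lparr>arcs := T - {e}\<rparr>))"

text \<open>
  The fundamental group with respect to a spanning tree \<open>T\<close>. It is generated by the vertex groups
  and a letter \<open>t\<^sub>e\<close> for each edge \<open>e\<close>, subject to the relations of the vertex groups, to
  \<open>t\<^sub>e\<inverse> (tail_map e c) t\<^sub>e = head_map e c\<close> for \<open>c\<close> in the group of \<open>e\<close>, and to \<open>t\<^sub>e = 1\<close> for \<open>e\<close> in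
  \<open>T\<close>. Up to isomorphism it depends neither on \<open>T\<close> nor on the orientation of the edges.
\<close>

datatype ('v, 'e, 'a) gog_generator = Vertex_Elt 'v 'a | Edge_Letter 'e

definition fundamental_group ::
  "('v, 'e, 'a, 'c) graph_of_groups_data \<Rightarrow> 'e set \<Rightarrow> ('v, 'e, 'a) gog_generator word set monoid"
where
  "fundamental_group \<A> T =
    presented_group
      ({Vertex_Elt v a | v a. v \<in> verts (base \<A>) \<and> a \<in> carrier (vgroup \<A> v)} \<union>
       Edge_Letter ` arcs (base \<A>))
      ((\<Union>v\<in>verts (base \<A>). table (Vertex_Elt v) (vgroup \<A> v)) \<union>
       {([(Edge_Letter e, False),
          (Vertex_Elt (tail (base \<A>) e) (tail_map \<A> e c), True),
          (Edge_Letter e, True)],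
         [(Vertex_Elt (head (base \<A>) e) (head_map \<A> e c), True)])
        | e c. e \<in> arcs (base \<A>) \<and> c \<in> carrier (egroup \<A> e)} \<union>
       {([(Edge_Letter e, True)], []) | e. e \<in> T})"

end

theory Submission
  imports Defs
begin

text \<open>
  The three kinds of groups have the f.g.i.p. because they are close to being slender. Call a group slender if
  all its subgroups are finitely generated; a slender group has the f.g.i.p. for trivial reasons. Virtually
  cyclic groups are slender, and slenderness passes to extensions by finite and by cyclic groups. If
  \<open>C\<close> has index two in \<open>A\<close> and in \<open>B\<close>, it is normal in
  \<open>A *\<^sub>C B\<close> with an infinite dihedral quotient, so \<open>A *\<^sub>C B\<close> is slender
  (\<open>slender_index_two_amalgam\<close>). The group \<open>A *\<^sub>\<phi>\<close> is an extension of an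
  increasing union of conjugates of \<open>A\<close> by the infinite cyclic group
  \<open>\<langle>t\<rangle>\<close>, and its finitely generated subgroups are either slender or of finite
  index (\<open>slender_or_finite_index\<close>). Intersecting with a slender subgroup gives a finitely
  generated group by definition, and intersecting with a subgroup of finite index does so by Schreier's lemma
  (\<open>fin_gen_finitely_covers\<close>).

  Conversely, there is an obstruction to the f.g.i.p. The edge groups are infinite, so that neighbouring
  vertex groups share an infinite cyclic group up to finite index. As the graph is connected, there is a
  single element \<open>z\<close> of infinite order such that every \<open>g\<close> in \<open>G\<close>
  satisfies \<open>g z\<^sup>m g\<^sup>-\<^sup>1 = z\<^sup>n\<close> for suitable nonzero \<open>m\<close> and
  \<open>n\<close> (\<open>all_commensurate\<close>). The quotient \<open>n/m\<close> is multiplicative in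
  \<open>g\<close>, hence it is \<open>1\<close> for commutators: each of them centralises a power of
  \<open>z\<close> (\<open>commutator_centralises\<close>). Suppose now that \<open>G\<close> contains a free
  group \<open>F\<close> of rank two with \<open>F \<inter> \<langle>z\<rangle> = 1\<close>. Any two elements
  \<open>a\<close>, \<open>b\<close> of its commutator subgroup commute with some \<open>z\<^sup>M\<close>,
  and \<open>\<langle>a, b\<rangle> \<inter> \<langle>a, b z\<^sup>M\<rangle>\<close> is generated by all the
  conjugates \<open>b\<^sup>i a b\<^sup>-\<^sup>i\<close>. For a suitable choice of \<open>a\<close> and
  \<open>b\<close> this is not finitely generated (\<open>not_fgip_central_twist\<close>,
  \<open>not_fgip_free_pair\<close>): this is the classical failure of the f.g.i.p. in the product of a free
  group with an infinite cyclic one.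

  Such an \<open>F\<close> is produced by ping-pong (locale \<open>ping_pong\<close>) as soon as
  \<open>G\<close> is an HNN extension both of whose associated subgroups are proper
  (\<open>not_fgip_hnn\<close>), or an amalgamated product \<open>A *\<^sub>C B\<close> with \<open>C\<close>
  proper in both factors and of index at least three in one of them (\<open>not_fgip_amalgam\<close>). Usually
  one would let \<open>G\<close> act on its Bass-Serre tree, which rests on normal forms. Here the action is
  built from the universal property alone. A free action of a countable group with infinitely many orbits, on
  a countable set, is unique up to isomorphism and restricts to an action of the same kind of every subgroup
  (\<open>free_sets_isomorphic\<close>). So two such actions of the two factors can be glued along
  \<open>C\<close>, and the gluing can be chosen so that it exchanges two parts of the set as ping-pong
  demands. In the same way one sees that the vertex groups embed into \<open>G\<close>
  (\<open>vert_inj\<close>).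

  Now let \<open>G\<close> have the f.g.i.p. If the graph is not a tree, \<open>G\<close> is an HNN extension
  along an edge outside the spanning tree. By the obstruction one of the two associated subgroups is the whole
  base group, which is therefore virtually \<open>\<int>\<close>, and the extension is ascending
  (\<open>non_tree_edge_ascending_hnn\<close>). If the graph is a tree, every edge splits \<open>G\<close> as
  an amalgamated product of its two sides. If some edge group is proper in both sides, it has index two in
  both by the obstruction, and the sides are virtually \<open>\<int>\<close> (\<open>tree_amalgam\<close>). If
  there is no such edge, \<open>G\<close> is equal to one of its vertex groups
  (\<open>vertex_group_if_edges_degenerate\<close>).
\<close>

section \<open>Homomorphisms out of groups given by generators and relations\<close>

definition word_value :: "('g, 'm) monoid_scheme \<Rightarrow> ('x \<Rightarrow> 'g) \<Rightarrow> 'x word \<Rightarrow> 'g" where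
  "word_value L f w =
     foldr (\<lambda>(x, b) g. (if b then f x else inv\<^bsub>L\<^esub> (f x)) \<otimes>\<^bsub>L\<^esub> g) w \<one>\<^bsub>L\<^esub>"

lemma word_value_Nil [simp]: "word_value L f [] = \<one>\<^bsub>L\<^esub>"
  by (simp add: word_value_def)

lemma word_value_Cons [simp]:
  "word_value L f ((x, b) # w) = (if b then f x else inv\<^bsub>L\<^esub> (f x)) \<otimes>\<^bsub>L\<^esub> word_value L f w"
  by (simp add: word_value_def)

context group
begin

lemma word_value_closed:
  assumes "f \<in> X \<rightarrow> carrier G" "w \<in> words X"
  shows "word_value G f w \<in> carrier G"
  using assms(2,1) by (induction w) (auto simp: Pi_iff)

lemma word_value_append:
  assumes "f \<in> X \<rightarrow> carrier G" "u \<in> words X" "v \<in> words X"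
  shows "word_value G f (u @ v) = word_value G f u \<otimes> word_value G f v"
  using assms(2)
proof (induction u)
  case Nil
  then show ?case using word_value_closed[OF assms(1,3)] by simp
next
  case (Cons p u)
  obtain x b where p: "p = (x, b)" by force
  have "f x \<in> carrier G" using Cons.hyps p assms(1) by auto
  moreover have "word_value G f u \<in> carrier G" "word_value G f v \<in> carrier G"
    using Cons.hyps assms word_value_closed by auto
  ultimately show ?case using Cons p by (simp add: m_assoc)
qed

lemma word_value_word_eq:
  assumes "(u, v) \<in> word_eq X R" and f: "f \<in> X \<rightarrow> carrier G"
    and R: "\<And>l r. (l, r) \<in> R \<Longrightarrow> l \<in> words X \<Longrightarrow> r \<in> words X \<Longrightarrow> word_value G f l = word_value G f r"
  shows "word_value G f u = word_value G f v"
  using assms(1)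
proof (induction rule: word_eq.induct)
  case (cancel u v x b)
  have fx: "f x \<in> carrier G" using cancel f by auto
  have w: "[(x, b), (x, \<not> b)] \<in> words X" "[(x, b), (x, \<not> b)] @ v \<in> words X" using cancel by auto
  have "word_value G f [(x, b), (x, \<not> b)] = \<one>" using fx by simp
  then show ?case
    using word_value_append[OF f cancel(1) w(2)] word_value_append[OF f w(1) cancel(2)]
      word_value_append[OF f cancel(1,2)] word_value_closed[OF f cancel(2)]
    by simp
next
  case (rel u v l r)
  have w: "l @ v \<in> words X" "r @ v \<in> words X" using rel by auto
  show ?case
    using word_value_append[OF f rel(1) w(1)] word_value_append[OF f rel(1) w(2)]
      word_value_append[OF f rel(4) rel(2)] word_value_append[OF f rel(5) rel(2)] R[OF rel(3,4,5)]
    by simp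
qed auto

lemma hom_eq_on_generate:
  assumes "group L" "h \<in> hom G L" "k \<in> hom G L" "S \<subseteq> carrier G"
    and "\<And>x. x \<in> S \<Longrightarrow> h x = k x" and "x \<in> generate G S"
  shows "h x = k x"
proof -
  interpret h: group_hom G L h using assms by (simp add: group_hom_def group_hom_axioms_def is_group)
  interpret k: group_hom G L k using assms by (simp add: group_hom_def group_hom_axioms_def is_group)
  have "x \<in> carrier G \<and> h x = k x"
    using assms(6) by (induction rule: generate.induct) (use assms(4,5) in auto)
  then show ?thesis ..
qed

end

definition pgen :: "'x set \<Rightarrow> ('x word \<times> 'x word) set \<Rightarrow> 'x \<Rightarrow> 'x word set" where
  "pgen X R x = word_eq X R `` {[(x, True)]}"

lemma word_eq_class_closed: "w \<in> words X \<Longrightarrow> word_eq X R `` {w} \<in> carrier (presented_group X R)"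
  by (simp add: presented_group_def quotientI)

lemma pgen_closed [simp]: "x \<in> X \<Longrightarrow> pgen X R x \<in> carrier (presented_group X R)"
  unfolding pgen_def by (rule word_eq_class_closed) simp

lemma presented_one: "\<one>\<^bsub>presented_group X R\<^esub> = word_eq X R `` {[]}"
  by (simp add: presented_group_def)

lemma inv_pgen:
  assumes "x \<in> X"
  shows "inv\<^bsub>presented_group X R\<^esub> (pgen X R x) = word_eq X R `` {[(x, False)]}"
proof -
  interpret P: group "presented_group X R" by (rule group_presented_group)
  have w: "[(x, True)] \<in> words X" "[(x, False)] \<in> words X" using assms by auto
  have "([] @ [(x, False), (x, \<not> False)] @ [], [] @ []) \<in> word_eq X R"
    using assms by (intro word_eq.cancel) auto
  then have "word_eq X R `` {[(x, False)] @ [(x, True)]} = word_eq X R `` {[]}"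
    by (intro equiv_class_eq[OF equiv_word_eq]) simp
  then have "(word_eq X R `` {[(x, False)]}) \<otimes>\<^bsub>presented_group X R\<^esub> pgen X R x = \<one>\<^bsub>presented_group X R\<^esub>"
    unfolding pgen_def presented_group_mult[OF w(2,1)] presented_one .
  then show ?thesis
    using P.inv_equality assms word_eq_class_closed[OF w(2)] by simp
qed

text \<open>
  The class of a word is the value of the word in the presented group itself, which turns computations
  with classes into computations in a group.
\<close>

lemma word_eq_class_eq_value:
  assumes "w \<in> words X"
  shows "word_eq X R `` {w} = word_value (presented_group X R) (pgen X R) w"
  using assms
proof (induction w)
  case Nil
  then show ?case by (simp add: presented_one)
next
  case (Cons p w)
  obtain x b where p: "p = (x, b)" by force
  have x: "x \<in> X" using Cons p by auto
  have "word_eq X R `` {[(x, b)] @ w} =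
      (word_eq X R `` {[(x, b)]}) \<otimes>\<^bsub>presented_group X R\<^esub> (word_eq X R `` {w})"
    using presented_group_mult[of "[(x, b)]" X w R] x Cons.hyps by simp
  then show ?case using Cons p inv_pgen[OF x, of R] by (auto simp: pgen_def)
qed

lemma presented_generate: "generate (presented_group X R) (pgen X R ` X) = carrier (presented_group X R)"
proof -
  interpret P: group "presented_group X R" by (rule group_presented_group)
  have "word_value (presented_group X R) (pgen X R) w \<in> generate (presented_group X R) (pgen X R ` X)"
    if "w \<in> words X" for w
    using that
  proof (induction w)
    case (Cons p w)
    obtain x b where p: "p = (x, b)" by force
    then have "pgen X R x \<in> pgen X R ` X" using Cons.hyps by auto
    then show ?case using Cons p by (auto intro: generate.intros)
  qed (simp add: generate.one)
  then have "carrier (presented_group X R) \<subseteq> generate (presented_group X R) (pgen X R ` X)"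
    using word_eq_class_eq_value by (fastforce simp: presented_group_def elim!: quotientE)
  then show ?thesis by (simp add: P.generate_incl image_subset_iff subset_antisym)
qed

lemma presented_relation:
  assumes "(l, r) \<in> R" "l \<in> words X" "r \<in> words X"
  shows "word_value (presented_group X R) (pgen X R) l = word_value (presented_group X R) (pgen X R) r"
proof -
  have "([] @ l @ [], [] @ r @ []) \<in> word_eq X R" using assms by (intro word_eq.rel) auto
  then have "word_eq X R `` {l} = word_eq X R `` {r}"
    by (intro equiv_class_eq[OF equiv_word_eq]) simp
  then show ?thesis using assms word_eq_class_eq_value by metis
qed

text \<open>
  The universal property: congruent words have the same value in \<open>L\<close>, so the value can be read off from
  any representative of a class.
\<close>

lemma presented_hom_ex:
  assumes "group L" and f: "f \<in> X \<rightarrow> carrier L"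
    and R: "\<And>l r. (l, r) \<in> R \<Longrightarrow> l \<in> words X \<Longrightarrow> r \<in> words X \<Longrightarrow> word_value L f l = word_value L f r"
  shows "\<exists>h \<in> hom (presented_group X R) L. \<forall>x\<in>X. h (pgen X R x) = f x"
proof -
  interpret L: group L by fact
  define h where "h p = word_value L f (SOME w. w \<in> p)" for p
  have h: "h (word_eq X R `` {w}) = word_value L f w" if w: "w \<in> words X" for w
  proof -
    have "w \<in> word_eq X R `` {w}" using w by (simp only: Image_singleton_iff word_eq.refl)
    then have "(SOME v. v \<in> word_eq X R `` {w}) \<in> word_eq X R `` {w}" by (rule someI)
    then have "(w, SOME v. v \<in> word_eq X R `` {w}) \<in> word_eq X R" by simp
    from L.word_value_word_eq[OF this f R] show ?thesis unfolding h_def by simp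
  qed
  have "h \<in> hom (presented_group X R) L"
  proof (rule homI)
    fix p q assume "p \<in> carrier (presented_group X R)" "q \<in> carrier (presented_group X R)"
    then obtain u v where "u \<in> words X" "p = word_eq X R `` {u}" "v \<in> words X" "q = word_eq X R `` {v}"
      by (auto simp: presented_group_def elim!: quotientE)
    then show "h (p \<otimes>\<^bsub>presented_group X R\<^esub> q) = h p \<otimes>\<^bsub>L\<^esub> h q"
      by (simp add: presented_group_mult h L.word_value_append[OF f])
  next
    fix p assume "p \<in> carrier (presented_group X R)"
    then obtain u where "u \<in> words X" "p = word_eq X R `` {u}"
      by (auto simp: presented_group_def elim!: quotientE)
    then show "h p \<in> carrier L" by (simp add: h L.word_value_closed[OF f])
  qed
  moreover have "h (pgen X R x) = f x" if "x \<in> X" for x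
  proof -
    have "f x \<in> carrier L" using f that by auto
    then show ?thesis using h[of "[(x, True)]"] that by (simp add: pgen_def)
  qed
  ultimately show ?thesis by blast
qed

lemma countable_presented_group:
  assumes "countable X"
  shows "countable (carrier (presented_group X R))"
proof -
  have "countable (words X)" using assms by simp
  then show ?thesis by (simp add: presented_group_def quotient_def)
qed


section \<open>Finitely generated subgroups\<close>

text \<open>
  If \<open>K\<close> is a subgroup that contains the subgroup \<open>H\<close>, this is finite index. In the form \<open>K \<subseteq> H F\<close> with
  \<open>F\<close> finite, the notion passes to arbitrary subsets of \<open>K\<close>, and no cosets have to be formed.
\<close>

definition finitely_covers :: "('g, 'm) monoid_scheme \<Rightarrow> 'g set \<Rightarrow> 'g set \<Rightarrow> bool" where
  "finitely_covers G H K \<longleftrightarrow>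
     (\<exists>F. finite F \<and> F \<subseteq> carrier G \<and> (\<forall>k\<in>K. \<exists>h\<in>H. \<exists>f\<in>F. k = h \<otimes>\<^bsub>G\<^esub> f))"

text \<open>
  Slenderness is relative to an ambient group, so that intersections, extensions and conjugates of
  subgroups can be treated without a change of the group.
\<close>

definition slender :: "('g, 'm) monoid_scheme \<Rightarrow> 'g set \<Rightarrow> bool" where
  "slender G W \<longleftrightarrow> (\<forall>H. subgroup H G \<and> H \<subseteq> W \<longrightarrow> fin_gen_subgroup H G)"

lemma finitely_covers_mono: "finitely_covers G H K \<Longrightarrow> K' \<subseteq> K \<Longrightarrow> finitely_covers G H K'"
  unfolding finitely_covers_def by (meson subsetD)

lemma fin_gen_generate: "finite S \<Longrightarrow> S \<subseteq> carrier G \<Longrightarrow> fin_gen_subgroup (generate G S) G"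
  unfolding fin_gen_subgroup_def by blast

lemma slenderD: "slender G W \<Longrightarrow> subgroup H G \<Longrightarrow> H \<subseteq> W \<Longrightarrow> fin_gen_subgroup H G"
  by (auto simp: slender_def)

lemma slender_mono: "slender G W \<Longrightarrow> V \<subseteq> W \<Longrightarrow> slender G V"
  by (auto simp: slender_def)

context group
begin

lemma subgroupD:
  assumes "subgroup H G"
  shows "H \<subseteq> carrier G" "\<one> \<in> H" "\<And>x. x \<in> H \<Longrightarrow> inv x \<in> H" "\<And>x y. x \<in> H \<Longrightarrow> y \<in> H \<Longrightarrow> x \<otimes> y \<in> H"
    "\<And>x (n::int). x \<in> H \<Longrightarrow> x [^] n \<in> H"
  using assms subgroup.subset subgroup.one_closed subgroup.m_inv_closed subgroup.m_closed
    subgroup_int_pow_closed by metis+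

lemma fin_gen_subgroup_iff:
  assumes "subgroup H G"
  shows "fin_gen_subgroup H G \<longleftrightarrow> (\<exists>S. finite S \<and> S \<subseteq> H \<and> H \<subseteq> generate G S)"
proof
  assume "fin_gen_subgroup H G"
  then show "\<exists>S. finite S \<and> S \<subseteq> H \<and> H \<subseteq> generate G S"
    unfolding fin_gen_subgroup_def by (blast intro: generate.incl)
next
  assume "\<exists>S. finite S \<and> S \<subseteq> H \<and> H \<subseteq> generate G S"
  then obtain S where "finite S" "S \<subseteq> H" "H \<subseteq> generate G S" by blast
  moreover from this have "generate G S \<subseteq> H" using generate_subgroup_incl[OF _ assms] by blast
  ultimately show "fin_gen_subgroup H G"
    unfolding fin_gen_subgroup_def using subgroupD(1)[OF assms] by blast
qed

lemma finite_fin_gen: "subgroup H G \<Longrightarrow> finite H \<Longrightarrow> fin_gen_subgroup H G"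
  by (subst fin_gen_subgroup_iff) (auto intro: generate.incl)

lemma finite_slender: "finite W \<Longrightarrow> slender G W"
  by (auto simp: slender_def intro: finite_fin_gen finite_subset)

lemma conjugate_cancel:
  assumes "s \<in> carrier G" "x \<in> carrier G"
  shows "inv s \<otimes> (s \<otimes> x) = x" "s \<otimes> (inv s \<otimes> x) = x"
  using assms by (simp_all add: m_assoc[symmetric])

text \<open>
  Schreier's lemma. Let \<open>F\<close> be a finite set with \<open>K = H F\<close> and \<open>\<one> \<in> F\<close>. Every \<open>f s\<close> with \<open>f\<close> in \<open>F\<close> and
  \<open>s\<close> a generator of \<open>K\<close> or the inverse of one can be rewritten as \<open>h f'\<close>. Pushing the \<open>f\<close> to the right
  through a word, one sees that the finitely many elements \<open>h\<close> that arise generate \<open>H\<close>, together with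
  the elements of \<open>F\<close> that lie in \<open>H\<close>.
\<close>

lemma fin_gen_finitely_covers:
  assumes "fin_gen_subgroup K G" "subgroup K G" "subgroup H G" "H \<subseteq> K" "finitely_covers G H K"
  shows "fin_gen_subgroup H G"
proof -
  obtain S where S: "finite S" "S \<subseteq> K" "K \<subseteq> generate G S"
    using assms(1,2) fin_gen_subgroup_iff by blast
  obtain F where F: "finite F" "F \<subseteq> carrier G" "\<forall>k\<in>K. \<exists>h\<in>H. \<exists>f\<in>F. k = h \<otimes> f"
    using assms(5) by (auto simp: finitely_covers_def)
  note H = subgroupD[OF assms(3)] and K = subgroupD[OF assms(2)]
  define F' where "F' = insert \<one> (F \<inter> K)"
  define S' where "S' = S \<union> m_inv G ` S"
  have F': "finite F'" "F' \<subseteq> K" using F K by (auto simp: F'_def)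
  have S': "finite S'" "S' \<subseteq> K" using S K by (auto simp: S'_def)
  have "\<exists>h\<in>H. \<exists>f\<in>F'. k = h \<otimes> f" if k: "k \<in> K" for k
  proof -
    obtain h f where hf: "h \<in> H" "f \<in> F" "k = h \<otimes> f" using F k by blast
    then have "f = inv h \<otimes> k" using H(1) F(2) conjugate_cancel by (metis subsetD)
    then have "f \<in> K" using hf assms(4) k K by blast
    then show ?thesis using hf by (auto simp: F'_def)
  qed
  then have "\<forall>p\<in>F' \<times> S'. \<exists>h\<in>H. \<exists>f\<in>F'. fst p \<otimes> snd p = h \<otimes> f"
    using F' S' K by (auto simp: subset_iff)
  then have "\<exists>hh. \<forall>r\<in>F'. \<forall>s\<in>S'. hh (r, s) \<in> H \<and> (\<exists>f\<in>F'. r \<otimes> s = hh (r, s) \<otimes> f)"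
    using bchoice[of "F' \<times> S'" "\<lambda>p h. h \<in> H \<and> (\<exists>f\<in>F'. fst p \<otimes> snd p = h \<otimes> f)"] by fastforce
  then obtain hh where hh: "\<And>r s. r \<in> F' \<Longrightarrow> s \<in> S' \<Longrightarrow> hh (r, s) \<in> H \<and> (\<exists>f\<in>F'. r \<otimes> s = hh (r, s) \<otimes> f)"
    by blast
  define U where "U = hh ` (F' \<times> S') \<union> (F' \<inter> H)"
  have U: "finite U" "U \<subseteq> H" using F' S' hh by (auto simp: U_def)
  then have Uc: "U \<subseteq> carrier G" using H by blast
  have gU: "generate G U \<subseteq> carrier G" by (rule generate_incl[OF Uc])
  have rewrite: "\<forall>r\<in>F'. \<exists>h\<in>generate G U. \<exists>f\<in>F'. r \<otimes> k = h \<otimes> f" if "k \<in> generate G S" for k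
    using that
  proof (induction rule: generate.induct)
    case one
    then show ?case using F' K by (metis generate.one l_one r_one subsetD)
  next
    case (incl s)
    then have "s \<in> S'" by (simp add: S'_def)
    then show ?case using hh by (metis U_def UnI1 generate.incl image_eqI mem_Sigma_iff)
  next
    case (inv s)
    then have "inv s \<in> S'" by (simp add: S'_def)
    then show ?case using hh by (metis U_def UnI1 generate.incl image_eqI mem_Sigma_iff)
  next
    case (eng k1 k2)
    have kc: "k1 \<in> carrier G" "k2 \<in> carrier G"
      using eng(1,2) generate_incl[of S] S(2) K(1) by blast+
    show ?case
    proof
      fix r assume r: "r \<in> F'"
      obtain h f where 1: "h \<in> generate G U" "f \<in> F'" "r \<otimes> k1 = h \<otimes> f" using eng r by blast
      obtain h' f' where 2: "h' \<in> generate G U" "f' \<in> F'" "f \<otimes> k2 = h' \<otimes> f'" using eng 1 by blast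
      have c: "r \<in> carrier G" "f \<in> carrier G" "f' \<in> carrier G" "h \<in> carrier G" "h' \<in> carrier G"
        using r 1(1,2) 2(1,2) F'(2) K(1) gU by blast+
      have "r \<otimes> (k1 \<otimes> k2) = (h \<otimes> f) \<otimes> k2" using c kc 1 by (metis m_assoc)
      also have "\<dots> = (h \<otimes> h') \<otimes> f'" using c kc 2 by (metis m_assoc)
      finally show "\<exists>h\<in>generate G U. \<exists>f\<in>F'. r \<otimes> (k1 \<otimes> k2) = h \<otimes> f"
        using 1 2 generate.eng by metis
    qed
  qed
  have "H \<subseteq> generate G U"
  proof
    fix x assume x: "x \<in> H"
    then obtain h f where hf: "h \<in> generate G U" "f \<in> F'" "\<one> \<otimes> x = h \<otimes> f"
      using rewrite S(3) assms(4) by (metis F'_def insertI1 subsetD)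
    have hH: "h \<in> H" using hf generate_subgroup_incl[OF U(2) assms(3)] by blast
    have "f = inv h \<otimes> x" using hf hH x H(1) F' K conjugate_cancel by (metis l_one subsetD)
    then have "f \<in> H" using hH x H by blast
    then have "f \<in> generate G U" using hf by (auto simp: U_def intro: generate.incl)
    then show "x \<in> generate G U" using hf x H generate.eng by (metis l_one subsetD)
  qed
  then show ?thesis using U assms(3) fin_gen_subgroup_iff by blast
qed

text \<open>
  Two elements of \<open>H\<close> in the same coset \<open>M f\<close> differ by an element of \<open>M \<inter> H\<close>. So \<open>H\<close> is generated by
  \<open>M \<inter> H\<close> and one element from each coset that it meets.
\<close>

lemma fin_gen_extend_finite:
  assumes "subgroup M G" "subgroup H G" "fin_gen_subgroup (M \<inter> H) G" "finitely_covers G M H"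
  shows "fin_gen_subgroup H G"
proof -
  note H = subgroupD[OF assms(2)] and M = subgroupD[OF assms(1)]
  have MH: "subgroup (M \<inter> H) G" using assms subgroups_Inter_pair by blast
  obtain S where S: "finite S" "S \<subseteq> M \<inter> H" "M \<inter> H \<subseteq> generate G S"
    using assms(3) fin_gen_subgroup_iff[OF MH] by blast
  obtain F where F: "finite F" "F \<subseteq> carrier G" "\<forall>k\<in>H. \<exists>h\<in>M. \<exists>f\<in>F. k = h \<otimes> f"
    using assms(4) by (auto simp: finitely_covers_def)
  define F' where "F' = {f \<in> F. \<exists>m\<in>M. m \<otimes> f \<in> H}"
  have "\<forall>f\<in>F'. \<exists>m\<in>M. m \<otimes> f \<in> H" by (simp add: F'_def)
  then obtain mm where mm: "\<And>f. f \<in> F' \<Longrightarrow> mm f \<in> M \<and> mm f \<otimes> f \<in> H" by metis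
  define U where "U = S \<union> (\<lambda>f. mm f \<otimes> f) ` F'"
  have "finite F'" using F by (simp add: F'_def)
  then have U: "finite U" "U \<subseteq> H" using S mm by (auto simp: U_def)
  have "H \<subseteq> generate G U"
  proof
    fix x assume x: "x \<in> H"
    then obtain m f where mf: "m \<in> M" "f \<in> F" "x = m \<otimes> f" using F by blast
    then have f: "f \<in> F'" using x by (auto simp: F'_def)
    let ?y = "mm f \<otimes> f"
    have c: "m \<in> carrier G" "f \<in> carrier G" "mm f \<in> carrier G" using mf F mm[OF f] M by blast+
    have "x \<otimes> inv ?y = m \<otimes> inv (mm f)"
      using c mf(3) by (simp add: inv_mult_group m_assoc conjugate_cancel)
    moreover have "m \<otimes> inv (mm f) \<in> M" using mf mm[OF f] M(3,4) by blast
    moreover have "x \<otimes> inv ?y \<in> H" using mm[OF f] x H(3,4) by blast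
    ultimately have "x \<otimes> inv ?y \<in> M \<inter> H" by simp
    then have "x \<otimes> inv ?y \<in> generate G U" using S(3) mono_generate[of S U] U_def by blast
    moreover have "?y \<in> generate G U" using f by (auto simp: U_def intro: generate.incl)
    moreover have "x = (x \<otimes> inv ?y) \<otimes> ?y" using c mf(3) by (simp add: m_assoc)
    ultimately show "x \<in> generate G U" using generate.eng by metis
  qed
  then show ?thesis using U assms(2) fin_gen_subgroup_iff by blast
qed

lemma slender_extend_finite:
  assumes "subgroup M G" "slender G M" "finitely_covers G M W"
  shows "slender G W"
  unfolding slender_def
proof (intro allI impI)
  fix H assume H: "subgroup H G \<and> H \<subseteq> W"
  have "fin_gen_subgroup (M \<inter> H) G"
    using slenderD[OF assms(2) subgroups_Inter_pair[OF assms(1)]] H by blast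
  moreover have "finitely_covers G M H" using finitely_covers_mono[OF assms(3)] H by simp
  ultimately show "fin_gen_subgroup H G" using fin_gen_extend_finite[OF assms(1)] H by simp
qed

text \<open>
  If \<open>s\<close> normalises \<open>M\<close>, the products \<open>m s\<^sup>i\<close> form a group in which the exponents add up. This lemma and
  the three that follow are the computations in this group.
\<close>

lemma normalised_pow:
  assumes M: "subgroup M G" and s: "s \<in> carrier G"
    and n: "\<And>m. m \<in> M \<Longrightarrow> s \<otimes> m \<otimes> inv s \<in> M" "\<And>m. m \<in> M \<Longrightarrow> inv s \<otimes> m \<otimes> s \<in> M"
    and m: "m \<in> M"
  shows "s [^] (k::int) \<otimes> m \<otimes> inv (s [^] k) \<in> M"
proof -
  note MD = subgroupD[OF M]
  have mc: "m \<in> carrier G" if "m \<in> M" for m using that MD by blast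
  have pos: "s [^] (int j) \<otimes> m \<otimes> inv (s [^] (int j)) \<in> M \<and>
             s [^] (- int j) \<otimes> m \<otimes> inv (s [^] (- int j)) \<in> M" for j
  proof (induction j)
    case 0
    then show ?case using m mc by simp
  next
    case (Suc j)
    have e: "s [^] (int (Suc j)) = s \<otimes> s [^] (int j)" "s [^] (- int (Suc j)) = inv s \<otimes> s [^] (- int j)"
      using s int_pow_mult[OF s, of 1 "int j"] int_pow_mult[OF s, of "-1" "- int j"]
        int_pow_neg[OF s, of 1] int_pow_1[OF s] by (simp_all add: algebra_simps)
    let ?p = "s [^] (int j)" and ?q = "s [^] (- int j)"
    have "s [^] (int (Suc j)) \<otimes> m \<otimes> inv (s [^] (int (Suc j))) = s \<otimes> (?p \<otimes> m \<otimes> inv ?p) \<otimes> inv s"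
      unfolding e using s mc[OF m] by (simp add: inv_mult_group m_assoc)
    moreover have "s [^] (- int (Suc j)) \<otimes> m \<otimes> inv (s [^] (- int (Suc j))) = inv s \<otimes> (?q \<otimes> m \<otimes> inv ?q) \<otimes> s"
      unfolding e using s mc[OF m] by (simp add: inv_mult_group m_assoc)
    ultimately show ?case using Suc n by simp
  qed
  show ?thesis using pos[of "nat \<bar>k\<bar>"] by (cases "k \<ge> 0") auto
qed

lemma mult_normalised_pow:
  assumes M: "subgroup M G" and s: "s \<in> carrier G"
    and n: "\<And>m. m \<in> M \<Longrightarrow> s \<otimes> m \<otimes> inv s \<in> M" "\<And>m. m \<in> M \<Longrightarrow> inv s \<otimes> m \<otimes> s \<in> M"
    and m: "m \<in> M" "m' \<in> M"
  shows "\<exists>m''\<in>M. (m \<otimes> s [^] (i::int)) \<otimes> (m' \<otimes> s [^] (j::int)) = m'' \<otimes> s [^] (i + j)"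
proof
  have c: "m \<in> carrier G" "m' \<in> carrier G" using m subgroupD[OF M] by blast+
  show "m \<otimes> (s [^] i \<otimes> m' \<otimes> inv (s [^] i)) \<in> M"
    using normalised_pow[OF M s n m(2)] m subgroupD[OF M] by blast
  have "(m \<otimes> s [^] i) \<otimes> (m' \<otimes> s [^] j) = m \<otimes> (s [^] i \<otimes> m' \<otimes> inv (s [^] i)) \<otimes> (s [^] i \<otimes> s [^] j)"
    using c s by (simp add: m_assoc conjugate_cancel)
  then show "(m \<otimes> s [^] i) \<otimes> (m' \<otimes> s [^] j) = m \<otimes> (s [^] i \<otimes> m' \<otimes> inv (s [^] i)) \<otimes> s [^] (i + j)"
    using s by (simp add: int_pow_mult)
qed

lemma inv_normalised_pow:
  assumes M: "subgroup M G" and s: "s \<in> carrier G"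
    and n: "\<And>m. m \<in> M \<Longrightarrow> s \<otimes> m \<otimes> inv s \<in> M" "\<And>m. m \<in> M \<Longrightarrow> inv s \<otimes> m \<otimes> s \<in> M"
    and m: "m \<in> M"
  shows "\<exists>m''\<in>M. inv (m \<otimes> s [^] (i::int)) = m'' \<otimes> s [^] (- i)"
proof
  have c: "m \<in> carrier G" using m subgroupD[OF M] by blast
  show "s [^] (-i) \<otimes> inv m \<otimes> inv (s [^] (-i)) \<in> M"
    using normalised_pow[OF M s n] m subgroupD[OF M] by blast
  show "inv (m \<otimes> s [^] i) = s [^] (-i) \<otimes> inv m \<otimes> inv (s [^] (-i)) \<otimes> s [^] (-i)"
    using c s by (simp add: inv_mult_group m_assoc int_pow_neg)
qed

lemma pow_mult_normalised:
  assumes M: "subgroup M G" and s: "s \<in> carrier G"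
    and n: "\<And>m. m \<in> M \<Longrightarrow> s \<otimes> m \<otimes> inv s \<in> M" "\<And>m. m \<in> M \<Longrightarrow> inv s \<otimes> m \<otimes> s \<in> M"
    and m: "m \<in> M"
  shows "\<exists>m''\<in>M. (m \<otimes> s [^] (i::int)) [^] (k::int) = m'' \<otimes> s [^] (i * k)"
proof -
  have c: "m \<in> carrier G" using m subgroupD[OF M] by blast
  have pos: "\<exists>m''\<in>M. (m \<otimes> s [^] i) [^] (int j) = m'' \<otimes> s [^] (i * int j)" for j
  proof (induction j)
    case 0
    then show ?case using subgroupD[OF M] by force
  next
    case (Suc j)
    then obtain m1 where m1: "m1 \<in> M" "(m \<otimes> s [^] i) [^] (int j) = m1 \<otimes> s [^] (i * int j)" by blast
    have "(m \<otimes> s [^] i) [^] (int (Suc j)) = (m1 \<otimes> s [^] (i * int j)) \<otimes> (m \<otimes> s [^] i)"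
      using int_pow_mult[of "m \<otimes> s [^] i" "int j" 1] m1 c s by (simp add: algebra_simps)
    then show ?case using mult_normalised_pow[OF M s n m1(1) m, of "i * int j" i]
      by (simp add: algebra_simps)
  qed
  show ?thesis
  proof (cases k rule: int_cases2)
    case (nonneg j)
    then show ?thesis using pos[of j] by simp
  next
    case (nonpos j)
    obtain m1 where m1: "m1 \<in> M" "(m \<otimes> s [^] i) [^] (int j) = m1 \<otimes> s [^] (i * int j)"
      using pos by blast
    have "(m \<otimes> s [^] i) [^] k = inv (m1 \<otimes> s [^] (i * int j))"
      unfolding nonpos m1(2)[symmetric] using c s by (intro int_pow_neg) simp
    then show ?thesis using inv_normalised_pow[OF M s n m1(1), of "i * int j"] nonpos by simp
  qed
qed

text \<open>
  Euclidean division of exponents: if \<open>d\<close> is the least positive exponent of an element \<open>m s\<^sup>d\<close> of \<open>H\<close>, then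
  this element and \<open>M \<inter> H\<close> generate \<open>H\<close>.
\<close>

lemma fin_gen_extend_cyclic:
  assumes M: "subgroup M G" and H: "subgroup H G" and s: "s \<in> carrier G"
    and n: "\<And>m. m \<in> M \<Longrightarrow> s \<otimes> m \<otimes> inv s \<in> M" "\<And>m. m \<in> M \<Longrightarrow> inv s \<otimes> m \<otimes> s \<in> M"
    and cov: "\<And>h. h \<in> H \<Longrightarrow> \<exists>m\<in>M. \<exists>i::int. h = m \<otimes> s [^] i"
    and fg: "fin_gen_subgroup (M \<inter> H) G"
  shows "fin_gen_subgroup H G"
proof -
  note HD = subgroupD[OF H] and MD = subgroupD[OF M]
  have MH: "subgroup (M \<inter> H) G" using M H subgroups_Inter_pair by blast
  obtain S where S: "finite S" "S \<subseteq> M \<inter> H" "M \<inter> H \<subseteq> generate G S"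
    using fg fin_gen_subgroup_iff[OF MH] by blast
  define E where "E d \<longleftrightarrow> d > 0 \<and> (\<exists>m\<in>M. m \<otimes> s [^] (int d) \<in> H)" for d :: nat
  show ?thesis
  proof (cases "\<exists>d. E d")
    case False
    have "H \<subseteq> M"
    proof
      fix h assume h: "h \<in> H"
      obtain m i where mi: "m \<in> M" "h = m \<otimes> s [^] (i::int)" using cov[OF h] by blast
      obtain m' where m': "m' \<in> M" "inv h = m' \<otimes> s [^] (-i)"
        using inv_normalised_pow[OF M s n mi(1)] mi by blast
      have "i = 0"
      proof (rule ccontr)
        assume "i \<noteq> 0"
        moreover have "m \<otimes> s [^] i \<in> H" "m' \<otimes> s [^] (-i) \<in> H" using mi m' h HD(3)[OF h] by simp_all
        ultimately have "E (nat \<bar>i\<bar>)"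
          using mi(1) m'(1) by (cases "i > 0") (auto simp: E_def)
        then show False using False by blast
      qed
      then show "h \<in> M" using mi MD(1) by auto
    qed
    then show ?thesis using fg by (simp add: Int_absorb1)
  next
    case True
    define d where "d = (LEAST d. E d)"
    have d: "E d" unfolding d_def using True by (rule LeastI_ex)
    have least: "\<not> E r" if "r < d" for r using that not_less_Least unfolding d_def by blast
    obtain m0 where m0: "m0 \<in> M" "m0 \<otimes> s [^] (int d) \<in> H" using d by (auto simp: E_def)
    let ?h0 = "m0 \<otimes> s [^] (int d)"
    define U where "U = insert ?h0 S"
    have U: "finite U" "U \<subseteq> H" using S m0 by (auto simp: U_def)
    have Uc: "U \<subseteq> carrier G" using U HD by blast
    have "H \<subseteq> generate G U"
    proof
      fix h assume h: "h \<in> H"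
      obtain m i where mi: "m \<in> M" "h = m \<otimes> s [^] (i::int)" using cov[OF h] by blast
      define k where "k = - (i div int d)"
      obtain m1 where m1: "m1 \<in> M" "?h0 [^] k = m1 \<otimes> s [^] (int d * k)"
        using pow_mult_normalised[OF M s n m0(1)] by blast
      obtain m2 where m2: "m2 \<in> M" "h \<otimes> ?h0 [^] k = m2 \<otimes> s [^] (i + int d * k)"
        using mult_normalised_pow[OF M s n mi(1) m1(1)] m1(2) mi(2) by metis
      have r: "i + int d * k = i mod int d" by (simp add: k_def minus_mult_div_eq_mod)
      have hH: "h \<otimes> ?h0 [^] k \<in> H" using HD(4)[OF h HD(5)[OF m0(2)]] .
      have "i mod int d = 0"
      proof (rule ccontr)
        assume ne: "i mod int d \<noteq> 0"
        have d0: "d > 0" using d by (simp add: E_def)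
        then have r0: "nat (i mod int d) < d" "i mod int d \<ge> 0" by (simp_all add: nat_less_iff)
        have "m2 \<otimes> s [^] (i mod int d) \<in> H" using m2(2) hH unfolding r by simp
        then have "m2 \<otimes> s [^] int (nat (i mod int d)) \<in> H" using r0(2) by simp
        moreover have "nat (i mod int d) > 0" using ne r0(2) by simp
        ultimately have "E (nat (i mod int d))" using m2(1) unfolding E_def by blast
        then show False using least r0(1) by blast
      qed
      then have "h \<otimes> ?h0 [^] k = m2" using m2 r MD(1) by auto
      then have "h \<otimes> ?h0 [^] k \<in> generate G U"
        using hH m2 S(3) mono_generate[of S U] U_def by blast
      moreover have h0: "?h0 [^] (-k) \<in> generate G U"
        using subgroupD(5)[OF generate_is_subgroup[OF Uc]] by (simp add: U_def generate.incl)
      moreover have "h = (h \<otimes> ?h0 [^] k) \<otimes> ?h0 [^] (-k)"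
      proof -
        have "h \<in> carrier G" "?h0 \<in> carrier G" using h m0 HD(1) by blast+
        then show ?thesis by (simp add: m_assoc int_pow_neg)
      qed
      ultimately show "h \<in> generate G U" using generate.eng by metis
    qed
    then show ?thesis using U H fin_gen_subgroup_iff by blast
  qed
qed

lemma slender_extend_cyclic:
  assumes M: "subgroup M G" "slender G M" and s: "s \<in> carrier G"
    and n: "\<And>m. m \<in> M \<Longrightarrow> s \<otimes> m \<otimes> inv s \<in> M" "\<And>m. m \<in> M \<Longrightarrow> inv s \<otimes> m \<otimes> s \<in> M"
    and cov: "\<And>w. w \<in> W \<Longrightarrow> \<exists>m\<in>M. \<exists>i::int. w = m \<otimes> s [^] i"
  shows "slender G W"
  unfolding slender_def
proof (intro allI impI)
  fix H assume H: "subgroup H G \<and> H \<subseteq> W"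
  have "fin_gen_subgroup (M \<inter> H) G"
    using slenderD[OF M(2) subgroups_Inter_pair[OF M(1)]] H by blast
  then show "fin_gen_subgroup H G"
    using fin_gen_extend_cyclic[OF M(1) _ s n, of H] H cov by (simp add: subset_iff)
qed

end


section \<open>Virtually cyclic groups\<close>

text \<open>
  Finite groups are included, so that the notion is stable under homomorphic images; that an image is
  infinite is a separate matter.
\<close>

definition virtually_cyclic :: "('g, 'm) monoid_scheme \<Rightarrow> 'g set \<Rightarrow> bool" where
  "virtually_cyclic G W \<longleftrightarrow> subgroup W G \<and>
     (\<exists>x\<in>W. finitely_covers G (range (\<lambda>n::int. x [^]\<^bsub>G\<^esub> n)) W)"

definition infinite_order :: "('g, 'm) monoid_scheme \<Rightarrow> 'g \<Rightarrow> bool" where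
  "infinite_order G x \<longleftrightarrow> x \<in> carrier G \<and> (\<forall>n::int. x [^]\<^bsub>G\<^esub> n = \<one>\<^bsub>G\<^esub> \<longrightarrow> n = 0)"

lemma virtually_cyclic_subgroup: "virtually_cyclic G W \<Longrightarrow> subgroup W G"
  by (simp add: virtually_cyclic_def)

lemma (in group) virtually_cyclicE:
  assumes "virtually_cyclic G W"
  obtains x F where "x \<in> W" "finite F" "F \<subseteq> W"
    "\<And>w. w \<in> W \<Longrightarrow> \<exists>n::int. \<exists>f\<in>F. w = x [^] n \<otimes> f"
proof -
  note W = subgroupD[OF virtually_cyclic_subgroup[OF assms]]
  obtain x F where x: "x \<in> W" and F: "finite F" "F \<subseteq> carrier G"
    and cov: "\<forall>k\<in>W. \<exists>h\<in>range (\<lambda>n::int. x [^] n). \<exists>f\<in>F. k = h \<otimes> f"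
    using assms unfolding virtually_cyclic_def finitely_covers_def by blast
  show ?thesis
  proof (rule that[of x "F \<inter> W"])
    fix w assume w: "w \<in> W"
    then obtain n :: int and f where nf: "f \<in> F" "w = x [^] n \<otimes> f" using cov by blast
    have "f = inv (x [^] n) \<otimes> w" using nf x W(1) F(2) by (auto simp: conjugate_cancel subset_iff)
    then have "f \<in> W" using W(4)[OF W(3)[OF W(5)[OF x]] w] by simp
    then show "\<exists>n::int. \<exists>f\<in>F \<inter> W. w = x [^] n \<otimes> f" using nf by blast
  qed (use x F in auto)
qed

lemma (in group) virtually_cyclicI:
  assumes "subgroup W G" "x \<in> W" "finite F" "F \<subseteq> carrier G"
    "\<And>w. w \<in> W \<Longrightarrow> \<exists>n::int. \<exists>f\<in>F. w = x [^] n \<otimes> f"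
  shows "virtually_cyclic G W"
  unfolding virtually_cyclic_def finitely_covers_def
proof (intro conjI bexI[OF _ assms(2)] exI ballI)
  fix w assume "w \<in> W"
  then obtain n :: int and f where "f \<in> F" "w = x [^] n \<otimes> f" using assms(5) by blast
  then show "\<exists>h\<in>range (\<lambda>n::int. x [^] n). \<exists>f\<in>F. w = h \<otimes> f" by blast
qed (use assms in auto)

context group
begin

lemma infinite_order_pow:
  assumes "infinite_order G x" "n \<noteq> (0::int)"
  shows "infinite_order G (x [^] n)"
  using assms unfolding infinite_order_def by (metis int_pow_closed int_pow_pow mult_eq_0_iff)

lemma infinite_order_inj:
  assumes "infinite_order G x" "x [^] (i::int) = x [^] (j::int)"
  shows "i = j"
proof -
  have "x [^] (i - j) = \<one>" using assms by (simp add: infinite_order_def int_pow_diff)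
  then have "i - j = 0" using assms(1) unfolding infinite_order_def by blast
  then show ?thesis by simp
qed

lemma virtually_Z_virtually_cyclic:
  assumes "virtually_Z G"
  shows "virtually_cyclic G (carrier G)" "\<exists>x. infinite_order G x"
proof -
  obtain H where H: "finite_index H G" "cyclic_group (G\<lparr>carrier := H\<rparr>)" "infinite H"
    using assms by (auto simp: virtually_Z_def)
  have sub: "subgroup H G" and fin: "finite (rcosets H)" using H by (auto simp: finite_index_def)
  note HD = subgroupD[OF sub]
  interpret H: group "G\<lparr>carrier := H\<rparr>" using subgroup_imp_group[OF sub] .
  obtain x where x: "x \<in> H" "H = range (\<lambda>n::int. x [^]\<^bsub>G\<lparr>carrier := H\<rparr>\<^esub> n)"
    using H(2) H.cyclic_group by auto
  then have xH: "H = range (\<lambda>n::int. x [^] n)" using int_pow_consistent[OF sub] by auto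
  have xc: "x \<in> carrier G" using x HD(1) by blast
  have "infinite_order G x"
    unfolding infinite_order_def
  proof (intro conjI allI impI)
    show "x \<in> carrier G" by (rule xc)
    fix n :: int assume n: "x [^] n = \<one>"
    show "n = 0"
    proof (rule ccontr)
      assume "n \<noteq> 0"
      have "x [^] i = x [^] (i mod \<bar>n\<bar>)" for i :: int
      proof -
        have 1: "x [^] \<bar>n\<bar> = \<one>" using n xc by (cases "n \<ge> 0") (auto simp: int_pow_neg)
        have "x [^] i = x [^] (\<bar>n\<bar> * (i div \<bar>n\<bar>)) \<otimes> x [^] (i mod \<bar>n\<bar>)"
          using xc by (simp add: int_pow_mult[symmetric])
        also have "x [^] (\<bar>n\<bar> * (i div \<bar>n\<bar>)) = \<one>"
          using 1 xc int_pow_pow[of x "\<bar>n\<bar>" "i div \<bar>n\<bar>"] by simp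
        finally show ?thesis using xc by simp
      qed
      moreover have "i mod \<bar>n\<bar> \<in> {0..<\<bar>n\<bar>}" for i using \<open>n \<noteq> 0\<close> by simp
      ultimately have "H \<subseteq> (\<lambda>i::int. x [^] i) ` {0..<\<bar>n\<bar>}" unfolding xH by blast
      then show False using H(3) finite_surj by blast
    qed
  qed
  then show "\<exists>x. infinite_order G x" by blast
  define rep where "rep C = (SOME a. a \<in> carrier G \<and> C = H #> a)" for C
  have rep: "rep C \<in> carrier G \<and> C = H #> rep C" if "C \<in> rcosets H" for C
  proof -
    have "\<exists>a. a \<in> carrier G \<and> C = H #> a" using that by (auto simp: RCOSETS_def)
    then show ?thesis unfolding rep_def by (rule someI_ex)
  qed
  show "virtually_cyclic G (carrier G)"
  proof (rule virtually_cyclicI[OF subgroup_self xc])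
    show "finite (rep ` (rcosets H))" using fin by simp
    show "rep ` (rcosets H) \<subseteq> carrier G" using rep by blast
    fix w assume w: "w \<in> carrier G"
    have C: "H #> w \<in> rcosets H" using w HD(1) by (rule rcosetsI[rotated])
    have "w \<in> H #> w" using rcos_self[OF w sub] .
    then have "w \<in> H #> rep (H #> w)" using rep[OF C] by simp
    then obtain h where "h \<in> H" "w = h \<otimes> rep (H #> w)" by (auto simp: r_coset_def)
    then show "\<exists>n::int. \<exists>f\<in>rep ` (rcosets H). w = x [^] n \<otimes> f" using C xH by blast
  qed
qed

lemma virtually_cyclic_slender:
  assumes "virtually_cyclic G W"
  shows "slender G W"
proof -
  obtain x F where x: "x \<in> W" and F: "finite F" "F \<subseteq> W"
    and cov: "\<And>w. w \<in> W \<Longrightarrow> \<exists>n::int. \<exists>f\<in>F. w = x [^] n \<otimes> f"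
    by (rule virtually_cyclicE[OF assms]) (rule that)
  note W = subgroupD[OF virtually_cyclic_subgroup[OF assms]]
  have xc: "x \<in> carrier G" using x W(1) by blast
  let ?C = "range (\<lambda>n::int. x [^] n)"
  have C: "subgroup ?C G"
    using xc by (intro subgroupI)
      (auto simp: int_pow_neg[symmetric] int_pow_mult[symmetric] simp del: int_pow_neg)
  have "slender G ?C"
    by (rule slender_extend_cyclic[OF triv_subgroup finite_slender xc]) (use xc in auto)
  moreover have "finitely_covers G ?C W"
    unfolding finitely_covers_def using F cov W(1) by (intro exI[of _ F]) blast
  ultimately show ?thesis using slender_extend_finite[OF C] by blast
qed

text \<open>
  Let \<open>W\<close> be the union of the cosets \<open>\<langle>x\<rangle> f\<close> with \<open>f \<in> F\<close>. If \<open>M\<close> contains no \<open>x\<^sup>k\<close> with \<open>k \<noteq> 0\<close>, it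
  meets every such coset at most once. If it contains \<open>x\<^sup>l\<close> with \<open>l > 0\<close>, exponents only matter
  modulo \<open>l\<close>.
\<close>

lemma virtually_cyclic_subgroup_cases:
  assumes W: "virtually_cyclic G W" and M: "subgroup M G" "M \<subseteq> W"
  shows "finite M \<or> finitely_covers G M W"
proof -
  obtain x F where x: "x \<in> W" and F: "finite F" "F \<subseteq> W"
    and cov: "\<And>w. w \<in> W \<Longrightarrow> \<exists>n::int. \<exists>f\<in>F. w = x [^] n \<otimes> f"
    by (rule virtually_cyclicE[OF W]) (rule that)
  note WD = subgroupD[OF virtually_cyclic_subgroup[OF W]] and MD = subgroupD[OF M(1)]
  have xc: "x \<in> carrier G" using x WD(1) by blast
  have Fc: "f \<in> carrier G" if "f \<in> F" for f using that F WD(1) by blast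
  show ?thesis
  proof (cases "\<exists>k::int. k \<noteq> 0 \<and> x [^] k \<in> M")
    case False
    have "\<forall>m\<in>M. \<exists>f. f \<in> F \<and> (\<exists>n::int. m = x [^] n \<otimes> f)" using cov M(2) by blast
    then obtain g where g: "\<And>m. m \<in> M \<Longrightarrow> g m \<in> F \<and> (\<exists>n::int. m = x [^] n \<otimes> g m)" by metis
    have "inj_on g M"
    proof (rule inj_onI)
      fix m m' assume m: "m \<in> M" "m' \<in> M" "g m = g m'"
      obtain i j :: int where ij: "m = x [^] i \<otimes> g m" "m' = x [^] j \<otimes> g m" using g m by metis
      have gm: "g m \<in> carrier G" using g m Fc by blast
      have "m \<otimes> inv m' = (x [^] i \<otimes> g m) \<otimes> inv (x [^] j \<otimes> g m)" using ij by simp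
      also have "\<dots> = x [^] (i - j)"
        using xc gm by (simp add: inv_mult_group m_assoc conjugate_cancel int_pow_diff)
      finally have "x [^] (i - j) \<in> M" using MD(4)[OF m(1) MD(3)[OF m(2)]] by simp
      then have "i - j = 0" using False by blast
      then show "m = m'" using ij by simp
    qed
    moreover have "g ` M \<subseteq> F" using g by blast
    ultimately have "finite M" using F(1) inj_on_finite by metis
    then show ?thesis ..
  next
    case True
    then obtain k :: int where k0: "k \<noteq> 0" "x [^] k \<in> M" by blast
    define l where "l = \<bar>k\<bar>"
    have l: "l > 0" using k0 by (simp add: l_def)
    have "x [^] (- k) \<in> M" using MD(3)[OF k0(2)] int_pow_neg[OF xc] by simp
    then have lM: "x [^] l \<in> M" using k0 by (cases "k > 0") (simp_all add: l_def)
    define F' where "F' = (\<lambda>(i, f). x [^] i \<otimes> f) ` ({0..<l} \<times> F)"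
    have "\<exists>m\<in>M. \<exists>f\<in>F'. w = m \<otimes> f" if w: "w \<in> W" for w
    proof -
      obtain n :: int and f where nf: "f \<in> F" "w = x [^] n \<otimes> f" using cov w by blast
      have 1: "x [^] (l * (n div l)) \<in> M" using MD(5)[OF lM, of "n div l"] xc by (simp add: int_pow_pow)
      have "x [^] n = x [^] (l * (n div l)) \<otimes> x [^] (n mod l)"
        using xc by (simp add: int_pow_mult[symmetric])
      then have "w = x [^] (l * (n div l)) \<otimes> (x [^] (n mod l) \<otimes> f)"
        using nf xc Fc by (simp add: m_assoc)
      moreover have "x [^] (n mod l) \<otimes> f \<in> F'" using nf l by (auto simp: F'_def)
      ultimately show ?thesis using 1 by blast
    qed
    moreover have "finite F'" "F' \<subseteq> carrier G" using F(1) Fc xc by (auto simp: F'_def)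
    ultimately show ?thesis unfolding finitely_covers_def by blast
  qed
qed

text \<open>
  The pigeonhole principle: two different powers of \<open>y\<close> lie in the same coset \<open>\<langle>x\<rangle> f\<close>.
\<close>

lemma infinite_order_pow_meets:
  assumes x: "x \<in> carrier G" and F: "finite F" "F \<subseteq> carrier G"
    and cov: "\<And>w. w \<in> W \<Longrightarrow> \<exists>n::int. \<exists>f\<in>F. w = x [^] n \<otimes> f"
    and W: "subgroup W G" and y: "infinite_order G y" "y \<in> W"
  shows "\<exists>(k::int) (l::int). k \<noteq> 0 \<and> l \<noteq> 0 \<and> y [^] k = x [^] l"
proof -
  have yc: "y \<in> carrier G" using y by (simp add: infinite_order_def)
  have "\<forall>i::nat. \<exists>f. f \<in> F \<and> (\<exists>n::int. y [^] (int i) = x [^] n \<otimes> f)"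
    using cov subgroupD(5)[OF W y(2)] by blast
  then obtain g where g: "\<And>i::nat. g i \<in> F \<and> (\<exists>n::int. y [^] (int i) = x [^] n \<otimes> g i)" by metis
  have "\<not> inj g"
    using F(1) g finite_imageD[of g UNIV] finite_subset[of "range g" F] by (auto simp: image_subset_iff)
  then obtain i j where ij: "i \<noteq> j" "g i = g j" by (auto simp: inj_def)
  obtain m n :: int where mn: "y [^] (int i) = x [^] m \<otimes> g i" "y [^] (int j) = x [^] n \<otimes> g i"
    using g ij by metis
  have gc: "g i \<in> carrier G" using g F by blast
  have "y [^] (int i - int j) = (x [^] m \<otimes> g i) \<otimes> inv (x [^] n \<otimes> g i)"
    using mn yc by (simp add: int_pow_diff)
  also have "\<dots> = x [^] (m - n)"
    using x gc by (simp add: inv_mult_group m_assoc conjugate_cancel int_pow_diff)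
  finally have e: "y [^] (int i - int j) = x [^] (m - n)" .
  have "m - n \<noteq> 0" using e ij(1) infinite_order_inj[OF y(1), of "int i - int j" 0] by auto
  moreover have "int i - int j \<noteq> 0" using ij(1) by simp
  ultimately show ?thesis using e by blast
qed

lemma virtually_cyclic_commensurable:
  assumes W: "virtually_cyclic G W" and x: "infinite_order G x" "x \<in> W" and y: "infinite_order G y" "y \<in> W"
  shows "\<exists>(k::int) (l::int). k \<noteq> 0 \<and> l \<noteq> 0 \<and> x [^] k = y [^] l"
proof -
  obtain w F where w: "w \<in> W" and F: "finite F" "F \<subseteq> W"
    and cov: "\<And>v. v \<in> W \<Longrightarrow> \<exists>n::int. \<exists>f\<in>F. v = w [^] n \<otimes> f"
    by (rule virtually_cyclicE[OF W]) (rule that)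
  note sub = virtually_cyclic_subgroup[OF W]
  note WD = subgroupD[OF sub]
  have wc: "w \<in> carrier G" and Fc: "F \<subseteq> carrier G" using w F WD(1) by blast+
  obtain a b :: int where ab: "a \<noteq> 0" "b \<noteq> 0" "x [^] a = w [^] b"
    using infinite_order_pow_meets[OF wc F(1) Fc cov sub x] by blast
  obtain c d :: int where cd: "c \<noteq> 0" "d \<noteq> 0" "y [^] c = w [^] d"
    using infinite_order_pow_meets[OF wc F(1) Fc cov sub y] by blast
  have xc: "x \<in> carrier G" "y \<in> carrier G" using x y by (simp_all add: infinite_order_def)
  have "x [^] (a * d) = w [^] (b * d)" using ab(3) xc wc by (metis int_pow_pow)
  moreover have "y [^] (c * b) = w [^] (b * d)" using cd(3) xc wc by (metis int_pow_pow mult.commute)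
  ultimately have "x [^] (a * d) = y [^] (c * b)" by simp
  then show ?thesis using ab cd by (intro exI[of _ "a * d"] exI[of _ "c * b"]) simp
qed

text \<open>
  The subgroup \<open>\<langle>x\<rangle>\<close> of finite index is infinite, since it contains a power of \<open>y\<close> other than \<open>\<one>\<close>.
\<close>

lemma virtually_cyclic_virtually_Z:
  assumes W: "virtually_cyclic G W" and y: "infinite_order G y" "y \<in> W"
  shows "virtually_Z (G\<lparr>carrier := W\<rparr>)"
proof -
  obtain x F where x: "x \<in> W" and F: "finite F" "F \<subseteq> W"
    and cov: "\<And>w. w \<in> W \<Longrightarrow> \<exists>n::int. \<exists>f\<in>F. w = x [^] n \<otimes> f"
    by (rule virtually_cyclicE[OF W]) (rule that)
  note sub = virtually_cyclic_subgroup[OF W]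
  note WD = subgroupD[OF sub]
  interpret W: group "G\<lparr>carrier := W\<rparr>" using subgroup_imp_group[OF sub] .
  have xc: "x \<in> carrier G" and Fc: "F \<subseteq> carrier G" using x F WD(1) by blast+
  obtain k l :: int where kl: "k \<noteq> 0" "l \<noteq> 0" "y [^] k = x [^] l"
    using infinite_order_pow_meets[OF xc F(1) Fc cov sub y] by blast
  define C where "C = range (\<lambda>n::int. x [^] n)"
  have C: "subgroup C G"
    unfolding C_def using xc by (intro subgroupI)
      (auto simp: int_pow_neg[symmetric] int_pow_mult[symmetric] simp del: int_pow_neg)
  have CW: "C \<subseteq> W" using WD(5)[OF x] by (auto simp: C_def)
  have CsW: "subgroup C (G\<lparr>carrier := W\<rparr>)" using subgroup_incl[OF C sub CW] .
  have "inj (\<lambda>n::int. y [^] (k * n))"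
    using infinite_order_inj[OF y(1)] kl(1) by (intro injI) (metis mult_cancel_left)
  then have "infinite (range (\<lambda>n::int. y [^] (k * n)))" using finite_imageD infinite_UNIV_int by blast
  moreover have "y [^] (k * n) = x [^] (l * n)" for n
  proof -
    have "y \<in> carrier G" using y(1) by (simp add: infinite_order_def)
    then show ?thesis using int_pow_pow[of y k n] int_pow_pow[OF xc, of l n] kl(3) by simp
  qed
  then have "range (\<lambda>n::int. y [^] (k * n)) \<subseteq> C" by (auto simp: C_def)
  ultimately have inf: "infinite C" using finite_subset by blast
  have "rcosets\<^bsub>G\<lparr>carrier := W\<rparr>\<^esub> C \<subseteq> (\<lambda>f. C #> f) ` F"
  proof
    fix D assume "D \<in> rcosets\<^bsub>G\<lparr>carrier := W\<rparr>\<^esub> C"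
    then obtain w where w: "w \<in> W" "D = C #> w" by (auto simp: RCOSETS_def r_coset_def)
    obtain n :: int and f where nf: "f \<in> F" "w = x [^] n \<otimes> f" using cov w by blast
    have "w \<in> C #> f" using nf by (auto simp: r_coset_def C_def)
    then have "D = C #> f" using w repr_independence[OF _ _ C] nf(1) Fc by blast
    then show "D \<in> (\<lambda>f. C #> f) ` F" using nf by blast
  qed
  then have "finite_index C (G\<lparr>carrier := W\<rparr>)"
    unfolding finite_index_def using CsW F(1) finite_surj by blast
  moreover have "cyclic_group (G\<lparr>carrier := W, carrier := C\<rparr>)"
  proof -
    interpret C: group "G\<lparr>carrier := C\<rparr>" using subgroup_imp_group[OF C] .
    have xC: "x \<in> C" using int_pow_1[OF xc] unfolding C_def by (metis rangeI)
    have "x [^]\<^bsub>G\<lparr>carrier := C\<rparr>\<^esub> n = x [^] n" for n :: int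
      using int_pow_consistent[OF C xC] by simp
    then have "carrier (G\<lparr>carrier := C\<rparr>) = range (\<lambda>n::int. x [^]\<^bsub>G\<lparr>carrier := C\<rparr>\<^esub> n)"
      by (simp add: C_def)
    then have "cyclic_group (G\<lparr>carrier := C\<rparr>)" unfolding C.cyclic_group using xC by auto
    then show ?thesis by simp
  qed
  ultimately show ?thesis unfolding virtually_Z_def using inf W.is_group by auto
qed

lemma virtually_cyclic_extend_finite:
  assumes W: "virtually_cyclic G W" and V: "subgroup V G" "W \<subseteq> V" "finitely_covers G W V"
  shows "virtually_cyclic G V"
proof -
  obtain x F where x: "x \<in> W" and F: "finite F" "F \<subseteq> W"
    and cov: "\<And>w. w \<in> W \<Longrightarrow> \<exists>n::int. \<exists>f\<in>F. w = x [^] n \<otimes> f"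
    by (rule virtually_cyclicE[OF W]) (rule that)
  obtain E where E: "finite E" "E \<subseteq> carrier G" "\<forall>k\<in>V. \<exists>h\<in>W. \<exists>f\<in>E. k = h \<otimes> f"
    using V(3) by (auto simp: finitely_covers_def)
  note WD = subgroupD[OF virtually_cyclic_subgroup[OF W]]
  have xc: "x \<in> carrier G" and Fc: "F \<subseteq> carrier G" using x F WD(1) by blast+
  show ?thesis
  proof (rule virtually_cyclicI[OF V(1)])
    show "x \<in> V" using x V by blast
    show "finite ((\<lambda>(f, e). f \<otimes> e) ` (F \<times> E))" using F E by simp
    show "(\<lambda>(f, e). f \<otimes> e) ` (F \<times> E) \<subseteq> carrier G" using Fc E by auto
    fix v assume v: "v \<in> V"
    obtain w e where we: "w \<in> W" "e \<in> E" "v = w \<otimes> e" using E(3) v by blast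
    obtain n :: int and f where nf: "f \<in> F" "w = x [^] n \<otimes> f" using cov we by blast
    have "v = x [^] n \<otimes> (f \<otimes> e)" using we nf xc Fc E(2) by (simp add: m_assoc subset_iff)
    then show "\<exists>n::int. \<exists>f\<in>(\<lambda>(f, e). f \<otimes> e) ` (F \<times> E). v = x [^] n \<otimes> f"
      using nf we by (intro exI[of _ n] bexI[of _ "f \<otimes> e"]) auto
  qed
qed

lemma virtually_cyclic_countable:
  assumes "virtually_cyclic G W"
  shows "countable W"
proof -
  obtain x F where F: "finite F" and cov: "\<And>w. w \<in> W \<Longrightarrow> \<exists>n::int. \<exists>f\<in>F. w = x [^] n \<otimes> f"
    by (rule virtually_cyclicE[OF assms]) (rule that)
  have "W \<subseteq> (\<lambda>(n::int, f). x [^] n \<otimes> f) ` (UNIV \<times> F)" using cov by (force simp: image_iff)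
  moreover have "countable ((\<lambda>(n::int, f). x [^] n \<otimes> f) ` (UNIV \<times> F))"
    using F by (intro countable_image countable_SIGMA) (auto intro: countable_finite)
  ultimately show ?thesis using countable_subset by blast
qed

end

lemma (in group_hom) virtually_cyclic_image:
  assumes "virtually_cyclic G W"
  shows "virtually_cyclic H (h ` W)"
proof -
  obtain x F where x: "x \<in> W" and F: "finite F" "F \<subseteq> W"
    and cov: "\<And>w. w \<in> W \<Longrightarrow> \<exists>n::int. \<exists>f\<in>F. w = x [^] n \<otimes> f"
    by (rule G.virtually_cyclicE[OF assms]) (rule that)
  note sub = virtually_cyclic_subgroup[OF assms]
  note WD = G.subgroupD[OF sub]
  show ?thesis
  proof (rule H.virtually_cyclicI)
    show "subgroup (h ` W) H" using subgroup_img_is_subgroup[OF sub] .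
    show "h x \<in> h ` W" "finite (h ` F)" using x F by auto
    show "h ` F \<subseteq> carrier H" using F WD(1) by auto
    fix w assume "w \<in> h ` W"
    then obtain v where v: "v \<in> W" "w = h v" by blast
    obtain n :: int and f where nf: "f \<in> F" "v = x [^] n \<otimes> f" using cov v by blast
    have "w = h x [^]\<^bsub>H\<^esub> n \<otimes>\<^bsub>H\<^esub> h f" using v nf x F WD(1) by (simp add: hom_int_pow subset_iff)
    then show "\<exists>n::int. \<exists>f\<in>h ` F. w = h x [^]\<^bsub>H\<^esub> n \<otimes>\<^bsub>H\<^esub> f" using nf by blast
  qed
qed


section \<open>Permutation groups and free words\<close>

text \<open>
  An action of \<open>G\<close> on a type is a homomorphism from \<open>G\<close> to this group. An action on a set of elements of
  the type is extended by letting everything fix the elements outside the set.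
\<close>

definition perms :: "('x \<Rightarrow> 'x) monoid" where
  "perms = \<lparr>carrier = {f. bij f}, monoid.mult = (\<circ>), one = id\<rparr>"

lemma perms_simps [simp]:
  "f \<in> carrier perms \<longleftrightarrow> bij f" "f \<otimes>\<^bsub>perms\<^esub> g = f \<circ> g" "\<one>\<^bsub>perms\<^esub> = id"
  by (simp_all add: perms_def)

lemma group_perms: "group perms"
proof (rule groupI)
  show "\<exists>g\<in>carrier perms. g \<otimes>\<^bsub>perms\<^esub> f = \<one>\<^bsub>perms\<^esub>" if "f \<in> carrier perms" for f :: "'a \<Rightarrow> 'a"
    using that by (intro bexI[of _ "inv_into UNIV f"]) (auto simp: bij_imp_bij_inv bij_is_inj)
qed (auto simp: bij_comp comp_assoc)

lemma inv_perms: "bij f \<Longrightarrow> inv\<^bsub>perms\<^esub> f = inv_into UNIV f"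
  by (rule group.inv_equality[OF group_perms]) (auto simp: bij_imp_bij_inv bij_is_inj)

abbreviation letter_inv :: "'x \<times> bool \<Rightarrow> 'x \<times> bool" where
  "letter_inv s \<equiv> (fst s, \<not> snd s)"

definition reduced :: "'x word \<Rightarrow> bool" where
  "reduced w \<longleftrightarrow> successively (\<lambda>s t. t \<noteq> letter_inv s) w"

lemma reduced_simps [simp]:
  "reduced []" "reduced [s]" "reduced (s # t # w) \<longleftrightarrow> t \<noteq> letter_inv s \<and> reduced (t # w)"
  by (simp_all add: reduced_def)

lemma word_eq_reduced:
  assumes "w \<in> words X"
  shows "\<exists>w'\<in>words X. reduced w' \<and> (w, w') \<in> word_eq X R"
  using assms
proof (induction w)
  case Nil
  show ?case by (rule bexI[of _ "[]"]) (auto intro: word_eq.refl)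
next
  case (Cons s w)
  then obtain w' where w': "w' \<in> words X" "reduced w'" "(w, w') \<in> word_eq X R" by blast
  have s: "[s] \<in> words X" using Cons by simp
  have e: "(s # w, s # w') \<in> word_eq X R" using word_eq_append_left[OF w'(3) s] by simp
  show ?case
  proof (cases "\<exists>v. w' = letter_inv s # v")
    case True
    then obtain v where v: "w' = letter_inv s # v" by blast
    obtain x b where sx: "s = (x, b)" by force
    have vX: "v \<in> words X" "x \<in> X" using v w' sx s by auto
    have "([] @ [(x, b), (x, \<not> b)] @ v, [] @ v) \<in> word_eq X R"
      using vX by (intro word_eq.cancel) auto
    then have "(s # w, v) \<in> word_eq X R" using e v sx by (auto intro: word_eq.trans)
    moreover have "reduced v" using w'(2) v by (cases v) auto
    ultimately show ?thesis using vX by blast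
  next
    case False
    then have "reduced (s # w')" using w'(2) by (cases w') auto
    then show ?thesis using e w' s by (intro bexI[of _ "s # w'"]) auto
  qed
qed

context group
begin

lemma generate_word_value:
  assumes f: "f \<in> X \<rightarrow> carrier G" and x: "x \<in> generate G (f ` X)"
  shows "\<exists>w\<in>words X. x = word_value G f w"
  using x
proof (induction rule: generate.induct)
  case one
  then show ?case by (intro bexI[of _ "[]"]) auto
next
  case (incl h)
  then obtain y where y: "y \<in> X" "h = f y" by blast
  then have "f y \<in> carrier G" using f by auto
  then show ?case using y by (intro bexI[of _ "[(y, True)]"]) auto
next
  case (inv h)
  then obtain y where y: "y \<in> X" "h = f y" by blast
  then have "f y \<in> carrier G" using f by auto
  then show ?case using y by (intro bexI[of _ "[(y, False)]"]) auto
next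
  case (eng h1 h2)
  then obtain u v where "u \<in> words X" "v \<in> words X" "h1 = word_value G f u" "h2 = word_value G f v"
    by blast
  then show ?case using word_value_append[OF f] by (intro bexI[of _ "u @ v"]) auto
qed

lemma word_value_inverse:
  assumes f: "f \<in> X \<rightarrow> carrier G" and w: "w \<in> words X"
  shows "word_value G f (rev (map (\<lambda>(x, b). (x, \<not> b)) w)) = inv (word_value G f w)"
proof -
  let ?i = "rev (map (\<lambda>(x, b). (x, \<not> b)) w)"
  have i: "?i \<in> words X" using w by (auto simp: in_lists_conv_set)
  have "word_value G f (?i @ w) = word_value G f []"
    by (rule word_value_word_eq[OF word_inverse[OF w, of "{}"] f]) simp
  then have "word_value G f ?i \<otimes> word_value G f w = \<one>"
    using word_value_append[OF f i w] by simp
  then show ?thesis using inv_equality word_value_closed[OF f] i w by metis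
qed

text \<open>
  The \<open>f x\<close> are a basis of a free group. If two words in them have the same value in \<open>G\<close>, the quotient
  of the two reduces to the empty word, so they also have the same value in \<open>L\<close>, and evaluation in
  \<open>L\<close> is well defined.
\<close>

lemma free_hom_ex:
  assumes f: "f \<in> X \<rightarrow> carrier G"
    and free: "\<And>w. w \<in> words X \<Longrightarrow> reduced w \<Longrightarrow> word_value G f w = \<one> \<Longrightarrow> w = []"
    and L: "group L" and k: "k \<in> X \<rightarrow> carrier L"
  shows "\<exists>\<theta>\<in>hom (G\<lparr>carrier := generate G (f ` X)\<rparr>) L. \<forall>x\<in>X. \<theta> (f x) = k x"
proof -
  interpret L: group L by fact
  let ?V = "word_value G f" and ?K = "word_value L k"
  have triv: "?K w = \<one>\<^bsub>L\<^esub>" if w: "w \<in> words X" "?V w = \<one>" for w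
  proof -
    obtain w' where w': "w' \<in> words X" "reduced w'" "(w, w') \<in> word_eq X {}"
      using word_eq_reduced[OF w(1), of "{}"] by blast
    have "?V w' = \<one>" using word_value_word_eq[OF w'(3) f] w(2) by simp
    then have "w' = []" using free w' by blast
    then show ?thesis using L.word_value_word_eq[OF w'(3) k] by simp
  qed
  have eq: "?K u = ?K v" if uv: "u \<in> words X" "v \<in> words X" "?V u = ?V v" for u v
  proof -
    let ?i = "rev (map (\<lambda>(x, b). (x, \<not> b)) v)"
    have i: "?i \<in> words X" using uv by (auto simp: in_lists_conv_set)
    have ui: "u @ ?i \<in> words X" using uv(1) i by (rule append_in_lists_conv[THEN iffD2, OF conjI])
    have "?V (u @ ?i) = \<one>"
      using uv word_value_closed[OF f]
      by (simp add: word_value_append[OF f uv(1) i] word_value_inverse[OF f uv(2)])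
    then have "?K (u @ ?i) = \<one>\<^bsub>L\<^esub>" using triv[OF ui] by simp
    then have "?K u \<otimes>\<^bsub>L\<^esub> inv\<^bsub>L\<^esub> (?K v) = \<one>\<^bsub>L\<^esub>"
      by (simp add: L.word_value_append[OF k uv(1) i] L.word_value_inverse[OF k uv(2)])
    then show ?thesis
      using L.inv_solve_right'[of "\<one>\<^bsub>L\<^esub>" "?K u" "?K v"] L.word_value_closed[OF k] uv by simp
  qed
  define \<theta> where "\<theta> x = ?K (SOME w. w \<in> words X \<and> ?V w = x)" for x
  have \<theta>: "\<theta> (?V w) = ?K w" if "w \<in> words X" for w
  proof -
    let ?u = "SOME u. u \<in> words X \<and> ?V u = ?V w"
    have "?u \<in> words X \<and> ?V ?u = ?V w" by (rule someI[of _ w]) (use that in simp)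
    then show ?thesis unfolding \<theta>_def using eq that by blast
  qed
  have "\<theta> \<in> hom (G\<lparr>carrier := generate G (f ` X)\<rparr>) L"
  proof (rule homI)
    fix x assume "x \<in> carrier (G\<lparr>carrier := generate G (f ` X)\<rparr>)"
    then have "x \<in> generate G (f ` X)" by simp
    then obtain w where "w \<in> words X" "x = ?V w" using generate_word_value[OF f] by blast
    then show "\<theta> x \<in> carrier L" using \<theta> L.word_value_closed[OF k] by simp
  next
    fix x y
    assume "x \<in> carrier (G\<lparr>carrier := generate G (f ` X)\<rparr>)" "y \<in> carrier (G\<lparr>carrier := generate G (f ` X)\<rparr>)"
    then have "x \<in> generate G (f ` X)" "y \<in> generate G (f ` X)" by simp_all
    then obtain u v where uv: "u \<in> words X" "x = ?V u" "v \<in> words X" "y = ?V v"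
      using generate_word_value[OF f] by blast
    then have "x \<otimes> y = ?V (u @ v)" "u @ v \<in> words X" using word_value_append[OF f] by auto
    then show "\<theta> (x \<otimes>\<^bsub>G\<lparr>carrier := generate G (f ` X)\<rparr>\<^esub> y) = \<theta> x \<otimes>\<^bsub>L\<^esub> \<theta> y"
      using \<theta> uv L.word_value_append[OF k] by simp
  qed
  moreover have "\<theta> (f x) = k x" if x: "x \<in> X" for x
  proof -
    have "f x \<in> carrier G" "k x \<in> carrier L" using f k x by auto
    then show ?thesis using \<theta>[of "[(x, True)]"] x by simp
  qed
  ultimately show ?thesis by blast
qed

end


section \<open>Commensurated cyclic subgroups\<close>

text \<open>
  This says \<open>g z\<^sup>m g\<^sup>-\<^sup>1 = z\<^sup>n\<close>. Equations of the form \<open>g x = y g\<close> are easily raised to powers, inverted and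
  composed.
\<close>

definition commensurates :: "('g, 'm) monoid_scheme \<Rightarrow> 'g \<Rightarrow> 'g \<Rightarrow> bool" where
  "commensurates G z g \<longleftrightarrow> g \<in> carrier G \<and>
     (\<exists>(m::int) (n::int). m \<noteq> 0 \<and> n \<noteq> 0 \<and> g \<otimes>\<^bsub>G\<^esub> z [^]\<^bsub>G\<^esub> m = z [^]\<^bsub>G\<^esub> n \<otimes>\<^bsub>G\<^esub> g)"

context group
begin

lemma slide_pow:
  assumes "g \<in> carrier G" "x \<in> carrier G" "y \<in> carrier G" "g \<otimes> x = y \<otimes> g"
  shows "g \<otimes> x [^] (t::int) = y [^] t \<otimes> g"
proof -
  have pos: "g \<otimes> x [^] (int j) = y [^] (int j) \<otimes> g" for j
  proof (induction j)
    case (Suc j)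
    have e: "u [^] (int (Suc j)) = u [^] (int j) \<otimes> u" if "u \<in> carrier G" for u
      using int_pow_mult[OF that, of "int j" 1] that by (simp add: add.commute)
    have "g \<otimes> x [^] (int (Suc j)) = (g \<otimes> x [^] (int j)) \<otimes> x"
      using assms(1,2) by (simp only: e[OF assms(2)] m_assoc int_pow_closed)
    also have "\<dots> = y [^] (int j) \<otimes> (g \<otimes> x)" using Suc assms by (simp add: m_assoc)
    also have "\<dots> = y [^] (int (Suc j)) \<otimes> g"
      using assms by (simp only: e[OF assms(3)] m_assoc int_pow_closed)
    finally show ?case .
  qed (use assms in simp)
  show ?thesis
  proof (cases t rule: int_cases2)
    case (nonneg n) then show ?thesis using pos by simp
  next
    case (nonpos n)
    let ?a = "x [^] (int n)" and ?b = "y [^] (int n)"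
    have c: "?a \<in> carrier G" "?b \<in> carrier G" using assms by simp_all
    have "g = inv ?b \<otimes> (?b \<otimes> g)" using assms(1) c by (simp add: conjugate_cancel)
    also have "\<dots> = inv ?b \<otimes> (g \<otimes> ?a)" using pos by simp
    finally have "g = (inv ?b \<otimes> g) \<otimes> ?a" using assms(1) c by (simp add: m_assoc)
    then have "g \<otimes> inv ?a = inv ?b \<otimes> g"
      using inv_solve_right[of "inv ?b \<otimes> g" g ?a] assms(1) c by auto
    then show ?thesis using assms nonpos by (simp add: int_pow_neg)
  qed
qed

lemma slide_inv:
  assumes "g \<in> carrier G" "x \<in> carrier G" "y \<in> carrier G" "g \<otimes> x = y \<otimes> g"
  shows "inv g \<otimes> y = x \<otimes> inv g"
proof -
  have "y = (g \<otimes> x) \<otimes> inv g" using inv_solve_right[of y "g \<otimes> x" g] assms by blast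
  then show ?thesis using assms(1,2) by (simp add: m_assoc conjugate_cancel)
qed

lemma slide_mult:
  assumes "g \<in> carrier G" "h \<in> carrier G" "w \<in> carrier G" "x \<in> carrier G" "y \<in> carrier G"
    "h \<otimes> w = x \<otimes> h" "g \<otimes> x = y \<otimes> g"
  shows "(g \<otimes> h) \<otimes> w = y \<otimes> (g \<otimes> h)"
proof -
  have "(g \<otimes> h) \<otimes> w = g \<otimes> (h \<otimes> w)" using assms(1-3) by (simp add: m_assoc)
  also have "\<dots> = (g \<otimes> x) \<otimes> h" using assms(1-4) unfolding assms(6) by (simp add: m_assoc)
  also have "\<dots> = y \<otimes> (g \<otimes> h)" using assms(1,2,5) unfolding assms(7) by (simp add: m_assoc)
  finally show ?thesis .
qed

lemma commensurates_mult:
  assumes z: "z \<in> carrier G" and "commensurates G z g" "commensurates G z h"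
  shows "commensurates G z (g \<otimes> h)"
proof -
  obtain m n :: int where g: "g \<in> carrier G" "m \<noteq> 0" "n \<noteq> 0" "g \<otimes> z [^] m = z [^] n \<otimes> g"
    using assms by (auto simp: commensurates_def)
  obtain k l :: int where h: "h \<in> carrier G" "k \<noteq> 0" "l \<noteq> 0" "h \<otimes> z [^] k = z [^] l \<otimes> h"
    using assms by (auto simp: commensurates_def)
  have 1: "h \<otimes> z [^] (k * m) = z [^] (m * l) \<otimes> h"
    using slide_pow[OF h(1) _ _ h(4), of m] z by (simp add: int_pow_pow mult.commute)
  have 2: "g \<otimes> z [^] (m * l) = z [^] (n * l) \<otimes> g"
    using slide_pow[OF g(1) _ _ g(4), of l] z by (simp add: int_pow_pow)
  have "(g \<otimes> h) \<otimes> z [^] (k * m) = z [^] (n * l) \<otimes> (g \<otimes> h)"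
    by (rule slide_mult[OF g(1) h(1) _ _ _ 1 2]) (use z in auto)
  then show ?thesis unfolding commensurates_def using g h
    by (intro conjI exI[of _ "k * m"] exI[of _ "n * l"]) auto
qed

lemma commensurates_inv:
  assumes z: "z \<in> carrier G" and "commensurates G z g"
  shows "commensurates G z (inv g)"
proof -
  obtain m n :: int where g: "g \<in> carrier G" "m \<noteq> 0" "n \<noteq> 0" "g \<otimes> z [^] m = z [^] n \<otimes> g"
    using assms by (auto simp: commensurates_def)
  have "inv g \<otimes> z [^] n = z [^] m \<otimes> inv g" by (rule slide_inv[OF g(1) _ _ g(4)]) (use z in auto)
  then show ?thesis unfolding commensurates_def using g by blast
qed

lemma commensurates_generate:
  assumes z: "z \<in> carrier G" and S: "\<And>s. s \<in> S \<Longrightarrow> commensurates G z s" and x: "x \<in> generate G S"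
  shows "commensurates G z x"
  using x
proof (induction rule: generate.induct)
  case one
  then show ?case using z unfolding commensurates_def by (intro conjI exI[of _ 1]) auto
qed (use S commensurates_mult[OF z] commensurates_inv[OF z] in auto)

text \<open>
  Conjugation by \<open>g\<close> multiplies the exponents of suitable powers of \<open>z\<close> by a rational number that
  is multiplicative in \<open>g\<close>; hence it is \<open>1\<close> for a commutator. The exponent \<open>M\<close> is chosen such that the
  four conjugations in turn lead from a power of \<open>z\<close> to a power of \<open>z\<close>.
\<close>

lemma commutator_centralises:
  assumes z: "z \<in> carrier G" and "commensurates G z g" "commensurates G z h"
  shows "\<exists>M::int. M \<noteq> 0 \<and>
    (g \<otimes> h \<otimes> inv g \<otimes> inv h) \<otimes> z [^] M = z [^] M \<otimes> (g \<otimes> h \<otimes> inv g \<otimes> inv h)"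
proof -
  obtain m n :: int where g: "g \<in> carrier G" "m \<noteq> 0" "n \<noteq> 0" "g \<otimes> z [^] m = z [^] n \<otimes> g"
    using assms by (auto simp: commensurates_def)
  obtain k l :: int where h: "h \<in> carrier G" "k \<noteq> 0" "l \<noteq> 0" "h \<otimes> z [^] k = z [^] l \<otimes> h"
    using assms by (auto simp: commensurates_def)
  have gt: "g \<otimes> z [^] (m * t) = z [^] (n * t) \<otimes> g" for t
    using slide_pow[OF g(1) _ _ g(4), of t] z by (simp add: int_pow_pow)
  have ht: "h \<otimes> z [^] (k * t) = z [^] (l * t) \<otimes> h" for t
    using slide_pow[OF h(1) _ _ h(4), of t] z by (simp add: int_pow_pow)
  have git: "inv g \<otimes> z [^] (n * t) = z [^] (m * t) \<otimes> inv g" for t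
    by (rule slide_inv[OF g(1) _ _ gt]) (use z in auto)
  have hit: "inv h \<otimes> z [^] (l * t) = z [^] (k * t) \<otimes> inv h" for t
    by (rule slide_inv[OF h(1) _ _ ht]) (use z in auto)
  let ?M = "n * (l * m * k)"
  have 1: "inv h \<otimes> z [^] ?M = z [^] (n * (k * m * k)) \<otimes> inv h"
    using hit[of "n * m * k"] by (simp add: algebra_simps)
  have 2: "inv g \<otimes> z [^] (n * (k * m * k)) = z [^] (k * (m * m * k)) \<otimes> inv g"
    using git[of "k * m * k"] by (simp add: algebra_simps)
  have 3: "h \<otimes> z [^] (k * (m * m * k)) = z [^] (m * (l * m * k)) \<otimes> h"
    using ht[of "m * m * k"] by (simp add: algebra_simps)
  have 4: "g \<otimes> z [^] (m * (l * m * k)) = z [^] ?M \<otimes> g" using gt .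
  have 5: "(g \<otimes> h) \<otimes> z [^] (k * (m * m * k)) = z [^] ?M \<otimes> (g \<otimes> h)"
    by (rule slide_mult[OF _ _ _ _ _ 3 4]) (use z g h in auto)
  have 6: "(g \<otimes> h \<otimes> inv g) \<otimes> z [^] (n * (k * m * k)) = z [^] ?M \<otimes> (g \<otimes> h \<otimes> inv g)"
    by (rule slide_mult[OF _ _ _ _ _ 2 5]) (use z g h in auto)
  have "(g \<otimes> h \<otimes> inv g \<otimes> inv h) \<otimes> z [^] ?M = z [^] ?M \<otimes> (g \<otimes> h \<otimes> inv g \<otimes> inv h)"
    by (rule slide_mult[OF _ _ _ _ _ 1 6]) (use z g h in auto)
  then show ?thesis using g h by (intro exI[of _ ?M]) auto
qed

text \<open>
  The product of exponents that work for the single elements works for all of them.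
\<close>

lemma commensurates_finite:
  assumes z: "z \<in> carrier G" and "finite A" and A: "\<And>h. h \<in> A \<Longrightarrow> commensurates G z h"
  shows "\<exists>m::nat. m > 0 \<and> (\<forall>h\<in>A. \<exists>n::int. h \<otimes> z [^] (int m) = z [^] n \<otimes> h)"
  using \<open>finite A\<close> A
proof (induction rule: finite_induct)
  case empty
  then show ?case by auto
next
  case (insert h A)
  then obtain m :: nat where m: "m > 0" "\<And>h. h \<in> A \<Longrightarrow> \<exists>n::int. h \<otimes> z [^] (int m) = z [^] n \<otimes> h" by auto
  obtain k l :: int where h: "h \<in> carrier G" "k \<noteq> 0" "h \<otimes> z [^] k = z [^] l \<otimes> h"
    using insert.prems[of h] by (auto simp: commensurates_def)
  let ?m = "m * nat \<bar>k\<bar>"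
  have 1: "\<exists>n::int. g \<otimes> z [^] (int ?m) = z [^] n \<otimes> g" if g: "g \<in> A" for g
  proof -
    obtain n :: int where n: "g \<otimes> z [^] (int m) = z [^] n \<otimes> g" using m g by blast
    have gc: "g \<in> carrier G" using insert.prems[of g] g by (auto simp: commensurates_def)
    show ?thesis using slide_pow[OF gc _ _ n, of "\<bar>k\<bar>"] z by (auto simp: int_pow_pow)
  qed
  have 2: "\<exists>n::int. h \<otimes> z [^] (int ?m) = z [^] n \<otimes> h"
  proof -
    have e: "int ?m = k * (sgn k * int m)" by (cases k "0::int" rule: linorder_cases) auto
    have "h \<otimes> (z [^] k) [^] (sgn k * int m) = (z [^] l) [^] (sgn k * int m) \<otimes> h"
      by (rule slide_pow[OF h(1) _ _ h(3)]) (use z in auto)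
    then have "h \<otimes> z [^] (int ?m) = z [^] (l * (sgn k * int m)) \<otimes> h"
      using z unfolding e by (simp only: int_pow_pow)
    then show ?thesis by blast
  qed
  show ?case using m(1) h(2) 1 2 by (intro exI[of _ ?m]) auto
qed

end


section \<open>A criterion for the failure of the f.g.i.p.\<close>

text \<open>
  A word involves finitely many generators, so its value already occurs at a finite stage of the chain.
\<close>

lemma (in group) generate_Un_chain:
  assumes A: "\<And>n::nat. A n \<subseteq> A (Suc n)" "\<And>n. A n \<subseteq> carrier G"
    and S: "finite S" "S \<subseteq> generate G (\<Union>n. A n)"
  shows "\<exists>n. S \<subseteq> generate G (A n)"
proof -
  have mono: "generate G (A m) \<subseteq> generate G (A n)" if "m \<le> n" for m n
    by (rule mono_generate) (use A(1) that lift_Suc_mono_le in blast)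
  have one: "\<exists>n. x \<in> generate G (A n)" if "x \<in> generate G (\<Union>n. A n)" for x
    using that
  proof (induction rule: generate.induct)
    case (eng h1 h2)
    then obtain m n where "h1 \<in> generate G (A m)" "h2 \<in> generate G (A n)" by blast
    then have "h1 \<in> generate G (A (max m n))" "h2 \<in> generate G (A (max m n))"
      using mono by (meson max.cobounded1 max.cobounded2 subsetD)+
    then show ?case using generate.eng by metis
  qed (auto intro: generate.intros)
  show ?thesis
    using S
  proof (induction rule: finite_induct)
    case (insert x S)
    then obtain m n where "x \<in> generate G (A m)" "S \<subseteq> generate G (A n)" using one by blast
    then have "insert x S \<subseteq> generate G (A (max m n))"
      using mono[of m "max m n"] mono[of n "max m n"] by auto
    then show ?case by blast
  qed simp
qed

text \<open>
  Let \<open>z\<close> be central in \<open>\<langle>a, b, z\<rangle>\<close> with \<open>\<langle>a, b\<rangle> \<inter> \<langle>z\<rangle> = 1\<close>. Then \<open>\<langle>a, b\<rangle>\<close> and \<open>\<langle>a, b z\<rangle>\<close> meet in the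
  subgroup generated by all the conjugates \<open>b\<^sup>i a b\<^sup>-\<^sup>i\<close>. Any action of \<open>\<langle>a, b\<rangle>\<close> in which, for every
  \<open>n\<close>, some point is fixed by the conjugates with \<open>\<bar>i\<bar> \<le> n\<close> but not by all of them shows that this
  subgroup is not finitely generated.
\<close>

lemma (in group) not_fgip_central_twist:
  assumes ab: "a \<in> carrier G" "b \<in> carrier G" and z: "infinite_order G z"
    and comm: "a \<otimes> z = z \<otimes> a" "b \<otimes> z = z \<otimes> b"
    and trivial: "\<And>k::int. z [^] k \<in> generate G {a, b} \<Longrightarrow> k = 0"
    and \<theta>: "\<theta> \<in> hom (G\<lparr>carrier := generate G {a, b}\<rparr>) (perms :: ('x \<Rightarrow> 'x) monoid)"
    and moved: "\<And>n::nat. \<exists>y. (\<forall>i::int. \<bar>i\<bar> \<le> int n \<longrightarrow> \<theta> (b [^] i \<otimes> a \<otimes> inv (b [^] i)) y = y) \<and>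
      (\<exists>m::int. \<theta> (b [^] m \<otimes> a \<otimes> inv (b [^] m)) y \<noteq> y)"
  shows "\<not> fgip G"
proof
  assume fgip: "fgip G"
  define c where "c i = b [^] (i::int) \<otimes> a \<otimes> inv (b [^] i)" for i
  have zc: "z \<in> carrier G" using z by (simp add: infinite_order_def)
  have cc: "c i \<in> carrier G" for i using ab by (simp add: c_def)
  define H where "H = generate G {a, b}"
  define K where "K = generate G {a, b \<otimes> z}"
  define N where "N = generate G (range c)"
  have sub: "subgroup H G" "subgroup K G" "subgroup N G"
    unfolding H_def K_def N_def using ab zc cc by (auto intro!: generate_is_subgroup)
  note HD = subgroupD[OF sub(1)] and KD = subgroupD[OF sub(2)] and ND = subgroupD[OF sub(3)]
  have abH: "a \<in> H" "b \<in> H" "a \<in> K" "b \<otimes> z \<in> K"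
    unfolding H_def K_def by (auto intro: generate.incl)
  have bz: "(b \<otimes> z) [^] i = b [^] i \<otimes> z [^] i" for i :: int
    using int_pow_mult_distrib[OF comm(2) ab(2) zc] .
  have za: "a \<otimes> z [^] i = z [^] i \<otimes> a" for i :: int by (rule slide_pow[OF ab(1) zc zc comm(1)])
  have cH: "c i \<in> H" for i
    unfolding c_def using HD(4)[OF HD(4)[OF HD(5)[OF abH(2)] abH(1)] HD(3)[OF HD(5)[OF abH(2)]]] .
  have cK: "c i \<in> K" for i
  proof -
    have "(b \<otimes> z) [^] i \<otimes> a \<otimes> inv ((b \<otimes> z) [^] i) = b [^] i \<otimes> (z [^] i \<otimes> a) \<otimes> inv (z [^] i) \<otimes> inv (b [^] i)"
      unfolding bz using ab zc by (simp add: inv_mult_group m_assoc)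
    also have "\<dots> = c i" unfolding za[symmetric] c_def using ab zc by (simp add: m_assoc)
    finally show ?thesis
      using KD(4)[OF KD(4)[OF KD(5)[OF abH(4)] abH(3)] KD(3)[OF KD(5)[OF abH(4)]], of i i] by simp
  qed
  have NH: "N \<subseteq> H" and NK: "N \<subseteq> K"
    unfolding N_def using generate_subgroup_incl[OF _ sub(1), of "range c"]
      generate_subgroup_incl[OF _ sub(2), of "range c"] cH cK by auto
  have c1: "b \<otimes> c i \<otimes> inv b = c (i + 1)" for i
    using ab int_pow_mult[of b 1 i] by (simp add: c_def m_assoc inv_mult_group add.commute)
  have c2: "inv b \<otimes> c i \<otimes> b = c (i - 1)" for i
  proof -
    have "c i = b \<otimes> c (i - 1) \<otimes> inv b" using c1[of "i - 1"] by simp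
    then show ?thesis using ab cc[of "i - 1"] by (simp add: m_assoc conjugate_cancel)
  qed
  have normal: "b \<otimes> n \<otimes> inv b \<in> N \<and> inv b \<otimes> n \<otimes> b \<in> N" if "n \<in> N" for n
    using that unfolding N_def
  proof (induction rule: generate.induct)
    case one
    then show ?case using ab generate.one by auto
  next
    case (incl h)
    then obtain i where i: "h = c i" by blast
    then show ?case by (auto simp: c1 c2 intro: generate.incl)
  next
    case (inv h)
    then obtain i where i: "h = c i" by blast
    have "b \<otimes> inv (c i) \<otimes> inv b = inv (c (i + 1))" "inv b \<otimes> inv (c i) \<otimes> b = inv (c (i - 1))"
      unfolding c1[symmetric] c2[symmetric] using ab cc[of i] by (simp_all add: inv_mult_group m_assoc)
    then show ?case using i by (auto intro: generate.inv)
  next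
    case (eng h1 h2)
    have h: "h1 \<in> carrier G" "h2 \<in> carrier G" using eng ND(1) unfolding N_def by auto
    have "b \<otimes> (h1 \<otimes> h2) \<otimes> inv b = (b \<otimes> h1 \<otimes> inv b) \<otimes> (b \<otimes> h2 \<otimes> inv b)"
      "inv b \<otimes> (h1 \<otimes> h2) \<otimes> b = (inv b \<otimes> h1 \<otimes> b) \<otimes> (inv b \<otimes> h2 \<otimes> b)"
      using h ab by (simp_all add: m_assoc conjugate_cancel)
    then show ?case using eng generate.eng by metis
  qed
  have bn: "n \<in> N \<Longrightarrow> b \<otimes> n \<otimes> inv b \<in> N" "n \<in> N \<Longrightarrow> inv b \<otimes> n \<otimes> b \<in> N" for n
    using normal by auto
  (* \<open>b\<close> normalises \<open>N\<close> and \<open>z\<close> is central, so the exponents of \<open>b\<close> and of \<open>z\<close> stay equal. In \<open>H\<close> no power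
     of \<open>z\<close> other than \<open>\<one>\<close> is left, which makes both exponents \<open>0\<close> on \<open>H \<inter> K\<close>. *)
  have shape: "\<exists>n\<in>N. \<exists>i::int. k = (n \<otimes> b [^] i) \<otimes> z [^] i" if "k \<in> K" for k
    using that unfolding K_def
  proof (induction rule: generate.induct)
    case one
    then show ?case using ND(2) by (intro bexI[of _ \<one>] exI[of _ 0]) auto
  next
    case (incl h)
    then consider "h = a" | "h = b \<otimes> z" by blast
    then show ?case
    proof cases
      case 1
      have "a = c 0" using ab by (simp add: c_def)
      then have "a \<in> N" unfolding N_def by (auto intro: generate.incl)
      then show ?thesis using 1 ab by (intro bexI[of _ a] exI[of _ 0]) auto
    next
      case 2
      then show ?thesis using ND(2) ab zc by (intro bexI[of _ \<one>] exI[of _ 1]) auto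
    qed
  next
    case (inv h)
    then consider "h = a" | "h = b \<otimes> z" by blast
    then show ?case
    proof cases
      case 1
      have "a = c 0" using ab by (simp add: c_def)
      then have "inv a \<in> N" unfolding N_def by (auto intro: generate.inv)
      then show ?thesis using 1 ab by (intro bexI[of _ "inv a"] exI[of _ 0]) auto
    next
      case 2
      have "inv (b \<otimes> z) = b [^] (-1::int) \<otimes> z [^] (-1::int)"
        using bz[of "-1"] ab zc by (simp add: int_pow_neg)
      then show ?thesis using 2 ND(2) ab zc by (intro bexI[of _ \<one>] exI[of _ "-1"]) auto
    qed
  next
    case (eng h1 h2)
    then obtain n1 i1 n2 i2 where n: "n1 \<in> N" "h1 = (n1 \<otimes> b [^] i1) \<otimes> z [^] (i1::int)"
      "n2 \<in> N" "h2 = (n2 \<otimes> b [^] i2) \<otimes> z [^] (i2::int)" by blast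
    obtain n3 where n3: "n3 \<in> N" "(n1 \<otimes> b [^] i1) \<otimes> (n2 \<otimes> b [^] i2) = n3 \<otimes> b [^] (i1 + i2)"
      using mult_normalised_pow[OF sub(3) ab(2) bn n(1,3)] by blast
    have nc: "n1 \<in> carrier G" "n2 \<in> carrier G" using n ND(1) by auto
    have x: "n2 \<otimes> b [^] i2 \<in> H" using HD(4)[OF _ HD(5)[OF abH(2)]] n(3) NH by blast
    have central: "h \<otimes> z = z \<otimes> h" if "h \<in> H" for h
      using that unfolding H_def
    proof (induction rule: generate.induct)
      case (inv h)
      have "h \<in> carrier G" "h \<otimes> z = z \<otimes> h" using inv ab comm by auto
      then show ?case using slide_inv[of h z z] zc by simp
    next
      case (eng g h)
      have "g \<in> carrier G" "h \<in> carrier G" using eng HD(1) unfolding H_def by auto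
      then show ?case using slide_mult[of g h z z z] eng zc by simp
    qed (use ab zc comm in auto)
    have y: "z [^] i1 \<otimes> (n2 \<otimes> b [^] i2) = (n2 \<otimes> b [^] i2) \<otimes> z [^] i1"
      using slide_pow[OF _ zc zc central[OF x]] nc ab by simp
    have "h1 \<otimes> h2 = (n1 \<otimes> b [^] i1) \<otimes> (z [^] i1 \<otimes> (n2 \<otimes> b [^] i2)) \<otimes> z [^] i2"
      using n nc ab zc by (simp add: m_assoc)
    also have "\<dots> = ((n1 \<otimes> b [^] i1) \<otimes> (n2 \<otimes> b [^] i2)) \<otimes> (z [^] i1 \<otimes> z [^] i2)"
      unfolding y using nc ab zc by (simp add: m_assoc)
    also have "\<dots> = (n3 \<otimes> b [^] (i1 + i2)) \<otimes> z [^] (i1 + i2)"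
      unfolding n3 using zc by (simp add: int_pow_mult)
    finally show ?case using n3 by blast
  qed
  have "H \<inter> K \<subseteq> N"
  proof
    fix k assume k: "k \<in> H \<inter> K"
    obtain n and i :: int where n: "n \<in> N" "k = (n \<otimes> b [^] i) \<otimes> z [^] i" using shape k by blast
    have nbH: "n \<otimes> b [^] i \<in> H" using HD(4)[OF _ HD(5)[OF abH(2)]] n(1) NH by blast
    then have nbc: "n \<otimes> b [^] i \<in> carrier G" using HD(1) by blast
    have "z [^] i = inv (n \<otimes> b [^] i) \<otimes> k" unfolding n(2) using nbc zc by (simp add: conjugate_cancel)
    also have "\<dots> \<in> H" using HD(4)[OF HD(3)[OF nbH]] k by blast
    finally have "i = 0" using trivial unfolding H_def by blast
    then show "k \<in> N" using n ND(1) by auto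
  qed
  then have HK: "H \<inter> K = N" using NH NK by blast
  have "fin_gen_subgroup H G" "fin_gen_subgroup K G"
    unfolding H_def K_def using ab zc by (simp_all add: fin_gen_generate)
  then have "fin_gen_subgroup N G" using fgip sub(1,2) unfolding fgip_def HK[symmetric] by blast
  then obtain S where S: "finite S" "S \<subseteq> N" "N \<subseteq> generate G S"
    using fin_gen_subgroup_iff[OF sub(3)] by blast
  (* A finite set of generators of \<open>N\<close> would lie in the subgroup generated by finitely many of the
     conjugates, and then all conjugates would fix the points that these finitely many fix. *)
  define A where "A n = c ` {- int n..int n}" for n
  have "(\<Union>n. A n) = range c"
  proof -
    have "c i \<in> A (nat \<bar>i\<bar>)" for i unfolding A_def by (rule imageI) auto
    then have "range c \<subseteq> (\<Union>n. A n)" by blast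
    moreover have "(\<Union>n. A n) \<subseteq> range c" by (auto simp: A_def)
    ultimately show ?thesis by blast
  qed
  then have "\<exists>n. S \<subseteq> generate G (A n)"
    by (intro generate_Un_chain) (use S cc in \<open>auto simp: A_def N_def\<close>)
  then obtain n where n: "S \<subseteq> generate G (A n)" by blast
  have An: "A n \<subseteq> carrier G" using cc by (auto simp: A_def)
  then have NA: "N \<subseteq> generate G (A n)"
    using S(3) generate_subgroup_incl[OF n generate_is_subgroup[OF An]] by blast
  obtain y m where y: "\<And>i::int. \<bar>i\<bar> \<le> int n \<Longrightarrow> \<theta> (c i) y = y" "\<theta> (c m) y \<noteq> y"
    using moved[of n] unfolding c_def by blast
  interpret HG: group "G\<lparr>carrier := H\<rparr>" using subgroup_imp_group[OF sub(1)] .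
  interpret \<theta>: group_hom "G\<lparr>carrier := H\<rparr>" "perms :: ('x \<Rightarrow> 'x) monoid" \<theta>
    using \<theta> group_perms HG.is_group by (simp add: group_hom_def group_hom_axioms_def H_def)
  have ci: "c i \<in> H" for i using cH .
  have AH: "generate G (A n) \<subseteq> H" using generate_subgroup_incl[OF _ sub(1), of "A n"] cH by (auto simp: A_def)
  have fixed: "\<theta> x y = y" if "x \<in> generate G (A n)" for x
    using that
  proof (induction rule: generate.induct)
    case one
    then show ?case using \<theta>.hom_one by simp
  next
    case (incl h)
    then show ?case using y(1) by (auto simp: A_def)
  next
    case (inv h)
    then have h: "h \<in> H" "\<theta> h y = y" using y(1) cH by (auto simp: A_def)
    then have "\<theta> h \<in> carrier perms" using \<theta>.hom_closed by simp
    then have bij: "bij (\<theta> h)" by simp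
    have "\<theta> (inv h) = inv\<^bsub>perms\<^esub> (\<theta> h)"
      using \<theta>.hom_inv[of h] h m_inv_consistent[OF sub(1)] by simp
    also have "\<dots> = inv_into UNIV (\<theta> h)" using inv_perms[OF bij] .
    finally show ?case using h(2) bij by (metis bij_inv_eq_iff)
  next
    case (eng h1 h2)
    then have "h1 \<in> H" "h2 \<in> H" using AH by blast+
    then have "\<theta> (h1 \<otimes> h2) = \<theta> h1 \<circ> \<theta> h2" using \<theta>.hom_mult[of h1 h2] by simp
    then show ?case using eng by simp
  qed
  have "c m \<in> N" by (auto simp: N_def intro: generate.incl)
  then show False using fixed NA y(2) by blast
qed


subsection \<open>Two commutators in the free group of rank two\<close>

text \<open>
  Let \<open>x\<close> and \<open>y\<close> be a basis of a free group. Wanted are \<open>a\<close> and \<open>b\<close> in its commutator subgroup and an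
  action on the integers as required above. If \<open>x\<close> acts as \<open>p \<mapsto> -p\<close> and \<open>y\<close> as the shift \<open>p \<mapsto> p + 1\<close>, the
  commutators \<open>[x, y]\<close> and \<open>[x, y\<^sup>-\<^sup>1]\<close> act as the translations by \<open>-2\<close> and by \<open>2\<close>, and their product is
  trivial. Disturbing the action of \<open>x\<close> by the transposition of \<open>0\<close> and \<open>1\<close> has an effect near the origin
  only. So \<open>b = [x, y]\<close> still moves large even numbers down by \<open>2\<close>, and \<open>a = [x, y] [x, y\<^sup>-\<^sup>1]\<close> fixes
  the positive even numbers without being trivial.
\<close>

definition swap01 :: "int \<Rightarrow> int" where
  "swap01 x = (if x = 0 then 1 else if x = 1 then 0 else x)"

definition flip_perm :: "int \<Rightarrow> int" where "flip_perm x = - swap01 x"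
definition shift_perm :: "int \<Rightarrow> int" where "shift_perm x = x + 1"

lemma swap01_swap01 [simp]: "swap01 (swap01 x) = x" by (simp add: swap01_def)

lemma bij_flip: "bij flip_perm"
  by (rule o_bij[of "\<lambda>x. swap01 (- x)"]) (auto simp: flip_perm_def fun_eq_iff)

lemma bij_shift: "bij shift_perm"
  by (rule o_bij[of "\<lambda>x. x - 1"]) (auto simp: shift_perm_def fun_eq_iff)

lemma inv_flip: "inv_into UNIV flip_perm = (\<lambda>x. swap01 (- x))"
  by (rule inv_equality) (auto simp: flip_perm_def)

lemma inv_shift: "inv_into UNIV shift_perm = (\<lambda>x. x - 1)"
  by (rule inv_equality) (auto simp: shift_perm_def)

abbreviation (in group) commutator :: "'a \<Rightarrow> 'a \<Rightarrow> 'a" where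
  "commutator g h \<equiv> g \<otimes> h \<otimes> inv g \<otimes> inv h"


interpretation perms: group "perms :: ('x \<Rightarrow> 'x) monoid" by (rule group_perms)

definition drift_perm :: "int \<Rightarrow> int" where
  "drift_perm = perms.commutator flip_perm shift_perm"

definition local_perm :: "int \<Rightarrow> int" where
  "local_perm = drift_perm \<otimes>\<^bsub>perms\<^esub> perms.commutator flip_perm (inv\<^bsub>perms\<^esub> shift_perm)"

lemma drift_perm_eq: "drift_perm x = - swap01 (swap01 (1 - x) + 1)"
  by (simp add: drift_perm_def inv_perms bij_flip bij_shift inv_flip inv_shift flip_perm_def shift_perm_def)

lemma local_perm_eq: "local_perm x = drift_perm (- swap01 (swap01 (- (x + 1)) - 1))"
proof -
  have "inv\<^bsub>perms\<^esub> (inv\<^bsub>perms\<^esub> shift_perm) = shift_perm" by (rule perms.inv_inv) (simp add: bij_shift)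
  then show ?thesis
    by (simp add: local_perm_def inv_perms bij_flip bij_shift inv_flip inv_shift flip_perm_def shift_perm_def)
qed

lemma bij_drift: "bij drift_perm"
proof -
  have "drift_perm \<in> carrier perms" unfolding drift_perm_def
    by (intro perms.m_closed perms.inv_closed) (simp_all add: bij_flip bij_shift)
  then show ?thesis by simp
qed

lemma drift_perm_even: "j \<ge> 2 \<Longrightarrow> drift_perm (2 * j) = 2 * (j - 1)" "drift_perm 2 = -1"
  by (simp_all add: drift_perm_eq swap01_def)

lemma local_perm_even: "j \<ge> 1 \<Longrightarrow> local_perm (2 * j) = 2 * j" "local_perm (-1) \<noteq> -1"
  by (auto simp: local_perm_eq drift_perm_eq swap01_def)

lemma drift_perm_pow:
  assumes "j \<ge> 1" "j - i \<ge> 1"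
  shows "(drift_perm [^]\<^bsub>perms\<^esub> i) (2 * j) = 2 * (j - (i::int))"
proof -
  have c: "drift_perm \<in> carrier perms" by (simp add: bij_drift)
  have pos: "(drift_perm [^]\<^bsub>perms\<^esub> (int n)) (2 * j) = 2 * (j - int n)" if "j - int n \<ge> 1" for n j
    using that
  proof (induction n)
    case (Suc n)
    have "drift_perm [^]\<^bsub>perms\<^esub> (int (Suc n)) = drift_perm \<circ> drift_perm [^]\<^bsub>perms\<^esub> (int n)"
      using perms.int_pow_mult[OF c, of 1 "int n"] perms.int_pow_1[OF c] by simp
    then show ?case using Suc drift_perm_even(1)[of "j - int n"] by simp
  qed simp
  show ?thesis
  proof (cases i rule: int_cases2)
    case (nonneg n) then show ?thesis using pos assms by simp
  next
    case (nonpos n)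
    let ?p = "drift_perm [^]\<^bsub>perms\<^esub> (int n)"
    have "?p \<in> carrier perms" using perms.int_pow_closed[OF c] .
    then have b: "bij ?p" by simp
    have "?p (2 * (j + int n)) = 2 * j" using pos[of "j + int n" n] assms by simp
    then have "inv_into UNIV ?p (2 * j) = 2 * (j + int n)" by (rule inv_f_eq[OF bij_is_inj[OF b]])
    then show ?thesis using nonpos perms.int_pow_neg[OF c, of "int n"] inv_perms[OF b] by simp
  qed
qed

lemma drift_local_moved:
  "\<exists>y. (\<forall>i::int. \<bar>i\<bar> \<le> int n \<longrightarrow>
        (drift_perm [^]\<^bsub>perms\<^esub> i \<otimes>\<^bsub>perms\<^esub> local_perm \<otimes>\<^bsub>perms\<^esub> inv\<^bsub>perms\<^esub> (drift_perm [^]\<^bsub>perms\<^esub> i)) y = y) \<and>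
     (\<exists>m::int. (drift_perm [^]\<^bsub>perms\<^esub> m \<otimes>\<^bsub>perms\<^esub> local_perm \<otimes>\<^bsub>perms\<^esub> inv\<^bsub>perms\<^esub> (drift_perm [^]\<^bsub>perms\<^esub> m)) y \<noteq> y)"
proof -
  have c: "drift_perm \<in> carrier perms" by (simp add: bij_drift)
  have b: "bij (drift_perm [^]\<^bsub>perms\<^esub> (i::int))" for i
    using perms.int_pow_closed[OF c, of i] by simp
  have inv: "inv\<^bsub>perms\<^esub> (drift_perm [^]\<^bsub>perms\<^esub> (i::int)) = drift_perm [^]\<^bsub>perms\<^esub> (- i)" for i
    using perms.int_pow_neg[OF c, of i] by simp
  have cancel: "(drift_perm [^]\<^bsub>perms\<^esub> i) ((drift_perm [^]\<^bsub>perms\<^esub> (- i)) x) = x" for i :: int and x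
    using perms.int_pow_mult[OF c, of i "- i"] by (simp add: fun_eq_iff)
  (* All powers of \<open>drift_perm\<close> with exponent between \<open>-n\<close> and \<open>n\<close> map \<open>y\<close> to a positive even number, which
     \<open>local_perm\<close> fixes. The next power takes \<open>y\<close> through \<open>2\<close> to \<open>-1\<close>, which \<open>local_perm\<close> moves. *)
  define y where "y = 2 * (int n + 1)"
  have "(drift_perm [^]\<^bsub>perms\<^esub> i \<otimes>\<^bsub>perms\<^esub> local_perm \<otimes>\<^bsub>perms\<^esub> inv\<^bsub>perms\<^esub> (drift_perm [^]\<^bsub>perms\<^esub> i)) y = y"
    if "\<bar>i\<bar> \<le> int n" for i :: int
  proof -
    have "(drift_perm [^]\<^bsub>perms\<^esub> (- i)) y = 2 * (int n + 1 - (- i))"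
      unfolding y_def by (rule drift_perm_pow) (use that in linarith)+
    moreover have "local_perm (2 * (int n + 1 - (- i))) = 2 * (int n + 1 - (- i))"
      by (rule local_perm_even(1)) (use that in linarith)
    ultimately have "local_perm ((drift_perm [^]\<^bsub>perms\<^esub> (- i)) y) = (drift_perm [^]\<^bsub>perms\<^esub> (- i)) y" by simp
    then show ?thesis using cancel[of i y] by (simp add: inv)
  qed
  moreover
  define m where "m = - (int n + 1)"
  have "drift_perm [^]\<^bsub>perms\<^esub> (- m) = drift_perm \<circ> drift_perm [^]\<^bsub>perms\<^esub> (int n)"
    using perms.int_pow_mult[OF c, of 1 "int n"] perms.int_pow_1[OF c] by (simp add: m_def add.commute)
  then have 1: "(drift_perm [^]\<^bsub>perms\<^esub> (- m)) y = -1"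
    using drift_perm_pow[of "int n + 1" "int n"] drift_perm_even(2) by (simp add: y_def)
  have "(drift_perm [^]\<^bsub>perms\<^esub> m \<otimes>\<^bsub>perms\<^esub> local_perm \<otimes>\<^bsub>perms\<^esub> inv\<^bsub>perms\<^esub> (drift_perm [^]\<^bsub>perms\<^esub> m)) y \<noteq> y"
  proof
    assume "(drift_perm [^]\<^bsub>perms\<^esub> m \<otimes>\<^bsub>perms\<^esub> local_perm \<otimes>\<^bsub>perms\<^esub> inv\<^bsub>perms\<^esub> (drift_perm [^]\<^bsub>perms\<^esub> m)) y = y"
    then have "(drift_perm [^]\<^bsub>perms\<^esub> m) (local_perm (-1)) = (drift_perm [^]\<^bsub>perms\<^esub> m) (-1)"
      using 1 cancel[of m y] by (simp add: inv)
    then show False using b local_perm_even(2) by (metis bij_is_inj injD)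
  qed
  ultimately show ?thesis by blast
qed

text \<open>
  The elements \<open>g True\<close> and \<open>g False\<close> are a basis of a free group that meets \<open>\<langle>z\<rangle>\<close> trivially. Elements of
  its commutator subgroup centralise powers of \<open>z\<close>, so that \<open>not_fgip_central_twist\<close> applies to a power
  of \<open>z\<close> and two such elements. The required action exists because the basis can be mapped to any two
  permutations.
\<close>

lemma (in group) not_fgip_free_pair:
  fixes g :: "bool \<Rightarrow> 'a"
  assumes g: "\<And>x. commensurates G z (g x)" and z: "infinite_order G z"
    and free: "\<And>w (e::int). reduced w \<Longrightarrow> word_value G g w = z [^] e \<Longrightarrow> w = []"
  shows "\<not> fgip G"
proof -
  have zc: "z \<in> carrier G" using z by (simp add: infinite_order_def)
  have gc: "g x \<in> carrier G" for x using g by (simp add: commensurates_def)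
  then have gF: "g \<in> UNIV \<rightarrow> carrier G" by simp
  define F where "F = generate G (range g)"
  have F: "subgroup F G" unfolding F_def using gc by (intro generate_is_subgroup) auto
  note FD = subgroupD[OF F]
  interpret F: group "G\<lparr>carrier := F\<rparr>" using subgroup_imp_group[OF F] .
  have "\<exists>\<theta>\<in>hom (G\<lparr>carrier := generate G (range g)\<rparr>) (perms :: (int \<Rightarrow> int) monoid).
      \<forall>x\<in>UNIV. \<theta> (g x) = (if x then flip_perm else shift_perm)"
  proof (rule free_hom_ex[OF gF _ group_perms])
    show "w = []" if "reduced w" "word_value G g w = \<one>" for w
      using free[of w 0] that by simp
  qed (auto simp: bij_flip bij_shift)
  then obtain \<theta> where \<theta>: "\<theta> \<in> hom (G\<lparr>carrier := F\<rparr>) (perms :: (int \<Rightarrow> int) monoid)"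
    and \<theta>g: "\<theta> (g True) = flip_perm" "\<theta> (g False) = shift_perm"
    by (auto simp: F_def)
  interpret \<theta>: group_hom "G\<lparr>carrier := F\<rparr>" "perms :: (int \<Rightarrow> int) monoid" \<theta>
    using \<theta> group_perms F.is_group by (simp add: group_hom_def group_hom_axioms_def)
  have \<theta>m: "\<theta> (x \<otimes> y) = \<theta> x \<otimes>\<^bsub>perms\<^esub> \<theta> y" if "x \<in> F" "y \<in> F" for x y
    using \<theta>.hom_mult[of x y] that by simp
  have \<theta>i: "\<theta> (inv x) = inv\<^bsub>perms\<^esub> (\<theta> x)" if "x \<in> F" for x
    using \<theta>.hom_inv[of x] m_inv_consistent[OF F] that by simp
  have \<theta>p: "\<theta> (x [^] (i::int)) = \<theta> x [^]\<^bsub>perms\<^esub> i" if "x \<in> F" for x i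
    using \<theta>.hom_int_pow[of x i] int_pow_consistent[OF F, of x i] that by simp
  have gF': "g x \<in> F" for x unfolding F_def by (auto intro: generate.incl)
  have comm_F: "commutator x y \<in> F" if "x \<in> F" "y \<in> F" for x y
    using that FD(3,4) by simp
  have \<theta>comm: "\<theta> (commutator x y) = perms.commutator (\<theta> x) (\<theta> y)" if "x \<in> F" "y \<in> F" for x y
    using that FD(3,4) by (simp only: \<theta>m \<theta>i)
  define b where "b = commutator (g True) (g False)"
  define c where "c = commutator (g True) (inv (g False))"
  define a where "a = b \<otimes> c"
  have F': "b \<in> F" "c \<in> F" "a \<in> F" unfolding a_def b_def c_def
    using comm_F gF' FD(3,4) by simp_all
  then have abc: "a \<in> carrier G" "b \<in> carrier G" "c \<in> carrier G" using FD(1) by blast+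
  have \<theta>b: "\<theta> b = drift_perm" unfolding b_def drift_perm_def \<theta>comm[OF gF' gF'] \<theta>g ..
  have \<theta>a: "\<theta> a = local_perm"
    unfolding a_def \<theta>m[OF F'(1,2)] \<theta>b local_perm_def
    by (simp only: c_def \<theta>comm[OF gF' FD(3)[OF gF']] \<theta>i[OF gF'] \<theta>g)
  obtain M1 :: int where M1: "M1 \<noteq> 0" "b \<otimes> z [^] M1 = z [^] M1 \<otimes> b"
    using commutator_centralises[OF zc g g] unfolding b_def by blast
  obtain M2 :: int where M2: "M2 \<noteq> 0" "c \<otimes> z [^] M2 = z [^] M2 \<otimes> c"
    using commutator_centralises[OF zc g commensurates_inv[OF zc g]] unfolding c_def by blast
  define M where "M = M1 * M2"
  have bM: "b \<otimes> z [^] M = z [^] M \<otimes> b"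
    using slide_pow[OF abc(2) _ _ M1(2), of M2] zc by (simp add: int_pow_pow M_def)
  have cM: "c \<otimes> z [^] M = z [^] M \<otimes> c"
    using slide_pow[OF abc(3) _ _ M2(2), of M1] zc by (simp add: int_pow_pow M_def mult.commute)
  have aM: "a \<otimes> z [^] M = z [^] M \<otimes> a"
    unfolding a_def by (rule slide_mult[OF abc(2,3) _ _ _ cM bM]) (use zc in auto)
  have HF: "generate G {a, b} \<subseteq> F" using generate_subgroup_incl[OF _ F] F' by simp
  show ?thesis
  proof (rule not_fgip_central_twist[OF abc(1,2) _ aM bM])
    show "infinite_order G (z [^] M)" using infinite_order_pow[OF z] M1 M2 by (simp add: M_def)
    show "k = 0" if "(z [^] M) [^] k \<in> generate G {a, b}" for k :: int
    proof -
      have "z [^] (M * k) \<in> generate G (range g)" using that HF zc by (auto simp: F_def int_pow_pow)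
      then obtain w where w: "w \<in> words UNIV" "z [^] (M * k) = word_value G g w"
        using generate_word_value[OF gF] by blast
      obtain w' where w': "w' \<in> words UNIV" "reduced w'" "(w, w') \<in> word_eq UNIV {}"
        using word_eq_reduced[OF w(1), of "{}"] by blast
      have "word_value G g w' = z [^] (M * k)" using word_value_word_eq[OF w'(3) gF] w(2) by simp
      then have "w' = []" using free w'(2) by blast
      then have "z [^] (M * k) = \<one>" using \<open>word_value G g w' = z [^] (M * k)\<close> by simp
      then have "M * k = 0" using z unfolding infinite_order_def by blast
      then show "k = 0" using M1 M2 by (simp add: M_def)
    qed
    show "\<theta> \<in> hom (G\<lparr>carrier := generate G {a, b}\<rparr>) perms"
      using \<theta> HF unfolding hom_def by auto
    have e: "\<theta> (b [^] i \<otimes> a \<otimes> inv (b [^] i)) =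
        drift_perm [^]\<^bsub>perms\<^esub> i \<otimes>\<^bsub>perms\<^esub> local_perm \<otimes>\<^bsub>perms\<^esub> inv\<^bsub>perms\<^esub> (drift_perm [^]\<^bsub>perms\<^esub> i)" for i :: int
      using F' FD(3-5) by (simp only: \<theta>m \<theta>i \<theta>p \<theta>a \<theta>b)
    show "\<exists>y. (\<forall>i::int. \<bar>i\<bar> \<le> int n \<longrightarrow> \<theta> (b [^] i \<otimes> a \<otimes> inv (b [^] i)) y = y) \<and>
      (\<exists>m::int. \<theta> (b [^] m \<otimes> a \<otimes> inv (b [^] m)) y \<noteq> y)" for n
      unfolding e by (rule drift_local_moved)
  qed
qed


section \<open>Ping-pong\<close>

text \<open>
  Elements \<open>\<alpha>\<^sub>1\<close>, \<open>\<alpha>\<^sub>2\<close> and their quotients map \<open>Q\<close> into \<open>P\<close>, and \<open>\<beta>\<^sup>\<plusminus>\<^sup>1\<close> maps \<open>P\<close> into \<open>Q\<close>. There may be no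
  second element like \<open>\<beta>\<close>, so a free group has to be found by hand. Of the four products
  \<open>\<alpha>\<^sub>i \<beta> \<alpha>\<^sub>j\<close>, called prefixes below, any two different ones have a quotient \<open>p\<^sup>-\<^sup>1 q\<close> that maps \<open>Q\<close> into
  \<open>P\<close>. Each of the two generators is \<open>p \<beta> q\<^sup>-\<^sup>1\<close> for two of the prefixes, so that between
  consecutive letters of a reduced word two different prefixes meet.
  
  The powers of \<open>z\<close> preserve \<open>P\<close>, which distinguishes them from the reduced words.
\<close>

locale ping_pong = group G for G (structure) +
  fixes act :: "'a \<Rightarrow> 'x \<Rightarrow> 'x" and z \<alpha>\<^sub>1 \<alpha>\<^sub>2 \<beta> :: 'a and P Q :: "'x set"
  assumes act: "act \<in> hom G perms"
    and z_order: "infinite_order G z" and z_commens: "\<And>g. g \<in> carrier G \<Longrightarrow> commensurates G z g"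
    and z_P: "\<And>n::int. act (z [^] n) ` P \<subseteq> P"
    and PQ: "P \<inter> Q = {}" "P \<noteq> {}"
    and closed: "\<alpha>\<^sub>1 \<in> carrier G" "\<alpha>\<^sub>2 \<in> carrier G" "\<beta> \<in> carrier G"
    and \<alpha>: "act \<alpha>\<^sub>1 ` Q \<subseteq> P" "act (inv \<alpha>\<^sub>1) ` Q \<subseteq> P" "act \<alpha>\<^sub>2 ` Q \<subseteq> P" "act (inv \<alpha>\<^sub>2) ` Q \<subseteq> P"
      "act (inv \<alpha>\<^sub>1 \<otimes> \<alpha>\<^sub>2) ` Q \<subseteq> P" "act (inv \<alpha>\<^sub>2 \<otimes> \<alpha>\<^sub>1) ` Q \<subseteq> P"
    and \<beta>: "act \<beta> ` P \<subseteq> Q" "act (inv \<beta>) ` P \<subseteq> Q"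
begin

definition alpha :: "bool \<Rightarrow> 'a" where "alpha x = (if x then \<alpha>\<^sub>1 else \<alpha>\<^sub>2)"
text \<open>
  The prefixes are indexed by letters: \<open>prefix (x, True)\<close> is the left end of the generator \<open>gen x\<close>, and
  \<open>prefix (x, False)\<close> is the left end of its inverse.
\<close>

definition prefix :: "bool \<times> bool \<Rightarrow> 'a" where "prefix s = alpha (fst s) \<otimes> \<beta> \<otimes> alpha (snd s)"
definition middle :: "bool \<Rightarrow> 'a" where "middle b = (if b then \<beta> else inv \<beta>)"
definition gen :: "bool \<Rightarrow> 'a" where
  "gen x = prefix (x, True) \<otimes> \<beta> \<otimes> inv (prefix (x, False))"

lemma cl [simp]: "alpha x \<in> carrier G" "prefix s \<in> carrier G" "middle b \<in> carrier G" "gen x \<in> carrier G"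
  using closed by (simp_all add: alpha_def prefix_def middle_def gen_def)

lemma act_mult: "g \<in> carrier G \<Longrightarrow> h \<in> carrier G \<Longrightarrow> act h ` R \<subseteq> S \<Longrightarrow> act g ` S \<subseteq> U \<Longrightarrow> act (g \<otimes> h) ` R \<subseteq> U"
  using hom_mult[OF act, of g h] by (auto simp: image_subset_iff)

lemma middle_P: "act (middle b) ` P \<subseteq> Q"
  using \<beta> by (simp add: middle_def)

lemma alpha_diff: "x \<noteq> y \<Longrightarrow> act (inv (alpha x) \<otimes> alpha y) ` Q \<subseteq> P"
  using \<alpha> by (auto simp: alpha_def)

lemma alpha_Q: "act (alpha x) ` Q \<subseteq> P" "act (inv (alpha x)) ` Q \<subseteq> P"
  using \<alpha> by (auto simp: alpha_def)

lemma prefix_diff: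
  assumes "s \<noteq> t"
  shows "act (inv (prefix s) \<otimes> prefix t) ` Q \<subseteq> P"
proof -
  obtain x b y c where s: "s = (x, b)" "t = (y, c)" by force
  show ?thesis
  proof (cases "x = y")
    case True
    then have "inv (prefix s) \<otimes> prefix t = inv (alpha b) \<otimes> alpha c"
      using s closed by (simp add: prefix_def inv_mult_group m_assoc conjugate_cancel)
    then show ?thesis using alpha_diff[of b c] assms s True by simp
  next
    case False
    have "inv (prefix s) \<otimes> prefix t =
        inv (alpha b) \<otimes> (inv \<beta> \<otimes> ((inv (alpha x) \<otimes> alpha y) \<otimes> (\<beta> \<otimes> alpha c)))"
      using s closed by (simp add: prefix_def inv_mult_group m_assoc)
    moreover have "act (\<beta> \<otimes> alpha c) ` Q \<subseteq> Q" by (rule act_mult[OF _ _ alpha_Q(1) \<beta>(1)]) (use closed in auto)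
    then have "act ((inv (alpha x) \<otimes> alpha y) \<otimes> (\<beta> \<otimes> alpha c)) ` Q \<subseteq> P"
      by (rule act_mult[OF _ _ _ alpha_diff[OF False], rotated 2]) (use closed in auto)
    then have "act (inv \<beta> \<otimes> ((inv (alpha x) \<otimes> alpha y) \<otimes> (\<beta> \<otimes> alpha c))) ` Q \<subseteq> Q"
      by (rule act_mult[OF _ _ _ \<beta>(2), rotated 2]) (use closed in auto)
    then have "act (inv (alpha b) \<otimes> (inv \<beta> \<otimes> ((inv (alpha x) \<otimes> alpha y) \<otimes> (\<beta> \<otimes> alpha c)))) ` Q \<subseteq> P"
      by (rule act_mult[OF _ _ _ alpha_Q(2), rotated 2]) (use closed in auto)
    ultimately show ?thesis by simp
  qed
qed

lemma letter_value:
  "(if b then gen x else inv (gen x)) = prefix (x, b) \<otimes> middle b \<otimes> inv (prefix (x, \<not> b))"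
  using closed by (cases b) (auto simp: gen_def middle_def inv_mult_group m_assoc)

lemma gen_funcset: "gen \<in> X \<rightarrow> carrier G" by simp

lemma value_closed [simp]: "word_value G gen w \<in> carrier G"
  using word_value_closed[of gen UNIV w] by (auto simp: in_lists_conv_set)

text \<open>
  Stripped of the prefixes at its two ends, a reduced word is an alternating product of \<open>\<beta>\<^sup>\<plusminus>\<^sup>1\<close> and
  quotients of different prefixes.
\<close>

lemma reduced_word_P:
  assumes "reduced w" "w \<noteq> []"
  shows "act (inv (prefix (hd w)) \<otimes> word_value G gen w \<otimes> prefix (letter_inv (last w))) ` P \<subseteq> Q"
  using assms
proof (induction w)
  case (Cons s w)
  obtain x b where s: "s = (x, b)" by force
  show ?case
  proof (cases w)
    case Nil
    have "inv (prefix s) \<otimes> word_value G gen [s] \<otimes> prefix (letter_inv s) = middle b"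
      using s closed by (simp add: letter_value m_assoc conjugate_cancel)
    then show ?thesis using Nil middle_P by simp
  next
    case (Cons t v)
    then have red: "t \<noteq> (x, \<not> b)" "reduced w" "w \<noteq> []" using Cons.prems s by auto
    let ?e = "prefix (letter_inv (last w))"
    have "inv (prefix s) \<otimes> word_value G gen (s # w) \<otimes> ?e =
      middle b \<otimes> ((inv (prefix (x, \<not> b)) \<otimes> prefix t) \<otimes> (inv (prefix t) \<otimes> word_value G gen w \<otimes> ?e))"
      using s by (simp add: letter_value m_assoc conjugate_cancel)
    moreover have "act (inv (prefix t) \<otimes> word_value G gen w \<otimes> ?e) ` P \<subseteq> Q"
      using Cons.IH red Cons by simp
    then have "act ((inv (prefix (x, \<not> b)) \<otimes> prefix t) \<otimes> (inv (prefix t) \<otimes> word_value G gen w \<otimes> ?e)) ` P \<subseteq> P"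
      by (rule act_mult[OF _ _ _ prefix_diff, rotated 2]) (use red in auto)
    then have "act (middle b \<otimes> ((inv (prefix (x, \<not> b)) \<otimes> prefix t) \<otimes> (inv (prefix t) \<otimes> word_value G gen w \<otimes> ?e))) ` P \<subseteq> Q"
      by (rule act_mult[OF _ _ _ middle_P, rotated 2]) auto
    ultimately show ?thesis using Cons by simp
  qed
qed simp

lemma reduced_Cons_iff: "w \<noteq> [] \<Longrightarrow> reduced (s # w) \<longleftrightarrow> hd w \<noteq> letter_inv s \<and> reduced w"
  by (cases w) auto

lemma reduced_snoc: "w \<noteq> [] \<Longrightarrow> reduced (w @ [t]) \<longleftrightarrow> reduced w \<and> t \<noteq> letter_inv (last w)"
  by (auto simp: reduced_def successively_append_iff)

text \<open>
  Suppose the value of a nonempty reduced word \<open>v\<close> is a power of \<open>z\<close>. A suitable letter \<open>s\<close> makes \<open>s v s\<^sup>-\<^sup>1\<close>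
  reduced as well, and its value without the two prefixes is a conjugate of a power of \<open>z\<close>. This maps
  \<open>P\<close> into \<open>Q\<close> by \<open>reduced_word_P\<close>. But if \<open>v\<close> is first replaced by a high power, the conjugate is again
  a power of \<open>z\<close>, and maps \<open>P\<close> into \<open>P\<close>.
\<close>

lemma free_mod_z:
  assumes "reduced w" "word_value G gen w = z [^] (e::int)"
  shows "w = []"
proof (rule ccontr)
  assume "w \<noteq> []"
  have zc: "z \<in> carrier G" using z_order by (simp add: infinite_order_def)
  (* \<open>h s\<close> is what is left of the letter \<open>s\<close> when its first prefix is removed. The exponent \<open>m\<close> is such
     that conjugation by \<open>h s\<close> maps \<open>z\<^sup>m\<close> to a power of \<open>z\<close>, for all four letters \<open>s\<close>. *)
  define h where "h s = middle (snd s) \<otimes> inv (prefix (letter_inv s))" for s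
  have hc: "h s \<in> carrier G" for s by (simp add: h_def)
  obtain m :: nat where m: "m > 0" "\<And>s. \<exists>n::int. h s \<otimes> z [^] (int m) = z [^] n \<otimes> h s"
  proof -
    have "\<exists>m::nat. m > 0 \<and> (\<forall>x\<in>range h. \<exists>n::int. x \<otimes> z [^] (int m) = z [^] n \<otimes> x)"
      by (rule commensurates_finite[OF zc]) (use z_commens hc in auto)
    then show ?thesis using that by blast
  qed
  (* The power \<open>w\<^sup>m\<close>, reduced. It is nonempty since \<open>z\<close> has infinite order; for \<open>e = 0\<close> the word \<open>w\<close>
     itself will do. *)
  obtain v where v: "reduced v" "v \<noteq> []" "word_value G gen v = z [^] (e * int m)"
  proof (cases "e = 0")
    case True
    then show ?thesis using that[of w] assms \<open>w \<noteq> []\<close> by simp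
  next
    case False
    have "\<exists>u. word_value G gen u = z [^] (e * int k)" for k
    proof (induction k)
      case 0
      then show ?case by (intro exI[of _ "[]"]) simp
    next
      case (Suc k)
      then obtain u where "word_value G gen u = z [^] (e * int k)" by blast
      then have "word_value G gen (w @ u) = z [^] (e * int (Suc k))"
        using word_value_append[OF gen_funcset, of w UNIV u] assms(2) zc
        by (simp add: in_lists_conv_set int_pow_mult[symmetric] algebra_simps)
      then show ?case ..
    qed
    then obtain u where u: "word_value G gen u = z [^] (e * int m)" by blast
    have "u \<in> words UNIV" by (simp add: in_lists_conv_set)
    then obtain v where v: "reduced v" "(u, v) \<in> word_eq UNIV {}"
      using word_eq_reduced[of u UNIV "{}"] by blast
    have val: "word_value G gen v = z [^] (e * int m)"
      using word_value_word_eq[OF v(2) gen_funcset] u by simp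
    have "e * int m \<noteq> 0" using False m by simp
    then have "v \<noteq> []" using val z_order unfolding infinite_order_def by force
    then show ?thesis using that v val by blast
  qed
  (* Two of the four letters are forbidden at most. *)
  obtain s where s: "s \<noteq> letter_inv (hd v)" "s \<noteq> last v"
  proof -
    have "\<exists>s :: bool \<times> bool. s \<noteq> p \<and> s \<noteq> q" for p q :: "bool \<times> bool" by (cases p; cases q) auto
    then show ?thesis using that by blast
  qed
  define w' where "w' = s # v @ [letter_inv s]"
  have "hd v \<noteq> letter_inv s" using s(1) by (cases s; cases "hd v") auto
  moreover have "letter_inv s \<noteq> letter_inv (last v)" using s(2) by (cases s; cases "last v") auto
  ultimately have "reduced w'"
    using v(1,2) by (simp add: w'_def reduced_Cons_iff reduced_snoc)
  then have "act (inv (prefix s) \<otimes> word_value G gen w' \<otimes> prefix s) ` P \<subseteq> Q"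
    using reduced_word_P[of w'] by (simp add: w'_def)
  moreover have "inv (prefix s) \<otimes> word_value G gen w' \<otimes> prefix s = h s \<otimes> z [^] (e * int m) \<otimes> inv (h s)"
  proof -
    obtain x b where sx: "s = (x, b)" by force
    let ?V = "if b then gen x else inv (gen x)" and ?W = "if \<not> b then gen x else inv (gen x)"
    have "word_value G gen (v @ [(x, \<not> b)]) = z [^] (e * int m) \<otimes> ?W"
      using word_value_append[OF gen_funcset, of v UNIV "[(x, \<not> b)]"] v(3)
      by (simp add: in_lists_conv_set)
    then have "word_value G gen w' = ?V \<otimes> (z [^] (e * int m) \<otimes> ?W)" by (simp add: w'_def sx)
    also have "?W = inv ?V" by simp
    also have "?V = prefix s \<otimes> h s" unfolding letter_value by (simp add: sx h_def m_assoc)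
    finally show ?thesis using hc zc by (simp add: inv_mult_group m_assoc conjugate_cancel)
  qed
  moreover obtain n :: int where n: "h s \<otimes> z [^] (int m) = z [^] n \<otimes> h s" using m by blast
  have "h s \<otimes> z [^] (e * int m) = z [^] (n * e) \<otimes> h s"
    using slide_pow[OF hc _ _ n, of e] zc by (simp add: int_pow_pow mult.commute)
  then have "h s \<otimes> z [^] (e * int m) \<otimes> inv (h s) = z [^] (n * e)"
    using hc zc by (simp add: m_assoc)
  ultimately have "act (z [^] (n * e)) ` P \<subseteq> Q" by simp
  then show False using z_P[of "n * e"] PQ by blast
qed

theorem not_fgip: "\<not> fgip G"
  by (rule not_fgip_free_pair[OF z_commens[OF cl(4)] z_order free_mod_z])

end


section \<open>Groups with the f.g.i.p.\<close>

lemma (in group) slender_fgip: "slender G (carrier G) \<Longrightarrow> fgip G"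
  unfolding fgip_def using slenderD subgroups_Inter_pair subgroup.subset by (metis Int_lower1 subset_trans)

lemma (in group_hom) fin_gen_image:
  assumes "fin_gen_subgroup K G"
  shows "fin_gen_subgroup (h ` K) H"
proof -
  obtain S where "finite S" "S \<subseteq> carrier G" "K = generate G S"
    using assms by (auto simp: fin_gen_subgroup_def)
  then have "finite (h ` S)" "h ` S \<subseteq> carrier H" "h ` K = generate H (h ` S)"
    using generate_img by auto
  then show ?thesis unfolding fin_gen_subgroup_def by blast
qed

lemma fgip_iso:
  assumes G: "group G" and H: "group H" and iso: "G \<cong> H" and "fgip H"
  shows "fgip G"
proof -
  obtain f where f: "f \<in> iso G H" using iso by (auto simp: is_iso_def)
  define k where "k = inv_into (carrier G) f"
  have k: "k \<in> iso H G" unfolding k_def using group.iso_set_sym[OF G f] .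
  have bij: "bij_betw f (carrier G) (carrier H)" using f by (simp add: iso_def)
  interpret f: group_hom G H f using f G H by (simp add: group_hom_def group_hom_axioms_def iso_def)
  interpret k: group_hom H G k using k G H by (simp add: group_hom_def group_hom_axioms_def iso_def)
  show ?thesis
    unfolding fgip_def
  proof (intro allI impI, elim conjE)
    fix K L assume KL: "subgroup K G" "fin_gen_subgroup K G" "subgroup L G" "fin_gen_subgroup L G"
    have sub: "K \<subseteq> carrier G" "L \<subseteq> carrier G" using KL subgroup.subset by blast+
    have "fin_gen_subgroup (f ` K \<inter> f ` L) H"
      using \<open>fgip H\<close> f.fin_gen_image f.subgroup_img_is_subgroup KL unfolding fgip_def by blast
    then have "fin_gen_subgroup (k ` (f ` K \<inter> f ` L)) G" by (rule k.fin_gen_image)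
    moreover have "f ` K \<inter> f ` L = f ` (K \<inter> L)"
      using inj_on_image_Int[OF bij_betw_imp_inj_on[OF bij] sub] by simp
    moreover have "k ` f ` (K \<inter> L) = K \<inter> L"
      unfolding k_def using bij sub by (intro inv_into_image_cancel) (auto simp: bij_betw_def)
    ultimately show "fin_gen_subgroup (K \<inter> L) G" by simp
  qed
qed

context group
begin

lemma finitely_covers_Int:
  assumes H: "subgroup H G" and K: "subgroup K G" and cov: "finitely_covers G H (carrier G)"
  shows "finitely_covers G (H \<inter> K) K"
proof -
  note HD = subgroupD[OF H] and KD = subgroupD[OF K]
  obtain F where F: "finite F" "F \<subseteq> carrier G" "\<forall>k\<in>carrier G. \<exists>h\<in>H. \<exists>f\<in>F. k = h \<otimes> f"
    using cov by (auto simp: finitely_covers_def)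
  define F' where "F' = {f \<in> F. \<exists>h\<in>H. h \<otimes> f \<in> K}"
  have "\<forall>f\<in>F'. \<exists>h\<in>H. h \<otimes> f \<in> K" by (simp add: F'_def)
  then obtain r where r: "\<And>f. f \<in> F' \<Longrightarrow> r f \<in> H \<and> r f \<otimes> f \<in> K" by metis
  have "\<exists>h\<in>H \<inter> K. \<exists>f\<in>(\<lambda>f. r f \<otimes> f) ` F'. k = h \<otimes> f" if k: "k \<in> K" for k
  proof -
    obtain h f where hf: "h \<in> H" "f \<in> F" "k = h \<otimes> f" using F(3) KD(1) k by blast
    then have f: "f \<in> F'" using k by (auto simp: F'_def)
    have c: "h \<in> carrier G" "f \<in> carrier G" "r f \<in> carrier G" using hf F r[OF f] HD(1) by blast+
    have e: "k \<otimes> inv (r f \<otimes> f) = h \<otimes> inv (r f)"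
      using c hf(3) by (simp add: inv_mult_group m_assoc conjugate_cancel)
    have "h \<otimes> inv (r f) \<in> H" using HD(4)[OF hf(1) HD(3)] r[OF f] by blast
    moreover have "h \<otimes> inv (r f) \<in> K" unfolding e[symmetric] using KD(4)[OF k KD(3)] r[OF f] by blast
    moreover have "k = (h \<otimes> inv (r f)) \<otimes> (r f \<otimes> f)" using c hf(3) by (simp add: m_assoc conjugate_cancel)
    ultimately show ?thesis using f by blast
  qed
  moreover have "finite ((\<lambda>f. r f \<otimes> f) ` F')" using F(1) by (simp add: F'_def)
  moreover have "(\<lambda>f. r f \<otimes> f) ` F' \<subseteq> carrier G" using r KD(1) by blast
  ultimately show ?thesis unfolding finitely_covers_def by blast
qed

text \<open>
  Index two, expressed by elements instead of cosets: this form can be transported along homomorphisms.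
\<close>

lemma card_rcosets_eq_2_iff:
  assumes H: "subgroup H G"
  shows "card (rcosets H) = 2 \<longleftrightarrow>
    (\<exists>x. x \<in> carrier G - H) \<and> (\<forall>x\<in>carrier G - H. \<forall>y\<in>carrier G - H. x \<otimes> inv y \<in> H)"
proof -
  note HD = subgroupD[OF H]
  have eq: "H #> x = H #> y \<longleftrightarrow> x \<otimes> inv y \<in> H" if "x \<in> carrier G" "y \<in> carrier G" for x y
  proof
    assume "H #> x = H #> y"
    then have "x \<in> H #> y" using rcos_self[OF that(1) H] by simp
    then obtain h where "h \<in> H" "x = h \<otimes> y" by (auto simp: r_coset_def)
    moreover have "h \<in> carrier G" using calculation HD(1) by blast
    ultimately show "x \<otimes> inv y \<in> H" using that by (simp add: m_assoc)
  next
    assume a: "x \<otimes> inv y \<in> H"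
    have "x = (x \<otimes> inv y) \<otimes> y" using that by (simp add: m_assoc)
    then have "x \<in> H #> y" using a by (auto simp: r_coset_def)
    then show "H #> x = H #> y" using repr_independence[OF _ that(2) H] by simp
  qed
  have eqH: "H #> x = H \<longleftrightarrow> x \<in> H" if "x \<in> carrier G" for x
    using eq[OF that one_closed] that coset_mult_one[OF HD(1)] by simp
  have Hin: "H \<in> rcosets H" using subgroup.subgroup_in_rcosets[OF H is_group] .
  show ?thesis
  proof
    assume "card (rcosets H) = 2"
    then obtain C D where CD: "rcosets H = {C, D}" "C \<noteq> D" by (auto simp: card_2_iff)
    then obtain D' where D': "rcosets H = {H, D'}" "D' \<noteq> H" using Hin by auto
    have *: "H #> x = D'" if "x \<in> carrier G - H" for x
      using that eqH rcosetsI[OF HD(1), of x] D' by auto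
    have "D' \<in> rcosets H" using D'(1) by simp
    then obtain x where "x \<in> carrier G" "D' = H #> x" by (auto simp: RCOSETS_def)
    then have "x \<in> carrier G - H" using eqH D' by auto
    then show "(\<exists>x. x \<in> carrier G - H) \<and> (\<forall>x\<in>carrier G - H. \<forall>y\<in>carrier G - H. x \<otimes> inv y \<in> H)"
      using * eq by (metis DiffD1)
  next
    assume a: "(\<exists>x. x \<in> carrier G - H) \<and> (\<forall>x\<in>carrier G - H. \<forall>y\<in>carrier G - H. x \<otimes> inv y \<in> H)"
    then obtain x where x: "x \<in> carrier G - H" by blast
    have "rcosets H = {H, H #> x}"
    proof
      show "{H, H #> x} \<subseteq> rcosets H" using Hin rcosetsI[OF HD(1), of x] x by simp
      show "rcosets H \<subseteq> {H, H #> x}"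
      proof
        fix D assume "D \<in> rcosets H"
        then obtain y where y: "y \<in> carrier G" "D = H #> y" by (auto simp: RCOSETS_def)
        show "D \<in> {H, H #> x}"
        proof (cases "y \<in> H")
          case True then show ?thesis using y eqH by simp
        next
          case False
          then have "y \<otimes> inv x \<in> H" using a x y by blast
          then show ?thesis using eq[of y x] x y by simp
        qed
      qed
    qed
    moreover have "H #> x \<noteq> H" using eqH x by simp
    ultimately show "card (rcosets H) = 2" by (simp add: card_2_iff)
  qed
qed

text \<open>
  If \<open>x\<close> is outside \<open>C\<close>, so are \<open>x c\<close>, \<open>x\<^sup>-\<^sup>1\<close> and \<open>x\<^sup>-\<^sup>1 c\<close>, and two elements outside \<open>C\<close> lie in the same coset.
\<close>

lemma index_two_normalised:
  assumes C: "subgroup C G" and A: "subgroup A G" and CA: "C \<subseteq> A"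
    and two: "\<forall>x\<in>A - C. \<forall>y\<in>A - C. x \<otimes> inv y \<in> C"
    and x: "x \<in> A - C" and c: "c \<in> C"
  shows "x \<otimes> c \<otimes> inv x \<in> C" "inv x \<otimes> c \<otimes> x \<in> C"
proof -
  note CD = subgroupD[OF C] and AD = subgroupD[OF A]
  have xc: "x \<in> carrier G" "c \<in> carrier G" using x c CD(1) AD(1) by blast+
  have "x \<otimes> c \<in> A - C"
  proof -
    have "x \<in> C" if "x \<otimes> c \<in> C"
      using CD(4)[OF that CD(3)[OF c]] xc by (simp add: m_assoc)
    then show ?thesis using x c CA AD(4) by blast
  qed
  then show "x \<otimes> c \<otimes> inv x \<in> C" using two x by blast
  have ix: "inv x \<in> A - C"
  proof -
    have "x \<in> C" if "inv x \<in> C" using CD(3)[OF that] xc by simp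
    then show ?thesis using x AD(3) by blast
  qed
  have "inv x \<otimes> c \<in> A - C"
  proof -
    have "inv x \<in> C" if "inv x \<otimes> c \<in> C"
      using CD(4)[OF that CD(3)[OF c]] xc by (simp add: m_assoc)
    then show ?thesis using ix c CA AD(4) by blast
  qed
  then have "(inv x \<otimes> c) \<otimes> inv (inv x) \<in> C" using two ix by blast
  then show "inv x \<otimes> c \<otimes> x \<in> C" using xc by simp
qed

text \<open>
  If \<open>C\<close> has index two in \<open>A\<close> and in \<open>B\<close>, it is normal in \<open>G = \<langle>A, B\<rangle>\<close>, and \<open>G/C\<close> is generated by two
  involutions, so that the product of the two generates a cyclic subgroup of index at most two.
\<close>

lemma slender_index_two_amalgam:
  assumes C: "subgroup C G" and A: "subgroup A G" and B: "subgroup B G"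
    and CA: "C \<subseteq> A" and CB: "C \<subseteq> B" and slender: "slender G C"
    and A2: "\<forall>x\<in>A - C. \<forall>y\<in>A - C. x \<otimes> inv y \<in> C"
    and B2: "\<forall>x\<in>B - C. \<forall>y\<in>B - C. x \<otimes> inv y \<in> C"
    and a: "a \<in> A - C" and b: "b \<in> B - C"
    and gen: "carrier G = generate G (A \<union> B)"
  shows "slender G (carrier G)"
proof -
  note CD = subgroupD[OF C] and AD = subgroupD[OF A] and BD = subgroupD[OF B]
  have abc: "a \<in> carrier G" "b \<in> carrier G" using a b AD(1) BD(1) by blast+
  have Cc: "c \<in> carrier G" if "c \<in> C" for c using that CD(1) by blast
  note na = index_two_normalised[OF C A CA A2 a] and nb = index_two_normalised[OF C B CB B2 b]
  define s where "s = a \<otimes> b"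
  have sc: "s \<in> carrier G" using abc by (simp add: s_def)
  have ns: "s \<otimes> c \<otimes> inv s \<in> C" "inv s \<otimes> c \<otimes> s \<in> C" if c: "c \<in> C" for c
    using na(1)[OF nb(1)[OF c]] nb(2)[OF na(2)[OF c]] abc Cc[OF c]
    by (simp_all add: s_def inv_mult_group m_assoc)
  (* \<open>N\<close> is the preimage of the rotations of the dihedral group \<open>G/C\<close>, and \<open>{\<one>, a}\<close> represents its cosets. *)
  define N where "N = {c \<otimes> s [^] i | c i. c \<in> C \<and> (i::int) \<in> UNIV}"
  have N: "subgroup N G"
  proof (rule subgroupI)
    show "N \<subseteq> carrier G" using Cc sc by (auto simp: N_def)
    have "\<one> \<otimes> s [^] (0::int) \<in> N" using CD(2) unfolding N_def by blast
    then show "N \<noteq> {}" by blast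
    show "inv x \<in> N" if x: "x \<in> N" for x
    proof -
      obtain c i where "c \<in> C" "x = c \<otimes> s [^] (i::int)" using x by (auto simp: N_def)
      then show ?thesis using inv_normalised_pow[OF C sc ns, of c i] by (auto simp: N_def)
    qed
    show "x \<otimes> y \<in> N" if xy: "x \<in> N" "y \<in> N" for x y
    proof -
      obtain c i d j where "c \<in> C" "x = c \<otimes> s [^] (i::int)" "d \<in> C" "y = d \<otimes> s [^] (j::int)"
        using xy by (auto simp: N_def)
      then show ?thesis using mult_normalised_pow[OF C sc ns, of c d i j] by (auto simp: N_def)
    qed
  qed
  note ND = subgroupD[OF N]
  have CN: "c \<in> N" if "c \<in> C" for c
  proof -
    have "c \<otimes> s [^] (0::int) \<in> N" using that unfolding N_def by blast
    then show ?thesis using Cc[OF that] by simp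
  qed
  have sN: "s \<in> N"
  proof -
    have "\<one> \<otimes> s [^] (1::int) \<in> N" using CD(2) unfolding N_def by blast
    then show ?thesis using sc by simp
  qed
  have "slender G N"
    by (rule slender_extend_cyclic[OF C slender sc ns]) (auto simp: N_def)
  moreover have "finitely_covers G N (carrier G)"
  proof -
    have inv_a: "inv a \<in> A - C" and inv_b: "inv b \<in> B - C"
      using a b AD(3) BD(3) CD(3)[of "inv a"] CD(3)[of "inv b"] abc by auto
    have aa: "a \<otimes> a \<in> C" and bb: "b \<otimes> b \<in> C" using A2[rule_format, OF a inv_a] B2[rule_format, OF b inv_b] abc by simp_all
    have sai: "b \<otimes> a = (b \<otimes> b) \<otimes> inv s \<otimes> (a \<otimes> a)"
      using abc by (simp add: s_def inv_mult_group m_assoc conjugate_cancel)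
    have baN: "b \<otimes> a \<in> N"
      unfolding sai using ND(4)[OF ND(4)[OF CN[OF bb] ND(3)[OF sN]] CN[OF aa]] .
    have biN: "b \<otimes> inv a \<in> N"
    proof -
      have "b \<otimes> inv a = (b \<otimes> a) \<otimes> inv (a \<otimes> a)"
        using abc by (simp add: inv_mult_group m_assoc conjugate_cancel)
      then show ?thesis using ND(4)[OF baN ND(3)[OF CN[OF aa]]] by simp
    qed
    have pair: "\<forall>r\<in>{\<one>, a}. \<exists>n\<in>N. \<exists>f\<in>{\<one>, a}. r \<otimes> k = n \<otimes> f"
      if "p \<in> N" "f \<in> {\<one>, a}" "\<one> \<otimes> k = p \<otimes> f" "q \<in> N" "g \<in> {\<one>, a}" "a \<otimes> k = q \<otimes> g" for k p f q g
      using that by blast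
    have step: "\<forall>r\<in>{\<one>, a}. \<exists>n\<in>N. \<exists>f\<in>{\<one>, a}. r \<otimes> k = n \<otimes> f" if k: "k \<in> A \<union> B" for k
    proof -
      have kc: "k \<in> carrier G" using k AD(1) BD(1) by blast
      consider "k \<in> C" | "k \<in> A - C" | "k \<in> B - C" using k by blast
      then show ?thesis
      proof cases
        case 1
        have "k \<in> N" "a \<otimes> k \<otimes> inv a \<in> N" using CN na(1)[OF 1] 1 by auto
        moreover have "a \<otimes> k = (a \<otimes> k \<otimes> inv a) \<otimes> a" using kc abc by (simp add: m_assoc)
        ultimately show ?thesis using kc by (intro pair[of k \<one> k "a \<otimes> k \<otimes> inv a" a]) auto
      next
        case 2
        have "k \<otimes> inv a \<in> N" using CN A2[rule_format, OF 2 a] by blast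
        moreover have "k = (k \<otimes> inv a) \<otimes> a" using kc abc by (simp add: m_assoc)
        moreover have "a \<otimes> k \<in> N"
        proof -
          have "inv k \<in> A - C" using 2 AD(3) CD(3)[of "inv k"] kc by auto
          then show ?thesis using CN A2[rule_format, OF a, of "inv k"] kc by simp
        qed
        moreover have "a \<otimes> k \<in> carrier G" using kc abc by simp
        ultimately show ?thesis using kc by (intro pair[of "k \<otimes> inv a" a k "a \<otimes> k" \<one>]) auto
      next
        case 3
        have c: "k \<otimes> inv b \<in> C" using B2[rule_format, OF 3 b] .
        have "k \<otimes> inv a = (k \<otimes> inv b) \<otimes> (b \<otimes> inv a)"
          using kc abc by (simp add: m_assoc conjugate_cancel)
        then have "k \<otimes> inv a \<in> N" using ND(4)[OF CN[OF c] biN] by simp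
        moreover have "k = (k \<otimes> inv a) \<otimes> a" using kc abc by (simp add: m_assoc)
        moreover have "a \<otimes> k = (a \<otimes> (k \<otimes> inv b) \<otimes> inv a) \<otimes> s"
          using kc abc by (simp add: s_def m_assoc conjugate_cancel)
        then have "a \<otimes> k \<in> N" using ND(4)[OF CN[OF na(1)[OF c]] sN] by simp
        moreover have "a \<otimes> k \<in> carrier G" using kc abc by simp
        ultimately show ?thesis using kc by (intro pair[of "k \<otimes> inv a" a k "a \<otimes> k" \<one>]) auto
      qed
    qed
    have AB: "A \<union> B \<subseteq> carrier G" using AD(1) BD(1) by blast
    have all: "\<forall>r\<in>{\<one>, a}. \<exists>n\<in>N. \<exists>f\<in>{\<one>, a}. r \<otimes> k = n \<otimes> f" if "k \<in> generate G (A \<union> B)" for k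
      using that
    proof (induction rule: generate.induct)
      case one
      show ?case using ND(2) abc by (intro pair[of \<one> \<one> _ \<one> a]) auto
    next
      case (incl h)
      then show ?case by (rule step)
    next
      case (inv h)
      then have "inv h \<in> A \<union> B" using AD(3) BD(3) by blast
      then show ?case by (rule step)
    next
      case (eng h1 h2)
      have hc: "h1 \<in> carrier G" "h2 \<in> carrier G" using eng generate_incl[OF AB] by auto
      show ?case
      proof
        fix r assume r: "r \<in> {\<one>, a}"
        obtain n f where 1: "n \<in> N" "f \<in> {\<one>, a}" "r \<otimes> h1 = n \<otimes> f" using eng(3) r by blast
        obtain n' f' where 2: "n' \<in> N" "f' \<in> {\<one>, a}" "f \<otimes> h2 = n' \<otimes> f'" using eng(4) 1(2) by blast
        have c: "r \<in> carrier G" "f \<in> carrier G" "f' \<in> carrier G" "n \<in> carrier G" "n' \<in> carrier G"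
          using r 1(1,2) 2(1,2) abc ND(1) by auto
        have "r \<otimes> (h1 \<otimes> h2) = (r \<otimes> h1) \<otimes> h2" using c hc by (simp add: m_assoc)
        also have "\<dots> = n \<otimes> (f \<otimes> h2)" unfolding 1(3) using c hc by (simp add: m_assoc)
        also have "\<dots> = (n \<otimes> n') \<otimes> f'" unfolding 2(3) using c by (simp add: m_assoc)
        finally show "\<exists>n\<in>N. \<exists>f\<in>{\<one>, a}. r \<otimes> (h1 \<otimes> h2) = n \<otimes> f"
          using ND(4)[OF 1(1) 2(1)] 2(2) by blast
      qed
    qed
    then have "\<exists>n\<in>N. \<exists>f\<in>{\<one>, a}. k = n \<otimes> f" if "k \<in> carrier G" for k
      proof -
      have "\<exists>n\<in>N. \<exists>f\<in>{\<one>, a}. \<one> \<otimes> k = n \<otimes> f" using all[of k] that gen by simp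
      then show ?thesis using that by simp
    qed
    then show ?thesis unfolding finitely_covers_def using abc by (intro exI[of _ "{\<one>, a}"]) auto
  qed
  ultimately show ?thesis using slender_extend_finite[OF N] by blast
qed

end


section \<open>Ascending HNN extensions have the f.g.i.p.\<close>

text \<open>
  Conjugation from the right, as in the relation \<open>t\<^sup>-\<^sup>1 a t = \<phi> a\<close> of an HNN extension.
\<close>

definition conj_by :: "('g, 'm) monoid_scheme \<Rightarrow> 'g \<Rightarrow> 'g \<Rightarrow> 'g" where
  "conj_by G g x = inv\<^bsub>G\<^esub> g \<otimes>\<^bsub>G\<^esub> x \<otimes>\<^bsub>G\<^esub> g"

context group
begin

lemma conj_by_closed [simp]: "g \<in> carrier G \<Longrightarrow> x \<in> carrier G \<Longrightarrow> conj_by G g x \<in> carrier G"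
  by (simp add: conj_by_def)

lemma conj_by_conj_by:
  "g \<in> carrier G \<Longrightarrow> h \<in> carrier G \<Longrightarrow> x \<in> carrier G \<Longrightarrow> conj_by G h (conj_by G g x) = conj_by G (g \<otimes> h) x"
  by (simp add: conj_by_def inv_mult_group m_assoc)

lemma conj_by_mult:
  "g \<in> carrier G \<Longrightarrow> x \<in> carrier G \<Longrightarrow> y \<in> carrier G \<Longrightarrow>
    conj_by G g (x \<otimes> y) = conj_by G g x \<otimes> conj_by G g y"
  by (simp add: conj_by_def m_assoc conjugate_cancel)

lemma conj_by_hom: "g \<in> carrier G \<Longrightarrow> conj_by G g \<in> hom G G"
  by (rule homI) (simp_all add: conj_by_mult)

lemma conj_by_one [simp]: "x \<in> carrier G \<Longrightarrow> conj_by G \<one> x = x"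
  by (simp add: conj_by_def)

lemma conj_by_inv_cancel [simp]:
  "g \<in> carrier G \<Longrightarrow> x \<in> carrier G \<Longrightarrow> conj_by G g (conj_by G (inv g) x) = x"
  "g \<in> carrier G \<Longrightarrow> x \<in> carrier G \<Longrightarrow> conj_by G (inv g) (conj_by G g x) = x"
  by (simp_all add: conj_by_conj_by)

lemma conj_by_subgroup:
  assumes "subgroup H G" "g \<in> H" "x \<in> H"
  shows "conj_by G g x \<in> H"
  using subgroupD(4)[OF assms(1) subgroupD(4)[OF assms(1) subgroupD(3)[OF assms(1,2)] assms(3)] assms(2)]
  by (simp add: conj_by_def)

lemma conj_by_subgroup_iff:
  assumes "subgroup H G" "g \<in> H" "x \<in> carrier G"
  shows "conj_by G g x \<in> H \<longleftrightarrow> x \<in> H"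
proof
  assume "conj_by G g x \<in> H"
  then have "conj_by G (inv g) (conj_by G g x) \<in> H"
    using conj_by_subgroup[OF assms(1) subgroupD(3)[OF assms(1,2)]] by simp
  moreover have "g \<in> carrier G" using subgroupD(1)[OF assms(1)] assms(2) by blast
  ultimately show "x \<in> H" using assms(3) by simp
qed (use conj_by_subgroup assms in blast)

text \<open>
  A set of elements of \<open>N\<close> in pairwise different cosets of \<open>H\<close> represents all cosets if it is as large
  as possible.
\<close>

lemma finitely_covers_by_separation:
  assumes H: "subgroup H G" and N: "N \<subseteq> carrier G"
    and bound: "\<And>E. finite E \<Longrightarrow> E \<subseteq> N \<Longrightarrow>
      (\<And>x y. x \<in> E \<Longrightarrow> y \<in> E \<Longrightarrow> x \<otimes> inv y \<in> H \<Longrightarrow> x = y) \<Longrightarrow> card E \<le> d"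
  shows "finitely_covers G H N"
proof -
  note HD = subgroupD[OF H]
  define sep where "sep E \<longleftrightarrow> finite E \<and> E \<subseteq> N \<and> (\<forall>x\<in>E. \<forall>y\<in>E. x \<otimes> inv y \<in> H \<longrightarrow> x = y)" for E
  have "sep {}" by (simp add: sep_def)
  moreover have "card E \<le> d" if "sep E" for E using bound that by (simp add: sep_def)
  ultimately have "\<exists>E. sep E \<and> (\<forall>E'. sep E' \<longrightarrow> card E' \<le> card E)"
    by (intro ex_has_greatest_nat[of sep "{}" card "Suc d"]) (auto simp: less_Suc_eq_le)
  then obtain E where E: "sep E" "\<And>E'. sep E' \<Longrightarrow> card E' \<le> card E" by blast
  have "\<exists>h\<in>H. \<exists>e\<in>E. n = h \<otimes> e" if n: "n \<in> N" for n
  proof (rule ccontr)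
    assume no: "\<not> (\<exists>h\<in>H. \<exists>e\<in>E. n = h \<otimes> e)"
    have nc: "n \<in> carrier G" using n N by blast
    have ne: "n \<otimes> inv e \<notin> H" "e \<otimes> inv n \<notin> H" if e: "e \<in> E" for e
    proof -
      have ec: "e \<in> carrier G" using e E(1) N by (auto simp: sep_def)
      have "n = (n \<otimes> inv e) \<otimes> e" using nc ec by (simp add: m_assoc)
      then show 1: "n \<otimes> inv e \<notin> H" using no e by blast
      have "inv (e \<otimes> inv n) = n \<otimes> inv e" using nc ec by (simp add: inv_mult_group)
      then show "e \<otimes> inv n \<notin> H" using 1 HD(3)[of "e \<otimes> inv n"] by auto
    qed
    have nE: "n \<notin> E" using ne(1)[of n] HD(2) nc by auto
    have "sep (insert n E)" using E(1) ne n unfolding sep_def by auto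
    then have "card (insert n E) \<le> card E" using E(2) by blast
    then show False using nE E(1) by (simp add: sep_def)
  qed
  then show ?thesis unfolding finitely_covers_def using E(1) N by (auto simp: sep_def)
qed

end

text \<open>
  An ascending HNN extension from the inside: \<open>t\<close> maps \<open>A\<close> into itself by conjugation. The homomorphism
  \<open>e\<close> to the integers counts the exponents of \<open>t\<close>; it separates \<open>\<langle>t\<rangle>\<close> from the normal closure of \<open>A\<close>.
\<close>

locale ascending = group G for G (structure) +
  fixes A :: "'a set" and t :: 'a and e :: "'a \<Rightarrow> int"
  assumes A: "virtually_cyclic G A" and t [simp]: "t \<in> carrier G"
    and asc: "\<And>a. a \<in> A \<Longrightarrow> conj_by G t a \<in> A"
    and gen: "carrier G = generate G (insert t A)"
    and e_mult: "\<And>x y. x \<in> carrier G \<Longrightarrow> y \<in> carrier G \<Longrightarrow> e (x \<otimes> y) = e x + e y"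
    and e_t: "e t = 1" and e_A: "\<And>a. a \<in> A \<Longrightarrow> e a = 0"
begin

text \<open>
  The conjugate \<open>t\<^sup>n A t\<^sup>-\<^sup>n\<close>. These subgroups increase with \<open>n\<close>, and their union is a normal subgroup with
  the quotient \<open>\<langle>t\<rangle>\<close>.
\<close>

definition level :: "nat \<Rightarrow> 'a set" where
  "level n = {x \<in> carrier G. conj_by G (t [^] (int n)) x \<in> A}"

definition base_closure :: "'a set" where "base_closure = (\<Union>n. level n)"

lemma sub_A: "subgroup A G" using A by (rule virtually_cyclic_subgroup)

lemma A_carrier: "a \<in> A \<Longrightarrow> a \<in> carrier G" using subgroupD(1)[OF sub_A] by blast

lemma asc_pow: "a \<in> A \<Longrightarrow> conj_by G (t [^] (int n)) a \<in> A"
proof (induction n)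
  case (Suc n)
  have "t [^] (int (Suc n)) = t [^] (int n) \<otimes> t"
    using int_pow_mult[OF t, of "int n" 1] by (simp add: add.commute)
  then show ?case using Suc asc A_carrier by (simp flip: conj_by_conj_by)
qed (use A_carrier in simp)

lemma conj_pow_pow:
  "x \<in> carrier G \<Longrightarrow> conj_by G (t [^] (j::int)) (conj_by G (t [^] (i::int)) x) = conj_by G (t [^] (i + j)) x"
  by (simp add: conj_by_conj_by int_pow_mult)

lemma level_eq_image: "level n = conj_by G (t [^] (- int n)) ` A"
proof
  show "level n \<subseteq> conj_by G (t [^] (- int n)) ` A"
  proof
    fix x assume x: "x \<in> level n"
    then have "x = conj_by G (t [^] (- int n)) (conj_by G (t [^] (int n)) x)"
      by (simp add: level_def conj_pow_pow)
    then show "x \<in> conj_by G (t [^] (- int n)) ` A" using x by (auto simp: level_def)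
  qed
  show "conj_by G (t [^] (- int n)) ` A \<subseteq> level n"
    using A_carrier by (auto simp: level_def conj_pow_pow)
qed

lemma level_virtually_cyclic: "virtually_cyclic G (level n)"
proof -
  have "group_hom G G (conj_by G (t [^] (- int n)))"
    using conj_by_hom by (simp add: group_hom_def group_hom_axioms_def is_group)
  then show ?thesis unfolding level_eq_image using group_hom.virtually_cyclic_image A by blast
qed

lemma level_shift:
  assumes "x \<in> level q" "k \<ge> 1"
  shows "conj_by G (t [^] (int k)) x \<in> level (q - 1)"
proof -
  have xc: "x \<in> carrier G" "conj_by G (t [^] (int q)) x \<in> A" using assms by (auto simp: level_def)
  have "conj_by G (t [^] (int (q - 1))) (conj_by G (t [^] (int k)) x) =
      conj_by G (t [^] (int (k + (q - 1) - q))) (conj_by G (t [^] (int q)) x)"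
    using xc(1) assms(2) by (simp add: conj_pow_pow of_nat_diff)
  then show ?thesis using asc_pow[OF xc(2)] xc(1) unfolding level_def by simp
qed

lemma level_mono: "p \<le> q \<Longrightarrow> level p \<subseteq> level q"
proof
  fix x assume pq: "p \<le> q" and x: "x \<in> level p"
  then have xc: "x \<in> carrier G" "conj_by G (t [^] (int p)) x \<in> A" by (auto simp: level_def)
  have "conj_by G (t [^] (int q)) x = conj_by G (t [^] (int (q - p))) (conj_by G (t [^] (int p)) x)"
    using xc(1) pq by (simp add: conj_pow_pow of_nat_diff)
  then show "x \<in> level q" using asc_pow[OF xc(2)] xc(1) unfolding level_def by simp
qed

lemma sub_level: "subgroup (level n) G"
  using level_virtually_cyclic virtually_cyclic_subgroup by blast

lemma sub_base_closure: "subgroup base_closure G"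
proof (rule subgroupI)
  show "base_closure \<subseteq> carrier G" by (auto simp: base_closure_def level_def)
  show "base_closure \<noteq> {}" using subgroupD(2)[OF sub_level] by (auto simp: base_closure_def)
  show "inv x \<in> base_closure" if "x \<in> base_closure" for x
    using that subgroupD(3)[OF sub_level] unfolding base_closure_def by blast
  show "x \<otimes> y \<in> base_closure" if xy: "x \<in> base_closure" "y \<in> base_closure" for x y
  proof -
    obtain p q where "x \<in> level p" "y \<in> level q" using xy by (auto simp: base_closure_def)
    then have "x \<in> level (max p q)" "y \<in> level (max p q)"
      using level_mono[of p "max p q"] level_mono[of q "max p q"] by auto
    then have "x \<otimes> y \<in> level (max p q)" using subgroupD(4)[OF sub_level] by blast
    then show ?thesis by (auto simp: base_closure_def)
  qed
qed

lemma base_closure_normalised: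
  assumes "x \<in> base_closure"
  shows "t \<otimes> x \<otimes> inv t \<in> base_closure" "inv t \<otimes> x \<otimes> t \<in> base_closure"
proof -
  obtain n where n: "x \<in> level n" using assms by (auto simp: base_closure_def)
  then have xc: "x \<in> carrier G" "conj_by G (t [^] (int n)) x \<in> A" by (auto simp: level_def)
  have "conj_by G (t [^] (int (Suc n))) (conj_by G (t [^] (-1::int)) x) \<in> A"
    using xc by (subst conj_pow_pow) simp_all
  then have "conj_by G (t [^] (-1::int)) x \<in> level (Suc n)" using xc(1) unfolding level_def by simp
  moreover have "conj_by G (t [^] (-1::int)) x = t \<otimes> x \<otimes> inv t"
    using xc(1) by (simp add: conj_by_def int_pow_neg)
  ultimately show "t \<otimes> x \<otimes> inv t \<in> base_closure" unfolding base_closure_def by auto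
  have "conj_by G (t [^] (int 1)) x \<in> level (n - 1)" by (rule level_shift[OF n]) simp
  then show "inv t \<otimes> x \<otimes> t \<in> base_closure" unfolding base_closure_def by (auto simp: conj_by_def)
qed

lemma A_base_closure: "a \<in> A \<Longrightarrow> a \<in> base_closure"
  unfolding base_closure_def using A_carrier by (auto simp: level_def intro: exI[of _ 0])

lemma normal_form:
  assumes "g \<in> carrier G"
  shows "\<exists>m\<in>base_closure. \<exists>i::int. g = m \<otimes> t [^] i"
  using assms unfolding gen
proof (induction rule: generate.induct)
  case one
  show ?case using subgroupD(2)[OF sub_base_closure] by (intro bexI[of _ \<one>] exI[of _ 0]) auto
next
  case (incl h)
  then consider "h = t" | "h \<in> A" by blast
  then show ?case
  proof cases
    case 1
    then show ?thesis using subgroupD(2)[OF sub_base_closure] by (intro bexI[of _ \<one>] exI[of _ 1]) auto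
  next
    case 2
    then show ?thesis using A_base_closure A_carrier by (intro bexI[of _ h] exI[of _ 0]) auto
  qed
next
  case (inv h)
  then consider "h = t" | "h \<in> A" by blast
  then show ?case
  proof cases
    case 1
    then show ?thesis using subgroupD(2)[OF sub_base_closure]
      by (intro bexI[of _ \<one>] exI[of _ "-1"]) (auto simp: int_pow_neg)
  next
    case 2
    then have "inv h \<in> A" using subgroupD(3)[OF sub_A] by blast
    then show ?thesis using A_base_closure A_carrier by (intro bexI[of _ "inv h"] exI[of _ 0]) auto
  qed
next
  case (eng h1 h2)
  then obtain m1 i1 m2 i2 where "m1 \<in> base_closure" "h1 = m1 \<otimes> t [^] (i1::int)"
    "m2 \<in> base_closure" "h2 = m2 \<otimes> t [^] (i2::int)" by blast
  then show ?case
    using mult_normalised_pow[OF sub_base_closure t base_closure_normalised, of m1 m2 i1 i2] by auto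
qed

lemma e_one: "e \<one> = 0" using e_mult[of \<one> \<one>] by simp

lemma e_inv: "x \<in> carrier G \<Longrightarrow> e (inv x) = - e x"
  using e_mult[of x "inv x"] e_one by simp

lemma e_pow: "x \<in> carrier G \<Longrightarrow> e (x [^] (i::int)) = i * e x"
proof -
  assume x: "x \<in> carrier G"
  have pos: "e (x [^] (int n)) = int n * e x" for n
  proof (induction n)
    case (Suc n)
    have "x [^] (int (Suc n)) = x \<otimes> x [^] (int n)" using int_pow_mult[OF x, of 1 "int n"] x by simp
    then show ?case using Suc e_mult x by (simp add: algebra_simps)
  qed (simp add: e_one)
  show ?thesis by (cases i rule: int_cases2) (auto simp: pos int_pow_neg x e_inv)
qed

lemma e_base_closure: "x \<in> base_closure \<Longrightarrow> e x = 0"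
proof -
  assume "x \<in> base_closure"
  then obtain n where "x \<in> carrier G" "conj_by G (t [^] (int n)) x \<in> A"
    by (auto simp: base_closure_def level_def)
  then show "e x = 0" using e_A[of "conj_by G (t [^] (int n)) x"] by (simp add: conj_by_def e_mult e_inv)
qed

lemma e_eq_0_base_closure: "x \<in> carrier G \<Longrightarrow> e x = 0 \<Longrightarrow> x \<in> base_closure"
proof -
  assume x: "x \<in> carrier G" "e x = 0"
  obtain m and i :: int where m: "m \<in> base_closure" "x = m \<otimes> t [^] i" using normal_form[OF x(1)] by blast
  have mc: "m \<in> carrier G" using m(1) subgroupD(1)[OF sub_base_closure] by blast
  have "e x = i" using m mc e_base_closure[OF m(1)] by (simp add: e_mult e_pow e_t)
  then show "x \<in> base_closure" using m mc x(2) by simp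
qed

text \<open>
  A finitely generated subgroup of an increasing union lies in one of the members.
\<close>

lemma base_part_slender:
  assumes fg: "fin_gen_subgroup H G" and H: "subgroup H G" "H \<subseteq> base_closure"
  shows "slender G H"
proof -
  obtain S where S: "finite S" "S \<subseteq> H" "H \<subseteq> generate G S" using fg fin_gen_subgroup_iff[OF H(1)] by blast
  have "\<exists>n. S \<subseteq> generate G (level n)"
  proof (rule generate_Un_chain)
    show "S \<subseteq> generate G (\<Union>n. level n)"
      using S(2) H(2) unfolding base_closure_def by (blast intro: generate.incl)
    show "level n \<subseteq> carrier G" for n by (auto simp: level_def)
  qed (use S(1) level_mono in auto)
  then obtain n where "S \<subseteq> generate G (level n)" by blast
  then have "S \<subseteq> level n" using generate_subgroup_incl[OF order_refl sub_level] by blast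
  then have "H \<subseteq> level n" using S(3) generate_subgroup_incl[OF _ sub_level] by blast
  then show ?thesis using virtually_cyclic_slender[OF level_virtually_cyclic] slender_mono by blast
qed

text \<open>
  Here \<open>H\<close> is an extension of a finite group by a cyclic one.
\<close>

lemma finite_base_part_slender:
  assumes H: "subgroup H G" and fin: "finite (H \<inter> base_closure)"
  shows "slender G H"
  unfolding slender_def
proof (intro allI impI)
  fix K assume K: "subgroup K G \<and> K \<subseteq> H"
  have "finite (base_closure \<inter> K)" by (rule finite_subset[OF _ fin]) (use K in blast)
  then have "fin_gen_subgroup (base_closure \<inter> K) G"
    using finite_fin_gen subgroups_Inter_pair[OF sub_base_closure] K by blast
  then show "fin_gen_subgroup K G"
    using fin_gen_extend_cyclic[OF sub_base_closure _ t base_closure_normalised, of K] K normal_form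
      subgroupD(1)[of K] by blast
qed

text \<open>
  If \<open>H\<close> is not contained in the union of the levels, it contains some \<open>g = m t\<^sup>k\<close> with \<open>k > 0\<close>, where \<open>m\<close>
  is in some level \<open>p\<close>. Conjugation by \<open>g\<close> maps level \<open>p\<close> into itself and lowers all levels above, so that
  some power of it takes any given element of the union into level \<open>p\<close>. Let \<open>M\<close> be the intersection
  of \<open>H\<close> with level \<open>p\<close>, which is finite or of finite index in level \<open>p\<close>.
  
  If \<open>M\<close> is finite, conjugation by \<open>g\<close> permutes it; going back along the powers of \<open>g\<close> one sees that
  \<open>H\<close> meets the whole union in \<open>M\<close>, and \<open>H\<close> is slender. If \<open>M\<close> has finite index in level \<open>p\<close>, take finitely
  many elements of the union in different cosets of \<open>H\<close>. A power of \<open>g\<close> conjugates them into level \<open>p\<close>,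
  where they are in different cosets of \<open>M\<close>, so their number is bounded. Hence the union is
  finitely covered by \<open>H\<close>. So is all of \<open>G\<close>, since modulo \<open>g\<close> the exponent of \<open>t\<close> can be
  taken between \<open>0\<close> and \<open>k - 1\<close>.
\<close>

lemma slender_or_finite_index:
  assumes fg: "fin_gen_subgroup H G" and H: "subgroup H G"
  shows "slender G H \<or> finitely_covers G H (carrier G)"
proof (cases "H \<subseteq> base_closure")
  case True
  then show ?thesis using base_part_slender fg H by blast
next
  case False
  note HD = subgroupD[OF H]
  have BC: "base_closure \<subseteq> carrier G" using subgroupD(1)[OF sub_base_closure] .
  obtain g0 where g0: "g0 \<in> H" "g0 \<notin> base_closure" using False by blast
  then have "e g0 \<noteq> 0" using e_eq_0_base_closure HD(1) by blast
  moreover have "e (inv g0) = - e g0" using e_inv g0 HD(1) by blast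
  ultimately obtain g where g: "g \<in> H" "e g > 0"
    using g0(1) HD(3)[OF g0(1)] by (metis neg_0_less_iff_less linorder_neqE)
  have gc: "g \<in> carrier G" using g HD(1) by blast
  obtain m and k' :: int where m0: "m \<in> base_closure" "g = m \<otimes> t [^] k'" using normal_form[OF gc] by blast
  have mc: "m \<in> carrier G" using m0 BC by blast
  have "e g = k'" using m0 mc e_base_closure[OF m0(1)] by (simp add: e_mult e_pow e_t)
  then obtain k where k: "k' = int k" "k \<ge> 1" using g(2) by (metis int_one_le_iff_zero_less of_nat_le_iff of_nat_1 zero_less_imp_eq_int)
  have g_eq: "g = m \<otimes> t [^] (int k)" using m0 k by simp
  have eg: "e g = int k" using \<open>e g = k'\<close> k by simp
  obtain p where p: "m \<in> level p" using m0 by (auto simp: base_closure_def)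
  have conj_g: "conj_by G g x = conj_by G (t [^] (int k)) (conj_by G m x)" if "x \<in> carrier G" for x
    unfolding g_eq using mc that by (simp add: conj_by_conj_by)
  have down: "conj_by G g x \<in> level (q - 1)" if x: "x \<in> level q" and q: "q \<ge> p" for x q
  proof -
    have "conj_by G m x \<in> level q" using conj_by_subgroup[OF sub_level _ x] p level_mono[OF q] by blast
    then show ?thesis using level_shift k(2) conj_g x by (simp add: level_def)
  qed
  have stay: "conj_by G g x \<in> level p" if "x \<in> level p" for x
    using down[OF that] level_mono[of "p - 1" p] by auto
  have reach: "\<exists>i::nat. conj_by G (g [^] (int i)) x \<in> level p" if "x \<in> level q" for x q
    using that
  proof (induction q arbitrary: x)
    case 0
    then have "x \<in> level p" "x \<in> carrier G" using level_mono[of 0 p] by (auto simp: level_def)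
    then show ?case by (intro exI[of _ 0]) simp
  next
    case (Suc q)
    have xc: "x \<in> carrier G" using Suc.prems by (simp add: level_def)
    show ?case
    proof (cases "Suc q \<ge> p")
      case True
      then have "conj_by G g x \<in> level q" using down[OF Suc.prems] by simp
      then obtain i :: nat where "conj_by G (g [^] (int i)) (conj_by G g x) \<in> level p" using Suc.IH by blast
      then have "conj_by G (g \<otimes> g [^] (int i)) x \<in> level p" using gc xc by (simp add: conj_by_conj_by)
      then show ?thesis using int_pow_mult[OF gc, of 1 "int i"] gc by (intro exI[of _ "Suc i"]) simp
    next
      case False
      then have "x \<in> level p" using Suc.prems level_mono[of "Suc q" p] by auto
      then show ?thesis using xc by (intro exI[of _ 0]) simp
    qed
  qed
  have up: "conj_by G (g [^] (int i)) x \<in> level p" if "x \<in> level p" for x i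
    using that
  proof (induction i)
    case 0
    then show ?case by (simp add: level_def)
  next
    case (Suc i)
    have "g [^] (int (Suc i)) = g [^] (int i) \<otimes> g"
      using int_pow_mult[OF gc, of "int i" 1] gc by (simp add: add.commute)
    moreover have "x \<in> carrier G" using Suc.prems by (simp add: level_def)
    ultimately show ?case using stay[OF Suc.IH[OF Suc.prems]] gc by (simp add: conj_by_conj_by)
  qed
  have gH: "g [^] (i::int) \<in> H" for i using HD(5)[OF g(1)] .
  let ?M = "H \<inter> level p"
  have M: "subgroup ?M G" using subgroups_Inter_pair[OF H sub_level] .
  have "finite ?M \<or> finitely_covers G ?M (level p)"
    by (rule virtually_cyclic_subgroup_cases[OF level_virtually_cyclic M]) blast
  then show ?thesis
  proof
    assume fin: "finite ?M"
    have inj: "inj_on (conj_by G g) ?M"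
    proof (rule inj_onI)
      fix x y assume "x \<in> ?M" "y \<in> ?M" and eq: "conj_by G g x = conj_by G g y"
      then have "x \<in> carrier G" "y \<in> carrier G" by (auto simp: level_def)
      then show "x = y" using arg_cong[OF eq, of "conj_by G (inv g)"] gc by simp
    qed
    have intoM: "conj_by G g ` ?M \<subseteq> ?M" using stay conj_by_subgroup[OF H g(1)] by auto
    have surjM: "conj_by G g ` ?M = ?M" using endo_inj_surj[OF fin intoM inj] .
    have pull: "conj_by G (inv g) y \<in> ?M" if y: "y \<in> ?M" for y
    proof -
      obtain x where x: "x \<in> ?M" "y = conj_by G g x" using y surjM by blast
      then have "x \<in> carrier G" by (auto simp: level_def)
      then show ?thesis using x gc by simp
    qed
    have "x \<in> ?M" if x: "x \<in> H" "x \<in> level q" for x q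
    proof -
      obtain i :: nat where i: "conj_by G (g [^] (int i)) x \<in> level p" using reach[OF x(2)] by blast
      have "conj_by G (g [^] (int i)) x \<in> ?M" using i conj_by_subgroup[OF H gH x(1)] by blast
      moreover have "x \<in> ?M" if "conj_by G (g [^] (int i)) x \<in> ?M" "x \<in> carrier G" for i x
        using that
      proof (induction i arbitrary: x)
        case (Suc i)
        have "g [^] (int (Suc i)) = g \<otimes> g [^] (int i)" using int_pow_mult[OF gc, of 1 "int i"] gc by simp
        then have "conj_by G (g [^] (int i)) (conj_by G g x) \<in> ?M"
          using Suc.prems gc by (simp add: conj_by_conj_by)
        then have "conj_by G g x \<in> ?M" using Suc.IH[of "conj_by G g x"] Suc.prems gc by simp
        then show ?case using pull[of "conj_by G g x"] Suc.prems gc by simp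
      qed simp
      moreover have "x \<in> carrier G" using x HD(1) by blast
      ultimately show ?thesis by blast
    qed
    then have "H \<inter> base_closure \<subseteq> ?M" by (auto simp: base_closure_def)
    then have "finite (H \<inter> base_closure)" using fin finite_subset by blast
    then show ?thesis using finite_base_part_slender[OF H] by blast
  next
    assume "finitely_covers G ?M (level p)"
    then obtain F where F: "finite F" "F \<subseteq> carrier G" "\<forall>x\<in>level p. \<exists>h\<in>?M. \<exists>f\<in>F. x = h \<otimes> f"
      by (auto simp: finitely_covers_def)
    have "finitely_covers G H base_closure"
    proof (rule finitely_covers_by_separation[OF H BC])
      fix E assume E: "finite E" "E \<subseteq> base_closure"
        and sep: "\<And>x y. x \<in> E \<Longrightarrow> y \<in> E \<Longrightarrow> x \<otimes> inv y \<in> H \<Longrightarrow> x = y"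
      have Ec: "x \<in> carrier G" if "x \<in> E" for x using that E BC by blast
      have "\<exists>i::nat. \<forall>x\<in>E. conj_by G (g [^] (int i)) x \<in> level p"
        using E
      proof (induction rule: finite_induct)
        case (insert x E)
        then obtain i :: nat where i: "\<forall>x\<in>E. conj_by G (g [^] (int i)) x \<in> level p" by blast
        obtain q where "x \<in> level q" using insert.prems by (auto simp: base_closure_def)
        then obtain j :: nat where j: "conj_by G (g [^] (int j)) x \<in> level p" using reach by blast
        have lift: "conj_by G (g [^] (int (i + j))) y \<in> level p"
          if "y \<in> carrier G" "conj_by G (g [^] (int l)) y \<in> level p" "l \<le> i + j" for y l
        proof -
          have "conj_by G (g [^] (int (i + j - l))) (conj_by G (g [^] (int l)) y) \<in> level p"
            using up that(2) by blast
          moreover have "g [^] (int l) \<otimes> g [^] (int (i + j - l)) = g [^] (int (i + j))"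
            using that(3) gc by (simp add: int_pow_mult[symmetric] of_nat_diff)
          ultimately show ?thesis using that(1) gc by (simp add: conj_by_conj_by)
        qed
        have "conj_by G (g [^] (int (i + j))) y \<in> level p" if y: "y \<in> insert x E" for y
        proof -
          have yc: "y \<in> carrier G" using y insert.prems BC by blast
          show ?thesis using y lift[OF yc, of i] lift[OF yc, of j] i j by auto
        qed
        then have "\<forall>y\<in>insert x E. conj_by G (g [^] (int (i + j))) y \<in> level p" by blast
        then show ?case ..
      qed simp
      then obtain i :: nat where i: "\<forall>x\<in>E. conj_by G (g [^] (int i)) x \<in> level p" by blast
      define c where "c x = conj_by G (g [^] (int i)) x" for x
      have "\<forall>x\<in>E. \<exists>f. f \<in> F \<and> (\<exists>h\<in>?M. c x = h \<otimes> f)" using F(3) i unfolding c_def by blast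
      then obtain r where r: "\<And>x. x \<in> E \<Longrightarrow> r x \<in> F \<and> (\<exists>h\<in>?M. c x = h \<otimes> r x)" by metis
      have "inj_on r E"
      proof (rule inj_onI)
        fix x y assume xy: "x \<in> E" "y \<in> E" "r x = r y"
        obtain h h' where h: "h \<in> ?M" "h' \<in> ?M" "c x = h \<otimes> r x" "c y = h' \<otimes> r x" using r xy by metis
        have hc: "h \<in> carrier G" "h' \<in> carrier G" "r x \<in> carrier G" using h HD(1) r xy F(2) by blast+
        have "c x \<otimes> inv (c y) = h \<otimes> inv h'"
          unfolding h(3,4) using hc by (simp add: inv_mult_group m_assoc conjugate_cancel)
        then have "c x \<otimes> inv (c y) \<in> H" using HD(4)[OF _ HD(3)] h(1,2) by auto
        moreover have "c x \<otimes> inv (c y) = conj_by G (g [^] (int i)) (x \<otimes> inv y)"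
          using Ec xy gc by (simp add: c_def conj_by_def inv_mult_group m_assoc conjugate_cancel)
        ultimately have "x \<otimes> inv y \<in> H" using conj_by_subgroup_iff[OF H gH] Ec xy by simp
        then show "x = y" using sep xy by blast
      qed
      moreover have "r ` E \<subseteq> F" using r by blast
      ultimately show "card E \<le> card F" using F(1) card_inj_on_le by blast
    qed
    then obtain D where D: "finite D" "D \<subseteq> carrier G" "\<forall>x\<in>base_closure. \<exists>h\<in>H. \<exists>f\<in>D. x = h \<otimes> f"
      by (auto simp: finitely_covers_def)
    define D' where "D' = (\<lambda>(d, r). d \<otimes> t [^] (int r)) ` (D \<times> {..<k})"
    have "\<exists>h\<in>H. \<exists>f\<in>D'. x = h \<otimes> f" if x: "x \<in> carrier G" for x
    proof -
      define q where "q = e x div int k"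
      define y where "y = g [^] (- q) \<otimes> x"
      have yc: "y \<in> carrier G" using gc x by (simp add: y_def)
      have "e y = e x mod int k"
        using gc x by (simp add: y_def e_mult e_pow eg q_def minus_div_mult_eq_mod[symmetric])
      moreover have "0 \<le> e x mod int k" "e x mod int k < int k" using k(2) by simp_all
      ultimately obtain r where r: "e y = int r" "r < k" by (metis nonneg_int_cases of_nat_less_iff)
      obtain n and i :: int where n: "n \<in> base_closure" "y = n \<otimes> t [^] i" using normal_form[OF yc] by blast
      have nc: "n \<in> carrier G" using n BC by blast
      have "i = int r" using n r nc e_base_closure[OF n(1)] by (simp add: e_mult e_pow e_t)
      obtain h d where hd: "h \<in> H" "d \<in> D" "n = h \<otimes> d" using D(3) n by blast
      have hc: "h \<in> carrier G" "d \<in> carrier G" using hd HD(1) D(2) by blast+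
      have "x = g [^] q \<otimes> y" using gc x by (simp add: y_def int_pow_neg conjugate_cancel)
      also have "\<dots> = (g [^] q \<otimes> h) \<otimes> (d \<otimes> t [^] (int r))"
        using n hd hc gc \<open>i = int r\<close> by (simp add: m_assoc)
      finally have "x = (g [^] q \<otimes> h) \<otimes> (d \<otimes> t [^] (int r))" .
      moreover have "g [^] q \<otimes> h \<in> H" using HD(4)[OF gH hd(1)] .
      moreover have "d \<otimes> t [^] (int r) \<in> D'" using hd r by (auto simp: D'_def)
      ultimately show ?thesis by blast
    qed
    moreover have "finite D'" "D' \<subseteq> carrier G" using D(1,2) by (auto simp: D'_def)
    ultimately show ?thesis unfolding finitely_covers_def by blast
  qed
qed

theorem fgip: "fgip G"
  unfolding fgip_def
proof (intro allI impI, elim conjE)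
  fix H K assume H: "subgroup H G" "fin_gen_subgroup H G" and K: "subgroup K G" "fin_gen_subgroup K G"
  have HK: "subgroup (H \<inter> K) G" using subgroups_Inter_pair[OF H(1) K(1)] .
  consider "slender G H" | "slender G K" | "finitely_covers G H (carrier G)"
    using slender_or_finite_index H K by blast
  then show "fin_gen_subgroup (H \<inter> K) G"
  proof cases
    case 1 then show ?thesis using slenderD[OF _ HK] by blast
  next
    case 2 then show ?thesis using slenderD[OF _ HK] by blast
  next
    case 3
    show ?thesis
      by (rule fin_gen_finitely_covers[OF K(2,1) HK _ finitely_covers_Int[OF H(1) K(1) 3]]) blast
  qed
qed

end


section \<open>Presented amalgamated products and HNN extensions\<close>

lemma presented_table_hom:
  assumes "group A" "table f A \<subseteq> R" "f ` carrier A \<subseteq> X"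
  shows "(\<lambda>a. pgen X R (f a)) \<in> hom A (presented_group X R)"
proof (rule homI)
  interpret A: group A by fact
  interpret P: group "presented_group X R" by (rule group_presented_group)
  show "pgen X R (f a) \<in> carrier (presented_group X R)" if "a \<in> carrier A" for a
    using that assms(3) by auto
  fix a b assume ab: "a \<in> carrier A" "b \<in> carrier A"
  have "([(f a, True), (f b, True)], [(f (a \<otimes>\<^bsub>A\<^esub> b), True)]) \<in> R"
    using assms(2) ab by (auto simp: table_def)
  moreover have "f a \<in> X" "f b \<in> X" "f (a \<otimes>\<^bsub>A\<^esub> b) \<in> X" using ab assms(3) by auto
  ultimately show "pgen X R (f (a \<otimes>\<^bsub>A\<^esub> b)) = pgen X R (f a) \<otimes>\<^bsub>presented_group X R\<^esub> pgen X R (f b)"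
    using presented_relation[of "[(f a, True), (f b, True)]" "[(f (a \<otimes>\<^bsub>A\<^esub> b), True)]" R X] by simp
qed

lemma group_homI: "group G \<Longrightarrow> group H \<Longrightarrow> h \<in> hom G H \<Longrightarrow> group_hom G H h"
  by (simp add: group_hom_def group_hom_axioms_def)

lemma monD: "f \<in> mon G H \<Longrightarrow> f \<in> hom G H" "f \<in> mon G H \<Longrightarrow> inj_on f (carrier G)"
  by (auto simp: mon_def)

subsection \<open>Amalgamated products\<close>

locale amalgam_data = A: group A + B: group B + i: group_hom C A i + j: group_hom C B j
  for A :: "'a monoid" and B :: "'b monoid" and C :: "'c monoid" and i j
begin

definition gens :: "('a + 'b) set" where "gens = carrier A <+> carrier B"

definition rels :: "(('a + 'b) word \<times> ('a + 'b) word) set" where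
  "rels = table Inl A \<union> table Inr B \<union> {([(Inl (i c), True)], [(Inr (j c), True)]) | c. c \<in> carrier C}"

abbreviation "P \<equiv> presented_group gens rels"

lemma amalgam_eq: "amalgam A B C i j = P"
  by (simp add: amalgam_def gens_def rels_def)

definition left :: "'a \<Rightarrow> ('a + 'b) word set" where "left a = pgen gens rels (Inl a)"
definition right :: "'b \<Rightarrow> ('a + 'b) word set" where "right b = pgen gens rels (Inr b)"

sublocale P: group P by (rule group_presented_group)

sublocale left: group_hom A P left
  unfolding left_def by (intro group_homI A.is_group P.is_group presented_table_hom) (auto simp: rels_def gens_def)

sublocale right: group_hom B P right
  unfolding right_def by (intro group_homI B.is_group P.is_group presented_table_hom) (auto simp: rels_def gens_def)

lemma left_right:
  assumes c: "c \<in> carrier C"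
  shows "left (i c) = right (j c)"
proof -
  have "([(Inl (i c), True)], [(Inr (j c), True)]) \<in> rels" using c by (auto simp: rels_def)
  moreover have "Inl (i c) \<in> gens" "Inr (j c) \<in> gens" using c by (auto simp: gens_def)
  ultimately show ?thesis
    using presented_relation[of "[(Inl (i c), True)]" "[(Inr (j c), True)]" rels gens]
    by (simp add: left_def right_def)
qed

lemma generated: "generate P (left ` carrier A \<union> right ` carrier B) = carrier P"
proof -
  have "pgen gens rels ` gens = left ` carrier A \<union> right ` carrier B"
    by (auto simp: gens_def left_def right_def)
  then show ?thesis using presented_generate[of gens rels] by simp
qed

lemma extend:
  assumes L: "group L" and f: "f \<in> hom A L" and g: "g \<in> hom B L"
    and agree: "\<And>c. c \<in> carrier C \<Longrightarrow> f (i c) = g (j c)"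
  shows "\<exists>h\<in>hom P L. (\<forall>a\<in>carrier A. h (left a) = f a) \<and> (\<forall>b\<in>carrier B. h (right b) = g b)"
proof -
  interpret L: group L by (rule L)
  define F where "F x = (case x of Inl a \<Rightarrow> f a | Inr b \<Rightarrow> g b)" for x
  have fg: "f a \<in> carrier L" "g b \<in> carrier L" if "a \<in> carrier A" "b \<in> carrier B" for a b
    using hom_in_carrier[OF f that(1)] hom_in_carrier[OF g that(2)] .
  have "\<exists>h\<in>hom P L. \<forall>x\<in>gens. h (pgen gens rels x) = F x"
  proof (rule presented_hom_ex[OF L])
    show "F \<in> gens \<rightarrow> carrier L" using hom_in_carrier[OF f] hom_in_carrier[OF g] by (auto simp: F_def gens_def)
    fix l r assume "(l, r) \<in> rels"
    then consider a b where "a \<in> carrier A" "b \<in> carrier A"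
        "l = [(Inl a, True), (Inl b, True)]" "r = [(Inl (a \<otimes>\<^bsub>A\<^esub> b), True)]"
      | a b where "a \<in> carrier B" "b \<in> carrier B"
        "l = [(Inr a, True), (Inr b, True)]" "r = [(Inr (a \<otimes>\<^bsub>B\<^esub> b), True)]"
      | c where "c \<in> carrier C" "l = [(Inl (i c), True)]" "r = [(Inr (j c), True)]"
      unfolding rels_def table_def by blast
    then show "word_value L F l = word_value L F r"
      by cases (simp_all add: F_def hom_mult[OF f] hom_mult[OF g] hom_in_carrier[OF f] hom_in_carrier[OF g] agree)
  qed
  then obtain h where h: "h \<in> hom P L" "\<And>x. x \<in> gens \<Longrightarrow> h (pgen gens rels x) = F x" by blast
  show ?thesis
    using h(1) h(2)[of "Inl _"] h(2)[of "Inr _"]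
    by (intro bexI[of _ h]) (auto simp: gens_def F_def left_def right_def)
qed

end

lemma amalgam_fgip:
  assumes A: "virtually_Z A" and B: "virtually_Z B" and C: "group C"
    and i: "i \<in> mon C A" and j: "j \<in> mon C B"
    and card: "card (rcosets\<^bsub>A\<^esub> (i ` carrier C)) = 2" "card (rcosets\<^bsub>B\<^esub> (j ` carrier C)) = 2"
  shows "fgip (amalgam A B C i j)"
proof -
  have AB: "group A" "group B" using A B by (simp_all add: virtually_Z_def)
  interpret amalgam_data A B C i j
    using AB group_homI[OF C AB(1) monD(1)[OF i]] group_homI[OF C AB(2) monD(1)[OF j]]
    by (simp add: amalgam_data_def)
  define A' where "A' = left ` carrier A"
  define B' where "B' = right ` carrier B"
  define C' where "C' = left ` i ` carrier C"
  have C'_alt: "C' = right ` j ` carrier C" using left_right by (auto simp: C'_def image_iff)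
  have iC: "subgroup (i ` carrier C) A" and jC: "subgroup (j ` carrier C) B"
    by (rule i.img_is_subgroup, rule j.img_is_subgroup)
  have sub: "subgroup A' P" "subgroup B' P" "subgroup C' P"
    unfolding A'_def B'_def C'_def
    using left.img_is_subgroup right.img_is_subgroup left.subgroup_img_is_subgroup[OF iC] by auto
  have CA: "C' \<subseteq> A'" unfolding A'_def C'_def using i.hom_closed by auto
  have CB: "C' \<subseteq> B'" unfolding B'_def C'_alt using j.hom_closed by auto
  have vcA: "virtually_cyclic P A'" and vcB: "virtually_cyclic P B'"
    unfolding A'_def B'_def using left.virtually_cyclic_image right.virtually_cyclic_image
      A.virtually_Z_virtually_cyclic(1)[OF A] B.virtually_Z_virtually_cyclic(1)[OF B] by auto
  have gen: "carrier P = generate P (A' \<union> B')" using generated by (simp add: A'_def B'_def)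
  have A2: "\<forall>x\<in>A' - C'. \<forall>y\<in>A' - C'. x \<otimes>\<^bsub>P\<^esub> inv\<^bsub>P\<^esub> y \<in> C'"
  proof (intro ballI)
    fix x y assume "x \<in> A' - C'" "y \<in> A' - C'"
    then obtain a b where ab: "a \<in> carrier A - i ` carrier C" "x = left a" "b \<in> carrier A - i ` carrier C" "y = left b"
      by (auto simp: A'_def C'_def)
    then have "a \<otimes>\<^bsub>A\<^esub> inv\<^bsub>A\<^esub> b \<in> i ` carrier C" using A.card_rcosets_eq_2_iff[OF iC] card by blast
    then have "left (a \<otimes>\<^bsub>A\<^esub> inv\<^bsub>A\<^esub> b) \<in> C'" by (simp add: C'_def)
    then show "x \<otimes>\<^bsub>P\<^esub> inv\<^bsub>P\<^esub> y \<in> C'" using ab by simp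
  qed
  have B2: "\<forall>x\<in>B' - C'. \<forall>y\<in>B' - C'. x \<otimes>\<^bsub>P\<^esub> inv\<^bsub>P\<^esub> y \<in> C'"
  proof (intro ballI)
    fix x y assume "x \<in> B' - C'" "y \<in> B' - C'"
    then obtain a b where ab: "a \<in> carrier B - j ` carrier C" "x = right a" "b \<in> carrier B - j ` carrier C" "y = right b"
      by (auto simp: B'_def C'_alt)
    then have "a \<otimes>\<^bsub>B\<^esub> inv\<^bsub>B\<^esub> b \<in> j ` carrier C" using B.card_rcosets_eq_2_iff[OF jC] card by blast
    then have "right (a \<otimes>\<^bsub>B\<^esub> inv\<^bsub>B\<^esub> b) \<in> C'" by (simp add: C'_alt)
    then show "x \<otimes>\<^bsub>P\<^esub> inv\<^bsub>P\<^esub> y \<in> C'" using ab by simp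
  qed
  (* If one of the factors coincides with \<open>C\<close> inside the amalgamated product, the other factor is everything. *)
  have "slender P (carrier P)"
  proof (cases "A' \<subseteq> C' \<or> B' \<subseteq> C'")
    case True
    then have "A' \<union> B' \<subseteq> A' \<or> A' \<union> B' \<subseteq> B'" using CA CB by blast
    then have "carrier P \<subseteq> A' \<or> carrier P \<subseteq> B'"
      unfolding gen using P.generate_subgroup_incl sub by blast
    then show ?thesis
      using P.virtually_cyclic_slender[OF vcA] P.virtually_cyclic_slender[OF vcB] slender_mono by blast
  next
    case False
    then obtain a b where "a \<in> A' - C'" "b \<in> B' - C'" by blast
    then show ?thesis
      by (intro P.slender_index_two_amalgam[OF sub(3,1,2) CA CB _ A2 B2 _ _ gen])
        (use P.virtually_cyclic_slender[OF vcA] slender_mono CA in auto)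
  qed
  then show ?thesis unfolding amalgam_eq by (rule P.slender_fgip)
qed


subsection \<open>Ascending HNN extensions\<close>

locale hnn_data = A: group A + \<phi>: group_hom A A \<phi> for A :: "'a monoid" and \<phi>
begin

definition gens :: "'a option set" where "gens = insert None (Some ` carrier A)"

definition rels :: "('a option word \<times> 'a option word) set" where
  "rels = table Some A \<union>
    {([(None, False), (Some a, True), (None, True)], [(Some (\<phi> a), True)]) | a. a \<in> carrier A}"

abbreviation "P \<equiv> presented_group gens rels"

lemma hnn_eq: "ascending_hnn A \<phi> = P"
  by (simp add: ascending_hnn_def gens_def rels_def)

definition base_elt :: "'a \<Rightarrow> 'a option word set" where "base_elt a = pgen gens rels (Some a)"
definition stable :: "'a option word set" where "stable = pgen gens rels None"

sublocale P: group P by (rule group_presented_group)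

sublocale base_elt: group_hom A P base_elt
  unfolding base_elt_def by (intro group_homI A.is_group P.is_group presented_table_hom) (auto simp: rels_def gens_def)

lemma stable_closed [simp]: "stable \<in> carrier P"
  by (simp add: stable_def gens_def)

lemma stable_relation:
  assumes a: "a \<in> carrier A"
  shows "conj_by P stable (base_elt a) = base_elt (\<phi> a)"
proof -
  have "([(None, False), (Some a, True), (None, True)], [(Some (\<phi> a), True)]) \<in> rels"
    using a by (auto simp: rels_def)
  moreover have "Some a \<in> gens" "Some (\<phi> a) \<in> gens" "None \<in> gens" using a by (auto simp: gens_def)
  ultimately have "inv\<^bsub>P\<^esub> stable \<otimes>\<^bsub>P\<^esub> (base_elt a \<otimes>\<^bsub>P\<^esub> stable) = base_elt (\<phi> a)"
    using presented_relation[of "[(None, False), (Some a, True), (None, True)]" "[(Some (\<phi> a), True)]" rels gens]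
    by (simp add: stable_def base_elt_def)
  then show ?thesis using base_elt.hom_closed[OF a] by (simp add: conj_by_def P.m_assoc)
qed

lemma generated: "generate P (insert stable (base_elt ` carrier A)) = carrier P"
proof -
  have "pgen gens rels ` gens = insert stable (base_elt ` carrier A)"
    by (auto simp: gens_def base_elt_def stable_def)
  then show ?thesis using presented_generate[of gens rels] by simp
qed

lemma extend:
  assumes L: "group L" and f: "f \<in> hom A L" and s: "s \<in> carrier L"
    and rel: "\<And>a. a \<in> carrier A \<Longrightarrow> conj_by L s (f a) = f (\<phi> a)"
  shows "\<exists>h\<in>hom P L. (\<forall>a\<in>carrier A. h (base_elt a) = f a) \<and> h stable = s"
proof -
  interpret L: group L by (rule L)
  define F where "F x = (case x of None \<Rightarrow> s | Some a \<Rightarrow> f a)" for x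
  have "\<exists>h\<in>hom P L. \<forall>x\<in>gens. h (pgen gens rels x) = F x"
  proof (rule presented_hom_ex[OF L])
    show "F \<in> gens \<rightarrow> carrier L" using s hom_in_carrier[OF f] by (auto simp: F_def gens_def)
    fix l r assume "(l, r) \<in> rels"
    then consider a b where "a \<in> carrier A" "b \<in> carrier A"
        "l = [(Some a, True), (Some b, True)]" "r = [(Some (a \<otimes>\<^bsub>A\<^esub> b), True)]"
      | a where "a \<in> carrier A" "l = [(None, False), (Some a, True), (None, True)]" "r = [(Some (\<phi> a), True)]"
      by (auto simp: rels_def table_def)
    then show "word_value L F l = word_value L F r"
    proof cases
      case 1
      then show ?thesis using hom_in_carrier[OF f] by (simp add: F_def hom_mult[OF f])
    next
      case 2
      then show ?thesis
        using rel[OF 2(1)] hom_in_carrier[OF f] s \<phi>.hom_closed by (simp add: F_def conj_by_def L.m_assoc)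
    qed
  qed
  then obtain h where h: "h \<in> hom P L" "\<And>x. x \<in> gens \<Longrightarrow> h (pgen gens rels x) = F x" by blast
  show ?thesis
    using h(1) h(2)[of "Some _"] h(2)[of None]
    by (intro bexI[of _ h]) (auto simp: gens_def F_def base_elt_def stable_def)
qed

end

lemma ascending_hnn_fgip:
  assumes A: "virtually_Z A" and \<phi>: "\<phi> \<in> mon A A"
  shows "fgip (ascending_hnn A \<phi>)"
proof -
  have gA: "group A" using A by (simp add: virtually_Z_def)
  interpret hnn_data A \<phi>
    using gA group_homI[OF gA gA monD(1)[OF \<phi>]] by (simp add: hnn_data_def)
  have "\<exists>e\<in>hom P integer_group. (\<forall>a\<in>carrier A. e (base_elt a) = 0) \<and> e stable = 1"
    by (rule extend) (auto simp: hom_def conj_by_def)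
  then obtain e where e: "e \<in> hom P integer_group" "\<And>a. a \<in> carrier A \<Longrightarrow> e (base_elt a) = 0" "e stable = 1"
    by blast
  interpret ascending P "base_elt ` carrier A" stable e
  proof
    show "virtually_cyclic P (base_elt ` carrier A)"
      by (intro base_elt.virtually_cyclic_image A.virtually_Z_virtually_cyclic(1)[OF A])
    show "e (x \<otimes>\<^bsub>P\<^esub> y) = e x + e y" if "x \<in> carrier P" "y \<in> carrier P" for x y
      using hom_mult[OF e(1) that] by simp
    show "conj_by P stable a \<in> base_elt ` carrier A" if "a \<in> base_elt ` carrier A" for a
      using that stable_relation by auto
  qed (use e generated in auto)
  show ?thesis unfolding hnn_eq by (rule fgip)
qed


section \<open>Free actions with infinitely many orbits\<close>

text \<open>
  Left multiplication makes \<open>\<nat> \<times> G\<close> a free \<open>G\<close>-set with infinitely many orbits.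
\<close>

definition lact :: "('g, 'm) monoid_scheme \<Rightarrow> 'g \<Rightarrow> nat \<times> 'g \<Rightarrow> nat \<times> 'g" where
  "lact G g p = (fst p, g \<otimes>\<^bsub>G\<^esub> snd p)"

lemma lact_simps [simp]: "fst (lact G g p) = fst p" "snd (lact G g p) = g \<otimes>\<^bsub>G\<^esub> snd p"
  by (simp_all add: lact_def)

lemma lact_Pair [simp]: "lact G g (n, x) = (n, g \<otimes>\<^bsub>G\<^esub> x)" by (simp add: lact_def)

lemma lact_carrier_update [simp]: "lact (G\<lparr>carrier := K\<rparr>) = lact G"
  by (simp add: lact_def fun_eq_iff)

text \<open>
  The set \<open>Y\<close> is a union of infinitely many \<open>C\<close>-orbits. As \<open>C\<close> preserves the first component, it is enough
  that infinitely many numbers occur there.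
\<close>

definition free_set :: "('g, 'm) monoid_scheme \<Rightarrow> 'g set \<Rightarrow> (nat \<times> 'g) set \<Rightarrow> bool" where
  "free_set G C Y \<longleftrightarrow> Y \<subseteq> UNIV \<times> carrier G \<and> countable Y \<and> infinite (fst ` Y) \<and>
     (\<forall>c\<in>C. \<forall>p\<in>Y. lact G c p \<in> Y)"

context group
begin

lemma lact_lact: "g \<in> carrier G \<Longrightarrow> h \<in> carrier G \<Longrightarrow> p \<in> UNIV \<times> carrier G \<Longrightarrow>
  lact G g (lact G h p) = lact G (g \<otimes> h) p"
  by (auto simp: m_assoc)

lemma lact_one: "p \<in> UNIV \<times> carrier G \<Longrightarrow> lact G \<one> p = p"
  by auto

text \<open>
  A representative of every orbit is chosen, and the orbits are numbered.
\<close>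

lemma free_set_coordinates:
  assumes C: "subgroup C G" and Y: "free_set G C Y"
  shows "\<exists>\<theta>. bij_betw \<theta> (UNIV \<times> C) Y \<and>
    (\<forall>n. \<forall>c\<in>C. \<forall>d\<in>C. \<theta> (n::nat, c \<otimes> d) = lact G c (\<theta> (n, d)))"
proof -
  note CD = subgroupD[OF C]
  have Yc: "Y \<subseteq> UNIV \<times> carrier G" "countable Y" "infinite (fst ` Y)"
    and inv: "\<And>c p. c \<in> C \<Longrightarrow> p \<in> Y \<Longrightarrow> lact G c p \<in> Y"
    using Y by (auto simp: free_set_def)
  have Cc: "c \<in> carrier G" if "c \<in> C" for c using that CD(1) by blast
  define orb where "orb p = (\<lambda>c. lact G c p) ` C" for p
  have orb_self: "p \<in> orb p" if "p \<in> Y" for p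
    using lact_one[of p] that Yc(1) CD(2) unfolding orb_def by (metis image_eqI subsetD)
  have orb_le: "orb (lact G c p) \<subseteq> orb p" if "c \<in> C" "p \<in> Y" for c p
  proof
    fix q assume "q \<in> orb (lact G c p)"
    then obtain d where d: "d \<in> C" "q = lact G d (lact G c p)" by (auto simp: orb_def)
    have "p \<in> UNIV \<times> carrier G" using that Yc(1) by blast
    then have "q = lact G (d \<otimes> c) p" using d that Cc by (simp add: lact_lact)
    then show "q \<in> orb p" using CD(4)[OF d(1) that(1)] by (auto simp: orb_def)
  qed
  have orb_eq: "orb (lact G c p) = orb p" if cp: "c \<in> C" "p \<in> Y" for c p
  proof
    have pc: "p \<in> UNIV \<times> carrier G" using cp Yc(1) by blast
    have "lact G (m_inv G c) (lact G c p) = p"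
      using cp Cc pc lact_lact[of "m_inv G c" c p] lact_one[OF pc] by simp
    then show "orb p \<subseteq> orb (lact G c p)"
      using orb_le[OF CD(3)[OF cp(1)] inv[OF cp]] by simp
  qed (rule orb_le[OF cp])
  let ?O = "orb ` Y"
  have "countable ?O" using Yc(2) by simp
  moreover have "infinite ?O"
  proof
    assume fin: "finite ?O"
    have "fst ` Y \<subseteq> (\<lambda>S. fst (SOME p. p \<in> S)) ` ?O"
    proof
      fix n assume "n \<in> fst ` Y"
      then obtain p where p: "p \<in> Y" "n = fst p" by blast
      have "(SOME q. q \<in> orb p) \<in> orb p" using orb_self[OF p(1)] by (rule someI)
      then have "fst (SOME q. q \<in> orb p) = n" using p(2) by (auto simp: orb_def)
      then show "n \<in> (\<lambda>S. fst (SOME p. p \<in> S)) ` ?O" using p(1) by blast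
    qed
    then show False using Yc(3) finite_surj[OF fin] by blast
  qed
  ultimately have bij: "bij_betw (from_nat_into ?O) UNIV ?O" by (rule bij_betw_from_nat_into)
  define r where "r n = (SOME p. p \<in> Y \<and> orb p = from_nat_into ?O n)" for n
  have r: "r n \<in> Y \<and> orb (r n) = from_nat_into ?O n" for n
  proof -
    have "from_nat_into ?O n \<in> ?O" using bij by (auto simp: bij_betw_def)
    then have "\<exists>p. p \<in> Y \<and> orb p = from_nat_into ?O n" by auto
    then show ?thesis unfolding r_def by (rule someI_ex)
  qed
  have rc: "r n \<in> UNIV \<times> carrier G" for n using r Yc(1) by blast
  define \<theta> where "\<theta> = (\<lambda>(n, c). lact G c (r n))"
  have "inj_on \<theta> (UNIV \<times> C)"
  proof (rule inj_onI, clarify)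
    fix n c m d assume cd: "c \<in> C" "d \<in> C" and eq: "\<theta> (n, c) = \<theta> (m, d)"
    then have e: "lact G c (r n) = lact G d (r m)" by (simp add: \<theta>_def)
    have "orb (r n) = orb (r m)" using orb_eq[OF cd(1), of "r n"] orb_eq[OF cd(2), of "r m"] r e by metis
    then have nm: "n = m" using r bij by (metis bij_betw_imp_inj_on inj_eq)
    have "c \<otimes> snd (r n) = d \<otimes> snd (r n)" using arg_cong[OF e, of snd] nm by simp
    moreover have "snd (r n) \<in> carrier G" using rc[of n] by auto
    ultimately have "c = d" using cd Cc by simp
    then show "n = m \<and> c = d" using nm by simp
  qed
  moreover have "\<theta> ` (UNIV \<times> C) = Y"
  proof
    have "lact G c (r n) \<in> Y" if "c \<in> C" for c n using inv[OF that] r by blast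
    then show "\<theta> ` (UNIV \<times> C) \<subseteq> Y" unfolding \<theta>_def by (auto simp del: lact_simps)
    show "Y \<subseteq> \<theta> ` (UNIV \<times> C)"
    proof
      fix p assume p: "p \<in> Y"
      then have "orb p \<in> range (from_nat_into ?O)" using bij by (simp add: bij_betw_def)
      then obtain n where "from_nat_into ?O n = orb p" by (metis rangeE)
      then have "p \<in> orb (r n)" using r orb_self[OF p] by simp
      then obtain c where "c \<in> C" "p = lact G c (r n)" by (auto simp: orb_def)
      then have "p = \<theta> (n, c)" "(n, c) \<in> UNIV \<times> C" by (simp_all add: \<theta>_def)
      then show "p \<in> \<theta> ` (UNIV \<times> C)" by blast
    qed
  qed
  moreover have "\<theta> (n, c \<otimes> d) = lact G c (\<theta> (n, d))" if "c \<in> C" "d \<in> C" for n c d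
    using that Cc rc[of n] by (simp add: \<theta>_def lact_lact)
  ultimately show ?thesis unfolding bij_betw_def by blast
qed

end

text \<open>
  In coordinates, both sides are left multiplication of a group on its product with \<open>\<nat>\<close>: a free action
  with countably infinitely many orbits has no invariants. This is the source of all actions of a
  fundamental group that are constructed below.
\<close>

lemma free_sets_isomorphic:
  assumes G: "group G" and H: "group H" and C: "subgroup C G" and D: "subgroup D H"
    and \<phi>: "bij_betw \<phi> C D" "\<And>c d. c \<in> C \<Longrightarrow> d \<in> C \<Longrightarrow> \<phi> (c \<otimes>\<^bsub>G\<^esub> d) = \<phi> c \<otimes>\<^bsub>H\<^esub> \<phi> d"
    and Y: "free_set G C Y" and Z: "free_set H D Z"
  shows "\<exists>\<sigma>. bij_betw \<sigma> Y Z \<and> (\<forall>p\<in>Y. \<forall>c\<in>C. \<sigma> (lact G c p) = lact H (\<phi> c) (\<sigma> p))"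
proof -
  obtain \<theta> where \<theta>: "bij_betw \<theta> (UNIV \<times> C) Y"
    "\<And>n c d. c \<in> C \<Longrightarrow> d \<in> C \<Longrightarrow> \<theta> (n::nat, c \<otimes>\<^bsub>G\<^esub> d) = lact G c (\<theta> (n, d))"
    using group.free_set_coordinates[OF G C Y] by blast
  obtain \<eta> where \<eta>: "bij_betw \<eta> (UNIV \<times> D) Z"
    "\<And>n c d. c \<in> D \<Longrightarrow> d \<in> D \<Longrightarrow> \<eta> (n::nat, c \<otimes>\<^bsub>H\<^esub> d) = lact H c (\<eta> (n, d))"
    using group.free_set_coordinates[OF H D Z] by blast
  have \<phi>D: "\<phi> c \<in> D" if "c \<in> C" for c using \<phi>(1) that by (auto simp: bij_betw_def)
  define \<sigma> where "\<sigma> = \<eta> \<circ> map_prod id \<phi> \<circ> inv_into (UNIV \<times> C) \<theta>"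
  have "bij_betw (map_prod id \<phi>) ((UNIV :: nat set) \<times> C) (UNIV \<times> D)"
    using \<phi>(1) by (auto simp: bij_betw_def inj_on_def image_iff)
  then have "bij_betw \<sigma> Y Z"
    unfolding \<sigma>_def using bij_betw_inv_into[OF \<theta>(1)] \<eta>(1) by (intro bij_betw_trans)
  moreover have "\<sigma> (lact G c p) = lact H (\<phi> c) (\<sigma> p)" if p: "p \<in> Y" and c: "c \<in> C" for p c
  proof -
    obtain n d where d: "d \<in> C" "p = \<theta> (n, d)" using \<theta>(1) p unfolding bij_betw_def by blast
    have inv: "inv_into (UNIV \<times> C) \<theta> (\<theta> (n, x)) = (n, x)" if "x \<in> C" for x
      using that bij_betw_imp_inj_on[OF \<theta>(1)] by (intro inv_into_f_f) auto
    have cd: "c \<otimes>\<^bsub>G\<^esub> d \<in> C" using subgroup.m_closed[OF C c d(1)] .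
    have "\<sigma> (lact G c p) = \<sigma> (\<theta> (n, c \<otimes>\<^bsub>G\<^esub> d))" using \<theta>(2)[OF c d(1)] d(2) by simp
    also have "\<dots> = \<eta> (n, \<phi> c \<otimes>\<^bsub>H\<^esub> \<phi> d)" using inv[OF cd] \<phi>(2)[OF c d(1)] by (simp add: \<sigma>_def)
    also have "\<dots> = lact H (\<phi> c) (\<eta> (n, \<phi> d))" using \<eta>(2)[OF \<phi>D[OF c] \<phi>D[OF d(1)]] .
    also have "\<eta> (n, \<phi> d) = \<sigma> p" using inv[OF d(1)] d(2) by (simp add: \<sigma>_def)
    finally show ?thesis .
  qed
  ultimately show ?thesis by blast
qed

text \<open>
  The action on \<open>X\<close> that \<open>\<sigma>\<close> makes isomorphic to left multiplication on \<open>\<nat> \<times> G\<close>.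
\<close>

definition tact :: "('g, 'm) monoid_scheme \<Rightarrow> 'x set \<Rightarrow> ('x \<Rightarrow> nat \<times> 'g) \<Rightarrow> 'g \<Rightarrow> 'x \<Rightarrow> 'x" where
  "tact G X \<sigma> g p = (if p \<in> X then inv_into X \<sigma> (lact G g (\<sigma> p)) else p)"

context group
begin

lemma tact_eq:
  assumes \<sigma>: "bij_betw \<sigma> X (UNIV \<times> carrier G)" and p: "p \<in> X" and g: "g \<in> carrier G"
  shows "tact G X \<sigma> g p \<in> X" "\<sigma> (tact G X \<sigma> g p) = lact G g (\<sigma> p)"
proof -
  have "\<sigma> p \<in> UNIV \<times> carrier G" using \<sigma> p by (auto simp: bij_betw_def)
  then have "lact G g (\<sigma> p) \<in> UNIV \<times> carrier G" using g by (cases "\<sigma> p") auto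
  then have 1: "lact G g (\<sigma> p) \<in> \<sigma> ` X" using \<sigma> by (simp add: bij_betw_def)
  show "tact G X \<sigma> g p \<in> X" using inv_into_into[OF 1] p by (simp add: tact_def)
  show "\<sigma> (tact G X \<sigma> g p) = lact G g (\<sigma> p)" using f_inv_into_f[OF 1] p by (simp add: tact_def)
qed

lemma tact_hom:
  assumes \<sigma>: "bij_betw \<sigma> X (UNIV \<times> carrier G)"
  shows "tact G X \<sigma> \<in> hom G perms"
proof -
  have inj: "inj_on \<sigma> X" using \<sigma> by (simp add: bij_betw_def)
  have \<sigma>c: "\<sigma> p \<in> UNIV \<times> carrier G" if "p \<in> X" for p using \<sigma> that by (auto simp: bij_betw_def)
  have mult: "tact G X \<sigma> (g \<otimes> h) p = tact G X \<sigma> g (tact G X \<sigma> h p)"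
    if gh: "g \<in> carrier G" "h \<in> carrier G" for g h p
  proof (cases "p \<in> X")
    case True
    note h = tact_eq[OF \<sigma> True gh(2)]
    note g = tact_eq[OF \<sigma> h(1) gh(1)]
    note m = tact_eq[OF \<sigma> True m_closed[OF gh]]
    have "\<sigma> (tact G X \<sigma> (g \<otimes> h) p) = \<sigma> (tact G X \<sigma> g (tact G X \<sigma> h p))"
      using g(2) h(2) m(2) lact_lact[OF gh \<sigma>c[OF True]] by simp
    then show ?thesis using inj g(1) m(1) by (simp add: inj_on_def)
  qed (simp add: tact_def)
  have one: "tact G X \<sigma> \<one> p = p" for p
  proof (cases "p \<in> X")
    case True
    show ?thesis using tact_eq[OF \<sigma> True one_closed] lact_one[OF \<sigma>c[OF True]] inj True
      by (simp add: inj_on_def)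
  qed (simp add: tact_def)
  show ?thesis
  proof (rule homI)
    fix g assume g: "g \<in> carrier G"
    have "bij (tact G X \<sigma> g)"
      by (rule o_bij[of "tact G X \<sigma> (inv g)"])
        (use g mult[of "inv g" g] mult[of g "inv g"] one in \<open>auto simp: fun_eq_iff\<close>)
    then show "tact G X \<sigma> g \<in> carrier perms" by simp
  qed (simp add: mult fun_eq_iff)
qed

end


section \<open>Splittings that rule out the f.g.i.p.\<close>

lemma free_setI:
  assumes "Y \<subseteq> UNIV \<times> K" "K \<subseteq> carrier G" "countable K" "infinite (fst ` Y)"
    and "\<And>c n x. c \<in> C \<Longrightarrow> (n, x) \<in> Y \<Longrightarrow> (n, c \<otimes>\<^bsub>G\<^esub> x) \<in> Y"
  shows "free_set G C Y"
proof -
  have "countable ((UNIV :: nat set) \<times> K)" using assms(3) by (intro countable_SIGMA) auto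
  then have "countable Y" using assms(1) countable_subset by blast
  moreover have "Y \<subseteq> UNIV \<times> carrier G" using assms(1,2) by blast
  moreover have "\<forall>c\<in>C. \<forall>p\<in>Y. lact G c p \<in> Y" using assms(5) by (auto simp: lact_def)
  ultimately show ?thesis using assms(4) unfolding free_set_def by blast
qed

lemma bij_betw_disjoint_Un:
  assumes "bij_betw f A B" "bij_betw g A' B'" "A \<inter> A' = {}" "B \<inter> B' = {}"
  shows "bij_betw (\<lambda>x. if x \<in> A then f x else g x) (A \<union> A') (B \<union> B')"
proof -
  have "bij_betw (\<lambda>x. if x \<in> A then f x else g x) A B"
    using assms(1) by (subst bij_betw_cong[of A _ f]) auto
  moreover have "bij_betw (\<lambda>x. if x \<in> A then f x else g x) A' B'"
    using assms(2,3) by (subst bij_betw_cong[of A' _ g]) auto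
  ultimately show ?thesis using assms(4) by (rule bij_betw_combine)
qed

context group
begin

lemma mult_outside:
  assumes "subgroup C G" "c \<in> C" "x \<in> carrier G"
  shows "c \<otimes> x \<in> C \<longleftrightarrow> x \<in> C" "x \<otimes> c \<in> C \<longleftrightarrow> x \<in> C"
proof -
  note CD = subgroupD[OF assms(1)]
  have c: "c \<in> carrier G" using assms(2) CD(1) by blast
  have "x \<in> C" if "c \<otimes> x \<in> C"
    using CD(4)[OF CD(3)[OF assms(2)] that] c assms(3) by (simp add: conjugate_cancel)
  then show "c \<otimes> x \<in> C \<longleftrightarrow> x \<in> C" using CD(4)[OF assms(2)] by blast
  have "x \<in> C" if "x \<otimes> c \<in> C"
    using CD(4)[OF that CD(3)[OF assms(2)]] c assms(3) by (simp add: m_assoc)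
  then show "x \<otimes> c \<in> C \<longleftrightarrow> x \<in> C" using CD(4)[OF _ assms(2)] by blast
qed

lemma inv_outside:
  assumes "subgroup C G" "x \<in> carrier G"
  shows "inv x \<in> C \<longleftrightarrow> x \<in> C"
  using subgroupD(3)[OF assms(1), of x] subgroupD(3)[OF assms(1), of "inv x"] assms(2) by auto

text \<open>
  An HNN extension with base \<open>K\<close> and stable letter \<open>t\<close>, given by its universal property, neither of
  whose associated subgroups \<open>C\<close> and \<open>D\<close> is all of \<open>K\<close>. The set \<open>X = \<nat> \<times> K\<close> with \<open>K\<close> acting by left
  multiplication plays the role of the Bass-Serre tree: \<open>Q\<close> is a model of the half-tree beyond the
  edge of \<open>t\<close>, with stabiliser \<open>C\<close> in \<open>K\<close>, and \<open>Q'\<close> of the half-tree beyond the edge of \<open>t\<^sup>-\<^sup>1\<close>, with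
  stabiliser \<open>D\<close>. Both have complements with infinitely many orbits, so \<open>t\<close> can be made to map \<open>X - Q'\<close>
  onto \<open>Q\<close> and \<open>Q'\<close> onto \<open>X - Q\<close>, in a way that is compatible with \<open>c \<mapsto> t\<^sup>-\<^sup>1 c t\<close>.
\<close>

lemma not_fgip_hnn:
  assumes K: "subgroup K G" "countable K" and C: "subgroup C G" "C \<subseteq> K"
    and t: "t \<in> carrier G" and D: "subgroup D G" "D \<subseteq> K" "D = conj_by G t ` C"
    and c: "c \<in> K - C" and d: "d \<in> K - D"
    and z: "infinite_order G z" "z \<in> C" "\<And>g. g \<in> carrier G \<Longrightarrow> commensurates G z g"
    and extend: "\<And>\<rho> (\<tau> :: nat \<times> 'a \<Rightarrow> nat \<times> 'a). \<rho> \<in> hom (G\<lparr>carrier := K\<rparr>) perms \<Longrightarrow> bij \<tau> \<Longrightarrow>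
      (\<And>c. c \<in> C \<Longrightarrow> inv_into UNIV \<tau> \<circ> \<rho> c \<circ> \<tau> = \<rho> (conj_by G t c)) \<Longrightarrow>
      \<exists>h\<in>hom G perms. (\<forall>x\<in>K. h x = \<rho> x) \<and> h t = \<tau>"
  shows "\<not> fgip G"
proof -
  note KD = subgroupD[OF K(1)] and CD = subgroupD[OF C(1)] and DD = subgroupD[OF D(1)]
  interpret K: group "G\<lparr>carrier := K\<rparr>" using subgroup_imp_group[OF K(1)] .
  define X :: "(nat \<times> 'a) set" where "X = UNIV \<times> K"
  (* The parities keep \<open>Q\<close> and \<open>Q'\<close> disjoint and leave infinitely many orbits outside of each. *)
  define Q where "Q = {n. even (n::nat)} \<times> C"
  define Q' where "Q' = {n. odd (n::nat)} \<times> D"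
  have QX: "Q \<subseteq> X" "Q' \<subseteq> X" using C D by (auto simp: Q_def Q'_def X_def)
  have inf: "infinite {n::nat. even n}" "infinite {n::nat. odd n}"
  proof -
    have "infinite (range (\<lambda>n::nat. 2 * n))" "infinite (range (\<lambda>n::nat. Suc (2 * n)))"
      by (intro range_inj_infinite injI, simp)+
    moreover have "range (\<lambda>n::nat. 2 * n) \<subseteq> {n. even n}" "range (\<lambda>n::nat. Suc (2 * n)) \<subseteq> {n. odd n}" by auto
    ultimately show "infinite {n::nat. even n}" "infinite {n::nat. odd n}"
      using infinite_super by metis+
  qed
  have fQ: "free_set G C Q"
    by (rule free_setI[OF _ KD(1) K(2)]) (use C CD(2,4) inf in \<open>auto simp: Q_def\<close>)
  have fQ': "free_set G D Q'"
    by (rule free_setI[OF _ KD(1) K(2)]) (use D(2) DD(2,4) inf in \<open>auto simp: Q'_def\<close>)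
  have Kc: "x \<in> carrier G" if "x \<in> K" for x using that KD(1) by blast
  have fXQ: "free_set G C (X - Q)"
  proof (rule free_setI[OF _ KD(1) K(2)])
    have "{n. odd n} \<subseteq> fst ` (X - Q)" using KD(2) by (force simp: X_def Q_def image_iff)
    then show "infinite (fst ` (X - Q))" using inf(2) infinite_super by blast
    show "(n, b \<otimes> x) \<in> X - Q" if "b \<in> C" "(n, x) \<in> X - Q" for b n x
      using that KD(4) C(2) mult_outside(1)[OF C(1) that(1), of x] Kc by (auto simp: X_def Q_def)
  qed (auto simp: X_def)
  have fXQ': "free_set G D (X - Q')"
  proof (rule free_setI[OF _ KD(1) K(2)])
    have "{n. even n} \<subseteq> fst ` (X - Q')" using KD(2) by (force simp: X_def Q'_def image_iff)
    then show "infinite (fst ` (X - Q'))" using inf(1) infinite_super by blast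
    show "(n, b \<otimes> x) \<in> X - Q'" if "b \<in> D" "(n, x) \<in> X - Q'" for b n x
      using that KD(4) D(2) mult_outside(1)[OF D(1) that(1), of x] Kc by (auto simp: X_def Q'_def)
  qed (auto simp: X_def)
  have "inj_on (conj_by G t) C"
  proof (rule inj_onI)
    fix x y assume "x \<in> C" "y \<in> C" and eq: "conj_by G t x = conj_by G t y"
    then have "x \<in> carrier G" "y \<in> carrier G" using CD(1) by blast+
    then show "x = y" using arg_cong[OF eq, of "conj_by G (inv t)"] t by simp
  qed
  then have \<phi>: "bij_betw (conj_by G t) C D" using D(3) by (simp add: bij_betw_def)
  have \<phi>m: "conj_by G t (x \<otimes> y) = conj_by G t x \<otimes> conj_by G t y" if "x \<in> C" "y \<in> C" for x y
    using conj_by_mult[OF t] that CD(1) by blast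
  obtain \<sigma>\<^sub>1 where \<sigma>\<^sub>1: "bij_betw \<sigma>\<^sub>1 Q (X - Q')"
    "\<forall>p\<in>Q. \<forall>b\<in>C. \<sigma>\<^sub>1 (lact G b p) = lact G (conj_by G t b) (\<sigma>\<^sub>1 p)"
    using free_sets_isomorphic[OF is_group is_group C(1) D(1) \<phi> \<phi>m fQ fXQ'] by blast
  obtain \<sigma>\<^sub>2 where \<sigma>\<^sub>2: "bij_betw \<sigma>\<^sub>2 (X - Q) Q'"
    "\<forall>p\<in>X - Q. \<forall>b\<in>C. \<sigma>\<^sub>2 (lact G b p) = lact G (conj_by G t b) (\<sigma>\<^sub>2 p)"
    using free_sets_isomorphic[OF is_group is_group C(1) D(1) \<phi> \<phi>m fXQ fQ'] by blast
  define \<sigma> where "\<sigma> p = (if p \<in> Q then \<sigma>\<^sub>1 p else if p \<in> X - Q then \<sigma>\<^sub>2 p else p)" for p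
  have \<sigma>QX: "\<sigma> p \<in> X - Q'" if "p \<in> Q" for p using \<sigma>\<^sub>1(1) that by (auto simp: \<sigma>_def bij_betw_def)
  have \<sigma>XQ: "\<sigma> p \<in> Q'" if "p \<in> X - Q" for p using \<sigma>\<^sub>2(1) that by (auto simp: \<sigma>_def bij_betw_def)
  have bij: "bij \<sigma>"
  proof -
    have 1: "bij_betw (\<lambda>p. if p \<in> X - Q then \<sigma>\<^sub>2 p else p) ((X - Q) \<union> - X) (Q' \<union> - X)"
      by (rule bij_betw_disjoint_Un[OF \<sigma>\<^sub>2(1), of "\<lambda>p. p"]) (use QX in \<open>auto simp: bij_betw_def\<close>)
    have "bij_betw \<sigma> (Q \<union> ((X - Q) \<union> - X)) ((X - Q') \<union> (Q' \<union> - X))"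
      unfolding \<sigma>_def by (rule bij_betw_disjoint_Un[OF \<sigma>\<^sub>1(1) 1]) (use QX in auto)
    moreover have "Q \<union> ((X - Q) \<union> - X) = UNIV" "(X - Q') \<union> (Q' \<union> - X) = UNIV" using QX by auto
    ultimately show ?thesis by simp
  qed
  define \<tau> where "\<tau> = inv_into UNIV \<sigma>"
  have \<tau>: "bij \<tau>" "inv_into UNIV \<tau> = \<sigma>"
    using bij by (simp_all add: \<tau>_def bij_imp_bij_inv inv_inv_eq)
  have \<tau>\<sigma>: "\<tau> (\<sigma> p) = p" "\<sigma> (\<tau> p) = p" for p
    using bij by (simp_all add: \<tau>_def bij_is_inj bij_is_surj surj_f_inv_f)
  have \<tau>X: "\<tau> p \<in> Q" if "p \<in> X - Q'" for p
  proof -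
    have "p \<in> \<sigma>\<^sub>1 ` Q" using \<sigma>\<^sub>1(1) that by (simp add: bij_betw_def)
    then obtain q where "q \<in> Q" "p = \<sigma> q" by (auto simp: \<sigma>_def)
    then show ?thesis using \<tau>\<sigma>(1) by simp
  qed
  define \<rho> where "\<rho> = tact (G\<lparr>carrier := K\<rparr>) X id"
  have "bij_betw id X (UNIV \<times> carrier (G\<lparr>carrier := K\<rparr>))" by (simp add: X_def)
  note tact = K.tact_hom[OF this] K.tact_eq[OF this]
  have \<rho>: "\<rho> \<in> hom (G\<lparr>carrier := K\<rparr>) perms" using tact(1) by (simp add: \<rho>_def)
  have \<rho>X: "\<rho> x p = lact G x p" "\<rho> x p \<in> X" if "x \<in> K" "p \<in> X" for x p
    using tact(2,3) that by (simp_all add: \<rho>_def)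
  have \<rho>out: "\<rho> x p = p" if "p \<notin> X" for x p using that by (simp add: \<rho>_def tact_def)
  have "\<exists>h\<in>hom G perms. (\<forall>x\<in>K. h x = \<rho> x) \<and> h t = \<tau>"
  proof (rule extend[OF \<rho> \<tau>(1)])
    fix b assume b: "b \<in> C"
    then have bK: "b \<in> K" "conj_by G t b \<in> K" using C(2) D(2,3) by auto
    have "\<sigma> (\<rho> b q) = \<rho> (conj_by G t b) (\<sigma> q)" for q
    proof (cases "q \<in> X")
      case True
      have "\<sigma> q \<in> X" using \<sigma>QX \<sigma>XQ True QX by blast
      moreover have "\<sigma> (lact G b q) = lact G (conj_by G t b) (\<sigma> q)"
      proof (cases "q \<in> Q")
        case q: True
        then have "lact G b q \<in> Q" using fQ b by (simp add: free_set_def)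
        then show ?thesis using \<sigma>\<^sub>1(2) q b by (simp add: \<sigma>_def)
      next
        case q: False
        then have "lact G b q \<in> X - Q" using fXQ b True by (simp add: free_set_def)
        then show ?thesis using \<sigma>\<^sub>2(2) q b True by (simp add: \<sigma>_def)
      qed
      ultimately show ?thesis using \<rho>X(1) bK True by simp
    next
      case False
      then have "\<sigma> q = q" using QX by (auto simp: \<sigma>_def)
      then show ?thesis using False \<rho>out by simp
    qed
    then show "inv_into UNIV \<tau> \<circ> \<rho> b \<circ> \<tau> = \<rho> (conj_by G t b)"
      unfolding \<tau>(2) using \<tau>\<sigma>(2) by (simp add: fun_eq_iff)
  qed
  then obtain h where h: "h \<in> hom G perms" "\<And>x. x \<in> K \<Longrightarrow> h x = \<rho> x" "h t = \<tau>" by blast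
  have hinv: "h (inv t) = \<sigma>"
  proof -
    interpret h: group_hom G "perms :: (nat \<times> 'a \<Rightarrow> nat \<times> 'a) monoid" h
      using group_homI[OF is_group group_perms h(1)] .
    show ?thesis using h.hom_inv[OF t] h(3) \<tau> inv_perms[OF \<tau>(1)] by simp
  qed
  define P where "P = X - Q"
  have F1: "h x ` Q \<subseteq> P" if x: "x \<in> K - C" for x
  proof -
    have "\<rho> x p \<in> P" if p: "p \<in> Q" for p
    proof -
      obtain n b where nb: "p = (n, b)" "b \<in> C" using p by (auto simp: Q_def)
      have "x \<otimes> b \<notin> C" using mult_outside(2)[OF C(1) nb(2), of x] x Kc by blast
      then show ?thesis using \<rho>X[of x p] x p QX nb by (auto simp: P_def Q_def)
    qed
    then show ?thesis using h(2) x by auto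
  qed
  have F2: "h x ` Q' \<subseteq> P" if x: "x \<in> K" for x
  proof -
    have "\<rho> x p \<in> P" if p: "p \<in> Q'" for p
      using \<rho>X[of x p] x p QX by (auto simp: P_def Q_def Q'_def lact_def)
    then show ?thesis using h(2) x by auto
  qed
  have F3: "h x ` Q \<subseteq> X - Q'" if x: "x \<in> K" for x
  proof -
    have "\<rho> x p \<in> X - Q'" if p: "p \<in> Q" for p
      using \<rho>X[of x p] x p QX by (auto simp: Q_def Q'_def lact_def)
    then show ?thesis using h(2) x by auto
  qed
  have F4: "h x ` Q' \<subseteq> X - Q'" if x: "x \<in> K - D" for x
  proof -
    have "\<rho> x p \<in> X - Q'" if p: "p \<in> Q'" for p
    proof -
      obtain n b where nb: "p = (n, b)" "b \<in> D" using p by (auto simp: Q'_def)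
      have "x \<otimes> b \<notin> D" using mult_outside(2)[OF D(1) nb(2), of x] x Kc by blast
      then show ?thesis using \<rho>X[of x p] x p QX nb by (auto simp: Q'_def)
    qed
    then show ?thesis using h(2) x by auto
  qed
  have T1: "h (inv t) ` P \<subseteq> Q'" using \<sigma>XQ by (auto simp: hinv P_def)
  have T2: "h t ` (X - Q') \<subseteq> Q" using \<tau>X by (auto simp: h(3))
  have Q'P: "Q' \<subseteq> P" and QX': "Q \<subseteq> X - Q'" using QX by (auto simp: P_def Q_def Q'_def)
  have hm: "h (x \<otimes> y) ` R \<subseteq> U" if "x \<in> carrier G" "y \<in> carrier G" "h y ` R \<subseteq> S" "h x ` S \<subseteq> U" for x y R S U
    using hom_mult[OF h(1), of x y] that by (auto simp: image_subset_iff)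
  have cd: "c \<in> carrier G" "d \<in> carrier G" using c d Kc by auto
  have ic: "inv c \<in> K - C" and id: "inv d \<in> K - D"
    using c d KD(3) inv_outside[OF C(1)] inv_outside[OF D(1)] cd by auto
  have tc: "h (inv t \<otimes> c) ` Q \<subseteq> Q'" by (rule hm[OF _ _ F1[OF c] T1]) (use t cd in auto)
  have TQ: "h t ` Q \<subseteq> Q" using T2 QX' by blast
  (* \<open>t\<^sup>-\<^sup>1\<close> maps \<open>P\<close> into \<open>Q'\<close>, then \<open>d\<close> moves \<open>Q'\<close> away from itself, and \<open>t\<close> maps what is outside of \<open>Q'\<close>
     into \<open>Q\<close>. *)
  interpret ping_pong G h z c "inv t \<otimes> c" "t \<otimes> d \<otimes> inv t" P Q
  proof
    show "h (z [^] n) ` P \<subseteq> P" for n :: int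
    proof -
      have zn: "z [^] n \<in> C" using CD(5)[OF z(2)] .
      have "\<rho> (z [^] n) p \<in> P" if p: "p \<in> P" for p
        using \<rho>X(1)[of "z [^] n" p] fXQ zn p C(2) unfolding P_def free_set_def by auto
      then show ?thesis using h(2) zn C(2) by auto
    qed
    have "(1, \<one>) \<in> P" using KD(2) by (simp add: P_def X_def Q_def)
    then show "P \<noteq> {}" by blast
    show "h c ` Q \<subseteq> P" "h (inv c) ` Q \<subseteq> P" using F1 c ic by auto
    show "h (inv t \<otimes> c) ` Q \<subseteq> P" using tc Q'P by blast
    show "h (inv (inv t \<otimes> c)) ` Q \<subseteq> P"
      using hm[OF _ t TQ F1[OF ic]] t cd by (simp add: inv_mult_group)
    show "h (inv c \<otimes> (inv t \<otimes> c)) ` Q \<subseteq> P"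
      by (rule hm[OF _ _ tc F2]) (use t cd ic in auto)
    have "h (t \<otimes> c) ` Q \<subseteq> Q" by (rule hm[OF _ _ F3 T2]) (use t cd c in auto)
    then have "h (inv c \<otimes> (t \<otimes> c)) ` Q \<subseteq> P" by (rule hm[OF _ _ _ F1[OF ic], rotated 2]) (use t cd in auto)
    then show "h (inv (inv t \<otimes> c) \<otimes> c) ` Q \<subseteq> P" using t cd by (simp add: inv_mult_group m_assoc)
    have "h (d \<otimes> inv t) ` P \<subseteq> X - Q'" by (rule hm[OF _ _ T1 F4[OF d]]) (use t cd in auto)
    then have "h (t \<otimes> (d \<otimes> inv t)) ` P \<subseteq> Q" by (rule hm[OF _ _ _ T2, rotated 2]) (use t cd in auto)
    then show "h (t \<otimes> d \<otimes> inv t) ` P \<subseteq> Q" using t cd by (simp add: m_assoc)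
    have "h (inv d \<otimes> inv t) ` P \<subseteq> X - Q'" by (rule hm[OF _ _ T1 F4[OF id]]) (use t cd in auto)
    then have "h (t \<otimes> (inv d \<otimes> inv t)) ` P \<subseteq> Q" by (rule hm[OF _ _ _ T2, rotated 2]) (use t cd in auto)
    then show "h (inv (t \<otimes> d \<otimes> inv t)) ` P \<subseteq> Q" using t cd by (simp add: inv_mult_group m_assoc)
  qed (use h(1) z cd t in \<open>auto simp: P_def\<close>)
  show ?thesis by (rule not_fgip)
qed

text \<open>
  The set \<open>X = \<nat> \<times> A\<close> is the disjoint union of \<open>Q = \<nat> \<times> C\<close> and \<open>P\<close>, and \<open>A\<close> acts on it by left multiplication,
  so that elements of \<open>A\<close> outside \<open>C\<close> map \<open>Q\<close> into \<open>P\<close>. A bijection from \<open>X\<close> to \<open>\<nat> \<times> B\<close> that is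
  compatible with \<open>C\<close> and maps \<open>P\<close> onto \<open>\<nat> \<times> C\<close> makes \<open>B\<close> act on \<open>X\<close> too, with the roles of \<open>P\<close> and \<open>Q\<close>
  exchanged. The two elements of \<open>A\<close> exist if \<open>C\<close> has index at least three in \<open>A\<close>.
\<close>

lemma not_fgip_amalgam:
  assumes A: "subgroup A G" "countable A" and B: "subgroup B G" "countable B"
    and C: "subgroup C G" "C \<subseteq> A" "C \<subseteq> B"
    and a: "a\<^sub>1 \<in> A - C" "a\<^sub>2 \<in> A - C" "inv a\<^sub>1 \<otimes> a\<^sub>2 \<notin> C" and b: "b \<in> B - C"
    and z: "infinite_order G z" "z \<in> C" "\<And>g. g \<in> carrier G \<Longrightarrow> commensurates G z g"
    and extend: "\<And>\<rho>\<^sub>1 \<rho>\<^sub>2. \<rho>\<^sub>1 \<in> hom (G\<lparr>carrier := A\<rparr>) (perms :: (nat \<times> 'a \<Rightarrow> nat \<times> 'a) monoid) \<Longrightarrow>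
      \<rho>\<^sub>2 \<in> hom (G\<lparr>carrier := B\<rparr>) perms \<Longrightarrow> (\<And>c. c \<in> C \<Longrightarrow> \<rho>\<^sub>1 c = \<rho>\<^sub>2 c) \<Longrightarrow>
      \<exists>h\<in>hom G perms. (\<forall>x\<in>A. h x = \<rho>\<^sub>1 x) \<and> (\<forall>x\<in>B. h x = \<rho>\<^sub>2 x)"
  shows "\<not> fgip G"
proof -
  note AD = subgroupD[OF A(1)] and BD = subgroupD[OF B(1)] and CD = subgroupD[OF C(1)]
  interpret A: group "G\<lparr>carrier := A\<rparr>" using subgroup_imp_group[OF A(1)] .
  interpret B: group "G\<lparr>carrier := B\<rparr>" using subgroup_imp_group[OF B(1)] .
  have Ac: "x \<in> carrier G" if "x \<in> A" for x using that AD(1) by blast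
  have Bc: "x \<in> carrier G" if "x \<in> B" for x using that BD(1) by blast
  define X :: "(nat \<times> 'a) set" where "X = UNIV \<times> A"
  define Y :: "(nat \<times> 'a) set" where "Y = UNIV \<times> B"
  define Q :: "(nat \<times> 'a) set" where "Q = UNIV \<times> C"
  define P where "P = X - Q"
  have QX: "Q \<subseteq> X" "Q \<subseteq> Y" using C by (auto simp: Q_def X_def Y_def)
  have inf: "infinite (fst ` (UNIV \<times> S :: (nat \<times> 'a) set))" if "S \<noteq> {}" for S
    using that by (simp add: fst_image_times)
  have f1: "free_set G C Q"
    by (rule free_setI[OF _ AD(1) A(2)]) (use C CD(2,4) inf[of C] in \<open>auto simp: Q_def\<close>)
  have f2: "free_set G C P"
  proof (rule free_setI[OF _ AD(1) A(2)])
    have "P = UNIV \<times> (A - C)" by (auto simp: P_def X_def Q_def)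
    then show "infinite (fst ` P)" using inf[of "A - C"] a by auto
    show "(n, c \<otimes> x) \<in> P" if "c \<in> C" "(n, x) \<in> P" for c n x
      using that AD(4) C(2) mult_outside(1)[OF C(1) that(1), of x] Ac by (auto simp: P_def X_def Q_def)
  qed (auto simp: P_def X_def)
  have f3: "free_set G C (Y - Q)"
  proof (rule free_setI[OF _ BD(1) B(2)])
    have "Y - Q = UNIV \<times> (B - C)" by (auto simp: Y_def Q_def)
    then show "infinite (fst ` (Y - Q))" using inf[of "B - C"] b by auto
    show "(n, c \<otimes> x) \<in> Y - Q" if "c \<in> C" "(n, x) \<in> Y - Q" for c n x
      using that BD(4) C(3) mult_outside(1)[OF C(1) that(1), of x] Bc by (auto simp: Y_def Q_def)
  qed (auto simp: Y_def)
  have idC: "bij_betw (\<lambda>c. c) C C" by (simp add: bij_betw_def)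
  obtain \<sigma>\<^sub>1 where \<sigma>\<^sub>1: "bij_betw \<sigma>\<^sub>1 Q (Y - Q)" "\<forall>p\<in>Q. \<forall>c\<in>C. \<sigma>\<^sub>1 (lact G c p) = lact G c (\<sigma>\<^sub>1 p)"
    using free_sets_isomorphic[OF is_group is_group C(1) C(1) idC _ f1 f3] by auto
  obtain \<sigma>\<^sub>2 where \<sigma>\<^sub>2: "bij_betw \<sigma>\<^sub>2 P Q" "\<forall>p\<in>P. \<forall>c\<in>C. \<sigma>\<^sub>2 (lact G c p) = lact G c (\<sigma>\<^sub>2 p)"
    using free_sets_isomorphic[OF is_group is_group C(1) C(1) idC _ f2 f1] by auto
  define \<sigma> where "\<sigma> p = (if p \<in> Q then \<sigma>\<^sub>1 p else \<sigma>\<^sub>2 p)" for p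
  have \<sigma>Q: "\<sigma> p \<in> Y - Q" if "p \<in> Q" for p using \<sigma>\<^sub>1(1) that by (auto simp: \<sigma>_def bij_betw_def)
  have \<sigma>P: "\<sigma> p \<in> Q" if "p \<in> P" for p using \<sigma>\<^sub>2(1) that by (auto simp: \<sigma>_def bij_betw_def P_def)
  have XPQ: "Q \<union> P = X" "P \<inter> Q = {}" using QX by (auto simp: P_def)
  have "bij_betw \<sigma> (Q \<union> P) ((Y - Q) \<union> Q)"
    unfolding \<sigma>_def by (rule bij_betw_disjoint_Un[OF \<sigma>\<^sub>1(1) \<sigma>\<^sub>2(1)]) (use XPQ in auto)
  moreover have "(Y - Q) \<union> Q = UNIV \<times> B" using QX by (auto simp: Y_def)
  ultimately have bij: "bij_betw \<sigma> X (UNIV \<times> carrier (G\<lparr>carrier := B\<rparr>))" using XPQ by simp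
  have \<sigma>C: "\<sigma> (lact G c p) = lact G c (\<sigma> p)" if c: "c \<in> C" and p: "p \<in> X" for c p
  proof (cases "p \<in> Q")
    case True
    then have "lact G c p \<in> Q" using f1 c by (simp add: free_set_def)
    then show ?thesis using \<sigma>\<^sub>1(2) True c by (simp add: \<sigma>_def)
  next
    case False
    then have pP: "p \<in> P" using p by (simp add: P_def)
    then have "lact G c p \<in> P" using f2 c by (simp add: free_set_def)
    then show ?thesis using \<sigma>\<^sub>2(2) pP c by (auto simp: \<sigma>_def P_def)
  qed
  have bijA: "bij_betw id X (UNIV \<times> carrier (G\<lparr>carrier := A\<rparr>))" by (simp add: X_def)
  define \<rho>\<^sub>1 where "\<rho>\<^sub>1 = tact (G\<lparr>carrier := A\<rparr>) X id"
  define \<rho>\<^sub>2 where "\<rho>\<^sub>2 = tact (G\<lparr>carrier := B\<rparr>) X \<sigma>"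
  note tA = A.tact_eq[OF bijA, folded \<rho>\<^sub>1_def] and tB = B.tact_eq[OF bij, folded \<rho>\<^sub>2_def]
  have "\<exists>h\<in>hom G perms. (\<forall>x\<in>A. h x = \<rho>\<^sub>1 x) \<and> (\<forall>x\<in>B. h x = \<rho>\<^sub>2 x)"
  proof (rule extend)
    show "\<rho>\<^sub>1 \<in> hom (G\<lparr>carrier := A\<rparr>) perms" unfolding \<rho>\<^sub>1_def by (rule A.tact_hom[OF bijA])
    show "\<rho>\<^sub>2 \<in> hom (G\<lparr>carrier := B\<rparr>) perms" unfolding \<rho>\<^sub>2_def by (rule B.tact_hom[OF bij])
    fix c assume c: "c \<in> C"
    show "\<rho>\<^sub>1 c = \<rho>\<^sub>2 c"
    proof
      fix p show "\<rho>\<^sub>1 c p = \<rho>\<^sub>2 c p"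
      proof (cases "p \<in> X")
        case True
        have cA: "c \<in> A" "c \<in> B" using c C by auto
        have "\<sigma> (\<rho>\<^sub>1 c p) = \<sigma> (\<rho>\<^sub>2 c p)" using tA(2)[OF True, of c] tB(2)[OF True, of c] cA \<sigma>C[OF c True] by simp
        then show ?thesis
          using bij_betw_imp_inj_on[OF bij] tA(1)[OF True, of c] tB(1)[OF True, of c] cA by (simp add: inj_on_def)
      qed (simp add: \<rho>\<^sub>1_def \<rho>\<^sub>2_def tact_def)
    qed
  qed
  then obtain h where h: "h \<in> hom G perms" "\<And>x. x \<in> A \<Longrightarrow> h x = \<rho>\<^sub>1 x" "\<And>x. x \<in> B \<Longrightarrow> h x = \<rho>\<^sub>2 x"
    by blast
  have FA: "h x ` Q \<subseteq> P" if x: "x \<in> A - C" for x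
  proof -
    have "\<rho>\<^sub>1 x p \<in> P" if p: "p \<in> Q" for p
    proof -
      obtain n c where nc: "p = (n, c)" "c \<in> C" using p by (auto simp: Q_def)
      have "x \<otimes> c \<notin> C" using mult_outside(2)[OF C(1) nc(2), of x] x Ac by blast
      moreover have "p \<in> X" using p QX by blast
      ultimately show ?thesis using tA[of p x] x nc by (auto simp: P_def Q_def)
    qed
    then show ?thesis using h(2) x by auto
  qed
  have FB: "h x ` P \<subseteq> Q" if x: "x \<in> B - C" for x
  proof -
    have "\<rho>\<^sub>2 x p \<in> Q" if p: "p \<in> P" for p
    proof -
      have pX: "p \<in> X" using p by (simp add: P_def)
      obtain n c where nc: "\<sigma> p = (n, c)" "c \<in> C" using \<sigma>P[OF p] by (auto simp: Q_def)
      have "x \<otimes> c \<notin> C" using mult_outside(2)[OF C(1) nc(2), of x] x Bc by blast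
      then have "\<sigma> (\<rho>\<^sub>2 x p) \<notin> Q" using tB(2)[OF pX, of x] x nc by (auto simp: Q_def)
      then have "\<rho>\<^sub>2 x p \<notin> P" using \<sigma>P by blast
      then show ?thesis using tB(1)[OF pX, of x] x by (simp add: P_def)
    qed
    then show ?thesis using h(3) x by auto
  qed
  have ac: "a\<^sub>1 \<in> carrier G" "a\<^sub>2 \<in> carrier G" "b \<in> carrier G" using a b Ac Bc by auto
  have out: "inv a\<^sub>1 \<in> A - C" "inv a\<^sub>2 \<in> A - C" "inv b \<in> B - C" "inv a\<^sub>1 \<otimes> a\<^sub>2 \<in> A - C" "inv a\<^sub>2 \<otimes> a\<^sub>1 \<in> A - C"
  proof -
    show "inv a\<^sub>1 \<in> A - C" "inv a\<^sub>2 \<in> A - C" "inv b \<in> B - C"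
      using a b ac AD(3) BD(3) inv_outside[OF C(1)] by auto
    show 1: "inv a\<^sub>1 \<otimes> a\<^sub>2 \<in> A - C" using a AD(4)[OF AD(3)] by auto
    have "inv (inv a\<^sub>1 \<otimes> a\<^sub>2) = inv a\<^sub>2 \<otimes> a\<^sub>1" using ac by (simp add: inv_mult_group)
    then show "inv a\<^sub>2 \<otimes> a\<^sub>1 \<in> A - C"
      using 1 AD(3)[of "inv a\<^sub>1 \<otimes> a\<^sub>2"] inv_outside[OF C(1), of "inv a\<^sub>1 \<otimes> a\<^sub>2"] ac by auto
  qed
  interpret ping_pong G h z a\<^sub>1 a\<^sub>2 b P Q
  proof
    show "h (z [^] n) ` P \<subseteq> P" for n :: int
    proof -
      have zn: "z [^] n \<in> C" "z [^] n \<in> A" using CD(5)[OF z(2)] C(2) by auto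
      have "\<rho>\<^sub>1 (z [^] n) p \<in> P" if p: "p \<in> P" for p
      proof -
        have "\<rho>\<^sub>1 (z [^] n) p = lact G (z [^] n) p" using tA(2)[of p "z [^] n"] p zn by (simp add: P_def)
        then show ?thesis using f2 zn p by (simp add: free_set_def)
      qed
      then show ?thesis using h(2) zn by auto
    qed
    show "P \<inter> Q = {}" using XPQ by simp
    have "(0, a\<^sub>1) \<in> P" using a by (simp add: P_def X_def Q_def)
    then show "P \<noteq> {}" by blast
  qed (use h(1) z ac FA FB a b out in auto)
  show ?thesis by (rule not_fgip)
qed

end


section \<open>Recognising amalgamated products and ascending HNN extensions\<close>

lemma (in group_hom) infinite_order_image:
  assumes "inj_on h (carrier G)" "infinite_order G x"
  shows "infinite_order H (h x)"
  unfolding infinite_order_def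
proof (intro conjI allI impI)
  have x: "x \<in> carrier G" using assms(2) by (simp add: infinite_order_def)
  then show "h x \<in> carrier H" by simp
  fix n :: int assume "h x [^]\<^bsub>H\<^esub> n = \<one>\<^bsub>H\<^esub>"
  then have "h (x [^] n) = h \<one>" using x by (simp add: hom_int_pow)
  then have "x [^] n = \<one>" using assms(1) x by (simp add: inj_on_def)
  then show "n = 0" using assms(2) by (simp add: infinite_order_def)
qed

lemma virtually_Z_iso:
  assumes "virtually_Z G" "group H" "f \<in> iso G H"
  shows "virtually_Z H"
proof -
  interpret G: group G using assms(1) by (simp add: virtually_Z_def)
  interpret H: group H by fact
  interpret f: group_hom G H f using assms(3) by (intro group_homI G.is_group H.is_group) (simp add: iso_def)
  have bij: "bij_betw f (carrier G) (carrier H)" using assms(3) by (simp add: iso_def)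
  obtain x where x: "infinite_order G x" using G.virtually_Z_virtually_cyclic(2)[OF assms(1)] by blast
  have "virtually_cyclic H (carrier H)"
    using f.virtually_cyclic_image[OF G.virtually_Z_virtually_cyclic(1)[OF assms(1)]] bij
    by (simp add: bij_betw_def)
  moreover have "infinite_order H (f x)" using f.infinite_order_image[OF bij_betw_imp_inj_on[OF bij] x] .
  ultimately show ?thesis
    using H.virtually_cyclic_virtually_Z[of "carrier H" "f x"] by (simp add: infinite_order_def)
qed

text \<open>
  The factors of an amalgamated product and the base of an HNN extension are to be groups whose elements are
  natural numbers, which is no restriction for countable groups.
\<close>

lemma nat_copy:
  fixes G :: "('g, 'm) monoid_scheme"
  assumes "group G" "countable (carrier G)"
  obtains A :: "nat monoid" and k where "group A" "k \<in> iso A G"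
proof -
  interpret G: group G by fact
  define f where "f = to_nat_on (carrier G)"
  define k where "k = from_nat_into (carrier G)"
  have kf: "k (f x) = x" if "x \<in> carrier G" for x
    using that assms(2) by (simp add: k_def f_def)
  define A where "A = \<lparr>carrier = f ` carrier G, monoid.mult = (\<lambda>x y. f (k x \<otimes>\<^bsub>G\<^esub> k y)), one = f \<one>\<^bsub>G\<^esub>\<rparr>"
  have A: "group A"
  proof (rule groupI)
    show "\<exists>y\<in>carrier A. y \<otimes>\<^bsub>A\<^esub> x = \<one>\<^bsub>A\<^esub>" if x: "x \<in> carrier A" for x
    proof -
      obtain g where g: "g \<in> carrier G" "x = f g" using x by (auto simp: A_def)
      then show ?thesis by (intro bexI[of _ "f (inv\<^bsub>G\<^esub> g)"]) (auto simp: A_def kf)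
    qed
  qed (auto simp: A_def kf G.m_assoc)
  have "k \<in> iso A G"
  proof (rule isoI)
    show "k \<in> hom A G" by (rule homI) (auto simp: A_def kf)
    show "bij_betw k (carrier A) (carrier G)"
      by (rule bij_betw_byWitness[of _ f]) (auto simp: A_def kf)
  qed
  then show ?thesis using that A by blast
qed

lemma (in group) subgroup_nat_copy:
  assumes H: "subgroup H G" "countable H"
  obtains M :: "nat monoid" and k k' where "group M"
    "\<And>a. a \<in> carrier M \<Longrightarrow> k a \<in> H" "\<And>a. a \<in> carrier M \<Longrightarrow> k' (k a) = a"
    "\<And>x. x \<in> H \<Longrightarrow> k' x \<in> carrier M" "\<And>x. x \<in> H \<Longrightarrow> k (k' x) = x"
    "\<And>a b. a \<in> carrier M \<Longrightarrow> b \<in> carrier M \<Longrightarrow> k (a \<otimes>\<^bsub>M\<^esub> b) = k a \<otimes> k b"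
    "\<And>x y. x \<in> H \<Longrightarrow> y \<in> H \<Longrightarrow> k' (x \<otimes> y) = k' x \<otimes>\<^bsub>M\<^esub> k' y"
    "k' \<in> iso (G\<lparr>carrier := H\<rparr>) M"
proof -
  interpret H: group "G\<lparr>carrier := H\<rparr>" using subgroup_imp_group[OF H(1)] .
  obtain M :: "nat monoid" and k where M: "group M" and k: "k \<in> iso M (G\<lparr>carrier := H\<rparr>)"
    using nat_copy[OF H.is_group] H(2) by auto
  define k' where "k' = inv_into (carrier M) k"
  have k': "k' \<in> iso (G\<lparr>carrier := H\<rparr>) M" unfolding k'_def using group.iso_set_sym[OF M k] .
  have bij: "bij_betw k (carrier M) H" using k by (simp add: iso_def)
  show ?thesis
  proof (rule that[OF M _ _ _ _ _ _ k'])
    show "k a \<in> H" "k' (k a) = a" if "a \<in> carrier M" for a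
      using bij that by (auto simp: k'_def bij_betw_def)
    show "k' x \<in> carrier M" "k (k' x) = x" if "x \<in> H" for x
      using bij that by (auto simp: k'_def bij_betw_def inv_into_into f_inv_into_f)
    show "k (a \<otimes>\<^bsub>M\<^esub> b) = k a \<otimes> k b" if "a \<in> carrier M" "b \<in> carrier M" for a b
      using k that by (simp add: iso_def hom_def)
    show "k' (x \<otimes> y) = k' x \<otimes>\<^bsub>M\<^esub> k' y" if "x \<in> H" "y \<in> H" for x y
      using k' that by (simp add: iso_def hom_def)
  qed
qed

lemma mutually_inverse_iso:
  assumes G: "group G" and H: "group H" and f: "f \<in> hom G H" and g: "g \<in> hom H G"
    and S: "S \<subseteq> carrier G" "generate G S = carrier G" "\<And>x. x \<in> S \<Longrightarrow> g (f x) = x"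
    and R: "R \<subseteq> carrier H" "generate H R = carrier H" "\<And>y. y \<in> R \<Longrightarrow> f (g y) = y"
  shows "G \<cong> H"
proof (rule is_isoI, rule isoI)
  show "f \<in> hom G H" by fact
  have 1: "g (f x) = x" if "x \<in> carrier G" for x
    using group.hom_eq_on_generate[OF G G hom_compose[OF f g], of "\<lambda>x. x" S x] S that
    by (auto simp: hom_def)
  have 2: "f (g y) = y" if "y \<in> carrier H" for y
    using group.hom_eq_on_generate[OF H H hom_compose[OF g f], of "\<lambda>x. x" R y] R that
    by (auto simp: hom_def)
  show "bij_betw f (carrier G) (carrier H)"
    by (rule bij_betw_byWitness[of _ g]) (use 1 2 hom_in_carrier[OF f] hom_in_carrier[OF g] in auto)
qed

context group
begin

text \<open>
  The universal properties of \<open>G\<close> and of the presented group provide homomorphisms in both directions,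
  which are inverse to each other on the generators. The universal property of \<open>G\<close> is only applied to
  maps into the presented group, hence the type of \<open>L\<close>.
\<close>

lemma iso_ascending_hnn:
  assumes K: "subgroup K G" "countable K" "virtually_Z (G\<lparr>carrier := K\<rparr>)" and s: "s \<in> carrier G"
    and into: "\<And>a. a \<in> K \<Longrightarrow> conj_by G s a \<in> K"
    and gen: "carrier G = generate G (insert s K)"
    and extend: "\<And>(L :: nat option word set monoid) \<rho> \<sigma>. group L \<Longrightarrow> \<rho> \<in> hom (G\<lparr>carrier := K\<rparr>) L \<Longrightarrow>
      \<sigma> \<in> carrier L \<Longrightarrow> (\<And>a. a \<in> K \<Longrightarrow> conj_by L \<sigma> (\<rho> a) = \<rho> (conj_by G s a)) \<Longrightarrow>
      \<exists>h\<in>hom G L. (\<forall>x\<in>K. h x = \<rho> x) \<and> h s = \<sigma>"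
  shows "\<exists>(A :: nat monoid) \<phi>. virtually_Z A \<and> \<phi> \<in> mon A A \<and> G \<cong> ascending_hnn A \<phi>"
proof -
  note KD = subgroupD[OF K(1)]
  obtain A :: "nat monoid" and k k' where A: "group A"
    and kK: "\<And>a. a \<in> carrier A \<Longrightarrow> k a \<in> K" and k'k: "\<And>a. a \<in> carrier A \<Longrightarrow> k' (k a) = a"
    and k'A: "\<And>x. x \<in> K \<Longrightarrow> k' x \<in> carrier A" and kk': "\<And>x. x \<in> K \<Longrightarrow> k (k' x) = x"
    and k_mult: "\<And>a b. a \<in> carrier A \<Longrightarrow> b \<in> carrier A \<Longrightarrow> k (a \<otimes>\<^bsub>A\<^esub> b) = k a \<otimes> k b"
    and k'_mult: "\<And>x y. x \<in> K \<Longrightarrow> y \<in> K \<Longrightarrow> k' (x \<otimes> y) = k' x \<otimes>\<^bsub>A\<^esub> k' y"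
    and k'_iso: "k' \<in> iso (G\<lparr>carrier := K\<rparr>) A"
    by (rule subgroup_nat_copy[OF K(1,2)]) (rule that)
  interpret A: group A by (rule A)
  define \<phi> where "\<phi> a = k' (conj_by G s (k a))" for a
  have vA: "virtually_Z A" using virtually_Z_iso[OF K(3) A k'_iso] .
  have \<phi>A: "\<phi> a \<in> carrier A" if "a \<in> carrier A" for a using k'A into kK that by (simp add: \<phi>_def)
  have k\<phi>: "k (\<phi> a) = conj_by G s (k a)" if "a \<in> carrier A" for a using kk' into kK that by (simp add: \<phi>_def)
  have Kc: "x \<in> carrier G" if "x \<in> K" for x using that KD(1) by blast
  have \<phi>: "\<phi> \<in> mon A A"
    unfolding mon_def
  proof (intro CollectI conjI)
    show "\<phi> \<in> hom A A"
    proof (rule homI)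
      show "\<phi> (a \<otimes>\<^bsub>A\<^esub> b) = \<phi> a \<otimes>\<^bsub>A\<^esub> \<phi> b" if "a \<in> carrier A" "b \<in> carrier A" for a b
        using that by (simp add: \<phi>_def k_mult conj_by_mult s Kc kK k'_mult into)
    qed (rule \<phi>A)
    show "inj_on \<phi> (carrier A)"
    proof (rule inj_onI)
      fix a b assume ab: "a \<in> carrier A" "b \<in> carrier A" "\<phi> a = \<phi> b"
      then have "conj_by G s (k a) = conj_by G s (k b)" using k\<phi> by metis
      then have "k a = k b"
        using arg_cong[of _ _ "conj_by G (inv s)"] s Kc[OF kK[OF ab(1)]] Kc[OF kK[OF ab(2)]]
        by (metis conj_by_inv_cancel(2))
      then show "a = b" using k'k ab by metis
    qed
  qed
  interpret H: hnn_data A \<phi>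
    using group_homI[OF A A monD(1)[OF \<phi>]] by (simp add: hnn_data_def)
  have "\<exists>\<Phi>\<in>hom H.P G. (\<forall>a\<in>carrier A. \<Phi> (H.base_elt a) = k a) \<and> \<Phi> H.stable = s"
  proof (rule H.extend[OF is_group _ s])
    show "k \<in> hom A G" by (rule homI) (use Kc kK k_mult in auto)
  qed (simp add: k\<phi>)
  then obtain \<Phi> where \<Phi>: "\<Phi> \<in> hom H.P G" "\<Phi> H.stable = s" "\<And>a. a \<in> carrier A \<Longrightarrow> \<Phi> (H.base_elt a) = k a"
    by blast
  have "(\<lambda>x. H.base_elt (k' x)) \<in> hom (G\<lparr>carrier := K\<rparr>) H.P"
    by (rule homI) (use H.base_elt.hom_closed k'A k'_mult in auto)
  moreover have "conj_by H.P H.stable (H.base_elt (k' a)) = H.base_elt (k' (conj_by G s a))" if "a \<in> K" for a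
    using H.stable_relation[OF k'A[OF that]] kk'[OF that] by (simp add: \<phi>_def)
  ultimately have "\<exists>h\<in>hom G H.P. (\<forall>x\<in>K. h x = H.base_elt (k' x)) \<and> h s = H.stable"
    by (rule extend[OF H.P.is_group _ H.stable_closed])
  then obtain \<Psi> where \<Psi>: "\<Psi> \<in> hom G H.P" "\<Psi> s = H.stable" "\<And>x. x \<in> K \<Longrightarrow> \<Psi> x = H.base_elt (k' x)" by blast
  have "G \<cong> H.P"
  proof (rule mutually_inverse_iso[OF is_group H.P.is_group \<Psi>(1) \<Phi>(1) _ _ _ _ H.generated])
    show "insert s K \<subseteq> carrier G" using s Kc by auto
    show "generate G (insert s K) = carrier G" using gen by simp
  qed (use \<Phi>(2,3) \<Psi>(2,3) kk' k'A kK k'k in auto)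
  then show ?thesis using vA \<phi> H.hnn_eq by metis
qed

lemma iso_amalgam:
  assumes A: "subgroup A G" "countable A" "virtually_Z (G\<lparr>carrier := A\<rparr>)"
    and B: "subgroup B G" "countable B" "virtually_Z (G\<lparr>carrier := B\<rparr>)"
    and C: "subgroup C G" "C \<subseteq> A" "C \<subseteq> B"
    and A2: "A - C \<noteq> {}" "\<forall>x\<in>A - C. \<forall>y\<in>A - C. x \<otimes> inv y \<in> C"
    and B2: "B - C \<noteq> {}" "\<forall>x\<in>B - C. \<forall>y\<in>B - C. x \<otimes> inv y \<in> C"
    and gen: "carrier G = generate G (A \<union> B)"
    and extend: "\<And>(L :: (nat + nat) word set monoid) \<rho> \<sigma>. group L \<Longrightarrow> \<rho> \<in> hom (G\<lparr>carrier := A\<rparr>) L \<Longrightarrow>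
      \<sigma> \<in> hom (G\<lparr>carrier := B\<rparr>) L \<Longrightarrow> (\<And>c. c \<in> C \<Longrightarrow> \<rho> c = \<sigma> c) \<Longrightarrow>
      \<exists>h\<in>hom G L. (\<forall>x\<in>A. h x = \<rho> x) \<and> (\<forall>x\<in>B. h x = \<sigma> x)"
  shows "\<exists>(A :: nat monoid) (B :: nat monoid) (C :: nat monoid) i j.
       virtually_Z A \<and> virtually_Z B \<and> group C \<and> i \<in> mon C A \<and> j \<in> mon C B \<and>
       card (rcosets\<^bsub>A\<^esub> (i ` carrier C)) = 2 \<and> card (rcosets\<^bsub>B\<^esub> (j ` carrier C)) = 2 \<and>
       G \<cong> amalgam A B C i j"
proof -
  obtain MA :: "nat monoid" and ka ka' where MA: "group MA"
    "\<And>a. a \<in> carrier MA \<Longrightarrow> ka a \<in> A" "\<And>a. a \<in> carrier MA \<Longrightarrow> ka' (ka a) = a"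
    "\<And>x. x \<in> A \<Longrightarrow> ka' x \<in> carrier MA" "\<And>x. x \<in> A \<Longrightarrow> ka (ka' x) = x"
    "\<And>a b. a \<in> carrier MA \<Longrightarrow> b \<in> carrier MA \<Longrightarrow> ka (a \<otimes>\<^bsub>MA\<^esub> b) = ka a \<otimes> ka b"
    "\<And>x y. x \<in> A \<Longrightarrow> y \<in> A \<Longrightarrow> ka' (x \<otimes> y) = ka' x \<otimes>\<^bsub>MA\<^esub> ka' y" "ka' \<in> iso (G\<lparr>carrier := A\<rparr>) MA"
    by (rule subgroup_nat_copy[OF A(1,2)]) (rule that)
  obtain MB :: "nat monoid" and kb kb' where MB: "group MB"
    "\<And>a. a \<in> carrier MB \<Longrightarrow> kb a \<in> B" "\<And>a. a \<in> carrier MB \<Longrightarrow> kb' (kb a) = a"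
    "\<And>x. x \<in> B \<Longrightarrow> kb' x \<in> carrier MB" "\<And>x. x \<in> B \<Longrightarrow> kb (kb' x) = x"
    "\<And>a b. a \<in> carrier MB \<Longrightarrow> b \<in> carrier MB \<Longrightarrow> kb (a \<otimes>\<^bsub>MB\<^esub> b) = kb a \<otimes> kb b"
    "\<And>x y. x \<in> B \<Longrightarrow> y \<in> B \<Longrightarrow> kb' (x \<otimes> y) = kb' x \<otimes>\<^bsub>MB\<^esub> kb' y" "kb' \<in> iso (G\<lparr>carrier := B\<rparr>) MB"
    by (rule subgroup_nat_copy[OF B(1,2)]) (rule that)
  have cC: "countable C" using A(2) C(2) countable_subset by blast
  obtain MC :: "nat monoid" and kc kc' where MC: "group MC"
    "\<And>a. a \<in> carrier MC \<Longrightarrow> kc a \<in> C" "\<And>a. a \<in> carrier MC \<Longrightarrow> kc' (kc a) = a"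
    "\<And>x. x \<in> C \<Longrightarrow> kc' x \<in> carrier MC" "\<And>x. x \<in> C \<Longrightarrow> kc (kc' x) = x"
    "\<And>a b. a \<in> carrier MC \<Longrightarrow> b \<in> carrier MC \<Longrightarrow> kc (a \<otimes>\<^bsub>MC\<^esub> b) = kc a \<otimes> kc b"
    by (rule subgroup_nat_copy[OF C(1) cC]) (rule that)
  interpret MA: group MA by (rule MA(1))
  interpret MB: group MB by (rule MB(1))
  interpret MC: group MC by (rule MC(1))
  have Ac: "x \<in> carrier G" if "x \<in> A" for x using that subgroupD(1)[OF A(1)] by blast
  have Bc: "x \<in> carrier G" if "x \<in> B" for x using that subgroupD(1)[OF B(1)] by blast
  have CA: "c \<in> A" and CB: "c \<in> B" if "c \<in> C" for c using that C(2,3) by auto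
  have vA: "virtually_Z MA" and vB: "virtually_Z MB"
    using virtually_Z_iso[OF A(3) MA(1,8)] virtually_Z_iso[OF B(3) MB(1,8)] .
  define i where "i c = ka' (kc c)" for c
  define j where "j c = kb' (kc c)" for c
  have i: "i \<in> mon MC MA"
    unfolding mon_def
  proof (intro CollectI conjI)
    show "i \<in> hom MC MA" by (rule homI) (simp_all add: i_def MA MC CA)
    show "inj_on i (carrier MC)"
      by (rule inj_on_inverseI[of _ "\<lambda>a. kc' (ka a)"]) (simp add: i_def MA MC CA)
  qed
  have j: "j \<in> mon MC MB"
    unfolding mon_def
  proof (intro CollectI conjI)
    show "j \<in> hom MC MB" by (rule homI) (simp_all add: j_def MB MC CB)
    show "inj_on j (carrier MC)"
      by (rule inj_on_inverseI[of _ "\<lambda>a. kc' (kb a)"]) (simp add: j_def MB MC CB)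
  qed
  have ka_inv: "ka (inv\<^bsub>MA\<^esub> a) = inv (ka a)" if a: "a \<in> carrier MA" for a
  proof (rule inv_equality[symmetric])
    have one: "ka \<one>\<^bsub>MA\<^esub> = \<one>"
      using MA(6)[of "\<one>\<^bsub>MA\<^esub>" "\<one>\<^bsub>MA\<^esub>"] Ac[OF MA(2)[OF MA.one_closed]] by (metis MA.one_closed MA.r_one l_cancel_one')
    show "ka (inv\<^bsub>MA\<^esub> a) \<otimes> ka a = \<one>" using MA(6)[of "inv\<^bsub>MA\<^esub> a" a] a one by simp
  qed (use Ac MA(2) a in auto)
  have kb_inv: "kb (inv\<^bsub>MB\<^esub> a) = inv (kb a)" if a: "a \<in> carrier MB" for a
  proof (rule inv_equality[symmetric])
    have one: "kb \<one>\<^bsub>MB\<^esub> = \<one>"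
      using MB(6)[of "\<one>\<^bsub>MB\<^esub>" "\<one>\<^bsub>MB\<^esub>"] Bc[OF MB(2)[OF MB.one_closed]] by (metis MB.one_closed MB.r_one l_cancel_one')
    show "kb (inv\<^bsub>MB\<^esub> a) \<otimes> kb a = \<one>" using MB(6)[of "inv\<^bsub>MB\<^esub> a" a] a one by simp
  qed (use Bc MB(2) a in auto)
  have i_iff: "a \<in> i ` carrier MC \<longleftrightarrow> ka a \<in> C" if "a \<in> carrier MA" for a
  proof
    assume "ka a \<in> C"
    then have "a = i (kc' (ka a))" "kc' (ka a) \<in> carrier MC" using MC MA that by (simp_all add: i_def)
    then show "a \<in> i ` carrier MC" by blast
  qed (use MA(5) MC(2) CA in \<open>auto simp: i_def\<close>)
  have j_iff: "a \<in> j ` carrier MC \<longleftrightarrow> kb a \<in> C" if "a \<in> carrier MB" for a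
  proof
    assume "kb a \<in> C"
    then have "a = j (kc' (kb a))" "kc' (kb a) \<in> carrier MC" using MC MB that by (simp_all add: j_def)
    then show "a \<in> j ` carrier MC" by blast
  qed (use MB(5) MC(2) CB in \<open>auto simp: j_def\<close>)
  interpret i: group_hom MC MA i using group_homI[OF MC(1) MA(1) monD(1)[OF i]] .
  interpret j: group_hom MC MB j using group_homI[OF MC(1) MB(1) monD(1)[OF j]] .
  have card_i: "card (rcosets\<^bsub>MA\<^esub> (i ` carrier MC)) = 2"
    unfolding MA.card_rcosets_eq_2_iff[OF i.img_is_subgroup]
  proof (intro conjI ballI)
    obtain x where "x \<in> A - C" using A2 by blast
    then have "ka' x \<in> carrier MA - i ` carrier MC" using i_iff[of "ka' x"] MA(4,5) by auto
    then show "\<exists>x. x \<in> carrier MA - i ` carrier MC" by blast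
    fix a b assume "a \<in> carrier MA - i ` carrier MC" "b \<in> carrier MA - i ` carrier MC"
    then have ab: "a \<in> carrier MA" "b \<in> carrier MA" "ka a \<in> A - C" "ka b \<in> A - C"
      using i_iff MA(2) by auto
    then have "ka (a \<otimes>\<^bsub>MA\<^esub> inv\<^bsub>MA\<^esub> b) \<in> C" using A2(2) MA(6) ka_inv by simp
    then show "a \<otimes>\<^bsub>MA\<^esub> inv\<^bsub>MA\<^esub> b \<in> i ` carrier MC" using i_iff ab by simp
  qed
  have card_j: "card (rcosets\<^bsub>MB\<^esub> (j ` carrier MC)) = 2"
    unfolding MB.card_rcosets_eq_2_iff[OF j.img_is_subgroup]
  proof (intro conjI ballI)
    obtain x where "x \<in> B - C" using B2 by blast
    then have "kb' x \<in> carrier MB - j ` carrier MC" using j_iff[of "kb' x"] MB(4,5) by auto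
    then show "\<exists>x. x \<in> carrier MB - j ` carrier MC" by blast
    fix a b assume "a \<in> carrier MB - j ` carrier MC" "b \<in> carrier MB - j ` carrier MC"
    then have ab: "a \<in> carrier MB" "b \<in> carrier MB" "kb a \<in> B - C" "kb b \<in> B - C"
      using j_iff MB(2) by auto
    then have "kb (a \<otimes>\<^bsub>MB\<^esub> inv\<^bsub>MB\<^esub> b) \<in> C" using B2(2) MB(6) kb_inv by simp
    then show "a \<otimes>\<^bsub>MB\<^esub> inv\<^bsub>MB\<^esub> b \<in> j ` carrier MC" using j_iff ab by simp
  qed
  interpret H: amalgam_data MA MB MC i j by (simp add: amalgam_data_def MA(1) MB(1) i.group_hom_axioms j.group_hom_axioms)
  have "\<exists>\<Phi>\<in>hom H.P G. (\<forall>a\<in>carrier MA. \<Phi> (H.left a) = ka a) \<and> (\<forall>b\<in>carrier MB. \<Phi> (H.right b) = kb b)"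
  proof (rule H.extend[OF is_group])
    show "ka \<in> hom MA G" by (rule homI) (use Ac MA(2,6) in auto)
    show "kb \<in> hom MB G" by (rule homI) (use Bc MB(2,6) in auto)
    show "ka (i c) = kb (j c)" if "c \<in> carrier MC" for c
      using that MA(5) MB(5) MC(2) CA CB by (simp add: i_def j_def)
  qed
  then obtain \<Phi> where \<Phi>: "\<Phi> \<in> hom H.P G" "\<And>a. a \<in> carrier MA \<Longrightarrow> \<Phi> (H.left a) = ka a"
    "\<And>b. b \<in> carrier MB \<Longrightarrow> \<Phi> (H.right b) = kb b" by blast
  have "(\<lambda>x. H.left (ka' x)) \<in> hom (G\<lparr>carrier := A\<rparr>) H.P"
    by (rule homI) (use H.left.hom_closed MA(4,7) in auto)
  moreover have "(\<lambda>x. H.right (kb' x)) \<in> hom (G\<lparr>carrier := B\<rparr>) H.P"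
    by (rule homI) (use H.right.hom_closed MB(4,7) in auto)
  moreover have "H.left (ka' c) = H.right (kb' c)" if "c \<in> C" for c
    using H.left_right[OF MC(4)[OF that]] MC(5)[OF that] by (simp add: i_def j_def)
  ultimately have "\<exists>h\<in>hom G H.P. (\<forall>x\<in>A. h x = H.left (ka' x)) \<and> (\<forall>x\<in>B. h x = H.right (kb' x))"
    by (rule extend[OF H.P.is_group])
  then obtain \<Psi> where \<Psi>: "\<Psi> \<in> hom G H.P" "\<And>x. x \<in> A \<Longrightarrow> \<Psi> x = H.left (ka' x)"
    "\<And>x. x \<in> B \<Longrightarrow> \<Psi> x = H.right (kb' x)" by blast
  have "G \<cong> H.P"
  proof (rule mutually_inverse_iso[OF is_group H.P.is_group \<Psi>(1) \<Phi>(1) _ _ _ _ H.generated])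
    show "A \<union> B \<subseteq> carrier G" using Ac Bc by auto
    show "generate G (A \<union> B) = carrier G" using gen by simp
  qed (use \<Phi>(2,3) \<Psi>(2,3) MA(2-5) MB(2-5) in auto)
  then have "G \<cong> amalgam MA MB MC i j" using H.amalgam_eq by simp
  then show ?thesis using vA vB MC(1) i j card_i card_j by blast
qed

end


section \<open>Connectedness and spanning trees\<close>

text \<open>
  A set of vertices that no edge enters or leaves is a union of connected components. Induction over
  connected graphs and trees takes this form below, which disregards the orientation of the edges.
\<close>

lemma connected_closed:
  assumes "connected D" "S \<subseteq> verts D" "S \<noteq> {}"
    and closed: "\<And>e. e \<in> arcs D \<Longrightarrow> tail D e \<in> S \<longleftrightarrow> head D e \<in> S"
  shows "S = verts D"
proof
  show "verts D \<subseteq> S"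
  proof
    fix v assume v: "v \<in> verts D"
    obtain u where u: "u \<in> S" using assms(3) by blast
    then have "u \<rightarrow>\<^sup>*\<^bsub>mk_symmetric D\<^esub> v"
      using assms(1,2) v by (auto simp: connected_def strongly_connected_def)
    then have "(u, v) \<in> rtrancl_on (verts D) (parcs (mk_symmetric D))" by (simp add: reachable_def)
    then show "v \<in> S"
    proof (induction rule: rtrancl_on_induct)
      case (step x y)
      then show ?case using closed by (auto simp: parcs_mk_symmetric)
    qed (rule u)
  qed
qed (rule assms(2))

lemma connectedI_closed:
  assumes D: "wf_digraph D" and ne: "verts D \<noteq> {}"
    and closed: "\<And>S. S \<subseteq> verts D \<Longrightarrow> S \<noteq> {} \<Longrightarrow>
      (\<And>e. e \<in> arcs D \<Longrightarrow> tail D e \<in> S \<longleftrightarrow> head D e \<in> S) \<Longrightarrow> S = verts D"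
  shows "connected D"
  unfolding connected_def strongly_connected_def
proof (intro conjI ballI)
  interpret D: wf_digraph D by fact
  interpret M: wf_digraph "with_proj (mk_symmetric D)"
    by unfold_locales (auto simp: parcs_mk_symmetric)
  show "verts (with_proj (mk_symmetric D)) \<noteq> {}" using ne by simp
  fix u v assume uv: "u \<in> verts (with_proj (mk_symmetric D))" "v \<in> verts (with_proj (mk_symmetric D))"
  define S where "S = {w \<in> verts D. u \<rightarrow>\<^sup>*\<^bsub>mk_symmetric D\<^esub> w}"
  have step: "y \<in> S" if "x \<in> S" "(x, y) \<in> parcs (mk_symmetric D)" for x y
  proof -
    have "u \<rightarrow>\<^sup>*\<^bsub>mk_symmetric D\<^esub> x" using that by (simp add: S_def)
    moreover have "x \<rightarrow>\<^bsub>mk_symmetric D\<^esub> y" using that(2) by simp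
    ultimately have "u \<rightarrow>\<^sup>*\<^bsub>mk_symmetric D\<^esub> y" by (rule M.reachable_adj_trans)
    moreover have "y \<in> verts D" using that(2) by (auto simp: parcs_mk_symmetric)
    ultimately show ?thesis by (simp add: S_def)
  qed
  have "S = verts D"
  proof (rule closed)
    have "u \<in> S" using uv(1) M.reachable_refl by (simp add: S_def)
    then show "S \<noteq> {}" by blast
    show "tail D e \<in> S \<longleftrightarrow> head D e \<in> S" if "e \<in> arcs D" for e
      using step[of "tail D e" "head D e"] step[of "head D e" "tail D e"] that
      by (auto simp: parcs_mk_symmetric)
  qed (auto simp: S_def)
  then show "u \<rightarrow>\<^sup>*\<^bsub>mk_symmetric D\<^esub> v" using uv(2) by (auto simp: S_def)
qed


section \<open>The fundamental group of a graph of groups\<close>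

locale graph_of_groups_tree = graph_of_groups \<A>
  for \<A> :: "('v, 'e, 'a, 'c) graph_of_groups_data" +
  fixes T :: "'e set"
  assumes spanning: "spanning_tree_arcs T (base \<A>)"
begin

abbreviation "V \<equiv> verts (base \<A>)"
abbreviation "E \<equiv> arcs (base \<A>)"
abbreviation "src \<equiv> tail (base \<A>)"
abbreviation "tgt \<equiv> head (base \<A>)"
abbreviation "vg \<equiv> vgroup \<A>"
abbreviation "eg \<equiv> egroup \<A>"

definition generators :: "('v, 'e, 'a) gog_generator set" where
  "generators = {Vertex_Elt v a | v a. v \<in> V \<and> a \<in> carrier (vg v)} \<union> Edge_Letter ` E"

definition relators :: "(('v, 'e, 'a) gog_generator word \<times> ('v, 'e, 'a) gog_generator word) set" where
  "relators = (\<Union>v\<in>V. table (Vertex_Elt v) (vg v)) \<union>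
       {([(Edge_Letter e, False), (Vertex_Elt (src e) (tail_map \<A> e c), True), (Edge_Letter e, True)],
         [(Vertex_Elt (tgt e) (head_map \<A> e c), True)]) | e c. e \<in> E \<and> c \<in> carrier (eg e)} \<union>
       {([(Edge_Letter e, True)], []) | e. e \<in> T}"

abbreviation "G \<equiv> presented_group generators relators"

lemma fundamental_group_eq: "fundamental_group \<A> T = G"
  by (simp add: fundamental_group_def generators_def relators_def)

sublocale G: group G by (rule group_presented_group)

definition vert :: "'v \<Rightarrow> 'a \<Rightarrow> ('v, 'e, 'a) gog_generator word set" where
  "vert v a = pgen generators relators (Vertex_Elt v a)"

definition stable :: "'e \<Rightarrow> ('v, 'e, 'a) gog_generator word set" where
  "stable e = pgen generators relators (Edge_Letter e)"

lemma T_sub: "T \<subseteq> E" using spanning by (simp add: spanning_tree_arcs_def)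

lemma ends: "e \<in> E \<Longrightarrow> src e \<in> V" "e \<in> E \<Longrightarrow> tgt e \<in> V"
  using wf_base by (auto simp: wf_digraph_def)

lemma maps_closed:
  assumes "e \<in> E" "c \<in> carrier (eg e)"
  shows "tail_map \<A> e c \<in> carrier (vg (src e))" "head_map \<A> e c \<in> carrier (vg (tgt e))"
  using hom_in_carrier[OF monD(1)[OF tail_map[OF assms(1)]] assms(2)]
    hom_in_carrier[OF monD(1)[OF head_map[OF assms(1)]] assms(2)] .

lemma vert_hom: "v \<in> V \<Longrightarrow> group_hom (vg v) G (vert v)"
  unfolding vert_def by (intro group_homI group_vgroup G.is_group presented_table_hom)
    (auto simp: relators_def generators_def)

lemma vert_closed: "v \<in> V \<Longrightarrow> a \<in> carrier (vg v) \<Longrightarrow> vert v a \<in> carrier G"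
  using group_hom.hom_closed[OF vert_hom] .

lemma stable_closed: "e \<in> E \<Longrightarrow> stable e \<in> carrier G"
  by (simp add: stable_def generators_def)

lemma edge_relation:
  assumes e: "e \<in> E" and c: "c \<in> carrier (eg e)"
  shows "conj_by G (stable e) (vert (src e) (tail_map \<A> e c)) = vert (tgt e) (head_map \<A> e c)"
proof -
  let ?s = "Vertex_Elt (src e) (tail_map \<A> e c) :: ('v, 'e, 'a) gog_generator"
  let ?t = "Vertex_Elt (tgt e) (head_map \<A> e c) :: ('v, 'e, 'a) gog_generator"
  have "([(Edge_Letter e, False), (?s, True), (Edge_Letter e, True)], [(?t, True)]) \<in> relators"
    unfolding relators_def using e c by blast
  moreover have "?s \<in> generators" "?t \<in> generators" "Edge_Letter e \<in> generators"
    unfolding generators_def using e ends maps_closed[OF e c] by auto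
  moreover have cl: "vert (src e) (tail_map \<A> e c) \<in> carrier G" "vert (tgt e) (head_map \<A> e c) \<in> carrier G"
    using vert_closed ends e maps_closed[OF e c] by auto
  ultimately have "inv\<^bsub>G\<^esub> stable e \<otimes>\<^bsub>G\<^esub> (vert (src e) (tail_map \<A> e c) \<otimes>\<^bsub>G\<^esub> stable e) = vert (tgt e) (head_map \<A> e c)"
    using presented_relation[of "[(Edge_Letter e, False), (?s, True), (Edge_Letter e, True)]" "[(?t, True)]"
      relators generators] stable_closed[OF e] by (simp add: stable_def vert_def)
  then show ?thesis using cl stable_closed[OF e] by (simp add: conj_by_def G.m_assoc)
qed

lemma stable_tree: "e \<in> T \<Longrightarrow> stable e = \<one>\<^bsub>G\<^esub>"
proof -
  assume e: "e \<in> T"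
  then have "([(Edge_Letter e, True)], []) \<in> relators" by (auto simp: relators_def)
  moreover have "Edge_Letter e \<in> generators" using e T_sub by (auto simp: generators_def)
  ultimately show ?thesis
    using presented_relation[of "[(Edge_Letter e, True)]" "[]" relators generators] stable_closed[of e] e T_sub
    by (auto simp: stable_def)
qed

lemma tree_relation:
  assumes "e \<in> T" "c \<in> carrier (eg e)"
  shows "vert (src e) (tail_map \<A> e c) = vert (tgt e) (head_map \<A> e c)"
proof -
  have e: "e \<in> E" using assms T_sub by blast
  show ?thesis
    using edge_relation[OF e assms(2)] stable_tree[OF assms(1)] vert_closed[OF ends(1)[OF e] maps_closed(1)[OF e assms(2)]]
    by simp
qed

text \<open>
  The images in \<open>G\<close> of a vertex group, and of an edge group at the tail and at the head of the edge.
\<close>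

definition vsub :: "'v \<Rightarrow> ('v, 'e, 'a) gog_generator word set set" where
  "vsub v = vert v ` carrier (vg v)"

definition esub_tail :: "'e \<Rightarrow> ('v, 'e, 'a) gog_generator word set set" where
  "esub_tail e = (\<lambda>c. vert (src e) (tail_map \<A> e c)) ` carrier (eg e)"

definition esub_head :: "'e \<Rightarrow> ('v, 'e, 'a) gog_generator word set set" where
  "esub_head e = (\<lambda>c. vert (tgt e) (head_map \<A> e c)) ` carrier (eg e)"

lemma vsub_subgroup: "v \<in> V \<Longrightarrow> subgroup (vsub v) G"
  unfolding vsub_def by (rule group_hom.img_is_subgroup[OF vert_hom])

lemma esub_tail_hom:
  assumes e: "e \<in> E"
  shows "group_hom (eg e) G (\<lambda>c. vert (src e) (tail_map \<A> e c))"
proof (rule group_homI[OF group_egroup[OF e] G.is_group])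
  show "(\<lambda>c. vert (src e) (tail_map \<A> e c)) \<in> hom (eg e) G"
    using hom_compose[OF monD(1)[OF tail_map[OF e]] group_hom.homh[OF vert_hom[OF ends(1)[OF e]]]]
    by (simp add: comp_def)
qed

lemma esub_head_hom:
  assumes e: "e \<in> E"
  shows "group_hom (eg e) G (\<lambda>c. vert (tgt e) (head_map \<A> e c))"
proof (rule group_homI[OF group_egroup[OF e] G.is_group])
  show "(\<lambda>c. vert (tgt e) (head_map \<A> e c)) \<in> hom (eg e) G"
    using hom_compose[OF monD(1)[OF head_map[OF e]] group_hom.homh[OF vert_hom[OF ends(2)[OF e]]]]
    by (simp add: comp_def)
qed

lemma esub_tail: "e \<in> E \<Longrightarrow> subgroup (esub_tail e) G" "e \<in> E \<Longrightarrow> esub_tail e \<subseteq> vsub (src e)"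
  unfolding esub_tail_def vsub_def
  by (rule group_hom.img_is_subgroup[OF esub_tail_hom], simp) (auto intro: maps_closed)

lemma esub_head: "e \<in> E \<Longrightarrow> subgroup (esub_head e) G" "e \<in> E \<Longrightarrow> esub_head e \<subseteq> vsub (tgt e)"
  unfolding esub_head_def vsub_def
  by (rule group_hom.img_is_subgroup[OF esub_head_hom], simp) (auto intro: maps_closed)

lemma esub_conj: "e \<in> E \<Longrightarrow> esub_head e = conj_by G (stable e) ` esub_tail e"
  unfolding esub_head_def esub_tail_def image_image using edge_relation by (intro image_cong) simp_all

lemma esub_tree: "e \<in> T \<Longrightarrow> esub_tail e = esub_head e"
  unfolding esub_head_def esub_tail_def using tree_relation by (intro image_cong) simp_all

lemma carrier_eq: "carrier G = generate G ((\<Union>v\<in>V. vsub v) \<union> stable ` E)"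
proof -
  have "pgen generators relators ` generators = (\<Union>v\<in>V. vsub v) \<union> stable ` E"
    by (force simp: generators_def vsub_def vert_def stable_def)
  then show ?thesis using presented_generate[of generators relators] by simp
qed

lemma extend:
  fixes L :: "('l, 'm) monoid_scheme"
  assumes L: "group L" and f: "\<And>v. v \<in> V \<Longrightarrow> f v \<in> hom (vg v) L" and s: "\<And>e. e \<in> E \<Longrightarrow> s e \<in> carrier L"
    and rel: "\<And>e c. e \<in> E \<Longrightarrow> c \<in> carrier (eg e) \<Longrightarrow>
      conj_by L (s e) (f (src e) (tail_map \<A> e c)) = f (tgt e) (head_map \<A> e c)"
    and tree: "\<And>e. e \<in> T \<Longrightarrow> s e = \<one>\<^bsub>L\<^esub>"
  shows "\<exists>h\<in>hom G L. (\<forall>v\<in>V. \<forall>a\<in>carrier (vg v). h (vert v a) = f v a) \<and> (\<forall>e\<in>E. h (stable e) = s e)"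
proof -
  interpret L: group L by (rule L)
  define F where "F x = (case x of Vertex_Elt v a \<Rightarrow> f v a | Edge_Letter e \<Rightarrow> s e)" for x
  have fc: "f v a \<in> carrier L" if "v \<in> V" "a \<in> carrier (vg v)" for v a
    using hom_in_carrier[OF f[OF that(1)] that(2)] .
  have "\<exists>h\<in>hom G L. \<forall>x\<in>generators. h (pgen generators relators x) = F x"
  proof (rule presented_hom_ex[OF L])
    show "F \<in> generators \<rightarrow> carrier L" using fc s by (auto simp: F_def generators_def)
    fix l r assume "(l, r) \<in> relators"
    then consider v a b where "v \<in> V" "a \<in> carrier (vg v)" "b \<in> carrier (vg v)"
        "l = [(Vertex_Elt v a, True), (Vertex_Elt v b, True)]" "r = [(Vertex_Elt v (a \<otimes>\<^bsub>vg v\<^esub> b), True)]"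
      | e c where "e \<in> E" "c \<in> carrier (eg e)"
        "l = [(Edge_Letter e, False), (Vertex_Elt (src e) (tail_map \<A> e c), True), (Edge_Letter e, True)]"
        "r = [(Vertex_Elt (tgt e) (head_map \<A> e c), True)]"
      | e where "e \<in> T" "l = [(Edge_Letter e, True)]" "r = []"
      unfolding relators_def table_def by blast
    then show "word_value L F l = word_value L F r"
    proof cases
      case 1
      then show ?thesis using fc hom_mult[OF f[OF 1(1)] 1(2,3)] by (simp add: F_def)
    next
      case 2
      then have "f (src e) (tail_map \<A> e c) \<in> carrier L" "f (tgt e) (head_map \<A> e c) \<in> carrier L" "s e \<in> carrier L"
        using fc ends maps_closed s by auto
      then show ?thesis using rel[OF 2(1,2)] 2(3,4) by (simp add: F_def conj_by_def L.m_assoc)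
    next
      case 3
      then show ?thesis using tree by (simp add: F_def)
    qed
  qed
  then obtain h where h: "h \<in> hom G L" "\<And>x. x \<in> generators \<Longrightarrow> h (pgen generators relators x) = F x" by blast
  have "h (vert v a) = f v a" if "v \<in> V" "a \<in> carrier (vg v)" for v a
    using h(2)[of "Vertex_Elt v a"] that by (simp add: generators_def vert_def F_def)
  moreover have "h (stable e) = s e" if "e \<in> E" for e
    using h(2)[of "Edge_Letter e"] that by (simp add: generators_def stable_def F_def)
  ultimately show ?thesis using h(1) by blast
qed


subsection \<open>Spanning trees\<close>

lemma tree_connected:
  assumes "S \<subseteq> V" "S \<noteq> {}" "\<And>e. e \<in> T \<Longrightarrow> src e \<in> S \<longleftrightarrow> tgt e \<in> S"
  shows "S = V"
  using connected_closed[of "(base \<A>)\<lparr>arcs := T\<rparr>" S] assms spanning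
  by (simp add: spanning_tree_arcs_def)

text \<open>
  No edge of a spanning tree can be dropped: without \<open>e\<close> the vertices fall apart into two sets, and since
  \<open>T\<close> connects them, \<open>e\<close> leads from one to the other.
\<close>

lemma tree_edge_sides:
  assumes e: "e \<in> T"
  obtains U where "U \<subseteq> V" "src e \<in> U" "tgt e \<notin> U" "\<And>f. f \<in> T - {e} \<Longrightarrow> src f \<in> U \<longleftrightarrow> tgt f \<in> U"
proof -
  let ?D = "(base \<A>)\<lparr>arcs := T - {e}\<rparr>"
  have nc: "\<not> connected ?D" using spanning e by (simp add: spanning_tree_arcs_def)
  have wf: "wf_digraph ?D" using ends T_sub by (auto simp: wf_digraph_def)
  have ne: "V \<noteq> {}" using ends T_sub e by blast
  obtain S where S: "S \<subseteq> V" "S \<noteq> {}" "S \<noteq> V" "\<And>f. f \<in> T - {e} \<Longrightarrow> src f \<in> S \<longleftrightarrow> tgt f \<in> S"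
    using connectedI_closed[OF wf] nc ne by auto
  have "\<not> (src e \<in> S \<longleftrightarrow> tgt e \<in> S)"
    using tree_connected[OF S(1,2)] S(3,4) by blast
  moreover have "src e \<in> V" "tgt e \<in> V" using ends T_sub e by blast+
  ultimately consider "src e \<in> S" "tgt e \<notin> S" | "src e \<in> V - S" "tgt e \<notin> V - S" by blast
  then show ?thesis
  proof cases
    case 1
    then show ?thesis using that[OF S(1)] S(4) by blast
  next
    case 2
    have "src f \<in> V - S \<longleftrightarrow> tgt f \<in> V - S" if f: "f \<in> T - {e}" for f
      using S(4)[OF f] ends[of f] T_sub f by blast
    then show ?thesis using that[of "V - S"] 2 by blast
  qed
qed

text \<open>
  Group-valued functions on the edges of a tree are coboundaries. When an edge is added, \<open>\<sigma>\<close> is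
  multiplied from the left by a constant on one side of it; the equations for the other edges, which
  do not cross from side to side, survive.
\<close>

lemma tree_potential:
  assumes L: "group L" and fin: "finite T" and p: "\<And>e. e \<in> T \<Longrightarrow> p e \<in> carrier L"
  shows "\<exists>\<sigma>. (\<forall>v. \<sigma> v \<in> carrier L) \<and> (\<forall>e\<in>T. \<sigma> (tgt e) = \<sigma> (src e) \<otimes>\<^bsub>L\<^esub> p e)"
proof -
  interpret L: group L by (rule L)
  have "\<exists>\<sigma>. (\<forall>v. \<sigma> v \<in> carrier L) \<and> (\<forall>e\<in>F. \<sigma> (tgt e) = \<sigma> (src e) \<otimes>\<^bsub>L\<^esub> p e)" if "F \<subseteq> T" for F
    using finite_subset[OF that fin] that
  proof (induction rule: finite_induct)
    case empty
    then show ?case by (intro exI[of _ "\<lambda>_. \<one>\<^bsub>L\<^esub>"]) simp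
  next
    case (insert e F)
    then obtain \<sigma> where \<sigma>: "\<And>v. \<sigma> v \<in> carrier L" "\<And>f. f \<in> F \<Longrightarrow> \<sigma> (tgt f) = \<sigma> (src f) \<otimes>\<^bsub>L\<^esub> p f" by auto
    have e: "e \<in> T" using insert.prems by simp
    obtain U where U: "src e \<in> U" "tgt e \<notin> U" "\<And>f. f \<in> T - {e} \<Longrightarrow> src f \<in> U \<longleftrightarrow> tgt f \<in> U"
      by (rule tree_edge_sides[OF e]) blast
    define g where "g = \<sigma> (src e) \<otimes>\<^bsub>L\<^esub> p e \<otimes>\<^bsub>L\<^esub> inv\<^bsub>L\<^esub> \<sigma> (tgt e)"
    have g: "g \<in> carrier L" using \<sigma>(1) p[OF e] by (simp add: g_def)
    define \<sigma>' where "\<sigma>' v = (if v \<in> U then \<sigma> v else g \<otimes>\<^bsub>L\<^esub> \<sigma> v)" for v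
    have "\<sigma>' v \<in> carrier L" for v using \<sigma>(1) g by (simp add: \<sigma>'_def)
    moreover have "\<sigma>' (tgt e) = \<sigma>' (src e) \<otimes>\<^bsub>L\<^esub> p e"
      using U(1,2) \<sigma>(1) p[OF e] by (simp add: \<sigma>'_def g_def L.m_assoc)
    moreover have "\<sigma>' (tgt f) = \<sigma>' (src f) \<otimes>\<^bsub>L\<^esub> p f" if f: "f \<in> F" for f
    proof -
      have "f \<in> T - {e}" using f insert.hyps insert.prems by auto
      then have "src f \<in> U \<longleftrightarrow> tgt f \<in> U" by (rule U(3))
      moreover have "p f \<in> carrier L" using p f insert.prems by auto
      ultimately show ?thesis using \<sigma> g f by (simp add: \<sigma>'_def L.m_assoc)
    qed
    ultimately show ?case by (intro exI[of _ \<sigma>']) auto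
  qed
  then show ?thesis by blast
qed

end


section \<open>Vertex groups embed and are commensurable\<close>

definition commensurable :: "('g, 'm) monoid_scheme \<Rightarrow> 'g \<Rightarrow> 'g \<Rightarrow> bool" where
  "commensurable G x y \<longleftrightarrow> (\<exists>(k::int) (l::int). k \<noteq> 0 \<and> l \<noteq> 0 \<and> x [^]\<^bsub>G\<^esub> k = y [^]\<^bsub>G\<^esub> l)"

context group
begin

lemma commensurable_trans:
  assumes "x \<in> carrier G" "y \<in> carrier G" "z \<in> carrier G" "commensurable G x y" "commensurable G y z"
  shows "commensurable G x z"
proof -
  obtain k l :: int where 1: "k \<noteq> 0" "l \<noteq> 0" "x [^] k = y [^] l" using assms(4) by (auto simp: commensurable_def)
  obtain m n :: int where 2: "m \<noteq> 0" "n \<noteq> 0" "y [^] m = z [^] n" using assms(5) by (auto simp: commensurable_def)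
  have "x [^] (k * m) = y [^] (l * m)" using 1(3) assms(1,2) by (metis int_pow_pow)
  also have "\<dots> = z [^] (n * l)" using 2(3) assms(2,3) by (metis int_pow_pow mult.commute)
  finally show ?thesis unfolding commensurable_def using 1 2
    by (intro exI[of _ "k * m"] exI[of _ "n * l"]) simp
qed

lemma commensurates_by_conjugation:
  assumes c: "g \<in> carrier G" "x \<in> carrier G" "y \<in> carrier G" "z \<in> carrier G" and g: "g \<otimes> x = y \<otimes> g"
    and xz: "commensurable G x z" and yz: "commensurable G y z"
  shows "commensurates G z g"
proof -
  obtain k l :: int where 1: "k \<noteq> 0" "l \<noteq> 0" "x [^] k = z [^] l" using xz by (auto simp: commensurable_def)
  obtain m n :: int where 2: "m \<noteq> 0" "n \<noteq> 0" "y [^] m = z [^] n" using yz by (auto simp: commensurable_def)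
  have "x [^] (k * m) = z [^] (l * m)" using 1(3) c by (metis int_pow_pow)
  moreover have "y [^] (k * m) = z [^] (n * k)" using 2(3) c by (metis int_pow_pow mult.commute)
  moreover have "g \<otimes> x [^] (k * m) = y [^] (k * m) \<otimes> g" by (rule slide_pow[OF c(1-3) g])
  ultimately have "g \<otimes> z [^] (l * m) = z [^] (n * k) \<otimes> g" by simp
  then show ?thesis unfolding commensurates_def using c 1 2
    by (intro conjI exI[of _ "l * m"] exI[of _ "n * k"]) auto
qed

lemma infinite_order_conj:
  assumes g: "g \<in> carrier G" and x: "infinite_order G x"
  shows "infinite_order G (conj_by G g x)"
proof -
  interpret c: group_hom G G "conj_by G g" using group_homI[OF is_group is_group conj_by_hom[OF g]] .
  have "inj_on (conj_by G g) (carrier G)"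
    by (rule inj_on_inverseI[of _ "conj_by G (inv g)"]) (use g in simp)
  then show ?thesis using c.infinite_order_image x by blast
qed

end

locale virtually_Z_graph = graph_of_groups_tree +
  assumes fin: "fin_digraph (base \<A>)"
    and vertex_Z: "\<And>v. v \<in> V \<Longrightarrow> virtually_Z (vg v)" and edge_Z: "\<And>e. e \<in> E \<Longrightarrow> virtually_Z (eg e)"
begin

lemma finite_V: "finite V" and finite_E: "finite E" and finite_T: "finite T"
proof -
  show "finite V" "finite E" using fin by (simp_all add: fin_digraph_def fin_digraph_axioms_def)
  then show "finite T" using T_sub finite_subset by blast
qed

lemma V_nonempty: "V \<noteq> {}"
  using spanning by (auto simp: spanning_tree_arcs_def connected_def strongly_connected_def)

lemma vg_facts:
  assumes "v \<in> V"
  shows "virtually_cyclic (vg v) (carrier (vg v))" "\<exists>x. infinite_order (vg v) x" "countable (carrier (vg v))"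
  using group.virtually_Z_virtually_cyclic[OF group_vgroup[OF assms] vertex_Z[OF assms]]
    group.virtually_cyclic_countable[OF group_vgroup[OF assms]] by auto

lemma eg_facts:
  assumes "e \<in> E"
  shows "virtually_cyclic (eg e) (carrier (eg e))" "\<exists>x. infinite_order (eg e) x" "countable (carrier (eg e))"
  using group.virtually_Z_virtually_cyclic[OF group_egroup[OF assms] edge_Z[OF assms]]
    group.virtually_cyclic_countable[OF group_egroup[OF assms]] by auto

lemma countable_G: "countable (carrier G)"
proof (rule countable_presented_group)
  have "generators = (\<Union>v\<in>V. Vertex_Elt v ` carrier (vg v)) \<union> Edge_Letter ` E"
    by (auto simp: generators_def)
  moreover have "countable (\<Union>v\<in>V. Vertex_Elt v ` carrier (vg v) :: ('a, 'b, 'c) gog_generator set)"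
    using finite_V vg_facts(3) by (intro countable_UN) (auto intro: countable_finite)
  moreover have "countable (Edge_Letter ` E :: ('a, 'b, 'c) gog_generator set)"
    using finite_E by (auto intro: countable_finite)
  ultimately show "countable generators" by simp
qed

text \<open>
  All vertex groups act freely, with infinitely many orbits, on one countable set. For such actions
  the two restrictions to an edge group are isomorphic, and since a spanning tree carries no
  cohomology the isomorphisms can be made the identity on the tree. So \<open>G\<close> acts on that set, with all
  the vertex groups acting freely.
\<close>

lemma vert_inj:
  assumes v0: "v \<in> V"
  shows "inj_on (vert v) (carrier (vg v))"
proof -
  (* \<open>\<kappa>\<close> identifies the natural numbers with the standard free action of each vertex group. *)
  define \<kappa> where "\<kappa> v = from_nat_into ((UNIV :: nat set) \<times> carrier (vg v))" for v
  have \<kappa>: "bij_betw (\<kappa> v) UNIV (UNIV \<times> carrier (vg v))" if v: "v \<in> V" for v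
    unfolding \<kappa>_def
  proof (rule bij_betw_from_nat_into)
    interpret vg: group "vg v" using group_vgroup[OF v] .
    have "\<one>\<^bsub>vg v\<^esub> \<in> carrier (vg v)" by simp
    then show "infinite ((UNIV :: nat set) \<times> carrier (vg v))" by (auto simp: finite_cartesian_product_iff)
  qed (use vg_facts(3)[OF v] in \<open>auto intro: countable_SIGMA\<close>)
  define \<rho> where "\<rho> v = tact (vg v) UNIV (\<kappa> v)" for v
  have \<rho>: "\<rho> v \<in> hom (vg v) perms" if "v \<in> V" for v
    unfolding \<rho>_def by (rule group.tact_hom[OF group_vgroup[OF that] \<kappa>[OF that]])
  have \<rho>_eq: "\<kappa> v (\<rho> v g n) = lact (vg v) g (\<kappa> v n)" if "v \<in> V" "g \<in> carrier (vg v)" for v g n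
    unfolding \<rho>_def by (rule group.tact_eq(2)[OF group_vgroup[OF that(1)] \<kappa>[OF that(1)] _ that(2)]) simp
  have \<kappa>_inj: "m = n" if "v \<in> V" "\<kappa> v m = \<kappa> v n" for v m n
    using \<kappa>[OF that(1)] that(2) by (auto simp: bij_betw_def inj_def)
  have free_all: "free_set (vg v) H (UNIV \<times> carrier (vg v))" if v: "v \<in> V" and H: "subgroup H (vg v)" for v H
  proof -
    interpret vg: group "vg v" using group_vgroup[OF v] .
    show ?thesis
      by (rule free_setI[of _ "carrier (vg v)"])
        (use vg_facts(3)[OF v] vg.subgroupD(1)[OF H] in \<open>auto simp: fst_image_times\<close>)
  qed
  (* The actions of the edge group through its two ends are isomorphic, by a permutation \<open>p\<close>. *)
  have "\<exists>p. bij p \<and> (\<forall>c\<in>carrier (eg e). inv_into UNIV p \<circ> \<rho> (src e) (tail_map \<A> e c) \<circ> p = \<rho> (tgt e) (head_map \<A> e c))"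
    if e: "e \<in> E" for e
  proof -
    interpret s: group "vg (src e)" using group_vgroup ends e by blast
    interpret t: group "vg (tgt e)" using group_vgroup ends e by blast
    interpret tm: group_hom "eg e" "vg (src e)" "tail_map \<A> e"
      using group_homI[OF group_egroup[OF e] s.is_group monD(1)[OF tail_map[OF e]]] .
    interpret hm: group_hom "eg e" "vg (tgt e)" "head_map \<A> e"
      using group_homI[OF group_egroup[OF e] t.is_group monD(1)[OF head_map[OF e]]] .
    let ?C = "tail_map \<A> e ` carrier (eg e)" and ?D = "head_map \<A> e ` carrier (eg e)"
    have inj: "inj_on (tail_map \<A> e) (carrier (eg e))" "inj_on (head_map \<A> e) (carrier (eg e))"
      using monD(2) tail_map[OF e] head_map[OF e] by blast+
    define \<phi> where "\<phi> x = head_map \<A> e (inv_into (carrier (eg e)) (tail_map \<A> e) x)" for x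
    have \<phi>c: "\<phi> (tail_map \<A> e c) = head_map \<A> e c" if "c \<in> carrier (eg e)" for c
      using inj(1) that by (simp add: \<phi>_def)
    have bij\<phi>: "bij_betw \<phi> ?C ?D"
      unfolding bij_betw_def using inj by (auto simp: inj_on_def \<phi>c image_iff)
    have \<phi>m: "\<phi> (x \<otimes>\<^bsub>vg (src e)\<^esub> y) = \<phi> x \<otimes>\<^bsub>vg (tgt e)\<^esub> \<phi> y" if xy: "x \<in> ?C" "y \<in> ?C" for x y
    proof -
      obtain c d where cd: "c \<in> carrier (eg e)" "d \<in> carrier (eg e)" "x = tail_map \<A> e c" "y = tail_map \<A> e d"
        using xy by blast
      have "c \<otimes>\<^bsub>eg e\<^esub> d \<in> carrier (eg e)" using cd by simp
      then show ?thesis using cd \<phi>c[of "c \<otimes>\<^bsub>eg e\<^esub> d"] \<phi>c[of c] \<phi>c[of d] by simp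
    qed
    obtain \<sigma> where \<sigma>: "bij_betw \<sigma> (UNIV \<times> carrier (vg (src e))) (UNIV \<times> carrier (vg (tgt e)))"
      "\<forall>q\<in>UNIV \<times> carrier (vg (src e)). \<forall>c\<in>?C. \<sigma> (lact (vg (src e)) c q) = lact (vg (tgt e)) (\<phi> c) (\<sigma> q)"
      using free_sets_isomorphic[OF s.is_group t.is_group tm.img_is_subgroup hm.img_is_subgroup bij\<phi> \<phi>m
          free_all[OF ends(1)[OF e] tm.img_is_subgroup] free_all[OF ends(2)[OF e] hm.img_is_subgroup]]
      by blast
    define q where "q = inv_into UNIV (\<kappa> (tgt e)) \<circ> \<sigma> \<circ> \<kappa> (src e)"
    have bijq: "bij q" unfolding q_def
      using bij_betw_trans[OF bij_betw_trans[OF \<kappa>[OF ends(1)[OF e]] \<sigma>(1)] bij_betw_inv_into[OF \<kappa>[OF ends(2)[OF e]]]]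
      by (simp add: comp_assoc)
    have \<kappa>q: "\<kappa> (tgt e) (q n) = \<sigma> (\<kappa> (src e) n)" for n
    proof -
      have "\<kappa> (src e) n \<in> UNIV \<times> carrier (vg (src e))" by (rule bij_betw_apply[OF \<kappa>[OF ends(1)[OF e]]]) simp
      then have "\<sigma> (\<kappa> (src e) n) \<in> UNIV \<times> carrier (vg (tgt e))" by (rule bij_betw_apply[OF \<sigma>(1)])
      then have "\<sigma> (\<kappa> (src e) n) \<in> range (\<kappa> (tgt e))" using \<kappa>[OF ends(2)[OF e]] by (simp add: bij_betw_def)
      then show ?thesis by (simp add: q_def f_inv_into_f)
    qed
    have comm: "q (\<rho> (src e) (tail_map \<A> e c) n) = \<rho> (tgt e) (head_map \<A> e c) (q n)"
      if c: "c \<in> carrier (eg e)" for c n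
    proof (rule \<kappa>_inj[OF ends(2)[OF e]])
      have n: "\<kappa> (src e) n \<in> UNIV \<times> carrier (vg (src e))" using \<kappa>[OF ends(1)[OF e]] by (auto simp: bij_betw_def)
      have "\<kappa> (tgt e) (q (\<rho> (src e) (tail_map \<A> e c) n)) = \<sigma> (lact (vg (src e)) (tail_map \<A> e c) (\<kappa> (src e) n))"
        unfolding \<kappa>q using \<rho>_eq[OF ends(1)[OF e] maps_closed(1)[OF e c]] by simp
      also have "\<dots> = lact (vg (tgt e)) (head_map \<A> e c) (\<sigma> (\<kappa> (src e) n))"
        using \<sigma>(2) n c \<phi>c[OF c] by (metis imageI)
      also have "\<dots> = \<kappa> (tgt e) (\<rho> (tgt e) (head_map \<A> e c) (q n))"
        using \<rho>_eq[OF ends(2)[OF e] maps_closed(2)[OF e c]] \<kappa>q by simp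
      finally show "\<kappa> (tgt e) (q (\<rho> (src e) (tail_map \<A> e c) n)) = \<kappa> (tgt e) (\<rho> (tgt e) (head_map \<A> e c) (q n))" .
    qed
    define p where "p = inv_into UNIV q"
    have "bij p" "inv_into UNIV p = q" using bijq by (simp_all add: p_def bij_imp_bij_inv inv_inv_eq)
    moreover have "q (p n) = n" for n using bijq by (simp add: p_def bij_is_surj surj_f_inv_f)
    ultimately show ?thesis using comm by (intro exI[of _ p]) (simp add: fun_eq_iff)
  qed
  then obtain p where p: "\<And>e. e \<in> E \<Longrightarrow> bij (p e)"
    "\<And>e c. e \<in> E \<Longrightarrow> c \<in> carrier (eg e) \<Longrightarrow>
      inv_into UNIV (p e) \<circ> \<rho> (src e) (tail_map \<A> e c) \<circ> p e = \<rho> (tgt e) (head_map \<A> e c)"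
    by metis
  have conj_p: "conj_by perms (p e) (\<rho> (src e) (tail_map \<A> e c)) = \<rho> (tgt e) (head_map \<A> e c)"
    if "e \<in> E" "c \<in> carrier (eg e)" for e c
    using p(2)[OF that] inv_perms[OF p(1)[OF that(1)]] by (simp add: conj_by_def)
  (* The permutations of the tree edges come from a choice of permutations at the vertices. Conjugating
     the actions of the vertex groups by these makes the tree edges act trivially. *)
  have "\<exists>\<sigma>. (\<forall>v. \<sigma> v \<in> carrier perms) \<and> (\<forall>e\<in>T. \<sigma> (tgt e) = \<sigma> (src e) \<otimes>\<^bsub>perms\<^esub> p e)"
    by (rule tree_potential[OF group_perms finite_T]) (use p(1) T_sub in auto)
  then obtain \<sigma> where \<sigma>: "\<And>v. \<sigma> v \<in> carrier perms" "\<And>e. e \<in> T \<Longrightarrow> \<sigma> (tgt e) = \<sigma> (src e) \<otimes>\<^bsub>perms\<^esub> p e"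
    by blast
  let ?L = "perms :: (nat \<Rightarrow> nat) monoid"
  define f where "f v a = conj_by ?L (inv\<^bsub>?L\<^esub> \<sigma> v) (\<rho> v a)" for v a
  define s where "s e = \<sigma> (src e) \<otimes>\<^bsub>?L\<^esub> p e \<otimes>\<^bsub>?L\<^esub> inv\<^bsub>?L\<^esub> \<sigma> (tgt e)" for e
  have pc: "p e \<in> carrier ?L" if "e \<in> E" for e using p(1)[OF that] by simp
  have \<rho>c: "\<rho> v a \<in> carrier ?L" if "v \<in> V" "a \<in> carrier (vg v)" for v a
    using hom_in_carrier[OF \<rho>[OF that(1)] that(2)] .
  have \<sigma>i: "inv\<^bsub>?L\<^esub> \<sigma> v \<in> carrier ?L" for v using perms.inv_closed[OF \<sigma>(1)] .
  have "\<exists>h\<in>hom G ?L. (\<forall>v\<in>V. \<forall>a\<in>carrier (vg v). h (vert v a) = f v a) \<and> (\<forall>e\<in>E. h (stable e) = s e)"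
  proof (rule extend[OF group_perms])
    show "f v \<in> hom (vg v) ?L" if v: "v \<in> V" for v
    proof -
      have "conj_by ?L (inv\<^bsub>?L\<^esub> \<sigma> v) \<circ> \<rho> v \<in> hom (vg v) ?L"
        by (rule hom_compose[OF \<rho>[OF v] perms.conj_by_hom[OF \<sigma>i]])
      moreover have "f v = conj_by ?L (inv\<^bsub>?L\<^esub> \<sigma> v) \<circ> \<rho> v" by (rule ext) (simp add: f_def)
      ultimately show ?thesis by simp
    qed
    show "s e \<in> carrier ?L" if "e \<in> E" for e
      unfolding s_def by (intro perms.m_closed \<sigma>(1) \<sigma>i pc[OF that])
    show "conj_by ?L (s e) (f (src e) (tail_map \<A> e c)) = f (tgt e) (head_map \<A> e c)"
      if e: "e \<in> E" and c: "c \<in> carrier (eg e)" for e c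
    proof -
      let ?r = "\<rho> (src e) (tail_map \<A> e c)"
      have r: "?r \<in> carrier ?L" using \<rho>c ends maps_closed(1)[OF e c] e by blast
      have "inv\<^bsub>?L\<^esub> \<sigma> (src e) \<otimes>\<^bsub>?L\<^esub> s e = p e \<otimes>\<^bsub>?L\<^esub> inv\<^bsub>?L\<^esub> \<sigma> (tgt e)"
        unfolding s_def using perms.m_assoc[OF \<sigma>(1) pc[OF e] \<sigma>i]
          perms.conjugate_cancel(1)[OF \<sigma>(1) perms.m_closed[OF pc[OF e] \<sigma>i]] by simp
      then have "conj_by ?L (s e) (f (src e) (tail_map \<A> e c)) = conj_by ?L (p e \<otimes>\<^bsub>?L\<^esub> inv\<^bsub>?L\<^esub> \<sigma> (tgt e)) ?r"
        unfolding f_def using perms.conj_by_conj_by[OF \<sigma>i _ r, of "s e" "src e"]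
          perms.m_closed[OF perms.m_closed[OF \<sigma>(1) pc[OF e]] \<sigma>i] by (simp add: s_def)
      also have "\<dots> = conj_by ?L (inv\<^bsub>?L\<^esub> \<sigma> (tgt e)) (conj_by ?L (p e) ?r)"
        using perms.conj_by_conj_by[OF pc[OF e] \<sigma>i r] by simp
      finally show ?thesis using conj_p[OF e c] by (simp add: f_def)
    qed
    show "s e = \<one>\<^bsub>?L\<^esub>" if e: "e \<in> T" for e
      unfolding s_def \<sigma>(2)[OF e, symmetric] by (rule perms.r_inv[OF \<sigma>(1)])
  qed
  then obtain h where h: "\<And>v a. v \<in> V \<Longrightarrow> a \<in> carrier (vg v) \<Longrightarrow> h (vert v a) = f v a" by blast
  show ?thesis
  proof (rule inj_onI)
    fix a b assume ab: "a \<in> carrier (vg v)" "b \<in> carrier (vg v)" and eq: "vert v a = vert v b"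
    have "f v a = f v b" using h[OF v0] ab eq by metis
    then have "conj_by ?L (\<sigma> v) (f v a) = conj_by ?L (\<sigma> v) (f v b)" by simp
    then have "\<rho> v a = \<rho> v b"
      unfolding f_def
      using perms.conj_by_inv_cancel(1)[OF \<sigma>(1) \<rho>c[OF v0 ab(1)]] perms.conj_by_inv_cancel(1)[OF \<sigma>(1) \<rho>c[OF v0 ab(2)]]
      by simp
    then have "lact (vg v) a (\<kappa> v 0) = lact (vg v) b (\<kappa> v 0)" using \<rho>_eq[OF v0] ab by metis
    then have "a \<otimes>\<^bsub>vg v\<^esub> snd (\<kappa> v 0) = b \<otimes>\<^bsub>vg v\<^esub> snd (\<kappa> v 0)" by (simp add: lact_def)
    moreover have "\<kappa> v 0 \<in> UNIV \<times> carrier (vg v)" by (rule bij_betw_apply[OF \<kappa>[OF v0]]) simp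
    then have "snd (\<kappa> v 0) \<in> carrier (vg v)" by (simp add: mem_Times_iff)
    ultimately show "a = b" using group.right_cancel[OF group_vgroup[OF v0]] ab by metis
  qed
qed

lemma vsub_virtually_cyclic: "v \<in> V \<Longrightarrow> virtually_cyclic G (vsub v)"
  unfolding vsub_def using group_hom.virtually_cyclic_image[OF vert_hom] vg_facts(1) by blast

lemma esub_tail_virtually_cyclic: "e \<in> E \<Longrightarrow> virtually_cyclic G (esub_tail e)"
  unfolding esub_tail_def using group_hom.virtually_cyclic_image[OF esub_tail_hom] eg_facts(1) by blast

lemma esub_head_virtually_cyclic: "e \<in> E \<Longrightarrow> virtually_cyclic G (esub_head e)"
  unfolding esub_head_def using group_hom.virtually_cyclic_image[OF esub_head_hom] eg_facts(1) by blast

lemma vsub_infinite_order: "v \<in> V \<Longrightarrow> \<exists>x\<in>vsub v. infinite_order G x"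
proof -
  assume v: "v \<in> V"
  obtain x where x: "infinite_order (vg v) x" using vg_facts(2)[OF v] by blast
  then have "vert v x \<in> vsub v" by (simp add: vsub_def infinite_order_def)
  then show ?thesis
    using group_hom.infinite_order_image[OF vert_hom[OF v] vert_inj[OF v] x] by blast
qed

lemma esub_tail_infinite_order: "e \<in> E \<Longrightarrow> \<exists>x\<in>esub_tail e. infinite_order G x"
proof -
  assume e: "e \<in> E"
  obtain x where x: "infinite_order (eg e) x" using eg_facts(2)[OF e] by blast
  have "inj_on (\<lambda>c. vert (src e) (tail_map \<A> e c)) (carrier (eg e))"
  proof (rule inj_onI)
    fix c d assume cd: "c \<in> carrier (eg e)" "d \<in> carrier (eg e)"
      and "vert (src e) (tail_map \<A> e c) = vert (src e) (tail_map \<A> e d)"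
    then have "tail_map \<A> e c = tail_map \<A> e d"
      using inj_onD[OF vert_inj[OF ends(1)[OF e]]] maps_closed(1)[OF e] by blast
    then show "c = d" using inj_onD[OF monD(2)[OF tail_map[OF e]]] cd by blast
  qed
  moreover have "vert (src e) (tail_map \<A> e x) \<in> esub_tail e"
    using x by (simp add: esub_tail_def infinite_order_def)
  ultimately show ?thesis
    using group_hom.infinite_order_image[OF esub_tail_hom[OF e] _ x] by blast
qed

text \<open>
  Neighbouring vertex groups share an element of infinite order, which comes from the edge group, and
  within a vertex group all elements of infinite order are commensurable.
\<close>

lemma vsub_commensurable:
  assumes "u \<in> V" "v \<in> V" "x \<in> vsub u" "infinite_order G x" "y \<in> vsub v" "infinite_order G y"
  shows "commensurable G x y"
proof -
  define S where "S = {w \<in> V. \<exists>y\<in>vsub w. infinite_order G y \<and> commensurable G x y}"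
  have all: "commensurable G x y" if w: "w \<in> S" "y \<in> vsub w" "infinite_order G y" for w y
  proof -
    obtain y' where y': "y' \<in> vsub w" "infinite_order G y'" "commensurable G x y'" and "w \<in> V"
      using w by (auto simp: S_def)
    then have "commensurable G y' y"
      using G.virtually_cyclic_commensurable[OF vsub_virtually_cyclic[OF \<open>w \<in> V\<close>] y'(2,1) w(3,2)]
      by (simp add: commensurable_def)
    then show ?thesis
      using G.commensurable_trans[OF _ _ _ y'(3)] assms(4) y'(2) w(3) by (auto simp: infinite_order_def)
  qed
  have "S = V"
  proof (rule tree_connected)
    have "commensurable G x x" unfolding commensurable_def by (intro exI[of _ 1]) simp
    then have "u \<in> S" using assms(1,3,4) by (auto simp: S_def)
    then show "S \<noteq> {}" by blast
    show "src e \<in> S \<longleftrightarrow> tgt e \<in> S" if e: "e \<in> T" for e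
    proof -
      have eE: "e \<in> E" using e T_sub by blast
      obtain y where y: "y \<in> esub_tail e" "infinite_order G y" using esub_tail_infinite_order[OF eE] by blast
      then have "y \<in> vsub (src e)" "y \<in> vsub (tgt e)"
        using esub_tail(2)[OF eE] esub_head(2)[OF eE] esub_tree[OF e] by auto
      then show ?thesis using all[of "src e" y] all[of "tgt e" y] y(2) ends[OF eE] by (auto simp: S_def)
    qed
  qed (auto simp: S_def)
  then show ?thesis using all assms by blast
qed

text \<open>
  A vertex group conjugates elements of infinite order within itself, and a stable letter takes one of
  its associated subgroups to the other. In both cases the result is again commensurable with \<open>z\<close>.
\<close>

lemma all_commensurate:
  assumes v: "v \<in> V" "z \<in> vsub v" "infinite_order G z" and g: "g \<in> carrier G"
  shows "commensurates G z g"
proof (rule G.commensurates_generate[of z "(\<Union>v\<in>V. vsub v) \<union> stable ` E"])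
  show zc: "z \<in> carrier G" using v(3) by (simp add: infinite_order_def)
  show "g \<in> generate G ((\<Union>v\<in>V. vsub v) \<union> stable ` E)" using g carrier_eq by simp
  fix s assume "s \<in> (\<Union>v\<in>V. vsub v) \<union> stable ` E"
  then consider w where "w \<in> V" "s \<in> vsub w" | e where "e \<in> E" "s = stable e" by blast
  then show "commensurates G z s"
  proof cases
    case 1
    obtain x where x: "x \<in> vsub w" "infinite_order G x" using vsub_infinite_order[OF 1(1)] by blast
    have sub: "subgroup (vsub w) G" using vsub_subgroup[OF 1(1)] .
    have c: "s \<in> carrier G" "x \<in> carrier G" using 1(2) x G.subgroupD(1)[OF sub] by blast+
    let ?y = "conj_by G (inv\<^bsub>G\<^esub> s) x"
    have y: "?y \<in> vsub w" "infinite_order G ?y"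
      using G.conj_by_subgroup[OF sub G.subgroupD(3)[OF sub 1(2)] x(1)] G.infinite_order_conj[OF _ x(2)] c by auto
    have "s \<otimes>\<^bsub>G\<^esub> x = ?y \<otimes>\<^bsub>G\<^esub> s" using c by (simp add: conj_by_def G.m_assoc)
    then show ?thesis
      using G.commensurates_by_conjugation[OF c _ zc _ vsub_commensurable[OF 1(1) v(1) x v(2,3)]
          vsub_commensurable[OF 1(1) v(1) y v(2,3)]] c by simp
  next
    case 2
    obtain x where x: "x \<in> esub_tail e" "infinite_order G x" using esub_tail_infinite_order[OF 2(1)] by blast
    have sc: "s \<in> carrier G" using stable_closed 2 by simp
    have xc: "x \<in> carrier G" using x(2) by (simp add: infinite_order_def)
    have xs: "x \<in> vsub (src e)" using x esub_tail(2)[OF 2(1)] by blast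
    let ?y = "conj_by G s x"
    have y: "?y \<in> vsub (tgt e)" "infinite_order G ?y"
      using esub_conj[OF 2(1)] esub_head(2)[OF 2(1)] x 2(2) G.infinite_order_conj[OF sc x(2)] by auto
    have yc: "?y \<in> carrier G" using sc xc by simp
    have "s \<otimes>\<^bsub>G\<^esub> ?y = x \<otimes>\<^bsub>G\<^esub> s" using sc xc by (simp add: conj_by_def G.m_assoc G.conjugate_cancel)
    then show ?thesis
      using G.commensurates_by_conjugation[OF sc yc xc zc _ vsub_commensurable[OF ends(2)[OF 2(1)] v(1) y v(2,3)]
          vsub_commensurable[OF ends(1)[OF 2(1)] v(1) xs x(2) v(2,3)]] by simp
  qed
qed

end


section \<open>Splittings of the fundamental group\<close>

context group
begin

lemma hom_eq_on_subgroup: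
  assumes L: "group L" and S: "S \<subseteq> carrier G" and h: "h \<in> hom G L"
    and \<rho>: "\<rho> \<in> hom (G\<lparr>carrier := generate G S\<rparr>) L" and eq: "\<And>x. x \<in> S \<Longrightarrow> h x = \<rho> x"
    and x: "x \<in> generate G S"
  shows "h x = \<rho> x"
proof -
  let ?K = "generate G S"
  have K: "subgroup ?K G" by (rule generate_is_subgroup[OF S])
  have SK: "S \<subseteq> ?K" by (auto intro: generate.incl)
  have "h \<in> hom (G\<lparr>carrier := ?K\<rparr>) L" using h subgroupD(1)[OF K] by (auto simp: hom_def)
  moreover have "x \<in> generate (G\<lparr>carrier := ?K\<rparr>) S" using x generate_consistent[OF SK K] by simp
  ultimately show ?thesis
    using group.hom_eq_on_generate[OF subgroup_imp_group[OF K] L _ \<rho>, of h S x] SK eq by simp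
qed

lemma hom_conj_by:
  assumes L: "group L" and K: "subgroup K G" and \<rho>: "\<rho> \<in> hom (G\<lparr>carrier := K\<rparr>) L" and x: "g \<in> K" "x \<in> K"
  shows "\<rho> (conj_by G g x) = conj_by L (\<rho> g) (\<rho> x)"
proof -
  interpret \<rho>: group_hom "G\<lparr>carrier := K\<rparr>" L \<rho> by (rule group_homI[OF subgroup_imp_group[OF K] L \<rho>])
  note KD = subgroupD[OF K]
  have "\<rho> (conj_by G g x) = \<rho> (inv g \<otimes> x) \<otimes>\<^bsub>L\<^esub> \<rho> g"
    unfolding conj_by_def using \<rho>.hom_mult[of "inv g \<otimes> x" g] x KD(3,4) by simp
  also have "\<rho> (inv g \<otimes> x) = inv\<^bsub>L\<^esub> (\<rho> g) \<otimes>\<^bsub>L\<^esub> \<rho> x"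
    using \<rho>.hom_mult[of "inv g" x] \<rho>.hom_inv[of g] m_inv_consistent[OF K] x KD(3) by simp
  finally show ?thesis by (simp add: conj_by_def)
qed

end

context virtually_Z_graph
begin

text \<open>
  The base of the HNN extension with the stable letter of \<open>f\<close>: whatever the other generators generate.
\<close>

definition base_group :: "'b \<Rightarrow> ('a, 'b, 'c) gog_generator word set set" where
  "base_group f = generate G ((\<Union>v\<in>V. vsub v) \<union> stable ` (E - {f}))"

lemma base_generators: "(\<Union>v\<in>V. vsub v) \<union> stable ` (E - {f}) \<subseteq> carrier G"
  using G.subgroupD(1)[OF vsub_subgroup] stable_closed by auto

lemma base_group_subgroup: "subgroup (base_group f) G"
  unfolding base_group_def by (rule G.generate_is_subgroup[OF base_generators])

lemma base_group_contains: "v \<in> V \<Longrightarrow> vsub v \<subseteq> base_group f" "e \<in> E \<Longrightarrow> e \<noteq> f \<Longrightarrow> stable e \<in> base_group f"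
  unfolding base_group_def by (auto intro: generate.incl)

text \<open>
  The relations of \<open>G\<close> that do not involve the letter of \<open>f\<close> hold in the base group, so they are respected
  by any homomorphism that is defined there. In this way \<open>G\<close> is recognised as an HNN extension without a
  presentation of the base group.
\<close>

lemma hnn_extend:
  fixes L :: "('l, 'm) monoid_scheme"
  assumes f: "f \<in> E - T" and L: "group L"
    and \<rho>: "\<rho> \<in> hom (G\<lparr>carrier := base_group f\<rparr>) L" and \<tau>: "\<tau> \<in> carrier L"
    and rel: "\<And>c. c \<in> esub_tail f \<Longrightarrow> conj_by L \<tau> (\<rho> c) = \<rho> (conj_by G (stable f) c)"
  shows "\<exists>h\<in>hom G L. (\<forall>x\<in>base_group f. h x = \<rho> x) \<and> h (stable f) = \<tau>"
proof -
  interpret L: group L by (rule L)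
  note K = base_group_subgroup[of f]
  have \<rho>c: "\<rho> x \<in> carrier L" if "x \<in> base_group f" for x using hom_in_carrier[OF \<rho>] that by simp
  have vK: "vert v a \<in> base_group f" if "v \<in> V" "a \<in> carrier (vg v)" for v a
    using base_group_contains(1)[OF that(1)] that(2) by (auto simp: vsub_def)
  have "\<exists>h\<in>hom G L. (\<forall>v\<in>V. \<forall>a\<in>carrier (vg v). h (vert v a) = \<rho> (vert v a)) \<and>
      (\<forall>e\<in>E. h (stable e) = (if e = f then \<tau> else \<rho> (stable e)))"
  proof (rule extend[OF L, where f = "\<lambda>v a. \<rho> (vert v a)"])
    show "(\<lambda>a. \<rho> (vert v a)) \<in> hom (vg v) L" if v: "v \<in> V" for v
    proof (rule homI)
      show "\<rho> (vert v (a \<otimes>\<^bsub>vg v\<^esub> b)) = \<rho> (vert v a) \<otimes>\<^bsub>L\<^esub> \<rho> (vert v b)"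
        if "a \<in> carrier (vg v)" "b \<in> carrier (vg v)" for a b
        using group_hom.hom_mult[OF vert_hom[OF v] that] hom_mult[OF \<rho>, of "vert v a" "vert v b"] vK v that by simp
    qed (use \<rho>c vK v in auto)
    show "(if e = f then \<tau> else \<rho> (stable e)) \<in> carrier L" if "e \<in> E" for e
      using \<tau> \<rho>c base_group_contains(2)[OF that] by simp
    show "conj_by L (if e = f then \<tau> else \<rho> (stable e)) (\<rho> (vert (src e) (tail_map \<A> e c))) =
        \<rho> (vert (tgt e) (head_map \<A> e c))" if e: "e \<in> E" and c: "c \<in> carrier (eg e)" for e c
    proof (cases "e = f")
      case True
      have "vert (src f) (tail_map \<A> f c) \<in> esub_tail f" using c True by (simp add: esub_tail_def)
      then show ?thesis using rel edge_relation[OF e c] True by simp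
    next
      case False
      show ?thesis
        using G.hom_conj_by[OF L K \<rho> base_group_contains(2)[OF e False] vK[OF ends(1)[OF e] maps_closed(1)[OF e c]]]
          edge_relation[OF e c] False by simp
    qed
    show "(if e = f then \<tau> else \<rho> (stable e)) = \<one>\<^bsub>L\<^esub>" if "e \<in> T" for e
    proof -
      have "\<rho> \<one>\<^bsub>G\<^esub> = \<one>\<^bsub>L\<^esub>"
        using group_hom.hom_one[OF group_homI[OF G.subgroup_imp_group[OF K] L \<rho>]] by simp
      then show ?thesis using stable_tree[OF that] f that by auto
    qed
  qed
  then obtain h where h: "h \<in> hom G L" "\<And>v a. v \<in> V \<Longrightarrow> a \<in> carrier (vg v) \<Longrightarrow> h (vert v a) = \<rho> (vert v a)"
    "\<And>e. e \<in> E \<Longrightarrow> h (stable e) = (if e = f then \<tau> else \<rho> (stable e))" by blast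
  have "h x = \<rho> x" if "x \<in> base_group f" for x
  proof (rule G.hom_eq_on_subgroup[OF L base_generators h(1) \<rho>[unfolded base_group_def] _ that[unfolded base_group_def]])
    fix y assume "y \<in> (\<Union>v\<in>V. vsub v) \<union> stable ` (E - {f})"
    then consider v a where "v \<in> V" "a \<in> carrier (vg v)" "y = vert v a" | e where "e \<in> E" "e \<noteq> f" "y = stable e"
      by (auto simp: vsub_def)
    then show "h y = \<rho> y" by cases (simp_all add: h(2,3))
  qed
  then show ?thesis using h(1,3) f by (intro bexI[of _ h]) auto
qed

lemma esub_base_group:
  assumes "f \<in> E"
  shows "esub_tail f \<subseteq> base_group f" "esub_head f \<subseteq> base_group f"
  using esub_tail(2)[OF assms] esub_head(2)[OF assms] base_group_contains(1) ends[OF assms] by blast+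

lemma carrier_eq_base_group:
  assumes "s \<in> carrier G" "s = stable f \<or> inv\<^bsub>G\<^esub> s = stable f"
  shows "carrier G = generate G (insert s (base_group f))"
proof
  let ?S = "insert s (base_group f)"
  have S: "?S \<subseteq> carrier G" using assms(1) G.subgroupD(1)[OF base_group_subgroup] by auto
  have "stable f \<in> generate G ?S" using assms(2) generate.incl[of s ?S G] generate.inv[of s ?S G] by auto
  moreover have "stable e \<in> generate G ?S" if "e \<in> E" "e \<noteq> f" for e
    using base_group_contains(2)[OF that] by (intro generate.incl) simp
  moreover have "vsub v \<subseteq> generate G ?S" if "v \<in> V" for v
    using base_group_contains(1)[OF that, of f] by (auto intro: generate.incl)
  ultimately have "(\<Union>v\<in>V. vsub v) \<union> stable ` E \<subseteq> generate G ?S" by blast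
  then show "carrier G \<subseteq> generate G ?S"
    unfolding carrier_eq using G.generate_subgroup_incl G.generate_is_subgroup[OF S] by blast
  show "generate G ?S \<subseteq> carrier G" by (rule G.generate_incl[OF S])
qed

text \<open>
  By \<open>not_fgip_hnn\<close> one of the associated subgroups is the whole base group. Then the base group is an
  image of the edge group, and the stable letter or its inverse conjugates it into itself.
\<close>

lemma non_tree_edge_ascending_hnn:
  assumes fgip: "fgip G" and f: "f \<in> E - T"
  shows "\<exists>(A :: nat monoid) \<phi>. virtually_Z A \<and> \<phi> \<in> mon A A \<and> G \<cong> ascending_hnn A \<phi>"
proof -
  let ?K = "base_group f" and ?t = "stable f"
  have fE: "f \<in> E" using f by blast
  note K = base_group_subgroup[of f]
  have tc: "?t \<in> carrier G" by (rule stable_closed[OF fE])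
  have Kc: "x \<in> carrier G" if "x \<in> ?K" for x using that G.subgroupD(1)[OF K] by blast
  have cK: "countable ?K" using countable_subset[OF G.subgroupD(1)[OF K] countable_G] .
  obtain z where z: "z \<in> esub_tail f" "infinite_order G z" using esub_tail_infinite_order[OF fE] by blast
  have "esub_tail f = ?K \<or> esub_head f = ?K"
  proof (rule ccontr)
    assume "\<not> ?thesis"
    then obtain c d where cd: "c \<in> ?K - esub_tail f" "d \<in> ?K - esub_head f"
      using esub_base_group[OF fE] by blast
    have "\<not> fgip G"
    proof (rule G.not_fgip_hnn[OF K cK esub_tail(1)[OF fE] esub_base_group(1)[OF fE] tc esub_head(1)[OF fE]
          esub_base_group(2)[OF fE] esub_conj[OF fE] cd z(2,1)])
      show "commensurates G z g" if "g \<in> carrier G" for g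
        using all_commensurate[OF ends(1)[OF fE] _ z(2) that] z(1) esub_tail(2)[OF fE] by blast
      show "\<exists>h\<in>hom G perms. (\<forall>x\<in>?K. h x = \<rho> x) \<and> h ?t = \<tau>"
        if "\<rho> \<in> hom (G\<lparr>carrier := ?K\<rparr>) perms" "bij \<tau>"
          and rel: "\<And>c. c \<in> esub_tail f \<Longrightarrow> inv_into UNIV \<tau> \<circ> \<rho> c \<circ> \<tau> = \<rho> (conj_by G ?t c)"
        for \<rho> and \<tau> :: "nat \<times> ('a, 'b, 'c) gog_generator word set \<Rightarrow> nat \<times> ('a, 'b, 'c) gog_generator word set"
      proof (rule hnn_extend[OF f group_perms that(1)])
        show "conj_by perms \<tau> (\<rho> c) = \<rho> (conj_by G ?t c)" if "c \<in> esub_tail f" for c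
          using rel[OF that] inv_perms[OF \<open>bij \<tau>\<close>] by (simp only: conj_by_def perms_simps)
      qed (simp add: that(2))
    qed
    then show False using fgip by blast
  qed
  then show ?thesis
  proof
    assume eq: "esub_tail f = ?K"
    show ?thesis
    proof (rule G.iso_ascending_hnn[OF K cK _ tc _ carrier_eq_base_group[OF tc]])
      show "virtually_Z (G\<lparr>carrier := ?K\<rparr>)"
        using G.virtually_cyclic_virtually_Z[OF esub_tail_virtually_cyclic[OF fE] z(2,1)] eq by simp
      show "conj_by G ?t a \<in> ?K" if "a \<in> ?K" for a
        using esub_conj[OF fE] esub_base_group(2)[OF fE] that eq by auto
      show "\<exists>h\<in>hom G L. (\<forall>x\<in>?K. h x = \<rho> x) \<and> h ?t = \<sigma>"
        if "group L" "\<rho> \<in> hom (G\<lparr>carrier := ?K\<rparr>) L" "\<sigma> \<in> carrier L"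
          "\<And>a. a \<in> ?K \<Longrightarrow> conj_by L \<sigma> (\<rho> a) = \<rho> (conj_by G ?t a)"
        for L :: "nat option word set monoid" and \<rho> \<sigma>
        by (rule hnn_extend[OF f that(1-3)]) (use that(4) eq in simp)
    qed simp
  next
    assume eq: "esub_head f = ?K"
    let ?s = "inv\<^bsub>G\<^esub> ?t"
    have sc: "?s \<in> carrier G" using tc by simp
    have z': "conj_by G ?t z \<in> ?K" "infinite_order G (conj_by G ?t z)"
      using esub_conj[OF fE] z eq G.infinite_order_conj[OF tc z(2)] by auto
    have tailc: "c \<in> carrier G" if "c \<in> esub_tail f" for c
      using that G.subgroupD(1)[OF esub_tail(1)[OF fE]] by blast
    show ?thesis
    proof (rule G.iso_ascending_hnn[OF K cK _ sc _ carrier_eq_base_group[OF sc]])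
      show "virtually_Z (G\<lparr>carrier := ?K\<rparr>)"
        using G.virtually_cyclic_virtually_Z[OF esub_head_virtually_cyclic[OF fE] z'(2)] z'(1) eq by simp
      show "conj_by G ?s a \<in> ?K" if a: "a \<in> ?K" for a
      proof -
        obtain c where "c \<in> esub_tail f" "a = conj_by G ?t c" using a esub_conj[OF fE] eq by blast
        then show ?thesis using tailc tc esub_base_group(1)[OF fE] by auto
      qed
      show "\<exists>h\<in>hom G L. (\<forall>x\<in>?K. h x = \<rho> x) \<and> h ?s = \<sigma>"
        if L: "group L" and \<rho>: "\<rho> \<in> hom (G\<lparr>carrier := ?K\<rparr>) L" and \<sigma>: "\<sigma> \<in> carrier L"
          and rel: "\<And>a. a \<in> ?K \<Longrightarrow> conj_by L \<sigma> (\<rho> a) = \<rho> (conj_by G ?s a)"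
        for L :: "nat option word set monoid" and \<rho> \<sigma>
      proof -
        interpret L: group L by (rule L)
        have "\<exists>h\<in>hom G L. (\<forall>x\<in>?K. h x = \<rho> x) \<and> h ?t = inv\<^bsub>L\<^esub> \<sigma>"
        proof (rule hnn_extend[OF f L \<rho>])
          fix c assume c: "c \<in> esub_tail f"
          have a: "conj_by G ?t c \<in> ?K" using esub_conj[OF fE] eq c by auto
          have "conj_by L \<sigma> (\<rho> (conj_by G ?t c)) = \<rho> c"
            using rel[OF a] tailc[OF c] tc by simp
          moreover have "\<rho> (conj_by G ?t c) \<in> carrier L" using hom_in_carrier[OF \<rho>] a by simp
          ultimately show "conj_by L (inv\<^bsub>L\<^esub> \<sigma>) (\<rho> c) = \<rho> (conj_by G ?t c)"
            using L.conj_by_inv_cancel(2)[OF \<sigma>] by metis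
        qed (use \<sigma> in simp)
        then obtain h where h: "h \<in> hom G L" "\<forall>x\<in>?K. h x = \<rho> x" "h ?t = inv\<^bsub>L\<^esub> \<sigma>" by blast
        have "h ?s = \<sigma>"
          using group_hom.hom_inv[OF group_homI[OF G.is_group L h(1)] tc] h(3) \<sigma> by simp
        then show ?thesis using h by blast
      qed
    qed (use tc in simp)
  qed
qed

definition side :: "'a set \<Rightarrow> ('a, 'b, 'c) gog_generator word set set" where
  "side U = generate G (\<Union>v\<in>U. vsub v)"

lemma side_generators: "U \<subseteq> V \<Longrightarrow> (\<Union>v\<in>U. vsub v) \<subseteq> carrier G"
  using G.subgroupD(1)[OF vsub_subgroup] by blast

lemma side_subgroup: "U \<subseteq> V \<Longrightarrow> subgroup (side U) G"
  unfolding side_def by (rule G.generate_is_subgroup[OF side_generators])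

lemma side_contains: "v \<in> U \<Longrightarrow> vsub v \<subseteq> side U"
  unfolding side_def by (auto intro: generate.incl)

text \<open>
  The relations of \<open>G\<close> hold separately on the two sides of \<open>e\<close>, except for the one that identifies the two
  images of the edge group of \<open>e\<close>.
\<close>

lemma amalgam_extend:
  fixes L :: "('l, 'm) monoid_scheme"
  assumes ET: "E = T" and e: "e \<in> T" and U: "U \<subseteq> V" "src e \<in> U" "tgt e \<notin> U"
    "\<And>f. f \<in> T - {e} \<Longrightarrow> src f \<in> U \<longleftrightarrow> tgt f \<in> U" and L: "group L"
    and \<rho>: "\<rho> \<in> hom (G\<lparr>carrier := side U\<rparr>) L" and \<sigma>: "\<sigma> \<in> hom (G\<lparr>carrier := side (V - U)\<rparr>) L"
    and agree: "\<And>c. c \<in> esub_tail e \<Longrightarrow> \<rho> c = \<sigma> c"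
  shows "\<exists>h\<in>hom G L. (\<forall>x\<in>side U. h x = \<rho> x) \<and> (\<forall>x\<in>side (V - U). h x = \<sigma> x)"
proof -
  interpret L: group L by (rule L)
  define f where "f v a = (if v \<in> U then \<rho> (vert v a) else \<sigma> (vert v a))" for v a
  have vs: "vert v a \<in> side W" if "v \<in> W" "a \<in> carrier (vg v)" for v a W
    using side_contains[OF that(1)] that(2) by (auto simp: vsub_def)
  have fc: "f v a \<in> carrier L" if "v \<in> V" "a \<in> carrier (vg v)" for v a
    using hom_in_carrier[OF \<rho>, of "vert v a"] hom_in_carrier[OF \<sigma>, of "vert v a"] vs that by (auto simp: f_def)
  have "\<exists>h\<in>hom G L. (\<forall>v\<in>V. \<forall>a\<in>carrier (vg v). h (vert v a) = f v a) \<and> (\<forall>e\<in>E. h (stable e) = \<one>\<^bsub>L\<^esub>)"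
  proof (rule extend[OF L])
    show "f v \<in> hom (vg v) L" if v: "v \<in> V" for v
    proof (rule homI)
      show "f v (a \<otimes>\<^bsub>vg v\<^esub> b) = f v a \<otimes>\<^bsub>L\<^esub> f v b" if "a \<in> carrier (vg v)" "b \<in> carrier (vg v)" for a b
        using group_hom.hom_mult[OF vert_hom[OF v] that] hom_mult[OF \<rho>, of "vert v a" "vert v b"]
          hom_mult[OF \<sigma>, of "vert v a" "vert v b"] vs v that by (simp add: f_def)
    qed (use fc v in auto)
    show "conj_by L \<one>\<^bsub>L\<^esub> (f (src g) (tail_map \<A> g c)) = f (tgt g) (head_map \<A> g c)"
      if g: "g \<in> E" and c: "c \<in> carrier (eg g)" for g c
    proof -
      have gT: "g \<in> T" using g ET by simp
      have "f (src g) (tail_map \<A> g c) = f (tgt g) (head_map \<A> g c)"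
      proof (cases "g = e")
        case True
        have "vert (src e) (tail_map \<A> e c) \<in> esub_tail e" using c True by (simp add: esub_tail_def)
        then show ?thesis using agree tree_relation[OF gT c] U(2,3) True by (simp add: f_def)
      next
        case False
        then show ?thesis using U(4)[of g] gT tree_relation[OF gT c] by (simp add: f_def)
      qed
      then show ?thesis using fc ends(2)[OF g] maps_closed(2)[OF g c] by simp
    qed
  qed simp_all
  then obtain h where h: "h \<in> hom G L" "\<And>v a. v \<in> V \<Longrightarrow> a \<in> carrier (vg v) \<Longrightarrow> h (vert v a) = f v a" by blast
  have "h x = \<rho> x" if "x \<in> side U" for x
    by (rule G.hom_eq_on_subgroup[OF L side_generators[OF U(1)] h(1) \<rho>[unfolded side_def] _ that[unfolded side_def]])
      (use h(2) U(1) in \<open>auto simp: vsub_def f_def\<close>)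
  moreover have "h x = \<sigma> x" if "x \<in> side (V - U)" for x
    by (rule G.hom_eq_on_subgroup[OF L side_generators h(1) \<sigma>[unfolded side_def] _ that[unfolded side_def]])
      (use h(2) in \<open>auto simp: vsub_def f_def\<close>)
  ultimately show ?thesis using h(1) by blast
qed

lemma carrier_eq_tree: "E = T \<Longrightarrow> carrier G = generate G (\<Union>v\<in>V. vsub v)"
proof
  assume ET: "E = T"
  have S: "(\<Union>v\<in>V. vsub v) \<subseteq> carrier G" using side_generators by blast
  have "(\<Union>v\<in>V. vsub v) \<union> stable ` E \<subseteq> generate G (\<Union>v\<in>V. vsub v)"
    using stable_tree ET by (auto intro: generate.incl generate.one)
  then show "carrier G \<subseteq> generate G (\<Union>v\<in>V. vsub v)"
    unfolding carrier_eq using G.generate_subgroup_incl G.generate_is_subgroup[OF S] by blast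
  show "generate G (\<Union>v\<in>V. vsub v) \<subseteq> carrier G" by (rule G.generate_incl[OF S])
qed

text \<open>
  Call an edge degenerate if its edge group is all of one of the two sides. If all edges are degenerate,
  a vertex group \<open>v\<close> that contains as many vertex groups as possible contains all of them. To see
  this, walk away from \<open>v\<close> through vertices whose groups are contained in that of \<open>v\<close>, and consider an
  edge that leads from such a vertex \<open>x\<close> to a vertex \<open>y\<close> whose group is not. If the side of \<open>v\<close> is the
  edge group, the group of \<open>v\<close> is contained in that of \<open>y\<close>, which contradicts the choice of \<open>v\<close>. If
  the side of \<open>y\<close> is the edge group, the group of \<open>y\<close> is contained in that of \<open>x\<close>, hence in that of \<open>v\<close>.
\<close>

lemma vertex_group_if_edges_degenerate:
  assumes ET: "E = T"
    and degenerate: "\<And>e U. e \<in> T \<Longrightarrow> U \<subseteq> V \<Longrightarrow> src e \<in> U \<Longrightarrow> tgt e \<notin> U \<Longrightarrow>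
      (\<And>f. f \<in> T - {e} \<Longrightarrow> src f \<in> U \<longleftrightarrow> tgt f \<in> U) \<Longrightarrow>
      side U \<subseteq> esub_tail e \<or> side (V - U) \<subseteq> esub_tail e"
  shows "\<exists>v\<in>V. carrier G = vsub v"
proof -
  define S where "S v = {u \<in> V. vsub u \<subseteq> vsub v}" for v
  have finS: "finite (S v)" for v using finite_V by (simp add: S_def)
  obtain v0 where "v0 \<in> V" using V_nonempty by blast
  have "\<exists>v. v \<in> V \<and> (\<forall>u. u \<in> V \<longrightarrow> card (S u) \<le> card (S v))"
    by (rule ex_has_greatest_nat[of "\<lambda>v. v \<in> V" v0 _ "Suc (card V)"])
      (use \<open>v0 \<in> V\<close> finite_V in \<open>auto simp: S_def less_Suc_eq_le intro!: card_mono\<close>)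
  then obtain v where v: "v \<in> V" "\<And>u. u \<in> V \<Longrightarrow> card (S u) \<le> card (S v)" by blast
  have no_larger: "\<not> vsub v \<subseteq> vsub w" if w: "w \<in> V - S v" for w
  proof
    assume le: "vsub v \<subseteq> vsub w"
    then have "S v \<subset> S w" using w by (auto simp: S_def)
    then have "card (S v) < card (S w)" by (rule psubset_card_mono[OF finS])
    then show False using v(2)[of w] w by auto
  qed
  (* \<open>R\<close> is the connected component of \<open>v\<close> in the subgraph spanned by \<open>S v\<close>. *)
  define r where "r = {(x, y). x \<in> S v \<and> y \<in> S v \<and> (\<exists>e\<in>T. (x = src e \<and> y = tgt e) \<or> (x = tgt e \<and> y = src e))}"
  define R where "R = {u. (v, u) \<in> r\<^sup>*}"
  have RS: "R \<subseteq> S v"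
  proof
    fix u assume "u \<in> R"
    then have "(v, u) \<in> r\<^sup>*" by (simp add: R_def)
    then show "u \<in> S v" by (induction rule: rtrancl_induct) (use v(1) in \<open>auto simp: r_def S_def\<close>)
  qed
  have same_side: "u \<in> U \<longleftrightarrow> v \<in> U"
    if e: "e \<in> T" "src e \<notin> S v \<or> tgt e \<notin> S v" and U: "\<And>f. f \<in> T - {e} \<Longrightarrow> src f \<in> U \<longleftrightarrow> tgt f \<in> U" and u: "u \<in> R"
    for e U u
  proof -
    have "(v, u) \<in> r\<^sup>*" using u by (simp add: R_def)
    then show ?thesis
    proof (induction rule: rtrancl_induct)
      case (step x y)
      then obtain f where f: "f \<in> T" "(x = src f \<and> y = tgt f) \<or> (x = tgt f \<and> y = src f)" "x \<in> S v" "y \<in> S v"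
        by (auto simp: r_def)
      then have "f \<noteq> e" using e(2) by auto
      then show ?case using U[of f] f step.IH by auto
    qed simp
  qed
  have "R = V"
  proof (rule tree_connected)
    show "R \<subseteq> V" using RS by (auto simp: S_def)
    show "R \<noteq> {}" by (auto simp: R_def)
    fix e assume e: "e \<in> T"
    have eE: "e \<in> E" using e ET by simp
    obtain U where U: "U \<subseteq> V" "src e \<in> U" "tgt e \<notin> U" "\<And>f. f \<in> T - {e} \<Longrightarrow> src f \<in> U \<longleftrightarrow> tgt f \<in> U"
      by (rule tree_edge_sides[OF e]) (rule that)
    have deg: "side U \<subseteq> esub_tail e \<or> side (V - U) \<subseteq> esub_tail e"
      by (rule degenerate[OF e U])
    have es: "esub_tail e \<subseteq> vsub (src e)" "esub_tail e \<subseteq> vsub (tgt e)"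
      using esub_tail(2)[OF eE] esub_head(2)[OF eE] esub_tree[OF e] by auto
    have step: "y \<in> R" if "x \<in> R" "y \<in> S v" "(x = src e \<and> y = tgt e) \<or> (x = tgt e \<and> y = src e)" for x y
    proof -
      have "(x, y) \<in> r" using that RS e by (auto simp: r_def)
      moreover have "(v, x) \<in> r\<^sup>*" using that(1) by (simp add: R_def)
      ultimately show ?thesis unfolding R_def by (simp add: rtrancl_into_rtrancl)
    qed
    show "src e \<in> R \<longleftrightarrow> tgt e \<in> R"
    proof
      assume s: "src e \<in> R"
      have "tgt e \<in> S v"
      proof (rule ccontr)
        assume t: "tgt e \<notin> S v"
        have "v \<in> U" using same_side[OF e _ U(4) s] t U(2) by blast
        show False
          using deg
        proof
          assume "side U \<subseteq> esub_tail e"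
          then show False using no_larger[of "tgt e"] side_contains[OF \<open>v \<in> U\<close>] es t ends[OF eE] by blast
        next
          assume "side (V - U) \<subseteq> esub_tail e"
          then have "vsub (tgt e) \<subseteq> vsub (src e)" using side_contains[of "tgt e" "V - U"] U(3) ends[OF eE] es by blast
          then show False using t s RS ends[OF eE] by (auto simp: S_def)
        qed
      qed
      then show "tgt e \<in> R" using step s by blast
    next
      assume t: "tgt e \<in> R"
      have "src e \<in> S v"
      proof (rule ccontr)
        assume s: "src e \<notin> S v"
        have "v \<notin> U" using same_side[OF e _ U(4) t] s U(3) by blast
        then have vU: "v \<in> V - U" using v(1) by blast
        show False
          using deg
        proof
          assume "side (V - U) \<subseteq> esub_tail e"
          then show False using no_larger[of "src e"] side_contains[OF vU] es s ends[OF eE] by blast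
        next
          assume "side U \<subseteq> esub_tail e"
          then have "vsub (src e) \<subseteq> vsub (tgt e)" using side_contains[OF U(2)] es by blast
          then show False using s t RS ends[OF eE] by (auto simp: S_def)
        qed
      qed
      then show "src e \<in> R" using step t by blast
    qed
  qed
  then have "(\<Union>u\<in>V. vsub u) \<subseteq> vsub v" using RS by (auto simp: S_def)
  then have "carrier G \<subseteq> vsub v"
    unfolding carrier_eq_tree[OF ET] using G.generate_subgroup_incl vsub_subgroup[OF v(1)] by blast
  then show ?thesis using v(1) G.subgroupD(1)[OF vsub_subgroup[OF v(1)]] by blast
qed

text \<open>
  If \<open>G\<close> is not a vertex group, some edge group \<open>C\<close> is a proper subgroup of both sides \<open>A\<close> and \<open>B\<close> of the edge.
  By \<open>not_fgip_amalgam\<close>, applied to both orders of the factors, elements of \<open>A\<close> outside \<open>C\<close> all lie in the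
  same coset of \<open>C\<close>, and so do those of \<open>B\<close>. As finite extensions of \<open>C\<close> the two sides are
  virtually \<open>\<int>\<close>.
\<close>

lemma tree_amalgam:
  assumes fgip: "fgip G" and ET: "E = T"
  shows "virtually_Z G \<or>
    (\<exists>(A :: nat monoid) (B :: nat monoid) (C :: nat monoid) i j.
       virtually_Z A \<and> virtually_Z B \<and> group C \<and> i \<in> mon C A \<and> j \<in> mon C B \<and>
       card (rcosets\<^bsub>A\<^esub> (i ` carrier C)) = 2 \<and> card (rcosets\<^bsub>B\<^esub> (j ` carrier C)) = 2 \<and>
       G \<cong> amalgam A B C i j)"
proof (cases "\<exists>v\<in>V. carrier G = vsub v")
  case True
  then obtain v where v: "v \<in> V" "carrier G = vsub v" by blast
  obtain x where x: "x \<in> vsub v" "infinite_order G x" using vsub_infinite_order[OF v(1)] by blast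
  have "virtually_Z (G\<lparr>carrier := carrier G\<rparr>)"
    using G.virtually_cyclic_virtually_Z[OF vsub_virtually_cyclic[OF v(1)] x(2,1)] v(2) by simp
  then show ?thesis by simp
next
  case False
  then obtain e U where e: "e \<in> T" and U: "U \<subseteq> V" "src e \<in> U" "tgt e \<notin> U"
    "\<And>f. f \<in> T - {e} \<Longrightarrow> src f \<in> U \<longleftrightarrow> tgt f \<in> U"
    and proper: "\<not> side U \<subseteq> esub_tail e" "\<not> side (V - U) \<subseteq> esub_tail e"
    using vertex_group_if_edges_degenerate[OF ET] by blast
  let ?A = "side U" and ?B = "side (V - U)" and ?C = "esub_tail e"
  have eE: "e \<in> E" using e ET by simp
  have A: "subgroup ?A G" and B: "subgroup ?B G" using side_subgroup U(1) by blast+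
  have C: "subgroup ?C G" by (rule esub_tail(1)[OF eE])
  have CA: "?C \<subseteq> ?A" using esub_tail(2)[OF eE] side_contains[OF U(2)] by blast
  have CB: "?C \<subseteq> ?B"
    using esub_head(2)[OF eE] esub_tree[OF e] side_contains[of "tgt e" "V - U"] U(3) ends(2)[OF eE] by blast
  have cA: "countable ?A" and cB: "countable ?B"
    using countable_subset[OF G.subgroupD(1)[OF A] countable_G] countable_subset[OF G.subgroupD(1)[OF B] countable_G] .
  obtain z where z: "z \<in> ?C" "infinite_order G z" using esub_tail_infinite_order[OF eE] by blast
  have comm: "commensurates G z g" if "g \<in> carrier G" for g
    using all_commensurate[OF ends(1)[OF eE] _ z(2) that] z(1) esub_tail(2)[OF eE] by blast
  have ext: "\<exists>h\<in>hom G L. (\<forall>x\<in>?A. h x = \<rho> x) \<and> (\<forall>x\<in>?B. h x = \<sigma> x)"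
    if "group L" "\<rho> \<in> hom (G\<lparr>carrier := ?A\<rparr>) L" "\<sigma> \<in> hom (G\<lparr>carrier := ?B\<rparr>) L" "\<And>c. c \<in> ?C \<Longrightarrow> \<rho> c = \<sigma> c"
    for L :: "(nat + nat) word set monoid" and \<rho> \<sigma>
    by (rule amalgam_extend[OF ET e U that])
  have index: "x \<otimes>\<^bsub>G\<^esub> inv\<^bsub>G\<^esub> y \<in> ?C"
    if inner: "\<forall>x\<in>D - ?C. \<forall>y\<in>D - ?C. inv\<^bsub>G\<^esub> x \<otimes>\<^bsub>G\<^esub> y \<in> ?C" and D: "subgroup D G"
      and xy: "x \<in> D - ?C" "y \<in> D - ?C" for D x y
  proof -
    have c: "x \<in> carrier G" "y \<in> carrier G" using xy G.subgroupD(1)[OF D] by blast+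
    have "inv\<^bsub>G\<^esub> x \<in> D - ?C" "inv\<^bsub>G\<^esub> y \<in> D - ?C"
      using xy G.subgroupD(3)[OF D] G.inv_outside[OF C] c by auto
    then show ?thesis using inner[rule_format, of "inv\<^bsub>G\<^esub> x" "inv\<^bsub>G\<^esub> y"] c by simp
  qed
  obtain a b where ab: "a \<in> ?A - ?C" "b \<in> ?B - ?C" using proper by blast
  have A1: "inv\<^bsub>G\<^esub> x \<otimes>\<^bsub>G\<^esub> y \<in> ?C" if xy: "x \<in> ?A - ?C" "y \<in> ?A - ?C" for x y
  proof (rule ccontr)
    assume "inv\<^bsub>G\<^esub> x \<otimes>\<^bsub>G\<^esub> y \<notin> ?C"
    then have "\<not> fgip G"
      by (rule G.not_fgip_amalgam[OF A cA B cB C CA CB xy _ ab(2) z(2,1) comm amalgam_extend[OF ET e U group_perms]])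
    then show False using fgip by blast
  qed
  have B1: "inv\<^bsub>G\<^esub> x \<otimes>\<^bsub>G\<^esub> y \<in> ?C" if xy: "x \<in> ?B - ?C" "y \<in> ?B - ?C" for x y
  proof (rule ccontr)
    assume n: "inv\<^bsub>G\<^esub> x \<otimes>\<^bsub>G\<^esub> y \<notin> ?C"
    have "\<not> fgip G"
    proof (rule G.not_fgip_amalgam[OF B cB A cA C CB CA xy n ab(1) z(2,1) comm])
      fix \<rho>\<^sub>1 \<rho>\<^sub>2
      assume h: "\<rho>\<^sub>1 \<in> hom (G\<lparr>carrier := ?B\<rparr>) (perms :: (nat \<times> ('a, 'b, 'c) gog_generator word set \<Rightarrow> _) monoid)"
        "\<rho>\<^sub>2 \<in> hom (G\<lparr>carrier := ?A\<rparr>) perms" "\<And>c. c \<in> ?C \<Longrightarrow> \<rho>\<^sub>1 c = \<rho>\<^sub>2 c"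
      have "\<exists>h\<in>hom G perms. (\<forall>x\<in>?A. h x = \<rho>\<^sub>2 x) \<and> (\<forall>x\<in>?B. h x = \<rho>\<^sub>1 x)"
        by (rule amalgam_extend[OF ET e U group_perms h(2,1)]) (auto simp: h(3)[symmetric])
      then show "\<exists>h\<in>hom G perms. (\<forall>x\<in>?B. h x = \<rho>\<^sub>1 x) \<and> (\<forall>x\<in>?A. h x = \<rho>\<^sub>2 x)" by blast
    qed
    then show False using fgip by blast
  qed
  have A2: "\<forall>x\<in>?A - ?C. \<forall>y\<in>?A - ?C. x \<otimes>\<^bsub>G\<^esub> inv\<^bsub>G\<^esub> y \<in> ?C" using index[of ?A] A1 A by simp
  have B2: "\<forall>x\<in>?B - ?C. \<forall>y\<in>?B - ?C. x \<otimes>\<^bsub>G\<^esub> inv\<^bsub>G\<^esub> y \<in> ?C" using index[of ?B] B1 B by simp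
  have vZ: "virtually_Z (G\<lparr>carrier := D\<rparr>)"
    if D: "subgroup D G" "?C \<subseteq> D" "\<forall>x\<in>D - ?C. \<forall>y\<in>D - ?C. x \<otimes>\<^bsub>G\<^esub> inv\<^bsub>G\<^esub> y \<in> ?C" "d \<in> D - ?C" for D d
  proof -
    have Dc: "x \<in> carrier G" if "x \<in> D" for x using that G.subgroupD(1)[OF D(1)] by blast
    have dc: "d \<in> carrier G" using D(4) Dc by blast
    have "\<exists>c\<in>?C. \<exists>f\<in>{\<one>\<^bsub>G\<^esub>, d}. x = c \<otimes>\<^bsub>G\<^esub> f" if x: "x \<in> D" for x
    proof (cases "x \<in> ?C")
      case True
      then show ?thesis using Dc[OF x] by (intro bexI[of _ x] bexI[of _ "\<one>\<^bsub>G\<^esub>"]) auto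
    next
      case False
      then have "x \<otimes>\<^bsub>G\<^esub> inv\<^bsub>G\<^esub> d \<in> ?C" using D(3,4) x by blast
      moreover have "x = (x \<otimes>\<^bsub>G\<^esub> inv\<^bsub>G\<^esub> d) \<otimes>\<^bsub>G\<^esub> d" using Dc[OF x] dc by (simp add: G.m_assoc)
      ultimately show ?thesis by blast
    qed
    then have "finitely_covers G ?C D"
      unfolding finitely_covers_def using dc by (intro exI[of _ "{\<one>\<^bsub>G\<^esub>, d}"]) auto
    then have "virtually_cyclic G D"
      by (rule G.virtually_cyclic_extend_finite[OF esub_tail_virtually_cyclic[OF eE] D(1,2)])
    then show ?thesis using G.virtually_cyclic_virtually_Z z D(2) by blast
  qed
  have "carrier G = generate G (?A \<union> ?B)"
  proof
    have S: "?A \<union> ?B \<subseteq> carrier G" using G.subgroupD(1)[OF A] G.subgroupD(1)[OF B] by blast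
    have "(\<Union>v\<in>V. vsub v) \<subseteq> generate G (?A \<union> ?B)"
    proof
      fix x assume "x \<in> (\<Union>v\<in>V. vsub v)"
      then obtain v where v: "v \<in> V" "x \<in> vsub v" by blast
      then have "x \<in> ?A \<union> ?B" using side_contains[of v U] side_contains[of v "V - U"] by blast
      then show "x \<in> generate G (?A \<union> ?B)" by (rule generate.incl)
    qed
    then show "carrier G \<subseteq> generate G (?A \<union> ?B)"
      unfolding carrier_eq_tree[OF ET] using G.generate_subgroup_incl G.generate_is_subgroup[OF S] by blast
    show "generate G (?A \<union> ?B) \<subseteq> carrier G" by (rule G.generate_incl[OF S])
  qed
  then have "\<exists>(A :: nat monoid) (B :: nat monoid) (C :: nat monoid) i j.
       virtually_Z A \<and> virtually_Z B \<and> group C \<and> i \<in> mon C A \<and> j \<in> mon C B \<and>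
       card (rcosets\<^bsub>A\<^esub> (i ` carrier C)) = 2 \<and> card (rcosets\<^bsub>B\<^esub> (j ` carrier C)) = 2 \<and>
       G \<cong> amalgam A B C i j"
    by (intro G.iso_amalgam[OF A cA vZ[OF A CA A2 ab(1)] B cB vZ[OF B CB B2 ab(2)] C CA CB _ A2 _ B2 _ ext])
      (use ab in auto)
  then show ?thesis by blast
qed

end

theorem theoremM:
  fixes \<A> :: "('v, 'e, 'a, 'c) graph_of_groups_data"
    and T :: "'e set"
  assumes "graph_of_groups \<A>"
    and "fin_digraph (base \<A>)"
    and "connected (base \<A>)"
    and "\<And>v. v \<in> verts (base \<A>) \<Longrightarrow> virtually_Z (vgroup \<A> v)"
    and "\<And>e. e \<in> arcs (base \<A>) \<Longrightarrow> virtually_Z (egroup \<A> e)"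
    and "spanning_tree_arcs T (base \<A>)"
  defines "G \<equiv> fundamental_group \<A> T"
  shows "fgip G \<longleftrightarrow>
    virtually_Z G \<or>
    (\<exists>(A :: nat monoid) (B :: nat monoid) (C :: nat monoid) i j.
       virtually_Z A \<and> virtually_Z B \<and> group C \<and> i \<in> mon C A \<and> j \<in> mon C B \<and>
       card (rcosets\<^bsub>A\<^esub> (i ` carrier C)) = 2 \<and> card (rcosets\<^bsub>B\<^esub> (j ` carrier C)) = 2 \<and>
       G \<cong> amalgam A B C i j) \<or>
    (\<exists>(A :: nat monoid) \<phi>.
       virtually_Z A \<and> \<phi> \<in> mon A A \<and> G \<cong> ascending_hnn A \<phi>)"
proof -
  interpret M: virtually_Z_graph \<A> T
    using assms(1,2,4-6)
    by (simp add: virtually_Z_graph_def virtually_Z_graph_axioms_def graph_of_groups_tree_def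
        graph_of_groups_tree_axioms_def)
  have G: "G = presented_group M.generators M.relators" by (simp add: G_def M.fundamental_group_eq)
  have group: "group G" unfolding G by (rule group_presented_group)
  show ?thesis
  proof
    assume "fgip G"
    show "virtually_Z G \<or>
      (\<exists>(A :: nat monoid) (B :: nat monoid) (C :: nat monoid) i j.
         virtually_Z A \<and> virtually_Z B \<and> group C \<and> i \<in> mon C A \<and> j \<in> mon C B \<and>
         card (rcosets\<^bsub>A\<^esub> (i ` carrier C)) = 2 \<and> card (rcosets\<^bsub>B\<^esub> (j ` carrier C)) = 2 \<and>
         G \<cong> amalgam A B C i j) \<or>
      (\<exists>(A :: nat monoid) \<phi>. virtually_Z A \<and> \<phi> \<in> mon A A \<and> G \<cong> ascending_hnn A \<phi>)"
    proof (cases "arcs (base \<A>) = T")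
      case True
      show ?thesis using M.tree_amalgam[OF _ True] \<open>fgip G\<close> unfolding G by blast
    next
      case False
      then obtain f where "f \<in> arcs (base \<A>) - T" using M.T_sub by blast
      then show ?thesis using M.non_tree_edge_ascending_hnn \<open>fgip G\<close> unfolding G by blast
    qed
  next
    assume "virtually_Z G \<or>
      (\<exists>(A :: nat monoid) (B :: nat monoid) (C :: nat monoid) i j.
         virtually_Z A \<and> virtually_Z B \<and> group C \<and> i \<in> mon C A \<and> j \<in> mon C B \<and>
         card (rcosets\<^bsub>A\<^esub> (i ` carrier C)) = 2 \<and> card (rcosets\<^bsub>B\<^esub> (j ` carrier C)) = 2 \<and>
         G \<cong> amalgam A B C i j) \<or>
      (\<exists>(A :: nat monoid) \<phi>. virtually_Z A \<and> \<phi> \<in> mon A A \<and> G \<cong> ascending_hnn A \<phi>)"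
    then consider "virtually_Z G"
      | A B C :: "nat monoid" and i j where "virtually_Z A" "virtually_Z B" "group C" "i \<in> mon C A" "j \<in> mon C B"
        "card (rcosets\<^bsub>A\<^esub> (i ` carrier C)) = 2" "card (rcosets\<^bsub>B\<^esub> (j ` carrier C)) = 2" "G \<cong> amalgam A B C i j"
      | A :: "nat monoid" and \<phi> where "virtually_Z A" "\<phi> \<in> mon A A" "G \<cong> ascending_hnn A \<phi>"
      by blast
    then show "fgip G"
    proof cases
      case 1
      then show ?thesis
        using group.slender_fgip[OF group] group.virtually_cyclic_slender[OF group]
          group.virtually_Z_virtually_cyclic(1)[OF group] by blast
    next
      case 2
      have "group (amalgam A B C i j)" unfolding amalgam_def by (rule group_presented_group)
      then show ?thesis using fgip_iso[OF group _ 2(8)] amalgam_fgip[OF 2(1-7)] by blast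
    next
      case 3
      have "group (ascending_hnn A \<phi>)" unfolding ascending_hnn_def by (rule group_presented_group)
      then show ?thesis using fgip_iso[OF group _ 3(3)] ascending_hnn_fgip[OF 3(1,2)] by blast
    qed
  qed
qed

end
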